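(* Let $Q=\mathrm{diag}(Q_1,\dots,Q_N)\in GL_N(\mathbb C)$, with an argument fixed for each of the distinct values among $Q_1,\dots,Q_N$. Let $\Lambda^{(1)},\dots,\Lambda^{(n)}$ be integral dominant $\mathfrak{gl}_N$-weights with $\Lambda^{(s)}_N=0$ for all $s$, let $z_1,\dots,z_n\in\mathbb C$, and let $M_{\boldsymbol\Lambda}(\boldsymbol z)[\boldsymbol m]$ be a weight subspace of $M_{\boldsymbol\Lambda}(\boldsymbol z)$. Assume that the index $i$ is such that $z_i-z_j\notin\mathbb Z$ for any $j\ne i$, and set $$S_i=\{z_i-1,\ z_i-\Lambda^{(i)}_{N-1}-2,\ \dots,\ z_i-\Lambda^{(i)}_1-N\}.$$ Let $f(u)$ be an $M_{\boldsymbol\Lambda}(\boldsymbol z)[\boldsymbol m]$-valued quasi-exponential lying in the kernel of $\mathfrak D_{Q,M_{\boldsymbol\Lambda}(\boldsymbol z)[\boldsymbol m]}$. Then: (i) $f(u)$ is uniquely determined by its values $$v_N=f(z_i-1),\quad v_{N-1}=f\big(z_i-\Lambda^{(i)}_{N-1}-2\big),\ \dots,\ v_1=f\big(z_i-\Lambda^{(i)}_1-N\big)\in M_{\boldsymbol\Lambda}(\boldsymbol z)[\boldsymbol m]$$ at the points of $S_i$. (ii) If $v_N=v_{N-1}=\dots=v_j=0$ for some $j>1$, then $f(z_i-k)=0$ for $k=1,2,\dots,\Lambda^{(i)}_{j-1}+N-j+1$. (iii) For any vectors $v_N,v_{N-1},\dots,v_1\in M_{\boldsymbol\Lambda}(\boldsymbol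 z)[\boldsymbol m]$ there exists a quasi-exponential $f(u)$ which lies in the kernel of $\mathfrak D_{Q,M_{\boldsymbol\Lambda}(\boldsymbol z)[\boldsymbol m]}$ and takes these values at $S_i$, that is, $f(z_i-\Lambda^{(i)}_j-N+j-1)=v_j$ for $j=1,\dots,N$.
   Context: $e_{ab}$ are the standard generators of $\mathfrak{gl}_N$. An integral dominant weight is $\Lambda=(\Lambda_1,\dots,\Lambda_N)$ with $\Lambda_a-\Lambda_{a+1}\in\mathbb Z_{\ge0}$; $M_\Lambda$ is the irreducible finite-dimensional $\mathfrak{gl}_N$-module with highest weight $\Lambda$. $M_{\boldsymbol\Lambda}(\boldsymbol z)=M_{\Lambda^{(1)}}(z_1)\otimes\dots\otimes M_{\Lambda^{(n)}}(z_n)$ is the tensor product of evaluation modules over the Yangian $Y(\mathfrak{gl}_N)$. Explicitly, it is the vector space $M_{\Lambda^{(1)}}\otimes\dots\otimes M_{\Lambda^{(n)}}$ on which the Yangian generating series $T_{ab}(u)$, $a,b=1,\dots,N$, act as the rational functions $$T_{ab}(u)=\sum_{c_1,\dots,c_{n-1}=1}^N L^{(n)}_{a\,c_{n-1}}(u)L^{(n-1)}_{c_{n-1}c_{n-2}}(u)\cdots L^{(2)}_{c_2c_1}(u)L^{(1)}_{c_1b}(u),\qquad L^{(i)}_{ab}(u)=\delta_{ab}+\frac{e^{(i)}_{ba}}{u-z_i},$$ where $e^{(i)}_{ab}$ is $e_{ab}$ acting on the $i$-th factor. $\mathfrak{gl}_N$ acts on it by $e_{ab}\mapsto\sum_i e^{(i)}_{ab}$;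 for $\boldsymbol m=(m_1,\dots,m_N)$, $M_{\boldsymbol\Lambda}(\boldsymbol z)[\boldsymbol m]$ is the subspace of vectors $x$ with $e_{aa}x=m_ax$ for all $a$. Let $(\tau f)(u)=f(u+1)$. The universal difference operator associated with $Q=(Q_{ab})$ is $$\mathfrak D(u,\tau)=\sum_{\sigma\in S_N}(-1)^\sigma\mathcal X_{1\sigma_1}\mathcal X_{2\sigma_2}\cdots\mathcal X_{N\sigma_N},\qquad \mathcal X_{ab}(u,\tau)=\delta_{ab}-\sum_{c=1}^NQ_{ac}T_{cb}(u)\tau^{-1},$$ acting on $M_{\boldsymbol\Lambda}(\boldsymbol z)$-valued functions of $u$. For diagonal $Q$ its coefficients preserve weight subspaces; $\mathfrak D_{Q,M_{\boldsymbol\Lambda}(\boldsymbol z)[\boldsymbol m]}$ denotes its restriction to $M_{\boldsymbol\Lambda}(\boldsymbol z)[\boldsymbol m]$-valued functions. Here a quasi-exponential means a finite sum $\sum_aQ_a^u\,p_a(u)$, where $p_a$ is a polynomial with values in $M_{\boldsymbol\Lambda}(\boldsymbol z)[\boldsymbol m]$, the $Q_a$ range over the distinct values among $Q_1,\dots,Q_N$, and $Q_a^u=e^{u\ln Q_a}$ with the fixed argument of $Q_a$. *)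

theory Defs
  imports "Jordan_Normal_Form.VS_Connect"
begin

text \<open>
  Indices of \<open>gl_N\<close> run over \<open>{1..N}\<close> and tensor factors over \<open>{1..n}\<close>; values of the parameter
  functions outside these ranges are irrelevant.
\<close>

definition integral_dominant :: "nat \<Rightarrow> (nat \<Rightarrow> complex) \<Rightarrow> bool" where
  "integral_dominant N \<Lambda> \<longleftrightarrow> (\<forall>a\<in>{1..<N}. \<Lambda> a - \<Lambda> (a + 1) \<in> \<nat>)"

text \<open>
  A \<open>gl_N\<close>-module of dimension \<open>r\<close> is given, in some basis, by the \<open>r \<times> r\<close> matrices \<open>e a b\<close> of
  the standard generators.
\<close>

definition gl_module :: "nat \<Rightarrow> nat \<Rightarrow> (nat \<Rightarrow> nat \<Rightarrow> complex mat) \<Rightarrow> bool" where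
  "gl_module N r e \<longleftrightarrow>
     (\<forall>a\<in>{1..N}. \<forall>b\<in>{1..N}. e a b \<in> carrier_mat r r) \<and>
     (\<forall>a\<in>{1..N}. \<forall>b\<in>{1..N}. \<forall>c\<in>{1..N}. \<forall>d\<in>{1..N}.
        e a b * e c d - e c d * e a b =
          (if b = c then e a d else 0\<^sub>m r r) - (if a = d then e c b else 0\<^sub>m r r))"

definition gl_irreducible :: "nat \<Rightarrow> nat \<Rightarrow> (nat \<Rightarrow> nat \<Rightarrow> complex mat) \<Rightarrow> bool" where
  "gl_irreducible N r e \<longleftrightarrow> gl_module N r e \<and> r \<noteq> 0 \<and>
     (\<forall>W. subspace class_ring W (module_vec TYPE(complex) r) \<longrightarrow>
        (\<forall>a\<in>{1..N}. \<forall>b\<in>{1..N}. \<forall>w\<in>W. e a b *\<^sub>v w \<in> W) \<longrightarrow>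
        W = {0\<^sub>v r} \<or> W = carrier_vec r)"

definition highest_weight_vector ::
  "nat \<Rightarrow> nat \<Rightarrow> (nat \<Rightarrow> nat \<Rightarrow> complex mat) \<Rightarrow> (nat \<Rightarrow> complex) \<Rightarrow> complex vec \<Rightarrow> bool" where
  "highest_weight_vector N r e \<Lambda> v \<longleftrightarrow> v \<in> carrier_vec r \<and> v \<noteq> 0\<^sub>v r \<and>
     (\<forall>a\<in>{1..N}. e a a *\<^sub>v v = \<Lambda> a \<cdot>\<^sub>v v) \<and>
     (\<forall>a\<in>{1..N}. \<forall>b\<in>{1..N}. a < b \<longrightarrow> e a b *\<^sub>v v = 0\<^sub>v r)"

text \<open>\<open>(r, e)\<close> is a realization of \<open>M_\<Lambda>\<close>; it is unique up to a change of basis.\<close>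

definition irreducible_highest_weight_module ::
  "nat \<Rightarrow> (nat \<Rightarrow> complex) \<Rightarrow> nat \<Rightarrow> (nat \<Rightarrow> nat \<Rightarrow> complex mat) \<Rightarrow> bool" where
  "irreducible_highest_weight_module N \<Lambda> r e \<longleftrightarrow>
     gl_irreducible N r e \<and> (\<exists>v. highest_weight_vector N r e \<Lambda> v)"

text \<open>
  An element of \<open>\<complex>\<^bsup>r 1\<^esup> \<otimes> \<dots> \<otimes> \<complex>\<^bsup>r n\<^esup>\<close> is its family of coordinates with respect to the basis of
  pure tensors of standard basis vectors. A basis element is a multi-index \<open>p\<close> with \<open>p s < r s\<close>;
  coordinates at functions that are not multi-indices are \<open>0\<close>.
\<close>

type_synonym tensor = "(nat \<Rightarrow> nat) \<Rightarrow> complex"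

definition multi_indices :: "nat \<Rightarrow> (nat \<Rightarrow> nat) \<Rightarrow> (nat \<Rightarrow> nat) set" where
  "multi_indices n r = PiE {1..n} (\<lambda>s. {..<r s})"

definition tensor_space :: "nat \<Rightarrow> (nat \<Rightarrow> nat) \<Rightarrow> tensor set" where
  "tensor_space n r = {x. \<forall>p. p \<notin> multi_indices n r \<longrightarrow> x p = 0}"

text \<open>The operator \<open>id \<otimes> \<dots> \<otimes> A \<otimes> \<dots> \<otimes> id\<close> with \<open>A\<close> in position \<open>s\<close>.\<close>

definition on_factor :: "nat \<Rightarrow> (nat \<Rightarrow> nat) \<Rightarrow> nat \<Rightarrow> complex mat \<Rightarrow> tensor \<Rightarrow> tensor" where
  "on_factor n r s A x = (\<lambda>p. if p \<in> multi_indices n r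
     then \<Sum>k<r s. A $$ (p s, k) * x (p(s := k)) else 0)"

definition weight_space ::
  "nat \<Rightarrow> nat \<Rightarrow> (nat \<Rightarrow> nat) \<Rightarrow> (nat \<Rightarrow> nat \<Rightarrow> nat \<Rightarrow> complex mat) \<Rightarrow> (nat \<Rightarrow> complex) \<Rightarrow> tensor set" where
  "weight_space N n r e m = {x \<in> tensor_space n r.
     \<forall>a\<in>{1..N}. (\<lambda>p. \<Sum>s=1..n. on_factor n r s (e s a a) x p) = (\<lambda>p. m a * x p)}"

text \<open>In \<open>L_op\<close> and \<open>T_op\<close> the junk value of division by zero is taken at \<open>u = z s\<close>.\<close>

definition L_op ::
  "nat \<Rightarrow> (nat \<Rightarrow> nat) \<Rightarrow> (nat \<Rightarrow> nat \<Rightarrow> nat \<Rightarrow> complex mat) \<Rightarrow> (nat \<Rightarrow> complex) \<Rightarrow>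
   nat \<Rightarrow> nat \<Rightarrow> nat \<Rightarrow> complex \<Rightarrow> tensor \<Rightarrow> tensor" where
  "L_op n r e z s a b u x =
     (\<lambda>p. (if a = b then x p else 0) + on_factor n r s (e s b a) x p / (u - z s))"

text \<open>
  \<open>T_partial \<dots> k\<close> is the \<open>(a, b)\<close> entry of the matrix product \<open>L\<^sup>(\<^sup>k\<^sup>)(u) \<cdots> L\<^sup>(\<^sup>1\<^sup>)(u)\<close> of
  operator-valued matrices.
\<close>

fun T_partial ::
  "nat \<Rightarrow> nat \<Rightarrow> (nat \<Rightarrow> nat) \<Rightarrow> (nat \<Rightarrow> nat \<Rightarrow> nat \<Rightarrow> complex mat) \<Rightarrow> (nat \<Rightarrow> complex) \<Rightarrow>
   nat \<Rightarrow> nat \<Rightarrow> nat \<Rightarrow> complex \<Rightarrow> tensor \<Rightarrow> tensor" where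
  "T_partial N n r e z 0 a b u x = (\<lambda>p. if a = b then x p else 0)"
| "T_partial N n r e z (Suc k) a b u x =
     (\<lambda>p. \<Sum>c=1..N. L_op n r e z (Suc k) a c u (T_partial N n r e z k c b u x) p)"

definition T_op ::
  "nat \<Rightarrow> nat \<Rightarrow> (nat \<Rightarrow> nat) \<Rightarrow> (nat \<Rightarrow> nat \<Rightarrow> nat \<Rightarrow> complex mat) \<Rightarrow> (nat \<Rightarrow> complex) \<Rightarrow>
   nat \<Rightarrow> nat \<Rightarrow> complex \<Rightarrow> tensor \<Rightarrow> tensor" where
  "T_op N n r e z = T_partial N n r e z n"

definition X_op ::
  "nat \<Rightarrow> nat \<Rightarrow> (nat \<Rightarrow> nat) \<Rightarrow> (nat \<Rightarrow> nat \<Rightarrow> nat \<Rightarrow> complex mat) \<Rightarrow> (nat \<Rightarrow> complex) \<Rightarrow>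
   (nat \<Rightarrow> nat \<Rightarrow> complex) \<Rightarrow> nat \<Rightarrow> nat \<Rightarrow> (complex \<Rightarrow> tensor) \<Rightarrow> complex \<Rightarrow> tensor" where
  "X_op N n r e z Q a b f = (\<lambda>u p. (if a = b then f u p else 0)
     - (\<Sum>c=1..N. Q a c * T_op N n r e z c b u (f (u - 1)) p))"

text \<open>
  The fold is the ordered composition \<open>X\<^bsub>1,\<sigma>1\<^esub> \<circ> \<dots> \<circ> X\<^bsub>N,\<sigma>N\<^esub>\<close>, the last factor acting first.
\<close>

definition universal_difference_operator ::
  "nat \<Rightarrow> nat \<Rightarrow> (nat \<Rightarrow> nat) \<Rightarrow> (nat \<Rightarrow> nat \<Rightarrow> nat \<Rightarrow> complex mat) \<Rightarrow> (nat \<Rightarrow> complex) \<Rightarrow>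
   (nat \<Rightarrow> nat \<Rightarrow> complex) \<Rightarrow> (complex \<Rightarrow> tensor) \<Rightarrow> complex \<Rightarrow> tensor" where
  "universal_difference_operator N n r e z Q f = (\<lambda>u p.
     \<Sum>\<sigma> | \<sigma> permutes {1..N}.
       of_int (sign \<sigma>) * foldr (\<lambda>a. X_op N n r e z Q a (\<sigma> a)) [1..<N + 1] f u p)"

definition diagonal :: "(nat \<Rightarrow> complex) \<Rightarrow> nat \<Rightarrow> nat \<Rightarrow> complex" where
  "diagonal q a b = (if a = b then q a else 0)"

text \<open>
  The coefficients of the operator are rational in \<open>u\<close>; they are built from the values of \<open>T\<close> at
  \<open>u, u - 1, \<dots>, u - N + 1\<close>. The equation \<open>D f = 0\<close> between meromorphic functions is required at
  every \<open>u\<close> for which none of these arguments is one of the points \<open>z s\<close>.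
\<close>

definition in_difference_kernel ::
  "nat \<Rightarrow> nat \<Rightarrow> (nat \<Rightarrow> nat) \<Rightarrow> (nat \<Rightarrow> nat \<Rightarrow> nat \<Rightarrow> complex mat) \<Rightarrow> (nat \<Rightarrow> complex) \<Rightarrow>
   (nat \<Rightarrow> nat \<Rightarrow> complex) \<Rightarrow> (complex \<Rightarrow> tensor) \<Rightarrow> bool" where
  "in_difference_kernel N n r e z Q f \<longleftrightarrow>
     (\<forall>u. (\<forall>s\<in>{1..n}. \<forall>k<N. u - of_nat k \<noteq> z s) \<longrightarrow>
        universal_difference_operator N n r e z Q f u = (\<lambda>p. 0))"

text \<open>\<open>\<theta> Q\<close> is the argument fixed for the value \<open>Q\<close>.\<close>

definition power_with_arg :: "(complex \<Rightarrow> real) \<Rightarrow> complex \<Rightarrow> complex \<Rightarrow> complex" where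
  "power_with_arg \<theta> Q u = exp (u * Complex (ln (cmod Q)) (\<theta> Q))"

text \<open>\<open>C Q k\<close> is the coefficient of \<open>u ^ k\<close> in the vector-valued polynomial that multiplies \<open>Q\<^sup>u\<close>.\<close>

definition quasi_exponential ::
  "nat \<Rightarrow> (nat \<Rightarrow> complex) \<Rightarrow> (complex \<Rightarrow> real) \<Rightarrow> tensor set \<Rightarrow> (complex \<Rightarrow> tensor) \<Rightarrow> bool" where
  "quasi_exponential N q \<theta> W f \<longleftrightarrow>
     (\<exists>(C :: complex \<Rightarrow> nat \<Rightarrow> tensor) D.
        (\<forall>Q\<in>q ` {1..N}. \<forall>k\<le>D. C Q k \<in> W) \<and>
        (\<forall>u. f u = (\<lambda>p. \<Sum>Q\<in>q ` {1..N}. power_with_arg \<theta> Q u * (\<Sum>k\<le>D. u ^ k * C Q k p))))"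

definition quasi_exponential_kernel ::
  "nat \<Rightarrow> nat \<Rightarrow> (nat \<Rightarrow> nat) \<Rightarrow> (nat \<Rightarrow> nat \<Rightarrow> nat \<Rightarrow> complex mat) \<Rightarrow> (nat \<Rightarrow> complex) \<Rightarrow>
   (nat \<Rightarrow> complex) \<Rightarrow> (complex \<Rightarrow> real) \<Rightarrow> (nat \<Rightarrow> complex) \<Rightarrow> (complex \<Rightarrow> tensor) set" where
  "quasi_exponential_kernel N n r e z q \<theta> m =
     {f. quasi_exponential N q \<theta> (weight_space N n r e m) f \<and>
         in_difference_kernel N n r e z (diagonal q) f}"

text \<open>The elements of \<open>S_i\<close> are \<open>eval_point N \<Lambda>\<^sup>(\<^sup>i\<^sup>) z\<^sub>i j\<close> for \<open>j = 1, \<dots>, N\<close>.\<close>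

definition eval_point :: "nat \<Rightarrow> (nat \<Rightarrow> complex) \<Rightarrow> complex \<Rightarrow> nat \<Rightarrow> complex" where
  "eval_point N \<Lambda> w j = w - \<Lambda> j - of_nat N + of_nat j - 1"

end

theory Submission
  imports Defs "HOL-Library.Function_Algebras" "HOL-Library.Nat_Bijection"
    "HOL-Combinatorics.Permutations" "HOL-Computational_Algebra.Polynomial"
begin

text \<open>
  With anticommuting variables adjoined, the alternating sum defining the operator becomes the top
  component of a product of \<open>N\<close> first-order difference operators, which anticommute because the
  \<open>T\<close>-matrices at \<open>u\<close> and \<open>u - 1\<close> satisfy the Manin relation.

  Existence of solutions is proved first when every site carries the vector representation and the
  \<open>z\<^sub>s\<close> are generic: then \<open>T\<close> has rank one at \<open>z\<^sub>s\<close>, the poles of the operator impose only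
  one condition of rank one per site, and a dimension count provides quasi-exponential solutions with
  arbitrary values at \<open>w - 1, \<dots>, w - N\<close> for any \<open>w\<close> off the lattices \<open>z\<^sub>s + \<int>\<close>. Arbitrary
  \<open>z\<close> follow by a compactness argument, uniqueness keeping the limit non-zero. A module with a partition
  as highest weight is embedded into a tensor power of the vector representation, in the common
  eigenspace of the Jucys--Murphy operators, where the \<open>L\<close>-operators shifted by the contents fuse;
  solutions with initial values in the embedded module stay in it.

  The coefficient of the last power of the shift is, after clearing denominators, the quantum
  determinant, which is the scalar \<open>\<Prod>\<^sub>s \<Prod>\<^sub>a (u - z\<^sub>s - a + 1 + \<Lambda>\<^sup>(\<^sup>s\<^sup>)\<^sub>a)\<close>. At
  \<open>u = z\<^sub>i + N - k\<close> the cleared equation expresses \<open>f(z\<^sub>i - k)\<close> through the values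
  \<open>f(z\<^sub>i - k')\<close>, \<open>1 \<le> k' < k\<close>, unless \<open>z\<^sub>i - k\<close> lies in \<open>S\<^sub>i\<close>. Hence a solution that vanishes on
  \<open>S\<^sub>i\<close> vanishes on a whole half-lattice and is zero, and since the space of solutions has the
  dimension of the space of values on \<open>S\<^sub>i\<close>, evaluation on \<open>S\<^sub>i\<close> is bijective.
\<close>

section \<open>Row-finite operators\<close>

text \<open>The obstacle is that the points of S_i lie on the lattice of the pole z_i, where the
  coefficients of the difference equation are singular, so that a solution cannot be built up
  directly from its values there. At a base point w off all lattices there is no such problem: the
  coefficient of the identity is 1, and N consecutive values determine everything to the right of
  them. The dimension count for vector sites rests on two facts. For a base Q of multiplicity \<mu>
  among the q_a, the operator conjugated by Q^u lowers the order at infinity by \<mu>. And the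
  residue of D f at z_s is a fixed operator applied to D f at z_s - 1, so that the pole costs
  nothing once D f vanishes at z_s - 1. As the multiplicities add up to N, exactly N vectors remain
  free. Weights are disregarded until the end: everything is done in the whole tensor product, and a
  solution whose values on S_i lie in a weight space stays in it, because e_cc - m_c maps it to a
  solution that vanishes on S_i.\<close>

lemmas pw = plus_fun_apply zero_fun_apply minus_apply uminus_apply

text \<open>Vectors are arbitrary functions on index types that may be infinite, so that one type
  serves all dimensions. With every output coordinate a finite combination of input coordinates,
  operators can be composed, and polynomiality, growth and limits can be checked coordinate by
  coordinate.\<close>

definition row_finite :: "(('i \<Rightarrow> complex) \<Rightarrow> 'i \<Rightarrow> complex) \<Rightarrow> bool" where
  "row_finite F \<longleftrightarrow> (\<forall>i. \<exists>S K. finite S \<and> (\<forall>x. F x i = (\<Sum>j\<in>S. K j * x j)))"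

lemma row_finiteI:
  assumes "\<And>i. \<exists>S K. finite S \<and> (\<forall>x. F x i = (\<Sum>j\<in>S. K j * x j))"
  shows "row_finite F"
  using assms unfolding row_finite_def by blast

lemma row_finite_id: "row_finite (\<lambda>x. x)"
proof (rule row_finiteI)
  fix i :: 'a
  have "finite {i} \<and> (\<forall>x. x i = (\<Sum>j\<in>{i}. (1 :: complex) * x j))"
    by simp
  then show "\<exists>S K. finite S \<and> (\<forall>x. x i = (\<Sum>j\<in>S. (K j :: complex) * x j))"
    by (intro exI)
qed

lemma row_finite_comp:
  assumes F: "row_finite F" and G: "row_finite G"
  shows "row_finite (\<lambda>x. F (G x))"
proof (rule row_finiteI)
  fix i
  obtain S K where S: "finite S" "\<And>x. F x i = (\<Sum>j\<in>S. K j * x j)"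
    using F unfolding row_finite_def by metis
  have "\<forall>j. \<exists>S' K'. finite S' \<and> (\<forall>x. G x j = (\<Sum>l\<in>S'. K' l * x l))"
    using G unfolding row_finite_def by blast
  then obtain S' K' where S': "\<And>j. finite (S' j)" "\<And>j x. G x j = (\<Sum>l\<in>S' j. K' j l * x l)"
    by metis
  define U where "U = (\<Union>j\<in>S. S' j)"
  have U: "finite U" using S(1) S'(1) by (auto simp: U_def)
  have "F (G x) i = (\<Sum>l\<in>U. (\<Sum>j\<in>S. K j * (if l \<in> S' j then K' j l else 0)) * x l)" for x
  proof -
    have "F (G x) i = (\<Sum>j\<in>S. K j * (\<Sum>l\<in>S' j. K' j l * x l))"
      using S(2) S'(2) by simp
    also have "\<dots> = (\<Sum>j\<in>S. K j * (\<Sum>l\<in>U. (if l \<in> S' j then K' j l else 0) * x l))"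
    proof (rule sum.cong[OF refl])
      fix j assume "j \<in> S"
      have "(\<Sum>l\<in>S' j. K' j l * x l) = (\<Sum>l\<in>U. (if l \<in> S' j then K' j l else 0) * x l)"
        by (rule sum.mono_neutral_cong_left) (use \<open>j \<in> S\<close> U in \<open>auto simp: U_def\<close>)
      then show "K j * (\<Sum>l\<in>S' j. K' j l * x l)
        = K j * (\<Sum>l\<in>U. (if l \<in> S' j then K' j l else 0) * x l)" by simp
    qed
    also have "\<dots> = (\<Sum>l\<in>U. \<Sum>j\<in>S. K j * ((if l \<in> S' j then K' j l else 0) * x l))"
      unfolding sum_distrib_left by (rule sum.swap)
    also have "\<dots> = (\<Sum>l\<in>U. (\<Sum>j\<in>S. K j * (if l \<in> S' j then K' j l else 0)) * x l)"
      by (simp add: sum_distrib_right mult.assoc)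
    finally show ?thesis .
  qed
  with U show "\<exists>S K. finite S \<and> (\<forall>x. F (G x) i = (\<Sum>j\<in>S. K j * x j))"
    by (intro exI[of _ U] exI) auto
qed

lemma row_finite_add:
  assumes F: "row_finite F" and G: "row_finite G"
  shows "row_finite (\<lambda>x. F x + G x)"
proof (rule row_finiteI)
  fix i
  obtain S K where S: "finite S" "\<And>x. F x i = (\<Sum>j\<in>S. K j * x j)"
    using F unfolding row_finite_def by metis
  obtain S' K' where S': "finite S'" "\<And>x. G x i = (\<Sum>j\<in>S'. K' j * x j)"
    using G unfolding row_finite_def by metis
  let ?K = "\<lambda>j. (if j \<in> S then K j else 0) + (if j \<in> S' then K' j else 0)"
  have "(F x + G x) i = (\<Sum>j\<in>S\<union>S'. ?K j * x j)" for x
  proof -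
    have "(\<Sum>j\<in>S. K j * x j) = (\<Sum>j\<in>S\<union>S'. (if j \<in> S then K j else 0) * x j)"
      by (rule sum.mono_neutral_cong_left) (use S S' in auto)
    moreover have "(\<Sum>j\<in>S'. K' j * x j) = (\<Sum>j\<in>S\<union>S'. (if j \<in> S' then K' j else 0) * x j)"
      by (rule sum.mono_neutral_cong_left) (use S S' in auto)
    ultimately show ?thesis by (simp add: S(2) S'(2) distrib_right sum.distrib)
  qed
  with S S' show "\<exists>S K. finite S \<and> (\<forall>x. (F x + G x) i = (\<Sum>j\<in>S. K j * x j))"
    by (intro exI[of _ "S \<union> S'"] exI[of _ ?K]) auto
qed

lemma row_finite_scale:
  assumes F: "row_finite F"
  shows "row_finite (\<lambda>x i. c * F x i)"
proof (rule row_finiteI)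
  fix i
  obtain S K where S: "finite S" "\<And>x. F x i = (\<Sum>j\<in>S. K j * x j)"
    using F unfolding row_finite_def by metis
  then show "\<exists>S K. finite S \<and> (\<forall>x. c * F x i = (\<Sum>j\<in>S. K j * x j))"
    by (intro exI[of _ "S"] exI[of _ "\<lambda>j. c * K j"]) (auto simp: sum_distrib_left mult.assoc)
qed

lemma row_finite_zero: "row_finite (\<lambda>x. 0)"
  by (rule row_finiteI) (auto intro: exI[of _ "{}"])

lemma row_finite_plus_arg: "row_finite F \<Longrightarrow> F (x + y) = F x + F y"
proof
  fix i assume "row_finite F"
  then obtain S K where S: "finite S" "\<And>x. F x i = (\<Sum>j\<in>S. K j * x j)"
    unfolding row_finite_def by metis
  then show "F (x + y) i = (F x + F y) i"
    by (simp add: distrib_left sum.distrib)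
qed

text \<open>Bundled as a ring, operators can serve as matrix entries: the Manin and commutation
  relations become identities in \<open>ring_1\<close>.\<close>

typedef 'i lop = "{F :: ('i \<Rightarrow> complex) \<Rightarrow> 'i \<Rightarrow> complex. row_finite F}"
  morphisms ap Abs_lop
  using row_finite_id by auto

setup_lifting type_definition_lop

notation ap (infixr "\<triangleright>" 75)

lemma row_finite_ap: "row_finite (ap A)"
  using ap by auto

lemma lop_eqI: "(\<And>x. A \<triangleright> x = B \<triangleright> x) \<Longrightarrow> A = B"
  by (metis ap_inject ext)

instantiation lop :: (type) ring_1
begin

lift_definition zero_lop :: "'a lop" is "\<lambda>x. 0" by (rule row_finite_zero)
lift_definition one_lop :: "'a lop" is "\<lambda>x. x" by (rule row_finite_id)
lift_definition plus_lop :: "'a lop \<Rightarrow> 'a lop \<Rightarrow> 'a lop" is "\<lambda>F G x. F x + G x"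
  by (rule row_finite_add)
lift_definition uminus_lop :: "'a lop \<Rightarrow> 'a lop" is "\<lambda>F x. - F x"
proof -
  fix F :: "('a \<Rightarrow> complex) \<Rightarrow> 'a \<Rightarrow> complex" assume "row_finite F"
  from row_finite_scale[OF this, of "-1"] show "row_finite (\<lambda>x. - F x)"
    by (simp add: fun_Compl_def)
qed
lift_definition minus_lop :: "'a lop \<Rightarrow> 'a lop \<Rightarrow> 'a lop" is "\<lambda>F G x. F x - G x"
proof -
  fix F G :: "('a \<Rightarrow> complex) \<Rightarrow> 'a \<Rightarrow> complex" assume "row_finite F" "row_finite G"
  from row_finite_add[OF this(1) row_finite_scale[OF this(2), of "-1"]] show "row_finite (\<lambda>x. F x - G x)"
    by (simp add: plus_fun_def fun_diff_def)
qed
lift_definition times_lop :: "'a lop \<Rightarrow> 'a lop \<Rightarrow> 'a lop" is "\<lambda>F G x. F (G x)"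
  by (rule row_finite_comp)

instance
proof
  fix a b c :: "'a lop"
  show "a * b * c = a * (b * c)" by transfer simp
  show "1 * a = a" by transfer simp
  show "a * 1 = a" by transfer simp
  show "a + b + c = a + (b + c)" by transfer (simp add: add.assoc)
  show "a + b = b + a" by transfer (simp add: add.commute)
  show "0 + a = a" by transfer simp
  show "- a + a = 0" by transfer simp
  show "a - b = a + - b" by transfer simp
  show "(a + b) * c = a * c + b * c" by transfer simp
  show "a * (b + c) = a * b + a * c" by transfer (auto intro!: ext row_finite_plus_arg)
  show "(0 :: 'a lop) \<noteq> 1"
  proof transfer
    show "(\<lambda>x :: 'a \<Rightarrow> complex. 0) \<noteq> (\<lambda>x. x)"
      by (auto simp: fun_eq_iff intro!: exI[of _ "\<lambda>_. 1"])
  qed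
qed

end

lift_definition sc :: "complex \<Rightarrow> 'i lop" is "\<lambda>c x i. c * x i"
  using row_finite_scale[OF row_finite_id] .

lemma ap_zero [simp]: "0 \<triangleright> x = 0" by transfer simp
lemma ap_one [simp]: "1 \<triangleright> x = x" by transfer simp
lemma ap_plus: "(A + B) \<triangleright> x = A \<triangleright> x + B \<triangleright> x" by transfer simp
lemma ap_minus: "(A - B) \<triangleright> x = A \<triangleright> x - B \<triangleright> x" by transfer simp
lemma ap_uminus: "(- A) \<triangleright> x = - (A \<triangleright> x)" by transfer simp
lemma ap_times: "(A * B) \<triangleright> x = A \<triangleright> B \<triangleright> x" by transfer simp
lemma ap_sc: "(sc c \<triangleright> x) i = c * x i" by transfer simp
lemma ap_add: "A \<triangleright> (x + y) = A \<triangleright> x + A \<triangleright> y"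
  by transfer (rule row_finite_plus_arg)

lemma ap_0 [simp]: "A \<triangleright> 0 = 0"
  using ap_add[of A 0 0] by simp

lemma ap_neg: "A \<triangleright> (- x) = - (A \<triangleright> x)"
  using ap_add[of A x "- x"] by (simp add: eq_neg_iff_add_eq_0 add.commute)

lemma ap_diff: "A \<triangleright> (x - y) = A \<triangleright> x - A \<triangleright> y"
  using ap_add[of A x "- y"] by (simp add: ap_neg)

lemma ap_sum: "A \<triangleright> (\<Sum>i\<in>S. f i) = (\<Sum>i\<in>S. A \<triangleright> f i)"
  by (induction S rule: infinite_finite_induct) (auto simp: ap_add simp del: pw)

lemma sum_ap: "(\<Sum>i\<in>S. A i) \<triangleright> x = (\<Sum>i\<in>S. A i \<triangleright> x)"
  by (induction S rule: infinite_finite_induct) (auto simp: ap_plus simp del: pw)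

lemma sum_apply: "(\<Sum>i\<in>S. f i) x = (\<Sum>i\<in>S. f i x)"
  by (induction S rule: infinite_finite_induct) auto

lemma lop_kernel:
  obtains S K where "finite S" "\<And>x. (A \<triangleright> x) i = (\<Sum>j\<in>S. K j * x j)"
  using row_finite_ap[of A] unfolding row_finite_def by metis

lemma sc_comm: "A * sc c = sc c * A"
proof (rule lop_eqI, rule ext)
  fix x i
  obtain S K where "finite S" "\<And>x. (A \<triangleright> x) i = (\<Sum>j\<in>S. K j * x j)"
    by (rule lop_kernel[of A i]) blast
  then show "((A * sc c) \<triangleright> x) i = ((sc c * A) \<triangleright> x) i"
    by (simp add: ap_times ap_sc sum_distrib_left mult.left_commute)
qed

lemma ap_sc_comm: "A \<triangleright> sc c \<triangleright> x = sc c \<triangleright> A \<triangleright> x"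
  using sc_comm[of A c] by (metis ap_times)

lemma sc_left_comm: "A * (sc c * B) = sc c * (A * B)"
  by (metis mult.assoc sc_comm)

lemma sc_mult: "sc (c * d) = sc c * sc d" by (rule lop_eqI, rule ext) (simp add: ap_times ap_sc)
lemma sc_add: "sc (c + d) = sc c + sc d" by (rule lop_eqI, rule ext) (simp add: ap_plus ap_sc distrib_right)
lemma sc_diff: "sc (c - d) = sc c - sc d" by (rule lop_eqI, rule ext) (simp add: ap_minus ap_sc left_diff_distrib)
lemma sc_neg: "sc (- c) = - sc c" by (rule lop_eqI, rule ext) (simp add: ap_uminus ap_sc)
lemma sc_0 [simp]: "sc 0 = 0" by (rule lop_eqI, rule ext) (simp add: ap_sc)
lemma sc_1 [simp]: "sc 1 = 1" by (rule lop_eqI, rule ext) (simp add: ap_sc)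

lemma lop_double_zero: "A = - A \<Longrightarrow> A = (0 :: 'i lop)"
proof (rule lop_eqI, rule ext)
  fix x i assume "A = - A"
  then have "(A \<triangleright> x) i = - (A \<triangleright> x) i" by (metis ap_uminus fun_Compl_def)
  then show "(A \<triangleright> x) i = (0 \<triangleright> x) i" by (simp add: eq_neg_iff_add_eq_0)
qed

lemma fun_double_zero: "f = - f \<Longrightarrow> f = (0 :: 'a \<Rightarrow> 'i \<Rightarrow> complex)"
proof (rule ext, rule ext)
  fix x i assume "f = - f"
  then have "f x i = - f x i" by (metis fun_Compl_def)
  then show "f x i = 0 x i" by (simp add: eq_neg_iff_add_eq_0)
qed

section \<open>Forms\<close>

type_synonym 'i form = "nat set \<Rightarrow> 'i \<Rightarrow> complex"

text \<open>
  The component of a form at \<open>S\<close> is the coefficient of the product of the anticommuting variables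
  \<open>\<psi>\<^sub>b\<close>, \<open>b \<in> S\<close>, in increasing order; \<open>fermi S b\<close> is the sign produced by moving \<open>\<psi>\<^sub>b\<close> to its place.
\<close>

definition fermi :: "nat set \<Rightarrow> nat \<Rightarrow> 'v \<Rightarrow> 'v :: ab_group_add" where
  "fermi S b x = (if even (card {c\<in>S. c < b}) then x else - x)"

text \<open>Left exterior multiplication by \<open>\<psi>\<^sub>b\<close>. The forms of degree 0 are
  the \<open>vac x\<close>, and a form of top degree lives at the single set
  \<open>{1..N}\<close>.\<close>

definition psi :: "nat \<Rightarrow> 'i form \<Rightarrow> 'i form" where
  "psi b F = (\<lambda>S. if b \<in> S then fermi S b (F (S - {b})) else 0)"

definition vac :: "('i \<Rightarrow> complex) \<Rightarrow> 'i form" where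
  "vac x = (\<lambda>S. if S = {} then x else 0)"

definition fap :: "'i lop \<Rightarrow> 'i form \<Rightarrow> 'i form" where
  "fap A F = (\<lambda>S. A \<triangleright> F S)"

lemma fermi_simps: "fermi S b (x + y) = fermi S b x + fermi S b y" "fermi S b (- x) = - fermi S b x"
  "fermi S b 0 = 0" "A \<triangleright> fermi S b w = fermi S b (A \<triangleright> w)" "fermi S b (fermi S b x) = x"
  "fermi S b (fermi S' b' x) = fermi S' b' (fermi S b x)"
  by (auto simp: fermi_def ap_neg)

text \<open>Only indices below \<open>b\<close> enter its sign. Of two distinct indices exactly one
  lies below the other, which is the source of the anticommutation of \<open>psi a\<close> and
  \<open>psi b\<close>.\<close>

lemma fermi_remove:
  assumes "a \<in> S"
  shows "fermi (S - {a}) b x = (if a < b then - fermi S b x else fermi S b x)"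
proof (cases "a < b")
  case True
  then have "{c\<in>S. c < b} = insert a {c\<in>S - {a}. c < b}" using assms by auto
  then have "card {c\<in>S. c < b} = Suc (card {c\<in>S - {a}. c < b})"
    by simp
  then show ?thesis using True by (auto simp: fermi_def)
next
  case False
  then have "{c\<in>S - {a}. c < b} = {c\<in>S. c < b}" by auto
  then show ?thesis using False unfolding fermi_def by presburger
qed

lemma psi_add: "psi b (F + G) = psi b F + psi b G"
  by (rule ext) (auto simp: psi_def fermi_simps)

lemma psi_neg: "psi b (- F) = - psi b F"
  by (rule ext) (auto simp: psi_def fermi_simps)

lemma psi_0 [simp]: "psi b 0 = 0"
  by (rule ext) (auto simp: psi_def fermi_simps)

lemma psi_diff: "psi b (F - G) = psi b F - psi b G"
  using psi_add[of b F "- G"] by (simp add: psi_neg)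

lemma psi_sum: "psi b (\<Sum>i\<in>S. F i) = (\<Sum>i\<in>S. psi b (F i))"
  by (induction S rule: infinite_finite_induct) (auto simp: psi_add simp del: pw)

lemma psi_psi_same [simp]: "psi b (psi b F) = 0"
  by (rule ext) (auto simp: psi_def fermi_simps)

lemma psi_anticomm: "psi a (psi b F) = - psi b (psi a F)"
proof (cases "a = b")
  case False
  show ?thesis
  proof (rule ext)
    fix S
    have "S - {a} - {b} = S - {b} - {a}" by auto
    then show "psi a (psi b F) S = (- psi b (psi a F)) S"
      using False by (auto simp: psi_def fermi_simps fermi_remove)
  qed
qed simp

lemma fap_add: "fap A (F + G) = fap A F + fap A G" by (rule ext) (simp add: fap_def ap_add)
lemma fap_neg: "fap A (- F) = - fap A F" by (rule ext) (simp add: fap_def ap_neg)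
lemma fap_diff: "fap A (F - G) = fap A F - fap A G" by (rule ext) (simp add: fap_def ap_diff)
lemma fap_0 [simp]: "fap A 0 = 0" by (rule ext) (simp add: fap_def)
lemma fap_sum: "fap A (\<Sum>i\<in>S. F i) = (\<Sum>i\<in>S. fap A (F i))"
  by (induction S rule: infinite_finite_induct) (auto simp: fap_add simp del: pw)
lemma fap_times: "fap (A * B) F = fap A (fap B F)" by (rule ext) (simp add: fap_def ap_times)
lemma fap_plus: "fap (A + B) F = fap A F + fap B F" by (rule ext) (simp add: fap_def ap_plus)
lemma fap_minus: "fap (A - B) F = fap A F - fap B F" by (rule ext) (simp add: fap_def ap_minus)
lemma fap_uminus: "fap (- A) F = - fap A F" by (rule ext) (simp add: fap_def ap_uminus)
lemma fap_one [simp]: "fap 1 F = F" by (rule ext) (simp add: fap_def)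
lemma fap_zero [simp]: "fap 0 F = 0" by (rule ext) (simp add: fap_def)
lemma sum_fap: "fap (\<Sum>i\<in>S. A i) F = (\<Sum>i\<in>S. fap (A i) F)"
  by (induction S rule: infinite_finite_induct) (auto simp: fap_plus simp del: pw)
lemma psi_fap: "psi b (fap A F) = fap A (psi b F)"
  by (rule ext) (auto simp: fap_def psi_def fermi_simps)
lemma fap_vac: "fap A (vac x) = vac (A \<triangleright> x)"
  by (rule ext) (auto simp: fap_def vac_def)
lemma vac_add: "vac (x + y) = vac x + vac y" by (rule ext) (auto simp: vac_def)
lemma vac_0 [simp]: "vac 0 = 0" by (rule ext) (auto simp: vac_def)

text \<open>Row \<open>a\<close> of the matrix as a one-form. The top component of an ordered
  product of rows is the row-ordered determinant: the exterior algebra supplies the signs although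
  the entries do not commute.\<close>

definition nu :: "nat \<Rightarrow> (nat \<Rightarrow> nat \<Rightarrow> 'i lop) \<Rightarrow> nat \<Rightarrow> 'i form \<Rightarrow> 'i form" where
  "nu N M a F = (\<Sum>b=1..N. fap (M a b) (psi b F))"

lemma nu_add: "nu N M a (F + G) = nu N M a F + nu N M a G"
  by (simp add: nu_def psi_add fap_add sum.distrib)
lemma nu_neg: "nu N M a (- F) = - nu N M a F"
  by (simp add: nu_def psi_neg fap_neg sum_negf)
lemma nu_0 [simp]: "nu N M a 0 = 0" by (simp add: nu_def)
lemma nu_diff: "nu N M a (F - G) = nu N M a F - nu N M a G"
  by (simp add: nu_def psi_diff fap_diff sum_subtractf)
lemma nu_sum: "nu N M a (\<Sum>i\<in>S. F i) = (\<Sum>i\<in>S. nu N M a (F i))"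
  by (induction S rule: infinite_finite_induct) (auto simp: nu_add simp del: pw)

lemma nu_psi: "nu N M a (psi c F) = - psi c (nu N M a F)"
  unfolding nu_def psi_sum psi_fap sum_negf[symmetric]
  by (intro sum.cong refl) (metis psi_anticomm fap_neg)

lemma nu_fap:
  assumes "\<And>b. b \<in> {1..N} \<Longrightarrow> M a b * A = A * M a b"
  shows "nu N M a (fap A F) = fap A (nu N M a F)"
  unfolding nu_def fap_sum
  by (intro sum.cong refl) (metis assms fap_times psi_fap)

text \<open>Exchanging the two summation indices preserves the symmetric coefficient and reverses
  the exterior product, so the sum is its own negative.\<close>

lemma sym_psi_psi:
  assumes "\<And>b d. b \<in> {1..N} \<Longrightarrow> d \<in> {1..N} \<Longrightarrow> Y b d = Y d b"
  shows "(\<Sum>b=1..N. \<Sum>d=1..N. fap (Y b d) (psi b (psi d F))) = 0" (is "?Z = 0")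
proof -
  have "?Z = (\<Sum>d=1..N. \<Sum>b=1..N. fap (Y b d) (psi b (psi d F)))" by (rule sum.swap)
  also have "\<dots> = (\<Sum>d=1..N. \<Sum>b=1..N. - fap (Y d b) (psi d (psi b F)))"
  proof (intro sum.cong refl)
    fix b d assume "b \<in> {1..N}" "d \<in> {1..N}"
    then show "fap (Y b d) (psi b (psi d F)) = - fap (Y d b) (psi d (psi b F))"
      using assms[of b d] psi_anticomm[of b d F] by (simp add: fap_neg)
  qed
  also have "\<dots> = - ?Z" by (simp add: sum_negf)
  finally show ?thesis by (rule fun_double_zero)
qed

lemma nu_nu:
  "nu N M a (nu N M' c F) = (\<Sum>b=1..N. \<Sum>d=1..N. fap (M a b * M' c d) (psi b (psi d F)))"
  by (simp add: nu_def psi_sum fap_sum fap_times psi_fap)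

text \<open>
  The relation satisfied by \<open>T\<close> at \<open>u\<close> and \<open>T\<close> at \<open>u - 1\<close>; it says that the one-forms
  \<open>nu N M\<close> and \<open>nu N M'\<close> anticommute.
\<close>

definition manin :: "nat \<Rightarrow> (nat \<Rightarrow> nat \<Rightarrow> 'r::ring_1) \<Rightarrow> (nat \<Rightarrow> nat \<Rightarrow> 'r) \<Rightarrow> bool" where
  "manin N M M' \<longleftrightarrow> (\<forall>a\<in>{1..N}. \<forall>b\<in>{1..N}. \<forall>c\<in>{1..N}. \<forall>d\<in>{1..N}.
     M a b * M' c d + M c b * M' a d = M a d * M' c b + M c d * M' a b)"

lemma maninD:
  assumes "manin N M M'" "a \<in> {1..N}" "b \<in> {1..N}" "c \<in> {1..N}" "d \<in> {1..N}"
  shows "M a b * M' c d + M c b * M' a d = M a d * M' c b + M c d * M' a b"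
  using assms unfolding manin_def by blast

lemma manin_nu:
  assumes "manin N M M'" "a \<in> {1..N}" "c \<in> {1..N}"
  shows "nu N M a (nu N M' c F) = - nu N M c (nu N M' a F)"
proof -
  have "nu N M a (nu N M' c F) + nu N M c (nu N M' a F)
    = (\<Sum>b=1..N. \<Sum>d=1..N. fap (M a b * M' c d + M c b * M' a d) (psi b (psi d F)))"
    by (simp add: nu_nu fap_plus sum.distrib)
  also have "\<dots> = 0"
    by (rule sym_psi_psi) (use assms in \<open>auto dest: maninD\<close>)
  finally show ?thesis by (simp add: eq_neg_iff_add_eq_0)
qed

lemma sum_antisym:
  fixes X :: "nat \<Rightarrow> nat \<Rightarrow> 'i lop"
  assumes "\<And>b d. b \<in> {1..N} \<Longrightarrow> d \<in> {1..N} \<Longrightarrow> X b d = - X d b"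
  shows "(\<Sum>b=1..N. \<Sum>d=1..N. X b d) = 0" (is "?Z = 0")
proof -
  have "?Z = (\<Sum>d=1..N. \<Sum>b=1..N. X b d)" by (rule sum.swap)
  also have "\<dots> = (\<Sum>d=1..N. \<Sum>b=1..N. - X d b)"
    by (intro sum.cong refl assms)
  also have "\<dots> = - ?Z" by (simp add: sum_negf)
  finally show ?thesis by (rule lop_double_zero)
qed

text \<open>The Manin relation makes the expression symmetrized in the row indices symmetric in the
  column indices as well; paired with something antisymmetric it gives 0.\<close>

lemma manin_contract:
  fixes A A' :: "nat \<Rightarrow> nat \<Rightarrow> 'i lop"
  assumes "manin N A A'" "a \<in> {1..N}" "c \<in> {1..N}"
    and "\<And>x y. x \<in> {1..N} \<Longrightarrow> y \<in> {1..N} \<Longrightarrow> S x y = - S y x"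
  shows "(\<Sum>x=1..N. \<Sum>y=1..N. (A a x * A' c y + A c x * A' a y) * S x y) = 0"
proof (rule sum_antisym)
  fix b d assume "b \<in> {1..N}" "d \<in> {1..N}"
  then have "A a b * A' c d + A c b * A' a d = A a d * A' c b + A c d * A' a b" "S b d = - S d b"
    using maninD[OF assms(1,2) _ assms(3)] assms(4) by blast+
  then show "(A a b * A' c d + A c b * A' a d) * S b d = - ((A a d * A' c b + A c d * A' a b) * S d b)"
    by (metis mult_minus_right)
qed

lemma mult_interchange:
  assumes "a' * c = c * (a' :: 'r :: ring_1)"
  shows "(a * c) * (a' * c') = (a * a') * (c * c')"
  by (metis assms mult.assoc)

text \<open>The commutation hypothesis separates the factors \<open>A\<close>, \<open>A'\<close>
  from \<open>C\<close>, \<open>C'\<close>. The Manin relation of \<open>C\<close> then makes the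
  difference of its two products antisymmetric in the inner indices, and
  \<open>manin_contract\<close> for \<open>A\<close> removes it.\<close>

lemma manin_mult:
  fixes A A' C C' :: "nat \<Rightarrow> nat \<Rightarrow> 'i lop"
  assumes A: "manin N A A'" and C: "manin N C C'"
    and comm: "\<And>a b c d. a \<in> {1..N} \<Longrightarrow> b \<in> {1..N} \<Longrightarrow> c \<in> {1..N} \<Longrightarrow> d \<in> {1..N} \<Longrightarrow>
      A' a b * C c d = C c d * A' a b"
  shows "manin N (\<lambda>a b. \<Sum>x=1..N. A a x * C x b) (\<lambda>a b. \<Sum>x=1..N. A' a x * C' x b)"
  unfolding manin_def
proof (intro ballI)
  fix a b c d assume abcd: "a \<in> {1..N}" "b \<in> {1..N}" "c \<in> {1..N}" "d \<in> {1..N}"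
  have expand: "(\<Sum>x=1..N. A a x * C x b) * (\<Sum>y=1..N. A' c y * C' y d)
    = (\<Sum>x=1..N. \<Sum>y=1..N. (A a x * A' c y) * (C x b * C' y d))"
    if "a \<in> {1..N}" "b \<in> {1..N}" "c \<in> {1..N}" "d \<in> {1..N}" for a b c d
    unfolding sum_product using that comm by (intro sum.cong refl mult_interchange) auto
  let ?S = "\<lambda>x y. C x b * C' y d - C x d * C' y b"
  have "(\<Sum>x=1..N. \<Sum>y=1..N. (A a x * A' c y + A c x * A' a y) * ?S x y) = 0"
  proof (rule manin_contract[OF A \<open>a \<in> _\<close> \<open>c \<in> _\<close>])
    fix x y assume "x \<in> {1..N}" "y \<in> {1..N}"
    from maninD[OF C this(1) \<open>b \<in> _\<close> this(2) \<open>d \<in> _\<close>]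
    show "?S x y = - ?S y x" by (simp add: algebra_simps)
  qed
  then show "(\<Sum>x=1..N. A a x * C x b) * (\<Sum>x=1..N. A' c x * C' x d)
      + (\<Sum>x=1..N. A c x * C x b) * (\<Sum>x=1..N. A' a x * C' x d)
    = (\<Sum>x=1..N. A a x * C x d) * (\<Sum>x=1..N. A' c x * C' x b)
      + (\<Sum>x=1..N. A c x * C x d) * (\<Sum>x=1..N. A' a x * C' x b)"
    unfolding expand[OF abcd] expand[OF abcd(3,2,1,4)] expand[OF abcd(1,4,3,2)] expand[OF abcd(3,4,1,2)]
    by (simp add: algebra_simps sum.distrib sum_subtractf)
qed

section \<open>The difference operator on forms\<close>

text \<open>The one-form of row \<open>a\<close> of the operator matrix with entries \<delta>_ab -
  M_ab(u) \<tau>^(-1); \<open>dop\<close> multiplies the rows in order and reads off the top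
  component.\<close>

definition phi :: "nat \<Rightarrow> (complex \<Rightarrow> nat \<Rightarrow> nat \<Rightarrow> 'i lop) \<Rightarrow> nat \<Rightarrow> (complex \<Rightarrow> 'i form) \<Rightarrow> complex \<Rightarrow> 'i form" where
  "phi N M a F = (\<lambda>u. psi a (F u) - nu N (M u) a (F (u - 1)))"

definition Phi :: "nat \<Rightarrow> (complex \<Rightarrow> nat \<Rightarrow> nat \<Rightarrow> 'i lop) \<Rightarrow> nat list \<Rightarrow> (complex \<Rightarrow> 'i form) \<Rightarrow> complex \<Rightarrow> 'i form" where
  "Phi N M as = foldr (phi N M) as"

definition dop :: "nat \<Rightarrow> (complex \<Rightarrow> nat \<Rightarrow> nat \<Rightarrow> 'i lop) \<Rightarrow> (complex \<Rightarrow> 'i \<Rightarrow> complex) \<Rightarrow> complex \<Rightarrow> 'i \<Rightarrow> complex" where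
  "dop N M f u = Phi N M [1..<N + 1] (\<lambda>u. vac (f u)) u {1..N}"

lemma Phi_Nil [simp]: "Phi N M [] F = F" by (simp add: Phi_def)
lemma Phi_Cons [simp]: "Phi N M (a # as) F = phi N M a (Phi N M as F)" by (simp add: Phi_def)
lemma phi_add: "phi N M a (F + G) = phi N M a F + phi N M a G"
  by (rule ext) (simp add: phi_def psi_add nu_add)
lemma phi_0 [simp]: "phi N M a 0 = 0" by (rule ext) (simp add: phi_def)
lemma Phi_add: "Phi N M as (F + G) = Phi N M as F + Phi N M as G"
  by (induction as) (auto simp: phi_add simp del: pw)
lemma Phi_0 [simp]: "Phi N M as 0 = 0" by (induction as) (auto simp del: pw)

text \<open>The mixed terms cancel because \<open>nu\<close> anticommutes with \<open>psi\<close>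
  whatever its coefficients are. The terms with two shifts involve the matrix at u and u - 1, which
  is the pair in the Manin hypothesis.\<close>

lemma phi_anticomm:
  assumes "\<And>u. manin N (M u) (M (u - 1))" "a \<in> {1..N}" "c \<in> {1..N}"
  shows "phi N M a (phi N M c F) = - phi N M c (phi N M a F)"
proof (rule ext)
  fix u
  have *: "psi c (psi a (F u)) = - psi a (psi c (F u))" by (rule psi_anticomm)
  show "phi N M a (phi N M c F) u = (- phi N M c (phi N M a F)) u"
    using manin_nu[OF assms(1)[of u] assms(2,3), of "F (u - 1 - 1)"]
    by (simp add: phi_def psi_diff nu_diff nu_psi *)
qed

text \<open>The factor is moved through the product by anticommutation until it meets its own copy,
  and the square vanishes.\<close>

lemma phi_Phi_mem:
  assumes "\<And>u. manin N (M u) (M (u - 1))" "a \<in> {1..N}" "set cs \<subseteq> {1..N}" "a \<in> set cs"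
  shows "phi N M a (Phi N M cs F) = 0"
  using assms(3,4)
proof (induction cs)
  case (Cons c cs)
  have anti: "phi N M a (phi N M c (Phi N M cs F)) = - phi N M c (phi N M a (Phi N M cs F))"
    by (rule phi_anticomm) (use assms Cons in auto)
  show ?case
  proof (cases "a = c")
    case True
    have "phi N M a (phi N M c (Phi N M cs F)) u = 0" for u
    proof (rule fun_double_zero)
      show "phi N M a (phi N M c (Phi N M cs F)) u = - phi N M a (phi N M c (Phi N M cs F)) u"
        using fun_cong[OF anti, of u] True by simp
    qed
    then show ?thesis by (simp add: fun_eq_iff)
  next
    case False
    then have *: "phi N M a (Phi N M cs F) = 0" using Cons by (auto simp del: pw)
    show ?thesis unfolding Phi_Cons anti * phi_0 by (simp del: pw)
  qed
qed simp

section \<open>Products of L-operators\<close>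

text \<open>The L-operator multiplied by u - z_s, hence polynomial in u. In \<open>Tt\<close> the
  head of the list is the leftmost factor; \<open>Mt\<close> puts back the denominators collected in
  \<open>ppi\<close> and the twist by Q.\<close>

definition Lt :: "('k \<Rightarrow> nat \<Rightarrow> nat \<Rightarrow> 'i lop) \<Rightarrow> ('k \<Rightarrow> complex) \<Rightarrow> 'k \<Rightarrow> complex \<Rightarrow> nat \<Rightarrow> nat \<Rightarrow> 'i lop" where
  "Lt e z s u a b = (if a = b then sc (u - z s) else 0) + e s b a"

fun Tt :: "nat \<Rightarrow> ('k \<Rightarrow> nat \<Rightarrow> nat \<Rightarrow> 'i lop) \<Rightarrow> ('k \<Rightarrow> complex) \<Rightarrow> 'k list \<Rightarrow> complex \<Rightarrow> nat \<Rightarrow> nat \<Rightarrow> 'i lop" where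
  "Tt N e z [] u a b = (if a = b then 1 else 0)"
| "Tt N e z (s # ss) u a b = (\<Sum>c=1..N. Lt e z s u a c * Tt N e z ss u c b)"

definition ppi :: "('k \<Rightarrow> complex) \<Rightarrow> 'k list \<Rightarrow> complex \<Rightarrow> complex" where
  "ppi z ss u = (\<Prod>s\<leftarrow>ss. u - z s)"

definition Mt :: "nat \<Rightarrow> ('k \<Rightarrow> nat \<Rightarrow> nat \<Rightarrow> 'i lop) \<Rightarrow> ('k \<Rightarrow> complex) \<Rightarrow> (nat \<Rightarrow> complex) \<Rightarrow> 'k list
    \<Rightarrow> complex \<Rightarrow> nat \<Rightarrow> nat \<Rightarrow> 'i lop" where
  "Mt N e z q ss u a b = sc (q a / ppi z ss u) * Tt N e z ss u a b"

definition gl_rel :: "nat \<Rightarrow> (nat \<Rightarrow> nat \<Rightarrow> 'r :: ring_1) \<Rightarrow> bool" where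
  "gl_rel N e \<longleftrightarrow> (\<forall>a\<in>{1..N}. \<forall>b\<in>{1..N}. \<forall>c\<in>{1..N}. \<forall>d\<in>{1..N}.
     e a b * e c d - e c d * e a b = (if b = c then e a d else 0) - (if a = d then e c b else 0))"

definition gl_sites :: "nat \<Rightarrow> ('k \<Rightarrow> nat \<Rightarrow> nat \<Rightarrow> 'r :: ring_1) \<Rightarrow> 'k set \<Rightarrow> bool" where
  "gl_sites N e S \<longleftrightarrow> (\<forall>s\<in>S. gl_rel N (e s)) \<and>
     (\<forall>s\<in>S. \<forall>t\<in>S. s \<noteq> t \<longrightarrow> (\<forall>a\<in>{1..N}. \<forall>b\<in>{1..N}. \<forall>c\<in>{1..N}. \<forall>d\<in>{1..N}.
        e s a b * e t c d = e t c d * e s a b))"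

definition matrix_units :: "nat \<Rightarrow> (nat \<Rightarrow> nat \<Rightarrow> 'r :: ring_1) \<Rightarrow> bool" where
  "matrix_units N e \<longleftrightarrow> (\<forall>a\<in>{1..N}. \<forall>b\<in>{1..N}. \<forall>c\<in>{1..N}. \<forall>d\<in>{1..N}.
     e a b * e c d = (if b = c then e a d else 0))"

lemma gl_rel_swap:
  assumes "gl_rel N e" "a \<in> {1..N}" "b \<in> {1..N}" "c \<in> {1..N}" "d \<in> {1..N}"
  shows "e a b * e c d = e c d * e a b + (if b = c then e a d else 0) - (if a = d then e c b else 0)"
proof -
  have "e a b * e c d - e c d * e a b = (if b = c then e a d else 0) - (if a = d then e c b else 0)"
    using assms unfolding gl_rel_def by blast
  then show ?thesis by (simp only: diff_eq_eq) (simp add: algebra_simps)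
qed

lemma gl_sites_rel: "gl_sites N e S \<Longrightarrow> s \<in> S \<Longrightarrow> gl_rel N (e s)"
  unfolding gl_sites_def by blast

lemma gl_sites_comm:
  assumes "gl_sites N e S" "s \<in> S" "t \<in> S" "s \<noteq> t"
    "a \<in> {1..N}" "b \<in> {1..N}" "c \<in> {1..N}" "d \<in> {1..N}"
  shows "e s a b * e t c d = e t c d * e s a b"
  using assms unfolding gl_sites_def by blast

lemma matrix_unitsD:
  assumes "matrix_units N e" "a \<in> {1..N}" "b \<in> {1..N}" "c \<in> {1..N}" "d \<in> {1..N}"
  shows "e a b * e c d = (if b = c then e a d else 0)"
  using assms unfolding matrix_units_def by blast

lemma matrix_units_gl_rel: "matrix_units N e \<Longrightarrow> gl_rel N e"
  unfolding gl_rel_def by (auto simp: matrix_unitsD)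

lemma Lt_comm:
  assumes "X * e s b a = e s b a * X"
  shows "X * Lt e z s u a b = Lt e z s u a b * X"
  using assms by (auto simp: Lt_def distrib_left distrib_right sc_comm)

lemma Tt_comm:
  assumes "\<And>s a b. s \<in> set ss \<Longrightarrow> a \<in> {1..N} \<Longrightarrow> b \<in> {1..N} \<Longrightarrow> X * e s a b = e s a b * X"
    and "a \<in> {1..N}" "b \<in> {1..N}"
  shows "X * Tt N e z ss u a b = Tt N e z ss u a b * X"
  using assms
proof (induction ss arbitrary: a b)
  case (Cons s ss)
  have "X * Tt N e z (s # ss) u a b = (\<Sum>c=1..N. (X * Lt e z s u a c) * Tt N e z ss u c b)"
    by (simp add: sum_distrib_left mult.assoc)
  also have "\<dots> = (\<Sum>c=1..N. Lt e z s u a c * Tt N e z ss u c b * X)"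
  proof (intro sum.cong refl)
    fix c assume c: "c \<in> {1..N}"
    have 1: "X * Lt e z s u a c = Lt e z s u a c * X"
      by (rule Lt_comm) (use Cons.prems c in auto)
    have 2: "X * Tt N e z ss u c b = Tt N e z ss u c b * X"
      by (rule Cons.IH) (use Cons.prems c in auto)
    show "X * Lt e z s u a c * Tt N e z ss u c b = Lt e z s u a c * Tt N e z ss u c b * X"
      by (metis 1 2 mult.assoc)
  qed
  finally show ?case by (simp add: sum_distrib_right)
qed auto

lemma Tt_append:
  assumes "a \<in> {1..N}" "b \<in> {1..N}"
  shows "Tt N e z (xs @ ys) u a b = (\<Sum>c=1..N. Tt N e z xs u a c * Tt N e z ys u c b)"
  using assms
proof (induction xs arbitrary: a)
  case Nil
  have "(\<Sum>c=1..N. Tt N e z [] u a c * Tt N e z ys u c b)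
    = (\<Sum>c=1..N. if a = c then Tt N e z ys u c b else 0)"
    by (intro sum.cong) auto
  then show ?case using Nil by simp
next
  case (Cons s xs)
  have "Tt N e z ((s # xs) @ ys) u a b
    = (\<Sum>c=1..N. Lt e z s u a c * (\<Sum>d=1..N. Tt N e z xs u c d * Tt N e z ys u d b))"
    using Cons by simp
  also have "\<dots> = (\<Sum>d=1..N. \<Sum>c=1..N. Lt e z s u a c * Tt N e z xs u c d * Tt N e z ys u d b)"
    unfolding sum_distrib_left by (subst sum.swap) (simp add: mult.assoc)
  finally show ?case by (simp add: sum_distrib_right)
qed

lemma Tt_sites_comm:
  assumes "gl_sites N e S" "set xs \<subseteq> S" "set ys \<subseteq> S" "set xs \<inter> set ys = {}"
    "a \<in> {1..N}" "b \<in> {1..N}" "c \<in> {1..N}" "d \<in> {1..N}"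
  shows "Tt N e z xs u a b * Tt N e z ys v c d = Tt N e z ys v c d * Tt N e z xs u a b"
proof -
  have "e t c d * Tt N e z xs u a b = Tt N e z xs u a b * e t c d"
    if "t \<in> set ys" "c \<in> {1..N}" "d \<in> {1..N}" for t c d
    by (rule Tt_comm) (use that assms gl_sites_comm[OF assms(1)] in blast)+
  then show ?thesis
    by (intro Tt_comm) (use assms in auto)
qed

lemma sc_sum_mult: "(sc a + X) * (sc b + Y) = sc (a * b) + sc a * Y + sc b * X + X * Y"
  by (simp add: distrib_left distrib_right sc_mult sc_comm[of X] algebra_simps)

text \<open>Reordering products of generators creates terms linear in the generators; they are
  compensated by the difference between the scalars u - z_s and u - 1 - z_s. This is where the shift
  by 1 comes from.\<close>

lemma manin_Lt:
  assumes "gl_rel N (e s)"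
  shows "manin N (Lt e z s u) (Lt e z s (u - 1))"
  unfolding manin_def
proof (intro ballI)
  fix a b c d assume abcd: "a \<in> {1..N}" "b \<in> {1..N}" "c \<in> {1..N}" "d \<in> {1..N}"
  define v where "v = u - z s"
  define \<delta> where "\<delta> = (\<lambda>x y :: nat. if x = y then 1 else 0 :: complex)"
  have L: "Lt e z s u x y = sc (v * \<delta> x y) + e s y x" "Lt e z s (u - 1) x y = sc ((v - 1) * \<delta> x y) + e s y x" for x y
    by (auto simp: Lt_def v_def \<delta>_def algebra_simps)
  have if_sc: "(if P then X else 0) = sc (if P then 1 else 0) * X" for P and X :: "'a lop" by simp
  have 1: "e s b a * e s d c = e s d c * e s b a + sc (\<delta> a d) * e s b c - sc (\<delta> b c) * e s d a"
    using gl_rel_swap[OF assms abcd(2,1,4,3)] by (auto simp: \<delta>_def)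
  have 2: "e s b c * e s d a = e s d a * e s b c + sc (\<delta> c d) * e s b a - sc (\<delta> b a) * e s d c"
    using gl_rel_swap[OF assms abcd(2,3,4,1)] by (auto simp: \<delta>_def)
  show "Lt e z s u a b * Lt e z s (u - 1) c d + Lt e z s u c b * Lt e z s (u - 1) a d
    = Lt e z s u a d * Lt e z s (u - 1) c b + Lt e z s u c d * Lt e z s (u - 1) a b"
    unfolding L sc_sum_mult 1 2
    by (cases "a = b"; cases "c = d"; cases "a = d"; cases "b = c")
      (simp_all add: \<delta>_def sc_diff left_diff_distrib algebra_simps)
qed

lemma manin_Tt:
  assumes "gl_sites N e S" "set ss \<subseteq> S" "distinct ss"
  shows "manin N (Tt N e z ss u) (Tt N e z ss (u - 1))"
  using assms(2,3)
proof (induction ss)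
  case Nil
  show ?case unfolding manin_def by auto
next
  case (Cons s ss)
  have eq: "Tt N e z (s # ss) v = (\<lambda>a b. \<Sum>c=1..N. Lt e z s v a c * Tt N e z ss v c b)" for v
    by (intro ext) simp
  show ?case unfolding eq
  proof (rule manin_mult)
    show "manin N (Lt e z s u) (Lt e z s (u - 1))"
      by (rule manin_Lt, rule gl_sites_rel[OF assms(1)]) (use Cons in auto)
    show "manin N (Tt N e z ss u) (Tt N e z ss (u - 1))"
      using Cons by auto
    fix a b c d assume abcd: "a \<in> {1..N}" "b \<in> {1..N}" "c \<in> {1..N}" "d \<in> {1..N}"
    have "Tt N e z ss u c d * Lt e z s (u - 1) a b = Lt e z s (u - 1) a b * Tt N e z ss u c d"
    proof (rule Lt_comm, rule sym, rule Tt_comm)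
      fix t a' b' assume "t \<in> set ss" "a' \<in> {1..N}" "b' \<in> {1..N}"
      then show "e s b a * e t a' b' = e t a' b' * e s b a"
        using gl_sites_comm[OF assms(1), of s t b a a' b'] Cons.prems abcd by auto
    qed (use abcd in auto)
    then show "Lt e z s (u - 1) a b * Tt N e z ss u c d = Tt N e z ss u c d * Lt e z s (u - 1) a b"
      by simp
  qed
qed

lemma manin_scale:
  fixes M M' :: "nat \<Rightarrow> nat \<Rightarrow> 'i lop"
  assumes "manin N M M'"
  shows "manin N (\<lambda>a b. sc (q a * g) * M a b) (\<lambda>a b. sc (q a * g') * M' a b)"
  unfolding manin_def
proof (intro ballI)
  fix a b c d assume abcd: "a \<in> {1..N}" "b \<in> {1..N}" "c \<in> {1..N}" "d \<in> {1..N}"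
  have prod: "(sc (q a * g) * X) * (sc (q c * g') * Y) = sc (q a * q c * g * g') * (X * Y)"
    for a c and X Y :: "'i lop"
    unfolding mult_interchange[OF sc_comm[symmetric]] sc_mult[symmetric] by (simp add: mult_ac)
  show "sc (q a * g) * M a b * (sc (q c * g') * M' c d) + sc (q c * g) * M c b * (sc (q a * g') * M' a d)
    = sc (q a * g) * M a d * (sc (q c * g') * M' c b) + sc (q c * g) * M c d * (sc (q a * g') * M' a b)"
    unfolding prod mult.commute[of "q c" "q a"] distrib_left[symmetric] maninD[OF assms abcd] ..
qed

lemma Lt_total_comm:
  assumes "gl_rel N (e s)" "a \<in> {1..N}" "b \<in> {1..N}" "c \<in> {1..N}" "d \<in> {1..N}"
  shows "e s c d * Lt e z s u a b = Lt e z s u a b * e s c d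
    + (if d = b then Lt e z s u a c else 0) - (if c = a then Lt e z s u d b else 0)"
  using gl_rel_swap[OF assms(1,4,5,3,2)]
  by (auto simp: Lt_def distrib_left distrib_right sc_comm)

text \<open>The diagonal action commutes with \<open>Tt\<close> up to replacing its column or its
  row index. When a site is added, the two terms at the summed inner index cancel. The case
  \<open>c = d\<close> later shows that the operator preserves weights.\<close>

lemma Tt_total_comm:
  assumes "gl_sites N e S" "set ss \<subseteq> S" "distinct ss"
    "a \<in> {1..N}" "b \<in> {1..N}" "c \<in> {1..N}" "d \<in> {1..N}"
  shows "(\<Sum>s\<in>set ss. e s c d) * Tt N e z ss u a b = Tt N e z ss u a b * (\<Sum>s\<in>set ss. e s c d)
    + (if d = b then Tt N e z ss u a c else 0) - (if c = a then Tt N e z ss u d b else 0)"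
  using assms(2-)
proof (induction ss arbitrary: a b)
  case (Cons s ss)
  let ?E = "\<Sum>t\<in>set ss. e t c d"
  let ?L = "Lt e z s u" and ?T = "Tt N e z ss u"
  have s: "s \<notin> set ss" "s \<in> S" using Cons.prems by auto
  have EL: "?E * ?L a x = ?L a x * ?E" if "x \<in> {1..N}" for x
    unfolding sum_distrib_left sum_distrib_right
  proof (intro sum.cong refl Lt_comm)
    fix t assume t: "t \<in> set ss"
    show "e t c d * e s x a = e s x a * e t c d"
      by (rule gl_sites_comm[OF assms(1)]) (use t s that Cons.prems in auto)
  qed
  have eT: "e s c d * ?T x b = ?T x b * e s c d" if "x \<in> {1..N}" for x
  proof (rule Tt_comm)
    fix t a' b' assume t: "t \<in> set ss" "a' \<in> {1..N}" "b' \<in> {1..N}"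
    show "e s c d * e t a' b' = e t a' b' * e s c d"
      by (rule gl_sites_comm[OF assms(1)]) (use t s that Cons.prems in auto)
  qed (use that Cons.prems in auto)
  have IH: "?E * ?T x b = ?T x b * ?E + (if d = b then ?T x c else 0) - (if c = x then ?T d b else 0)"
    if "x \<in> {1..N}" for x
    by (rule Cons.IH) (use that Cons.prems in auto)
  have eL: "e s c d * ?L a x = ?L a x * e s c d + (if d = x then ?L a c else 0) - (if c = a then ?L d x else 0)"
    if "x \<in> {1..N}" for x
    by (rule Lt_total_comm[where e = e and s = s, OF gl_sites_rel[OF assms(1) s(2)]]) (use that Cons.prems in auto)
  have summand: "(e s c d + ?E) * (?L a x * ?T x b) = (?L a x * ?T x b) * (e s c d + ?E)
      + (if d = x then ?L a c * ?T x b else 0) - (if c = a then ?L d x * ?T x b else 0)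
      + (if d = b then ?L a x * ?T x c else 0) - (if c = x then ?L a x * ?T d b else 0)"
    if x: "x \<in> {1..N}" for x
  proof -
    have "(e s c d + ?E) * (?L a x * ?T x b) = (e s c d * ?L a x) * ?T x b + (?E * ?L a x) * ?T x b"
      by (simp add: distrib_right mult.assoc)
    also have "(?E * ?L a x) * ?T x b = ?L a x * (?E * ?T x b)"
      unfolding EL[OF x] by (simp add: mult.assoc)
    also have "(e s c d * ?L a x) * ?T x b = ?L a x * (e s c d * ?T x b)
      + (if d = x then ?L a c * ?T x b else 0) - (if c = a then ?L d x * ?T x b else 0)"
      unfolding eL[OF x] by (auto simp: distrib_right left_diff_distrib mult.assoc)
    finally show ?thesis
      unfolding IH[OF x] eT[OF x] by (auto simp: distrib_left right_diff_distrib mult.assoc)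
  qed
  have "(\<Sum>t\<in>set (s # ss). e t c d) = e s c d + ?E" using s by simp
  then have "(\<Sum>t\<in>set (s # ss). e t c d) * Tt N e z (s # ss) u a b
    = (\<Sum>x=1..N. (e s c d + ?E) * (?L a x * ?T x b))"
    by (simp add: sum_distrib_left)
  also have "\<dots> = (\<Sum>x=1..N. (?L a x * ?T x b) * (e s c d + ?E)
      + (if d = x then ?L a c * ?T x b else 0) - (if c = a then ?L d x * ?T x b else 0)
      + (if d = b then ?L a x * ?T x c else 0) - (if c = x then ?L a x * ?T d b else 0))"
    by (intro sum.cong refl summand)
  also have "\<dots> = Tt N e z (s # ss) u a b * (e s c d + ?E) + ?L a c * ?T d b
      - (if c = a then Tt N e z (s # ss) u d b else 0)
      + (if d = b then Tt N e z (s # ss) u a c else 0) - ?L a c * ?T d b"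
    using Cons.prems
    by (simp add: sum.distrib sum_subtractf sum_distrib_right sum.delta sum.delta')
  finally show ?case using s by simp
qed auto

section \<open>Sites carrying the vector representation\<close>

lemma Tt_split:
  assumes "a \<in> {1..N}" "b \<in> {1..N}"
  shows "Tt N e z (xs @ s # ys) u a b
    = (\<Sum>c=1..N. \<Sum>d=1..N. Tt N e z xs u a c * Lt e z s u c d * Tt N e z ys u d b)"
  using assms by (simp add: Tt_append sum_distrib_left mult.assoc)

text \<open>
  The two factors of \<open>Tt\<close> at \<open>u = z s\<close>, where it has rank one in the auxiliary space.
\<close>

definition col_part :: "nat \<Rightarrow> ('k \<Rightarrow> nat \<Rightarrow> nat \<Rightarrow> 'i lop) \<Rightarrow> ('k \<Rightarrow> complex) \<Rightarrow> 'k \<Rightarrow> 'k list \<Rightarrow> nat \<Rightarrow> 'i lop" where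
  "col_part N e z s ys b = (\<Sum>d=1..N. Tt N e z ys (z s) d b * e s d 1)"

definition row_part :: "nat \<Rightarrow> ('k \<Rightarrow> nat \<Rightarrow> nat \<Rightarrow> 'i lop) \<Rightarrow> ('k \<Rightarrow> complex) \<Rightarrow> 'k \<Rightarrow> 'k list \<Rightarrow> nat \<Rightarrow> 'i lop" where
  "row_part N e z s xs a = (\<Sum>k=1..N. Tt N e z xs (z s) a k * e s 1 k)"

context
  fixes N :: nat and e :: "'k \<Rightarrow> nat \<Rightarrow> nat \<Rightarrow> 'i lop" and z :: "'k \<Rightarrow> complex"
    and xs ys :: "'k list" and s :: 'k
  assumes N: "1 \<le> N" and sites: "gl_sites N e (set (xs @ s # ys))" and dist: "distinct (xs @ s # ys)"
    and units: "matrix_units N (e s)"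
begin

private lemma A_e:
  assumes "a \<in> {1..N}" "b \<in> {1..N}" "c \<in> {1..N}" "d \<in> {1..N}"
  shows "e s c d * Tt N e z xs u a b = Tt N e z xs u a b * e s c d"
proof (rule Tt_comm)
  fix t a b assume "t \<in> set xs" "a \<in> {1..N}" "b \<in> {1..N}"
  then show "e s c d * e t a b = e t a b * e s c d"
    using dist assms by (intro gl_sites_comm[OF sites]) auto
qed (use assms in auto)

private lemma C_e:
  assumes "a \<in> {1..N}" "b \<in> {1..N}" "c \<in> {1..N}" "d \<in> {1..N}"
  shows "e s c d * Tt N e z ys u a b = Tt N e z ys u a b * e s c d"
proof (rule Tt_comm)
  fix t a b assume "t \<in> set ys" "a \<in> {1..N}" "b \<in> {1..N}"
  then show "e s c d * e t a b = e t a b * e s c d"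
    using dist assms by (intro gl_sites_comm[OF sites]) auto
qed (use assms in auto)

private lemma A_C:
  assumes "a \<in> {1..N}" "b \<in> {1..N}" "c \<in> {1..N}" "d \<in> {1..N}"
  shows "Tt N e z ys v c d * Tt N e z xs u a b = Tt N e z xs u a b * Tt N e z ys v c d"
  by (rule Tt_sites_comm[OF sites]) (use assms dist in auto)

text \<open>At u = z_s the scalar part of the L-operator disappears, and a matrix unit factors
  through the index 1: \<open>e s d c = e s d 1 * e s 1 c\<close>. Since operators at distinct sites
  commute, everything that carries the column index can be collected on the left.\<close>

lemma Tt_at_site:
  assumes "a \<in> {1..N}" "b \<in> {1..N}"
  shows "Tt N e z (xs @ s # ys) (z s) a b = col_part N e z s ys b * row_part N e z s xs a"
proof -
  have "col_part N e z s ys b * row_part N e z s xs a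
    = (\<Sum>d=1..N. \<Sum>c=1..N. Tt N e z ys (z s) d b * e s d 1 * (Tt N e z xs (z s) a c * e s 1 c))"
    by (simp add: col_part_def row_part_def sum_product)
  also have "\<dots> = (\<Sum>d=1..N. \<Sum>c=1..N. Tt N e z xs (z s) a c * e s d c * Tt N e z ys (z s) d b)"
  proof (intro sum.cong refl)
    fix c d assume cd: "d \<in> {1..N}" "c \<in> {1..N}"
    have "Tt N e z ys (z s) d b * e s d 1 * (Tt N e z xs (z s) a c * e s 1 c)
      = Tt N e z ys (z s) d b * (e s d 1 * Tt N e z xs (z s) a c) * e s 1 c"
      by (simp add: mult.assoc)
    also have "\<dots> = (Tt N e z ys (z s) d b * Tt N e z xs (z s) a c) * (e s d 1 * e s 1 c)"
      using A_e[of a c d 1 "z s"] assms cd N by (simp add: mult.assoc)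
    also have "\<dots> = Tt N e z xs (z s) a c * (Tt N e z ys (z s) d b * e s d c)"
      using A_C[of a c d b "z s" "z s"] matrix_unitsD[OF units, of d 1 1 c] assms cd N
      by (simp add: mult.assoc)
    also have "\<dots> = Tt N e z xs (z s) a c * e s d c * Tt N e z ys (z s) d b"
      using C_e[of d b d c "z s"] assms cd by (simp add: mult.assoc)
    finally show "Tt N e z ys (z s) d b * e s d 1 * (Tt N e z xs (z s) a c * e s 1 c)
      = Tt N e z xs (z s) a c * e s d c * Tt N e z ys (z s) d b" .
  qed
  also have "\<dots> = (\<Sum>c=1..N. \<Sum>d=1..N. Tt N e z xs (z s) a c * Lt e z s (z s) c d * Tt N e z ys (z s) d b)"
  proof -
    have "Lt e z s (z s) c d = e s d c" for c d by (auto simp: Lt_def)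
    then show ?thesis by (subst sum.swap) simp
  qed
  also have "\<dots> = Tt N e z (xs @ s # ys) (z s) a b"
    by (rule Tt_split[OF assms, symmetric])
  finally show ?thesis ..
qed

text \<open>With matrix units the product of the L-operators at z_s + 1 and z_s has two terms, which
  differ by exchanging the indices that face the sites \<open>ys\<close>. The contribution of
  \<open>ys\<close> is therefore a symmetrized product, and their Manin relation makes it symmetric
  in \<open>b\<close> and \<open>d\<close>.\<close>

lemma Tt_next_to_site_sym:
  assumes "a \<in> {1..N}" "b \<in> {1..N}" "c \<in> {1..N}" "d \<in> {1..N}"
  shows "Tt N e z (xs @ s # ys) (z s + 1) a b * Tt N e z (xs @ s # ys) (z s) c d
       = Tt N e z (xs @ s # ys) (z s + 1) a d * Tt N e z (xs @ s # ys) (z s) c b"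
proof -
  let ?A = "Tt N e z xs (z s + 1)" and ?A' = "Tt N e z xs (z s)"
  let ?C = "Tt N e z ys (z s + 1)" and ?C' = "Tt N e z ys (z s)"
  have expand: "Tt N e z (xs @ s # ys) (z s + 1) a b * Tt N e z (xs @ s # ys) (z s) c d
    = (\<Sum>x=1..N. \<Sum>k=1..N. \<Sum>l=1..N. ?A a x * ?A' c k * e s l k * (?C x b * ?C' l d + ?C l b * ?C' x d))"
    if b: "b \<in> {1..N}" and d: "d \<in> {1..N}" for b d
  proof -
    have inner: "(?A a x * Lt e z s (z s + 1) x y * ?C y b) * (?A' c k * Lt e z s (z s) k l * ?C' l d)
      = (if x = y then ?A a x * ?A' c k * e s l k * (?C x b * ?C' l d) else 0)
        + (if x = l then ?A a x * ?A' c k * e s y k * (?C y b * ?C' x d) else 0)"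
      if "x \<in> {1..N}" "y \<in> {1..N}" "k \<in> {1..N}" "l \<in> {1..N}" for x y k l
    proof -
      have L': "Lt e z s (z s) k l = e s l k" by (simp add: Lt_def)
      have Le: "Lt e z s (z s + 1) x y * e s l k = (if x = y then e s l k else 0) + (if x = l then e s y k else 0)"
        using matrix_unitsD[OF units that(2,1,4,3)] by (auto simp: Lt_def distrib_right)
      have LA: "Lt e z s (z s + 1) x y * ?A' c k = ?A' c k * Lt e z s (z s + 1) x y"
        using Lt_comm[of "?A' c k" e s y x] A_e[of c k y x "z s"] that assms by auto
      have "(?A a x * Lt e z s (z s + 1) x y * ?C y b) * (?A' c k * Lt e z s (z s) k l * ?C' l d)
        = ?A a x * Lt e z s (z s + 1) x y * (?C y b * ?A' c k) * e s l k * ?C' l d"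
        unfolding L' by (simp add: mult.assoc)
      also have "?C y b * ?A' c k = ?A' c k * ?C y b"
        by (rule A_C) (use that assms b in auto)
      also have "?A a x * Lt e z s (z s + 1) x y * (?A' c k * ?C y b) * e s l k * ?C' l d
        = ?A a x * (Lt e z s (z s + 1) x y * ?A' c k) * (?C y b * e s l k) * ?C' l d"
        by (simp add: mult.assoc)
      also have "?C y b * e s l k = e s l k * ?C y b"
        by (rule C_e[symmetric]) (use that b in auto)
      also have "?A a x * (Lt e z s (z s + 1) x y * ?A' c k) * (e s l k * ?C y b) * ?C' l d
        = ?A a x * ?A' c k * (Lt e z s (z s + 1) x y * e s l k) * (?C y b * ?C' l d)"
        unfolding LA by (simp add: mult.assoc)
      finally show ?thesis unfolding Le by (auto simp: distrib_left distrib_right)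
    qed
    have "Tt N e z (xs @ s # ys) (z s + 1) a b * Tt N e z (xs @ s # ys) (z s) c d
      = (\<Sum>x=1..N. \<Sum>k=1..N. \<Sum>y=1..N. \<Sum>l=1..N.
           (?A a x * Lt e z s (z s + 1) x y * ?C y b) * (?A' c k * Lt e z s (z s) k l * ?C' l d))"
      unfolding Tt_split[OF assms(1) b] Tt_split[OF assms(3) d] sum_product ..
    also have "\<dots> = (\<Sum>x=1..N. \<Sum>k=1..N. \<Sum>y=1..N. \<Sum>l=1..N.
        (if x = y then ?A a x * ?A' c k * e s l k * (?C x b * ?C' l d) else 0)
        + (if x = l then ?A a x * ?A' c k * e s y k * (?C y b * ?C' x d) else 0))"
      by (intro sum.cong refl inner)
    also have "\<dots> = (\<Sum>x=1..N. \<Sum>k=1..N. (\<Sum>l=1..N. ?A a x * ?A' c k * e s l k * (?C x b * ?C' l d))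
        + (\<Sum>y=1..N. ?A a x * ?A' c k * e s y k * (?C y b * ?C' x d)))"
    proof (intro sum.cong refl)
      fix x k assume x: "x \<in> {1..N}"
      have 1: "(\<Sum>y=1..N. \<Sum>l=1..N. if x = y then ?A a x * ?A' c k * e s l k * (?C x b * ?C' l d) else 0)
        = (\<Sum>l=1..N. ?A a x * ?A' c k * e s l k * (?C x b * ?C' l d))"
        by (subst sum.swap) (use x in simp)
      show "(\<Sum>y=1..N. \<Sum>l=1..N.
        (if x = y then ?A a x * ?A' c k * e s l k * (?C x b * ?C' l d) else 0)
        + (if x = l then ?A a x * ?A' c k * e s y k * (?C y b * ?C' x d) else 0))
        = (\<Sum>l=1..N. ?A a x * ?A' c k * e s l k * (?C x b * ?C' l d))
        + (\<Sum>y=1..N. ?A a x * ?A' c k * e s y k * (?C y b * ?C' x d))"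
        unfolding sum.distrib 1 using x by simp
    qed
    finally show ?thesis by (simp add: sum.distrib distrib_left)
  qed
  have man: "manin N ?C ?C'"
    using manin_Tt[OF sites, of ys z "z s + 1"] dist by auto
  show ?thesis
    unfolding expand[OF assms(2,4)] expand[OF assms(4,2)]
  proof (intro sum.cong refl)
    fix x k l assume x: "x \<in> {1..N}" and l: "l \<in> {1..N}"
    show "?A a x * ?A' c k * e s l k * (?C x b * ?C' l d + ?C l b * ?C' x d)
      = ?A a x * ?A' c k * e s l k * (?C x d * ?C' l b + ?C l d * ?C' x b)"
      unfolding maninD[OF man x assms(2) l assms(4)] ..
  qed
qed

text \<open>At z_s - 1 the scalar part of the L-operator is -1. This makes \<open>e s 1 k\<close>
  times it antisymmetric in the indices that face the sites \<open>xs\<close>, and the Manin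
  relation of \<open>xs\<close> then kills the part symmetric in \<open>a\<close> and
  \<open>c\<close>.\<close>

lemma row_part_anti:
  assumes "a \<in> {1..N}" "c \<in> {1..N}" "d \<in> {1..N}"
  shows "row_part N e z s xs a * Tt N e z (xs @ s # ys) (z s - 1) c d
    = - (row_part N e z s xs c * Tt N e z (xs @ s # ys) (z s - 1) a d)"
proof -
  let ?A = "Tt N e z xs (z s)" and ?A' = "Tt N e z xs (z s - 1)"
  let ?C = "Tt N e z ys (z s - 1)"
  let ?S = "\<lambda>k x. - (e s 1 k * ?C x d) + e s 1 x * ?C k d"
  have expand: "row_part N e z s xs a * Tt N e z (xs @ s # ys) (z s - 1) c d
    = (\<Sum>k=1..N. \<Sum>x=1..N. ?A a k * ?A' c x * ?S k x)"
    if ac: "a \<in> {1..N}" "c \<in> {1..N}" for a c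
  proof -
    have inner: "(?A a k * e s 1 k) * (?A' c x * Lt e z s (z s - 1) x y * ?C y d)
      = (if x = y then - (?A a k * ?A' c x * (e s 1 k * ?C x d)) else 0)
        + (if k = y then ?A a k * ?A' c x * (e s 1 x * ?C k d) else 0)"
      if "k \<in> {1..N}" "x \<in> {1..N}" "y \<in> {1..N}" for k x y
    proof -
      have eL: "e s 1 k * Lt e z s (z s - 1) x y = (if x = y then - e s 1 k else 0) + (if k = y then e s 1 x else 0)"
        using matrix_unitsD[OF units, of 1 k y x] N that by (auto simp: Lt_def distrib_left sc_neg)
      have "(?A a k * e s 1 k) * (?A' c x * Lt e z s (z s - 1) x y * ?C y d)
        = ?A a k * (e s 1 k * ?A' c x) * Lt e z s (z s - 1) x y * ?C y d"
        by (simp add: mult.assoc)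
      also have "e s 1 k * ?A' c x = ?A' c x * e s 1 k"
        by (rule A_e) (use ac that N in auto)
      also have "?A a k * (?A' c x * e s 1 k) * Lt e z s (z s - 1) x y * ?C y d
        = ?A a k * ?A' c x * (e s 1 k * Lt e z s (z s - 1) x y) * ?C y d"
        by (simp add: mult.assoc)
      finally show ?thesis unfolding eL by (auto simp: distrib_left distrib_right mult.assoc)
    qed
    have "row_part N e z s xs a * Tt N e z (xs @ s # ys) (z s - 1) c d
      = (\<Sum>k=1..N. \<Sum>x=1..N. \<Sum>y=1..N. (?A a k * e s 1 k) * (?A' c x * Lt e z s (z s - 1) x y * ?C y d))"
      unfolding Tt_split[OF ac(2) assms(3)] row_part_def sum_distrib_right unfolding sum_distrib_left ..
    also have "\<dots> = (\<Sum>k=1..N. \<Sum>x=1..N. \<Sum>y=1..N.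
        (if x = y then - (?A a k * ?A' c x * (e s 1 k * ?C x d)) else 0)
        + (if k = y then ?A a k * ?A' c x * (e s 1 x * ?C k d) else 0))"
      by (intro sum.cong refl inner)
    also have "\<dots> = (\<Sum>k=1..N. \<Sum>x=1..N. - (?A a k * ?A' c x * (e s 1 k * ?C x d))
        + ?A a k * ?A' c x * (e s 1 x * ?C k d))"
      by (intro sum.cong refl) (auto simp: sum.distrib)
    finally show ?thesis by (simp add: distrib_left right_diff_distrib)
  qed
  have man: "manin N ?A ?A'"
    using manin_Tt[OF sites, of xs z "z s"] dist by auto
  have "(\<Sum>k=1..N. \<Sum>x=1..N. (?A a k * ?A' c x + ?A c k * ?A' a x) * ?S k x) = 0"
    by (rule manin_contract[OF man assms(1,2)]) simp
  then have "row_part N e z s xs a * Tt N e z (xs @ s # ys) (z s - 1) c d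
    + row_part N e z s xs c * Tt N e z (xs @ s # ys) (z s - 1) a d = 0"
    unfolding expand[OF assms(1,2)] expand[OF assms(2,1)]
    by (simp add: distrib_right sum.distrib)
  then show ?thesis by (simp add: eq_neg_iff_add_eq_0)
qed

end

section \<open>Expansion in powers of the shift\<close>

text \<open>The part of the product \<open>Phi\<close> with exactly \<open>k\<close> shifts.\<close>

fun Vc :: "nat \<Rightarrow> (complex \<Rightarrow> nat \<Rightarrow> nat \<Rightarrow> 'i lop) \<Rightarrow> nat list \<Rightarrow> (complex \<Rightarrow> 'i form) \<Rightarrow> nat \<Rightarrow> complex \<Rightarrow> 'i form" where
  "Vc N M [] F k u = (if k = 0 then F u else 0)"
| "Vc N M (a # as) F k u
    = psi a (Vc N M as F k u) - (if k = 0 then 0 else nu N (M u) a (Vc N M as F (k - 1) (u - 1)))"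

text \<open>\<open>Ec\<close> collects the terms of \<open>Phi\<close> that contain a shift, the factor \<open>g u\<close> removed.\<close>

fun Ec :: "nat \<Rightarrow> (complex \<Rightarrow> nat \<Rightarrow> nat \<Rightarrow> 'i lop) \<Rightarrow> (complex \<Rightarrow> complex) \<Rightarrow> nat list \<Rightarrow> (complex \<Rightarrow> 'i form) \<Rightarrow> complex \<Rightarrow> 'i form" where
  "Ec N M g [] F u = 0"
| "Ec N M g (a # as) F u = psi a (Ec N M g as F u)
     - nu N (M u) a (Phi N (\<lambda>u a b. sc (g u) * M u a b) as F (u - 1))"

lemma nu_sc: "nu N (\<lambda>a b. sc c * M a b) a F = fap (sc c) (nu N M a F)"
  by (simp add: nu_def fap_sum fap_times)

lemma fap_sc_comm: "fap A (fap (sc c) F) = fap (sc c) (fap A F)"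
  by (metis fap_times sc_comm)

lemma nu_fap_sc: "nu N M a (fap (sc c) F) = fap (sc c) (nu N M a F)"
  by (rule nu_fap) (rule sc_comm)

lemma Vc_gt: "k > length as \<Longrightarrow> Vc N M as F k u = 0"
  by (induction as arbitrary: k u) (auto simp del: pw)

definition gprod :: "(complex \<Rightarrow> complex) \<Rightarrow> nat \<Rightarrow> complex \<Rightarrow> complex" where
  "gprod g k u = (\<Prod>i<k. g (u - of_nat i))"

lemma gprod_Suc: "gprod g (Suc k) u = g u * gprod g k (u - 1)"
  unfolding gprod_def prod.lessThan_Suc_shift by (simp add: algebra_simps)

lemma Phi_Vc:
  "Phi N (\<lambda>u a b. sc (g u) * M u a b) as F u
    = (\<Sum>k\<le>length as. fap (sc (gprod g k u)) (Vc N M as F k u))"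
proof (induction as arbitrary: u)
  case Nil
  then show ?case by (simp add: gprod_def)
next
  case (Cons a as)
  let ?M = "\<lambda>u a b. sc (g u) * M u a b"
  let ?n = "length as"
  have "Phi N ?M (a # as) F u = psi a (Phi N ?M as F u) - fap (sc (g u)) (nu N (M u) a (Phi N ?M as F (u - 1)))"
    by (simp add: phi_def nu_sc del: pw)
  also have "psi a (Phi N ?M as F u) = (\<Sum>k\<le>?n. fap (sc (gprod g k u)) (psi a (Vc N M as F k u)))"
    unfolding Cons psi_sum psi_fap ..
  also have "\<dots> = (\<Sum>k\<le>Suc ?n. fap (sc (gprod g k u)) (psi a (Vc N M as F k u)))"
    by (simp add: Vc_gt del: pw)
  also have "fap (sc (g u)) (nu N (M u) a (Phi N ?M as F (u - 1)))
    = (\<Sum>k\<le>?n. fap (sc (gprod g (Suc k) u)) (nu N (M u) a (Vc N M as F k (u - 1))))"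
    unfolding Cons nu_sum fap_sum nu_fap_sc gprod_Suc sc_mult fap_times ..
  also have "\<dots> = (\<Sum>k\<le>Suc ?n. fap (sc (gprod g k u))
      (if k = 0 then 0 else nu N (M u) a (Vc N M as F (k - 1) (u - 1))))"
    unfolding sum.atMost_Suc_shift by (simp del: pw)
  finally show ?case
    by (simp only: sum_subtractf[symmetric] fap_diff[symmetric] Vc.simps list.size add_0_right add_Suc_right)
qed

text \<open>All terms with a shift share the factor \<open>g u\<close>. Once it is removed,
  \<open>g\<close> occurs only at u - 1, u - 2, ..., so the expression makes sense at a pole of
  \<open>g\<close>; for \<open>g\<close> the inverse of \<open>ppi\<close> this gives access to the
  residue at a site.\<close>

lemma Ec_Vc:
  "Ec N M g as F u = (\<Sum>k<length as. fap (sc (gprod g k (u - 1))) (Vc N M as F (Suc k) u))"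
proof (induction as)
  case Nil
  then show ?case by simp
next
  case (Cons a as)
  let ?n = "length as"
  have "Ec N M g (a # as) F u = (\<Sum>k<?n. fap (sc (gprod g k (u - 1))) (psi a (Vc N M as F (Suc k) u)))
     - (\<Sum>k\<le>?n. fap (sc (gprod g k (u - 1))) (nu N (M u) a (Vc N M as F k (u - 1))))"
    by (simp only: Ec.simps Cons psi_sum psi_fap Phi_Vc nu_sum nu_fap_sc)
  also have "(\<Sum>k<?n. fap (sc (gprod g k (u - 1))) (psi a (Vc N M as F (Suc k) u)))
    = (\<Sum>k\<le>?n. fap (sc (gprod g k (u - 1))) (psi a (Vc N M as F (Suc k) u)))"
    unfolding lessThan_Suc_atMost[symmetric] by (simp add: Vc_gt del: pw)
  finally show ?case
    by (simp only: sum_subtractf[symmetric] fap_diff[symmetric] Vc.simps list.size add_0_right add_Suc_right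
        lessThan_Suc_atMost nat.simps if_False diff_Suc_1)
qed

section \<open>The local identity at a vector site\<close>

context
  fixes N :: nat and e :: "'k \<Rightarrow> nat \<Rightarrow> nat \<Rightarrow> 'i lop" and z :: "'k \<Rightarrow> complex"
    and ss xs ys :: "'k list" and s :: 'k and q :: "nat \<Rightarrow> complex" and M :: "complex \<Rightarrow> nat \<Rightarrow> nat \<Rightarrow> 'i lop"
  assumes N: "1 \<le> N" and ss: "ss = xs @ s # ys" and sites: "gl_sites N e (set ss)" and dist: "distinct ss"
    and units: "matrix_units N (e s)"
    and M: "M = (\<lambda>u a b. sc (q a) * Tt N e z ss u a b)"
begin

lemma nu_next_to_site:
  assumes "a \<in> {1..N}" "b \<in> {1..N}"
  shows "nu N (M (z s + 1)) b (nu N (M (z s)) a F) = 0"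
  unfolding nu_nu
proof (rule sym_psi_psi)
  fix c d assume cd: "c \<in> {1..N}" "d \<in> {1..N}"
  have "Tt N e z ss (z s + 1) b c * Tt N e z ss (z s) a d = Tt N e z ss (z s + 1) b d * Tt N e z ss (z s) a c"
    unfolding ss by (rule Tt_next_to_site_sym) (use N sites dist units ss assms cd in auto)
  then show "M (z s + 1) b c * M (z s) a d = M (z s + 1) b d * M (z s) a c"
    unfolding M mult_interchange[OF sc_comm[symmetric]] by simp
qed

lemma nu_Vc_at_site:
  assumes "set as \<subseteq> {1..N}" "b \<in> {1..N}" "k \<ge> 1"
  shows "nu N (M (z s + 1)) b (Vc N M as F k (z s)) = 0"
  using assms(1)
proof (induction as)
  case Nil
  then show ?case using assms(3) by (simp del: pw)
next
  case (Cons a as)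
  have "nu N (M (z s + 1)) b (Vc N M (a # as) F k (z s))
    = - psi a (nu N (M (z s + 1)) b (Vc N M as F k (z s)))
      - nu N (M (z s + 1)) b (nu N (M (z s)) a (Vc N M as F (k - 1) (z s - 1)))"
    using assms(3) by (simp add: nu_diff nu_psi del: pw)
  then show ?case using Cons assms(2) by (simp add: nu_next_to_site del: pw)
qed

text \<open>The shifted rows use the matrix at u, u - 1, ..., u - k + 1. For u = z_s + j with 1
  \<le> j < k, two consecutive ones use it at z_s + 1 and z_s, and their product vanishes by
  \<open>nu_next_to_site\<close>; the \<open>psi\<close> in between only contribute signs. These
  zeros cancel the poles at z_s + j with positive j, so that for generic z the only pole left is a
  simple one at z_s itself.\<close>

lemma Vc_vanish:
  assumes "set as \<subseteq> {1..N}" "1 \<le> j" "j < k"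
  shows "Vc N M as F k (z s + of_nat j) = 0"
  using assms
proof (induction as arbitrary: k j)
  case Nil
  then show ?case by simp
next
  case (Cons a as)
  have 1: "Vc N M as F k (z s + of_nat j) = 0" using Cons by (simp del: pw)
  have 2: "nu N (M (z s + of_nat j)) a (Vc N M as F (k - 1) (z s + of_nat j - 1)) = 0"
  proof (cases "j = 1")
    case True
    then show ?thesis using nu_Vc_at_site[of as a "k - 1"] Cons.prems by simp
  next
    case False
    then have eq: "z s + of_nat j - 1 = z s + of_nat (j - 1)" using Cons.prems by simp
    have "Vc N M as F (k - 1) (z s + of_nat j - 1) = 0"
      unfolding eq by (rule Cons.IH) (use Cons.prems False in auto)
    then show ?thesis by (simp only: nu_0)
  qed
  show ?case by (simp only: Vc.simps 1 2 psi_0) simp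
qed

private definition alpha :: "nat \<Rightarrow> 'i lop" where
  "alpha a = sc (q a) * row_part N e z s xs a"

private lemma M_at_site:
  assumes "a \<in> {1..N}" "b \<in> {1..N}"
  shows "M (z s) a b = col_part N e z s ys b * alpha a"
proof -
  have "Tt N e z ss (z s) a b = col_part N e z s ys b * row_part N e z s xs a"
    unfolding ss by (rule Tt_at_site) (use N sites dist units ss assms in auto)
  then show ?thesis by (simp add: M alpha_def sc_left_comm)
qed

private lemma alpha_nu:
  assumes "a \<in> {1..N}" "c \<in> {1..N}"
  shows "fap (alpha a) (nu N (M (z s - 1)) c F) = - fap (alpha c) (nu N (M (z s - 1)) a F)"
proof -
  have "fap (alpha a) (fap (M (z s - 1) c b) (psi b F)) = - fap (alpha c) (fap (M (z s - 1) a b) (psi b F))"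
    if b: "b \<in> {1..N}" for b
  proof -
    have *: "row_part N e z s xs a * Tt N e z ss (z s - 1) c b = - (row_part N e z s xs c * Tt N e z ss (z s - 1) a b)"
      unfolding ss by (rule row_part_anti) (use N sites dist units ss assms b in auto)
    have "alpha a * M (z s - 1) c b = - (alpha c * M (z s - 1) a b)"
      unfolding alpha_def M mult_interchange[OF sc_comm[symmetric]] *
      by (simp add: sc_mult[symmetric] mult.commute)
    then show ?thesis by (metis fap_times fap_uminus)
  qed
  then show ?thesis by (simp add: nu_def fap_sum sum_negf)
qed

text \<open>At z_s every one-form \<open>nu\<close> has the same left factor, built from
  \<open>col_part\<close> and \<open>psi\<close>. Pulling it to the front, with a sign for each
  \<open>psi\<close> it passes, leaves this form.\<close>

private fun omega :: "(complex \<Rightarrow> complex) \<Rightarrow> nat list \<Rightarrow> (complex \<Rightarrow> 'i form) \<Rightarrow> 'i form" where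
  "omega g [] F = 0"
| "omega g (a # as) F
    = fap (alpha a) (Phi N (\<lambda>u a b. sc (g u) * M u a b) as F (z s - 1)) - psi a (omega g as F)"

private lemma Ec_omega:
  assumes "set as \<subseteq> {1..N}"
  shows "Ec N M g as F (z s) = - (\<Sum>b=1..N. fap (col_part N e z s ys b) (psi b (omega g as F)))"
  using assms
proof (induction as)
  case (Cons a as)
  let ?P = "Phi N (\<lambda>u a b. sc (g u) * M u a b) as F (z s - 1)"
  have nu: "nu N (M (z s)) a ?P = (\<Sum>b=1..N. fap (col_part N e z s ys b) (psi b (fap (alpha a) ?P)))"
    unfolding nu_def psi_fap using Cons.prems by (intro sum.cong refl) (auto simp: M_at_site fap_times)
  have psi: "psi a (fap X (psi b G)) = - fap X (psi b (psi a G))" for X :: "'i lop" and b G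
    by (simp only: psi_fap psi_anticomm[of a b] fap_neg)
  have "Ec N M g (a # as) F (z s)
    = psi a (- (\<Sum>b=1..N. fap (col_part N e z s ys b) (psi b (omega g as F)))) - nu N (M (z s)) a ?P"
    using Cons by (simp del: pw)
  also have "\<dots> = - (\<Sum>b=1..N. fap (col_part N e z s ys b) (psi b (omega g (a # as) F)))"
    unfolding nu psi_neg psi_sum psi
    by (simp only: omega.simps psi_diff fap_diff sum_subtractf sum_negf) (simp del: pw)
  finally show ?case .
qed simp

text \<open>Multiplying by \<open>psi b\<close> restores a full product. In the term of row
  \<open>b\<close>, the shifted part is killed by \<open>alpha b\<close> because of antisymmetry.
  For the rows before it, \<open>phi b\<close> annihilates the product of the remaining rows, which
  contains row \<open>b\<close>; this trades \<open>psi b\<close> for the shifted one-form, to which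
  \<open>alpha_nu\<close> applies.\<close>

private lemma psi_omega:
  assumes "set as \<subseteq> {1..N}" "b \<in> set as" "distinct as"
  shows "psi b (omega g as F) = fap (alpha b) (Phi N (\<lambda>u a b. sc (g u) * M u a b) as F (z s - 1))"
  using assms
proof (induction as)
  case (Cons a as)
  let ?M = "\<lambda>u a b. sc (g u) * M u a b"
  let ?P = "Phi N ?M as F"
  have a: "a \<in> {1..N}" and b: "b \<in> {1..N}" using Cons.prems by auto
  have alpha_phi: "fap (alpha b) (phi N ?M a ?P (z s - 1))
    = fap (alpha b) (psi a (?P (z s - 1))) + fap (sc (g (z s - 1))) (fap (alpha a) (nu N (M (z s - 1)) b (?P (z s - 1 - 1))))"
    unfolding phi_def nu_sc fap_diff fap_sc_comm alpha_nu[OF b a] by (simp add: fap_neg del: pw)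
  show ?case
  proof (cases "b = a")
    case True
    have "fap (alpha a) (nu N (M (z s - 1)) a G) = 0" for G
      by (rule fun_double_zero) (rule alpha_nu[OF a a])
    then show ?thesis using alpha_phi True by (simp add: psi_diff psi_fap del: pw)
  next
    case False
    then have bas: "b \<in> set as" using Cons.prems by simp
    have anti: "phi N ?M b ?P = 0"
    proof (rule phi_Phi_mem)
      fix u
      show "manin N (?M u) (?M (u - 1))"
        unfolding M mult.assoc[symmetric] sc_mult[symmetric] mult.commute[of "g _"]
        by (rule manin_scale, rule manin_Tt[OF sites]) (use dist in auto)
    qed (use Cons.prems b bas in auto)
    have "phi N ?M b ?P (z s - 1) = 0" by (simp add: anti)
    then have "psi b (?P (z s - 1)) = fap (sc (g (z s - 1))) (nu N (M (z s - 1)) b (?P (z s - 1 - 1)))"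
      by (simp add: phi_def nu_sc del: pw)
    then have *: "fap (sc (g (z s - 1))) (fap (alpha a) (nu N (M (z s - 1)) b (?P (z s - 1 - 1))))
      = fap (alpha a) (psi b (?P (z s - 1)))" by (simp add: fap_sc_comm)
    have "psi b (omega g (a # as) F) = psi b (fap (alpha a) (?P (z s - 1))) + psi a (psi b (omega g as F))"
      using psi_anticomm[of b a "omega g as F"] by (simp add: psi_diff del: pw)
    also have "psi b (omega g as F) = fap (alpha b) (?P (z s - 1))"
      using Cons bas by simp
    finally show ?thesis
      using alpha_phi * by (simp add: psi_fap add.commute del: pw)
  qed
qed simp

definition local_K :: "'i lop" where
  "local_K = (\<Sum>b=1..N. col_part N e z s ys b * (sc (q b) * row_part N e z s xs b))"

text \<open>The residue formula: the numerator at z_s is a fixed operator applied to the value of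
  the full operator at z_s - 1. If the operator gives 0 at z_s - 1, the pole at z_s disappears. Here
  all N rows are present, so that \<open>psi_omega\<close> is available for every
  \<open>b\<close>.\<close>

theorem Ec_at_site:
  "Ec N M g [1..<N+1] F (z s) = - fap local_K (Phi N (\<lambda>u a b. sc (g u) * M u a b) [1..<N+1] F (z s - 1))"
proof -
  have "Ec N M g [1..<N+1] F (z s)
    = - (\<Sum>b=1..N. fap (col_part N e z s ys b) (psi b (omega g [1..<N+1] F)))"
    by (rule Ec_omega) auto
  also have "(\<Sum>b=1..N. fap (col_part N e z s ys b) (psi b (omega g [1..<N+1] F)))
    = (\<Sum>b=1..N. fap (col_part N e z s ys b) (fap (alpha b) (Phi N (\<lambda>u a b. sc (g u) * M u a b) [1..<N+1] F (z s - 1))))"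
  proof (intro sum.cong refl arg_cong[where f = "fap _"])
    fix b assume "b \<in> {1..N}"
    then show "psi b (omega g [1..<N+1] F) = fap (alpha b) (Phi N (\<lambda>u a b. sc (g u) * M u a b) [1..<N+1] F (z s - 1))"
      by (intro psi_omega) auto
  qed
  finally show ?thesis
    by (simp add: local_K_def sum_fap fap_times alpha_def del: pw)
qed

end

lemma ap_sc_sc: "sc c \<triangleright> sc d \<triangleright> x = sc (c * d) \<triangleright> x"
  by (simp add: sc_mult ap_times)

section \<open>Coordinate functions\<close>

text \<open>Instances are the polynomial functions and the functions continuous everywhere; closure
  under the shift is what a difference operator asks for.\<close>

definition fun_class :: "((complex \<Rightarrow> complex) \<Rightarrow> bool) \<Rightarrow> bool" where
  "fun_class \<C> \<longleftrightarrow> (\<forall>c. \<C> (\<lambda>u. c)) \<and> \<C> (\<lambda>u. u) \<and> (\<forall>f g. \<C> f \<longrightarrow> \<C> g \<longrightarrow> \<C> (\<lambda>u. f u + g u)) \<and>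
     (\<forall>f g. \<C> f \<longrightarrow> \<C> g \<longrightarrow> \<C> (\<lambda>u. f u * g u)) \<and> (\<forall>f. \<C> f \<longrightarrow> \<C> (\<lambda>u. f (u - 1)))"

definition op_in :: "((complex \<Rightarrow> complex) \<Rightarrow> bool) \<Rightarrow> (complex \<Rightarrow> 'i lop) \<Rightarrow> bool" where
  "op_in \<C> A \<longleftrightarrow> (\<forall>x. (\<forall>j. \<C> (\<lambda>u. x u j)) \<longrightarrow> (\<forall>i. \<C> (\<lambda>u. (A u \<triangleright> x u) i)))"

lemma op_inI:
  "(\<And>x i. (\<And>j. \<C> (\<lambda>u. x u j)) \<Longrightarrow> \<C> (\<lambda>u. (A u \<triangleright> x u) i)) \<Longrightarrow> op_in \<C> A"
  unfolding op_in_def by simp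

lemma op_inD:
  assumes "op_in \<C> A" "\<And>j. \<C> (\<lambda>u. x u j)"
  shows "\<C> (\<lambda>u. (A u \<triangleright> x u) i)"
  using assms(1)[unfolded op_in_def, THEN spec, of x] assms(2) by simp

definition form_in :: "((complex \<Rightarrow> complex) \<Rightarrow> bool) \<Rightarrow> (complex \<Rightarrow> 'i form) \<Rightarrow> bool" where
  "form_in \<C> F \<longleftrightarrow> (\<forall>S i. \<C> (\<lambda>u. F u S i))"

context
  fixes \<C> :: "(complex \<Rightarrow> complex) \<Rightarrow> bool"
  assumes cls: "fun_class \<C>"
begin

lemma cls_const: "\<C> (\<lambda>u. c)" using cls unfolding fun_class_def by blast
lemma cls_id: "\<C> (\<lambda>u. u)" using cls unfolding fun_class_def by blast
lemma cls_add: "\<C> f \<Longrightarrow> \<C> g \<Longrightarrow> \<C> (\<lambda>u. f u + g u)" using cls unfolding fun_class_def by blast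
lemma cls_mult: "\<C> f \<Longrightarrow> \<C> g \<Longrightarrow> \<C> (\<lambda>u. f u * g u)" using cls unfolding fun_class_def by blast
lemma cls_shift: "\<C> f \<Longrightarrow> \<C> (\<lambda>u. f (u - 1))" using cls unfolding fun_class_def by blast
lemma cls_neg: "\<C> f \<Longrightarrow> \<C> (\<lambda>u. - f u)" using cls_mult[OF cls_const[of "-1"], of f] by simp
lemma cls_diff: "\<C> f \<Longrightarrow> \<C> g \<Longrightarrow> \<C> (\<lambda>u. f u - g u)" using cls_add[OF _ cls_neg, of f g] by simp
lemma cls_sum: "(\<And>i. i \<in> A \<Longrightarrow> \<C> (f i)) \<Longrightarrow> \<C> (\<lambda>u. \<Sum>i\<in>A. f i u)"
  by (induction A rule: infinite_finite_induct) (auto intro: cls_add cls_const)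
lemma op_in_const: "op_in \<C> (\<lambda>u. A)"
  unfolding op_in_def
proof (intro allI impI)
  fix x :: "complex \<Rightarrow> 'a \<Rightarrow> complex" and i assume x: "\<forall>j. \<C> (\<lambda>u. x u j)"
  obtain S K where "finite S" "\<And>x. (A \<triangleright> x) i = (\<Sum>j\<in>S. K j * x j)"
    by (rule lop_kernel[of A i]) blast
  then have eq: "(\<lambda>u. (A \<triangleright> x u) i) = (\<lambda>u. \<Sum>j\<in>S. K j * x u j)" by auto
  show "\<C> (\<lambda>u. (A \<triangleright> x u) i)"
    unfolding eq by (intro cls_sum cls_mult cls_const x[rule_format])
qed

lemma op_in_sc: "\<C> f \<Longrightarrow> op_in \<C> (\<lambda>u. sc (f u))"
  unfolding op_in_def ap_sc by (auto intro: cls_mult)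
lemma op_in_add: "op_in \<C> A \<Longrightarrow> op_in \<C> B \<Longrightarrow> op_in \<C> (\<lambda>u. A u + B u)"
  unfolding op_in_def ap_plus plus_fun_apply by (auto intro: cls_add)
lemma op_in_mult: "op_in \<C> A \<Longrightarrow> op_in \<C> B \<Longrightarrow> op_in \<C> (\<lambda>u. A u * B u)"
  by (rule op_inI) (simp only: ap_times, rule op_inD, assumption, rule op_inD)
lemma op_in_sum: "(\<And>i. i \<in> S \<Longrightarrow> op_in \<C> (A i)) \<Longrightarrow> op_in \<C> (\<lambda>u. \<Sum>i\<in>S. A i u)"
  by (induction S rule: infinite_finite_induct) (auto intro: op_in_add op_in_const)

lemma op_in_Tt: "op_in \<C> (\<lambda>u. Tt N e z ss u a b)"
proof (induction ss arbitrary: a b)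
  case Nil
  then show ?case by (simp add: op_in_const)
next
  case (Cons s ss)
  have "op_in \<C> (\<lambda>u. Lt e z s u a c)" for c
  proof (cases "a = c")
    case True
    then show ?thesis unfolding Lt_def
      by (auto intro!: op_in_add op_in_sc cls_diff cls_id cls_const op_in_const)
  next
    case False
    then show ?thesis by (simp add: Lt_def op_in_const)
  qed
  with Cons show ?case by (auto intro!: op_in_sum op_in_mult)
qed

lemma form_in_psi: "form_in \<C> F \<Longrightarrow> form_in \<C> (\<lambda>u. psi b (F u))"
proof -
  assume F: "form_in \<C> F"
  have "\<C> (\<lambda>u. psi b (F u) S i)" for S i
    using F by (cases "b \<in> S"; cases "even (card {c\<in>S. c < b})")
      (simp_all add: psi_def fermi_def form_in_def cls_const cls_neg)
  then show ?thesis by (simp add: form_in_def)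
qed

lemma form_in_fap: "form_in \<C> F \<Longrightarrow> op_in \<C> A \<Longrightarrow> form_in \<C> (\<lambda>u. fap (A u) (F u))"
  unfolding form_in_def fap_def by (auto intro: op_inD)

lemma form_in_sum: "(\<And>i. i \<in> S \<Longrightarrow> form_in \<C> (F i)) \<Longrightarrow> form_in \<C> (\<lambda>u. \<Sum>i\<in>S. F i u)"
  unfolding form_in_def by (auto simp: sum_apply intro: cls_sum)

lemma form_in_diff: "form_in \<C> F \<Longrightarrow> form_in \<C> G \<Longrightarrow> form_in \<C> (\<lambda>u. F u - G u)"
  unfolding form_in_def by (auto intro: cls_diff)

lemma form_in_0: "form_in \<C> (\<lambda>u. 0)"
  unfolding form_in_def by (auto intro: cls_const)

lemma form_in_shift: "form_in \<C> F \<Longrightarrow> form_in \<C> (\<lambda>u. F (u - 1))"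
  unfolding form_in_def by (auto intro: cls_shift)

lemma form_in_vac: "(\<And>i. \<C> (\<lambda>u. f u i)) \<Longrightarrow> form_in \<C> (\<lambda>u. vac (f u))"
proof -
  assume f: "\<And>i. \<C> (\<lambda>u. f u i)"
  have "\<C> (\<lambda>u. vac (f u) S i)" for S i
    using f by (cases "S = {}") (simp_all add: vac_def cls_const)
  then show ?thesis by (simp add: form_in_def)
qed

lemma form_in_Vc:
  assumes "\<And>a b. op_in \<C> (\<lambda>u. M u a b)" "form_in \<C> F"
  shows "form_in \<C> (Vc N M as F k)"
proof (induction as arbitrary: k)
  case Nil
  show ?case
  proof (cases "k = 0")
    case True
    then have "Vc N M [] F k = F" by (intro ext) simp
    then show ?thesis using assms(2) by simp
  next
    case False
    then have "Vc N M [] F k = (\<lambda>u. 0)" by (intro ext) simp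
    then show ?thesis using form_in_0 by (simp only:)
  qed
next
  case (Cons a as)
  show ?case
  proof (cases "k = 0")
    case True
    have "Vc N M (a # as) F k = (\<lambda>u. psi a (Vc N M as F k u))"
      using True by (intro ext) (simp add: fun_eq_iff)
    then show ?thesis using form_in_psi[OF Cons] by simp
  next
    case False
    have eq: "Vc N M (a # as) F k = (\<lambda>u. psi a (Vc N M as F k u)
      - (\<Sum>b=1..N. fap (M u a b) (psi b (Vc N M as F (k - 1) (u - 1)))))"
      using False by (intro ext) (simp add: nu_def)
    show ?thesis unfolding eq
      by (intro form_in_diff form_in_psi form_in_sum form_in_fap form_in_shift[of "Vc N M as F (k - 1)"]
          Cons assms(1))
  qed
qed

end

definition is_poly :: "(complex \<Rightarrow> complex) \<Rightarrow> bool" where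
  "is_poly f \<longleftrightarrow> (\<exists>P. \<forall>u. f u = poly P u)"

lemma is_polyI: "(\<And>u. f u = poly P u) \<Longrightarrow> is_poly f"
  unfolding is_poly_def by blast

lemma fun_class_poly: "fun_class is_poly"
  unfolding fun_class_def
proof (intro conjI allI impI)
  fix c show "is_poly (\<lambda>u. c)" by (rule is_polyI[of _ "[:c:]"]) simp
next
  show "is_poly (\<lambda>u. u)" by (rule is_polyI[of _ "[:0, 1:]"]) simp
next
  fix f g assume "is_poly f" "is_poly g"
  then obtain P Q where "\<And>u. f u = poly P u" "\<And>u. g u = poly Q u" unfolding is_poly_def by blast
  then show "is_poly (\<lambda>u. f u + g u)" "is_poly (\<lambda>u. f u * g u)"
    by (simp_all add: is_polyI[of _ "P + Q"] is_polyI[of _ "P * Q"])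
next
  fix f assume "is_poly f"
  then obtain P where "\<And>u. f u = poly P u" unfolding is_poly_def by blast
  then show "is_poly (\<lambda>u. f (u - 1))"
    by (intro is_polyI[of _ "pcompose P [:-1, 1:]"]) (simp add: poly_pcompose)
qed

lemma fun_class_isCont: "fun_class (\<lambda>f. \<forall>u. isCont f u)"
  unfolding fun_class_def
proof (intro conjI allI impI)
  fix f :: "complex \<Rightarrow> complex" and u assume "\<forall>u. isCont f u"
  then have f: "isCont f (u - 1)" by blast
  show "isCont (\<lambda>u. f (u - 1)) u"
    by (rule isCont_o2[where f = "\<lambda>u. u - 1" and g = f]) (auto intro: isCont_diff f)
qed (auto intro: isCont_add isCont_mult)

section \<open>Order at infinity of rational functions\<close>

text \<open>Growth at infinity of order at most \<open>d\<close>, for a function that is rational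
  away from the zeros of some denominator; the values at those zeros, where division by zero yields
  junk, are left unconstrained.\<close>

definition rat_order :: "int \<Rightarrow> (complex \<Rightarrow> complex) \<Rightarrow> bool" where
  "rat_order d f \<longleftrightarrow> (\<exists>P Q. Q \<noteq> 0 \<and> (P = 0 \<or> int (degree P) \<le> d + int (degree Q)) \<and>
     (\<forall>u. poly Q u \<noteq> 0 \<longrightarrow> f u = poly P u / poly Q u))"

lemma rat_orderI:
  assumes "Q \<noteq> 0" "P = 0 \<or> int (degree P) \<le> d + int (degree Q)"
    "\<And>u. poly Q u \<noteq> 0 \<Longrightarrow> f u = poly P u / poly Q u"
  shows "rat_order d f"
  using assms unfolding rat_order_def by blast

lemma rat_order_mono: "rat_order d f \<Longrightarrow> d \<le> d' \<Longrightarrow> rat_order d' f"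
  unfolding rat_order_def by (elim exE conjE, intro exI conjI, assumption) auto

lemma rat_order_cong:
  assumes "rat_order d f" "R \<noteq> 0" "\<And>u. poly R u \<noteq> 0 \<Longrightarrow> f u = g u"
  shows "rat_order d g"
proof -
  obtain P Q where PQ: "Q \<noteq> 0" "P = 0 \<or> int (degree P) \<le> d + int (degree Q)"
    "\<And>u. poly Q u \<noteq> 0 \<Longrightarrow> f u = poly P u / poly Q u"
    using assms(1) unfolding rat_order_def by blast
  show ?thesis
    by (rule rat_orderI[of "Q * R" "P * R"])
      (use PQ assms(2,3)[symmetric] degree_mult_le[of P R] in \<open>auto simp: degree_mult_eq\<close>)
qed

lemma rat_order_poly: "int (degree P) \<le> d \<Longrightarrow> rat_order d (poly P)"
  by (rule rat_orderI[of 1 P]) auto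

lemma rat_order_0 [simp]: "rat_order d (\<lambda>u. 0)"
  by (rule rat_orderI[of 1 0]) auto

lemma rat_order_mult:
  assumes "rat_order d f" "rat_order d' g"
  shows "rat_order (d + d') (\<lambda>u. f u * g u)"
proof -
  obtain P Q where PQ: "Q \<noteq> 0" "P = 0 \<or> int (degree P) \<le> d + int (degree Q)"
    "\<And>u. poly Q u \<noteq> 0 \<Longrightarrow> f u = poly P u / poly Q u"
    using assms(1) unfolding rat_order_def by blast
  obtain P' Q' where PQ': "Q' \<noteq> 0" "P' = 0 \<or> int (degree P') \<le> d' + int (degree Q')"
    "\<And>u. poly Q' u \<noteq> 0 \<Longrightarrow> g u = poly P' u / poly Q' u"
    using assms(2) unfolding rat_order_def by blast
  show ?thesis
    by (rule rat_orderI[of "Q * Q'" "P * P'"])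
      (use PQ PQ' degree_mult_le[of P P'] in \<open>auto simp: degree_mult_eq\<close>)
qed

lemma rat_order_const: "rat_order 0 (\<lambda>u. c)"
proof -
  have "poly [:c:] = (\<lambda>u. c)" by (intro ext) simp
  then show ?thesis using rat_order_poly[of "[:c:]" 0] by simp
qed

lemma rat_order_cmult: "rat_order d f \<Longrightarrow> rat_order d (\<lambda>u. c * f u)"
  using rat_order_mult[OF rat_order_const[of c]] by simp

lemma rat_order_neg: "rat_order d f \<Longrightarrow> rat_order d (\<lambda>u. - f u)"
  using rat_order_cmult[of d f "-1"] by simp

lemma rat_order_inverse_linear: "rat_order (- 1) (\<lambda>u. 1 / (u - c))"
  by (rule rat_orderI[of "[:-c, 1:]" 1]) auto

lemma rat_order_add:
  assumes "rat_order d f" "rat_order d g"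
  shows "rat_order d (\<lambda>u. f u + g u)"
proof -
  obtain P Q where PQ: "Q \<noteq> 0" "P = 0 \<or> int (degree P) \<le> d + int (degree Q)"
    "\<And>u. poly Q u \<noteq> 0 \<Longrightarrow> f u = poly P u / poly Q u"
    using assms(1) unfolding rat_order_def by blast
  obtain P' Q' where PQ': "Q' \<noteq> 0" "P' = 0 \<or> int (degree P') \<le> d + int (degree Q')"
    "\<And>u. poly Q' u \<noteq> 0 \<Longrightarrow> g u = poly P' u / poly Q' u"
    using assms(2) unfolding rat_order_def by blast
  have deg: "P * Q' + P' * Q = 0 \<or> int (degree (P * Q' + P' * Q)) \<le> d + int (degree (Q * Q'))"
  proof (rule ccontr)
    assume A: "\<not> ?thesis"
    have 1: "P * Q' = 0 \<or> int (degree (P * Q')) \<le> d + int (degree (Q * Q'))"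
      using PQ PQ' degree_mult_le[of P Q'] by (auto simp: degree_mult_eq)
    have 2: "P' * Q = 0 \<or> int (degree (P' * Q)) \<le> d + int (degree (Q * Q'))"
      using PQ PQ' degree_mult_le[of P' Q] by (auto simp: degree_mult_eq)
    have "degree (P * Q' + P' * Q) \<le> max (degree (P * Q')) (degree (P' * Q))"
      by (rule degree_add_le_max)
    with 1 2 A show False by (smt (verit) add.right_neutral add.left_neutral max_def of_nat_mono)
  qed
  show ?thesis by (rule rat_orderI[of "Q * Q'" "P * Q' + P' * Q"])
      (use PQ PQ' deg in \<open>auto simp: field_simps\<close>)
qed

lemma rat_order_diff: "rat_order d f \<Longrightarrow> rat_order d g \<Longrightarrow> rat_order d (\<lambda>u. f u - g u)"
  using rat_order_add[OF _ rat_order_neg, of d f g] by simp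

lemma rat_order_sum: "(\<And>i. i \<in> A \<Longrightarrow> rat_order d (f i)) \<Longrightarrow> rat_order d (\<lambda>u. \<Sum>i\<in>A. f i u)"
  by (induction A rule: infinite_finite_induct) (auto intro: rat_order_add)

lemma degree_pcompose_shift: "degree (pcompose P [:c, 1:]) = degree (P :: complex poly)"
  by (simp add: degree_pcompose)

lemma rat_order_shift:
  assumes "rat_order d f"
  shows "rat_order d (\<lambda>u. f (u - 1))"
proof -
  obtain P Q where PQ: "Q \<noteq> 0" "P = 0 \<or> int (degree P) \<le> d + int (degree Q)"
    "\<And>u. poly Q u \<noteq> 0 \<Longrightarrow> f u = poly P u / poly Q u"
    using assms(1) unfolding rat_order_def by blast
  show ?thesis by (rule rat_orderI[of "pcompose Q [:-1, 1:]" "pcompose P [:-1, 1:]"])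
      (use PQ in \<open>auto simp: poly_pcompose degree_pcompose_shift pcompose_eq_0_iff\<close>)
qed

text \<open>A shift preserves leading coefficients, so the top terms of P(u) Q(u - 1) and P(u - 1)
  Q(u) cancel in the numerator.\<close>

lemma rat_order_difference:
  assumes "rat_order d f"
  shows "rat_order (d - 1) (\<lambda>u. f u - f (u - 1))"
proof -
  obtain P Q where PQ: "Q \<noteq> 0" "P = 0 \<or> int (degree P) \<le> d + int (degree Q)"
    "\<And>u. poly Q u \<noteq> 0 \<Longrightarrow> f u = poly P u / poly Q u"
    using assms(1) unfolding rat_order_def by blast
  define P1 where "P1 = pcompose P [:-1, 1:]"
  define Q1 where "Q1 = pcompose Q [:-1, 1:]"
  have Q1: "Q1 \<noteq> 0" "degree Q1 = degree Q" "degree P1 = degree P"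
    using PQ(1) by (auto simp: Q1_def P1_def degree_pcompose_shift pcompose_eq_0_iff)
  have lc: "lead_coeff P1 = lead_coeff P" "lead_coeff Q1 = lead_coeff Q"
    by (simp_all add: P1_def Q1_def lead_coeff_comp)
  define n where "n = degree P + degree Q"
  define R where "R = P * Q1 - P1 * Q"
  have "degree (P * Q1) \<le> n" "degree (P1 * Q) \<le> n"
    using degree_mult_le[of P Q1] degree_mult_le[of P1 Q] Q1 by (auto simp: n_def)
  then have degR: "degree R \<le> n" unfolding R_def by (rule degree_diff_le)
  have "coeff (P * Q1) n = lead_coeff P * lead_coeff Q1" "coeff (P1 * Q) n = lead_coeff P1 * lead_coeff Q"
    using coeff_mult_degree_sum[of P Q1] coeff_mult_degree_sum[of P1 Q] Q1 by (simp_all add: n_def)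
  then have "coeff R n = 0" by (simp add: R_def lc)
  then have R: "R = 0 \<or> degree R < n"
    using degR by (metis leading_coeff_0_iff le_neq_implies_less)
  have degR': "R = 0 \<or> int (degree R) \<le> d - 1 + int (degree (Q * Q1))"
  proof (cases "P = 0")
    case True
    then show ?thesis by (simp add: R_def P1_def)
  next
    case False
    then show ?thesis using R PQ(1,2) Q1 by (auto simp: degree_mult_eq n_def)
  qed
  show ?thesis
    by (rule rat_orderI[of "Q * Q1" R])
      (use PQ(1,3) Q1 degR' in \<open>auto simp: R_def P1_def Q1_def poly_pcompose field_simps\<close>)
qed

lemma rat_order_degree:
  assumes "rat_order d f" "R \<noteq> 0" "\<And>u. poly R u \<noteq> 0 \<Longrightarrow> f u = poly h u"
  shows "h = 0 \<or> int (degree h) \<le> d"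
proof -
  obtain P Q where PQ: "Q \<noteq> 0" "P = 0 \<or> int (degree P) \<le> d + int (degree Q)"
    "\<And>u. poly Q u \<noteq> 0 \<Longrightarrow> f u = poly P u / poly Q u"
    using assms(1) unfolding rat_order_def by blast
  have "poly (R * Q * (h * Q - P)) u = 0" for u
  proof (cases "poly R u = 0 \<or> poly Q u = 0")
    case False
    then have "poly h u = poly P u / poly Q u" using PQ(3)[of u] assms(3)[of u] by simp
    then show ?thesis using False by simp
  qed auto
  then have "R * Q * (h * Q - P) = 0" using poly_all_0_iff_0 by blast
  then have "h * Q = P" using assms(2) PQ(1) by auto
  then show ?thesis using PQ by (cases "h = 0") (auto simp: degree_mult_eq)
qed

definition vec_order :: "int \<Rightarrow> (complex \<Rightarrow> 'i \<Rightarrow> complex) \<Rightarrow> bool" where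
  "vec_order d x \<longleftrightarrow> (\<forall>i. rat_order d (\<lambda>u. x u i))"

lemma vec_order_ap: "vec_order d x \<Longrightarrow> vec_order d (\<lambda>u. A \<triangleright> x u)"
  unfolding vec_order_def
proof
  fix i assume x: "\<forall>i. rat_order d (\<lambda>u. x u i)"
  obtain S K where "finite S" "\<And>x. (A \<triangleright> x) i = (\<Sum>j\<in>S. K j * x j)"
    by (rule lop_kernel[of A i]) blast
  then have eq: "(\<lambda>u. (A \<triangleright> x u) i) = (\<lambda>u. \<Sum>j\<in>S. K j * x u j)" by auto
  show "rat_order d (\<lambda>u. (A \<triangleright> x u) i)"
    unfolding eq by (intro rat_order_sum rat_order_cmult x[rule_format])
qed

lemma vec_order_add: "vec_order d x \<Longrightarrow> vec_order d y \<Longrightarrow> vec_order d (\<lambda>u. x u + y u)"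
  unfolding vec_order_def by (auto intro: rat_order_add)
lemma vec_order_neg: "vec_order d x \<Longrightarrow> vec_order d (\<lambda>u. - x u)"
  unfolding vec_order_def by (auto intro: rat_order_neg)
lemma vec_order_diff: "vec_order d x \<Longrightarrow> vec_order d y \<Longrightarrow> vec_order d (\<lambda>u. x u - y u)"
  unfolding vec_order_def by (auto intro: rat_order_diff)
lemma vec_order_0 [simp]: "vec_order d (\<lambda>u. 0)"
  unfolding vec_order_def by simp
lemma vec_order_sum: "(\<And>i. i \<in> A \<Longrightarrow> vec_order d (x i)) \<Longrightarrow> vec_order d (\<lambda>u. \<Sum>i\<in>A. x i u)"
  unfolding vec_order_def by (auto simp: sum_apply intro: rat_order_sum)
lemma vec_order_mono: "vec_order d x \<Longrightarrow> d \<le> d' \<Longrightarrow> vec_order d' x"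
  unfolding vec_order_def using rat_order_mono by blast
lemma vec_order_shift: "vec_order d x \<Longrightarrow> vec_order d (\<lambda>u. x (u - 1))"
  unfolding vec_order_def by (auto intro: rat_order_shift)
lemma vec_order_cong:
  "vec_order d x \<Longrightarrow> R \<noteq> 0 \<Longrightarrow> (\<And>u. poly R u \<noteq> 0 \<Longrightarrow> x u = y u) \<Longrightarrow> vec_order d y"
  unfolding vec_order_def
proof
  fix i assume "\<forall>i. rat_order d (\<lambda>u. x u i)" and *: "R \<noteq> 0" "\<And>u. poly R u \<noteq> 0 \<Longrightarrow> x u = y u"
  then have "rat_order d (\<lambda>u. x u i)" by blast
  from this *(1) show "rat_order d (\<lambda>u. y u i)"
    by (rule rat_order_cong) (simp add: *(2))
qed

lemma vec_order_Lt:
  assumes "vec_order d x"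
  shows "vec_order (d - 1) (\<lambda>u. sc (1 / (u - z s)) \<triangleright> Lt e z s u a b \<triangleright> x u - (if a = b then x u else 0))"
proof -
  have "vec_order (d - 1) (\<lambda>u. sc (1 / (u - z s)) \<triangleright> e s b a \<triangleright> x u)"
    unfolding vec_order_def ap_sc
    using rat_order_mult[OF rat_order_inverse_linear, of d] vec_order_ap[OF assms]
    by (auto simp: vec_order_def)
  then show ?thesis
  proof (rule vec_order_cong)
    show "[:- z s, 1:] \<noteq> 0" by simp
    fix u assume "poly [:- z s, 1:] u \<noteq> 0"
    then show "sc (1 / (u - z s)) \<triangleright> e s b a \<triangleright> x u
      = sc (1 / (u - z s)) \<triangleright> Lt e z s u a b \<triangleright> x u - (if a = b then x u else 0)"
      by (intro ext) (auto simp: Lt_def ap_plus ap_sc field_simps)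
  qed
qed

lemma vec_order_Tt:
  assumes "vec_order d x" "a \<in> {1..N}" "b \<in> {1..N}"
  shows "vec_order (d - 1) (\<lambda>u. sc (1 / ppi z ss u) \<triangleright> Tt N e z ss u a b \<triangleright> x u - (if a = b then x u else 0))"
  using assms(2,3)
proof (induction ss arbitrary: a b)
  case Nil
  then show ?case by (simp add: ppi_def del: pw)
next
  case (Cons s ss)
  let ?T = "\<lambda>c u. sc (1 / ppi z ss u) \<triangleright> Tt N e z ss u c b \<triangleright> x u"
  let ?L = "\<lambda>c u. sc (1 / (u - z s)) \<triangleright> Lt e z s u a c \<triangleright> ?T c u"
  have T: "vec_order d (?T c)" if c: "c \<in> {1..N}" for c
  proof -
    have "vec_order d (\<lambda>u. ?T c u - (if c = b then x u else 0))"
      using Cons.IH[OF c \<open>b \<in> _\<close>] by (rule vec_order_mono) simp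
    from vec_order_add[OF this, of "\<lambda>u. if c = b then x u else 0"]
    show ?thesis using assms(1) by (cases "c = b") auto
  qed
  have "vec_order (d - 1) (\<lambda>u. (?T a u - (if a = b then x u else 0))
    + (\<Sum>c=1..N. ?L c u - (if a = c then ?T c u else 0)))"
    by (intro vec_order_add vec_order_sum Cons.IH vec_order_Lt T) (use Cons.prems in auto)
  moreover have "(?T a u - (if a = b then x u else 0)) + (\<Sum>c=1..N. ?L c u - (if a = c then ?T c u else 0))
    = sc (1 / ppi z (s # ss) u) \<triangleright> Tt N e z (s # ss) u a b \<triangleright> x u - (if a = b then x u else 0)" for u
  proof -
    have "(\<Sum>c=1..N. ?L c u - (if a = c then ?T c u else 0)) = (\<Sum>c=1..N. ?L c u) - ?T a u"
      using Cons.prems by (simp add: sum_subtractf)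
    moreover have "(\<Sum>c=1..N. ?L c u) = sc (1 / ppi z (s # ss) u) \<triangleright> Tt N e z (s # ss) u a b \<triangleright> x u"
    proof -
      have "?L c u = sc (1 / ppi z (s # ss) u) \<triangleright> (Lt e z s u a c * Tt N e z ss u c b) \<triangleright> x u" for c
        unfolding ap_sc_comm[of "Lt e z s u a c"] ap_sc_sc by (simp add: ppi_def ap_times)
      then show ?thesis by (simp only: Tt.simps sum_ap ap_sum)
    qed
    ultimately show ?thesis by (simp del: pw)
  qed
  ultimately show ?case by (simp only:)
qed

definition form_order :: "int \<Rightarrow> (complex \<Rightarrow> 'i form) \<Rightarrow> bool" where
  "form_order d F \<longleftrightarrow> (\<forall>S. vec_order d (\<lambda>u. F u S))"

lemma form_order_psi: "form_order d F \<Longrightarrow> form_order d (\<lambda>u. psi b (F u))"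
proof -
  assume F: "form_order d F"
  have "vec_order d (\<lambda>u. psi b (F u) S)" for S
    using F by (cases "b \<in> S"; cases "even (card {c\<in>S. c < b})")
      (simp_all add: psi_def fermi_def form_order_def vec_order_neg del: pw)
  then show ?thesis by (simp add: form_order_def)
qed

text \<open>Up to terms of relative order 1/u, the matrix is the constant diagonal one with entries
  \<open>q a\<close>. For \<open>q a = 1\<close> the leading part of the row is therefore a
  difference F(u) - F(u - 1), which lowers the order by one.\<close>

lemma form_order_phi:
  assumes "form_order d F" "a \<in> {1..N}"
  shows "form_order (if q a = 1 then d - 1 else d) (phi N (Mt N e z q ss) a F)"
proof -
  let ?r = "\<lambda>b G u. sc (1 / ppi z ss u) \<triangleright> Tt N e z ss u a b \<triangleright> G u - (if a = b then G u else 0)"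
  have shift: "vec_order d (\<lambda>u. psi b (F (u - 1)) S)" for b S
    using vec_order_shift form_order_psi[OF assms(1), of b] unfolding form_order_def by blast
  have psi: "vec_order d (\<lambda>u. psi a (F u) S)" for S
    using form_order_psi[OF assms(1), of a] unfolding form_order_def by blast
  have eq: "phi N (Mt N e z q ss) a F u S = (psi a (F u) S - sc (q a) \<triangleright> psi a (F (u - 1)) S)
    - sc (q a) \<triangleright> (\<Sum>b=1..N. ?r b (\<lambda>u. psi b (F (u - 1)) S) u)" for u S
  proof -
    have "(\<Sum>b=1..N. ?r b (\<lambda>u. psi b (F (u - 1)) S) u)
      = (\<Sum>b=1..N. sc (1 / ppi z ss u) \<triangleright> Tt N e z ss u a b \<triangleright> psi b (F (u - 1)) S) - psi a (F (u - 1)) S"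
      using assms(2) by (simp add: sum_subtractf)
    moreover have "nu N (Mt N e z q ss u) a (F (u - 1)) S
      = sc (q a) \<triangleright> (\<Sum>b=1..N. sc (1 / ppi z ss u) \<triangleright> Tt N e z ss u a b \<triangleright> psi b (F (u - 1)) S)"
      unfolding nu_def ap_sum
      by (subst sum_apply, intro sum.cong refl) (simp add: fap_def Mt_def ap_times[symmetric] sc_mult[symmetric] mult.assoc[symmetric])
    ultimately show ?thesis by (simp add: phi_def ap_diff del: minus_apply) simp
  qed
  have rest: "vec_order (d - 1) (\<lambda>u. sc (q a) \<triangleright> (\<Sum>b=1..N. ?r b (\<lambda>u. psi b (F (u - 1)) S) u))" for S
    by (intro vec_order_ap vec_order_sum vec_order_Tt shift) (use assms(2) in auto)
  show ?thesis
  proof (cases "q a = 1")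
    case True
    have "vec_order (d - 1) (\<lambda>u. psi a (F u) S - sc (q a) \<triangleright> psi a (F (u - 1)) S)" for S
    proof -
      have "rat_order (d - 1) (\<lambda>u. psi a (F u) S i - psi a (F (u - 1)) S i)" for i
        by (rule rat_order_difference) (use psi[of S] in \<open>auto simp: vec_order_def\<close>)
      then show ?thesis using True by (simp add: vec_order_def)
    qed
    then show ?thesis using True rest unfolding form_order_def eq by (auto intro: vec_order_diff)
  next
    case False
    have "vec_order d (\<lambda>u. (psi a (F u) S - sc (q a) \<triangleright> psi a (F (u - 1)) S)
      - sc (q a) \<triangleright> (\<Sum>b=1..N. ?r b (\<lambda>u. psi b (F (u - 1)) S) u))" for S
      by (intro vec_order_diff psi vec_order_ap shift vec_order_mono[OF rest[unfolded]]) simp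
    then show ?thesis using False unfolding form_order_def eq by auto
  qed
qed

lemma form_order_Phi:
  assumes "form_order d F" "set as \<subseteq> {1..N}"
  shows "form_order (d - int (length (filter (\<lambda>a. q a = 1) as))) (Phi N (Mt N e z q ss) as F)"
  using assms(2)
proof (induction as)
  case Nil
  then show ?case using assms(1) by simp
next
  case (Cons a as)
  then have "form_order (d - int (length (filter (\<lambda>a. q a = 1) as))) (Phi N (Mt N e z q ss) as F)" by simp
  from form_order_phi[OF this, of a N q] Cons.prems show ?case
    by (auto split: if_splits simp: algebra_simps)
qed

lemma vec_order_dop:
  assumes "vec_order d f"
  shows "vec_order (d - int (card {a\<in>{1..N}. q a = 1})) (dop N (Mt N e z q ss) f)"
proof -
  have "vec_order d (\<lambda>u. vac (f u) S)" for S
    using assms by (cases "S = {}") (simp_all add: vac_def del: pw)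
  then have "form_order d (\<lambda>u. vac (f u))" by (simp add: form_order_def)
  moreover have "set [1..<N+1] \<subseteq> {1..N}" by auto
  ultimately have "form_order (d - int (length (filter (\<lambda>a. q a = 1) [1..<N+1]))) (Phi N (Mt N e z q ss) [1..<N+1] (\<lambda>u. vac (f u)))"
    by (rule form_order_Phi)
  moreover have "length (filter (\<lambda>a. q a = 1) [1..<N+1]) = card {a\<in>{1..N}. q a = 1}"
    by (subst distinct_length_filter) (auto intro!: arg_cong[where f = card])
  ultimately show ?thesis unfolding form_order_def dop_def by auto
qed

section \<open>The operator on polynomials\<close>

definition generic_sites :: "('k \<Rightarrow> complex) \<Rightarrow> 'k set \<Rightarrow> bool" where
  "generic_sites z S \<longleftrightarrow> (\<forall>s\<in>S. \<forall>t\<in>S. s \<noteq> t \<longrightarrow> z s - z t \<notin> \<int>)"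

lemma poly_dvd_prod_roots:
  fixes P :: "complex poly"
  assumes "finite B" "inj_on \<phi> B" "\<And>b. b \<in> B \<Longrightarrow> poly P (\<phi> b) = 0"
  shows "\<exists>P'. P = (\<Prod>b\<in>B. [:- \<phi> b, 1:]) * P'"
  using assms
proof (induction B rule: finite_induct)
  case (insert b B)
  then obtain P' where P': "P = (\<Prod>b\<in>B. [:- \<phi> b, 1:]) * P'" by auto
  have "poly (\<Prod>b\<in>B. [:- \<phi> b, 1:]) (\<phi> b) \<noteq> 0"
    using insert by (auto simp: poly_prod)
  then have "poly P' (\<phi> b) = 0" using insert.prems(2)[of b] P' by simp
  then obtain P'' where P'': "P' = [:- \<phi> b, 1:] * P''"
    unfolding poly_eq_0_iff_dvd by (rule dvdE)
  have "P = (\<Prod>b\<in>insert b B. [:- \<phi> b, 1:]) * P''"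
    unfolding P' P'' prod.insert[OF insert.hyps(1,2)] by (simp only: mult_ac)
  then show ?case ..
qed auto

lemma ppi_poly: "ppi z ss u = poly (\<Prod>s\<leftarrow>ss. [:- z s, 1:]) u"
  by (induction ss) (auto simp: ppi_def algebra_simps)

lemma ppi_degree: "degree (\<Prod>s\<leftarrow>ss. [:- z s, 1:] :: complex poly) = length ss"
proof (induction ss)
  case (Cons s ss)
  have "(\<Prod>s\<leftarrow>ss. [:- z s, 1:] :: complex poly) \<noteq> 0" by (auto simp: prod_list_zero_iff)
  then show ?case using Cons by (simp add: degree_mult_eq del: mult_pCons_left)
qed simp

lemma ppi_0_iff: "ppi z ss u = 0 \<longleftrightarrow> (\<exists>s\<in>set ss. u = z s)"
  by (auto simp: ppi_def prod_list_zero_iff)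

lemma ppi_prod: "distinct ss \<Longrightarrow> ppi z ss u = (\<Prod>s\<in>set ss. u - z s)"
  by (simp add: ppi_def prod.distinct_set_conv_list)

lemma foldr_psi_top: "foldr psi [1..<N+1] (vac x) {1..N} = x"
proof -
  have *: "k \<le> N \<Longrightarrow> foldr psi [N - k + 1..<N+1] (vac x) {N - k + 1..N} = x" for k
  proof (induction k)
    case 0
    then show ?case by (simp add: vac_def)
  next
    case (Suc k)
    have eq: "[N - Suc k + 1..<N+1] = (N - k) # [N - k + 1..<N+1]"
    proof -
      have "N - Suc k + 1 = N - k" using Suc.prems by simp
      then show ?thesis using upt_conv_Cons[of "N - k" "N + 1"] by simp
    qed
    have "{N - Suc k + 1..N} - {N - k} = {N - k + 1..N}" "N - k \<in> {N - Suc k + 1..N}"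
      "{c \<in> {N - Suc k + 1..N}. c < N - k} = {}" using Suc.prems by auto
    then show ?case using Suc by (simp only: eq foldr.simps o_apply psi_def fermi_def) simp
  qed
  show ?thesis using *[of N] by simp
qed

lemma Vc_0: "Vc N M as F 0 u = foldr psi as (F u)"
  by (induction as) (auto simp del: pw)

definition site_op :: "nat \<Rightarrow> ('k \<Rightarrow> nat \<Rightarrow> nat \<Rightarrow> 'i lop) \<Rightarrow> ('k \<Rightarrow> complex) \<Rightarrow> (nat \<Rightarrow> complex) \<Rightarrow> 'k list
    \<Rightarrow> complex \<Rightarrow> nat \<Rightarrow> nat \<Rightarrow> 'i lop" where
  "site_op N e z q ss u a b = sc (q a) * Tt N e z ss u a b"

lemma Mt_site_op: "Mt N e z q ss = (\<lambda>u a b. sc (1 / ppi z ss u) * site_op N e z q ss u a b)"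
  by (intro ext) (simp add: Mt_def site_op_def mult.assoc[symmetric] sc_mult[symmetric])

text \<open>The coefficient of the \<open>k\<close>-th power of the shift, denominators removed, applied to \<open>f\<close>.\<close>

definition shift_coeff :: "nat \<Rightarrow> ('k \<Rightarrow> nat \<Rightarrow> nat \<Rightarrow> 'i lop) \<Rightarrow> ('k \<Rightarrow> complex) \<Rightarrow> (nat \<Rightarrow> complex) \<Rightarrow> 'k list
    \<Rightarrow> (complex \<Rightarrow> 'i \<Rightarrow> complex) \<Rightarrow> nat \<Rightarrow> complex \<Rightarrow> 'i \<Rightarrow> complex" where
  "shift_coeff N e z q ss f k u = Vc N (site_op N e z q ss) [1..<N+1] (\<lambda>u. vac (f u)) k u {1..N}"

lemma shift_coeff_0: "shift_coeff N e z q ss f 0 u = f u"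
  by (simp only: shift_coeff_def Vc_0 foldr_psi_top)

lemma dop_shift_coeff:
  "dop N (Mt N e z q ss) f u = (\<Sum>k\<le>N. sc (gprod (\<lambda>u. 1 / ppi z ss u) k u) \<triangleright> shift_coeff N e z q ss f k u)"
proof -
  have "dop N (Mt N e z q ss) f u
    = (\<Sum>k\<le>length [1..<N+1]. fap (sc (gprod (\<lambda>u. 1 / ppi z ss u) k u))
        (Vc N (site_op N e z q ss) [1..<N+1] (\<lambda>u. vac (f u)) k u)) {1..N}"
    unfolding dop_def Mt_site_op Phi_Vc ..
  then show ?thesis by (simp only: sum_apply fap_def shift_coeff_def length_upt diff_add_inverse2)
qed

lemma shift_coeff_in:
  assumes "fun_class \<C>" "\<And>i. \<C> (\<lambda>u. f u i)"
  shows "\<C> (\<lambda>u. shift_coeff N e z q ss f k u i)"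
proof -
  have "form_in \<C> (Vc N (site_op N e z q ss) [1..<N+1] (\<lambda>u. vac (f u)) k)"
    unfolding site_op_def
    by (intro form_in_Vc op_in_mult op_in_const op_in_Tt form_in_vac assms)
  then show ?thesis unfolding shift_coeff_def form_in_def by blast
qed

definition good_point :: "nat \<Rightarrow> ('k \<Rightarrow> complex) \<Rightarrow> 'k set \<Rightarrow> complex \<Rightarrow> bool" where
  "good_point N z S u \<longleftrightarrow> (\<forall>s\<in>S. \<forall>k<N. u - of_nat k \<noteq> z s)"

text \<open>One factor \<open>ppi z ss u\<close> clears all denominators, because
  \<open>Vc_vanish\<close> cancels the poles to the right of the sites. The degree bound gains one
  for each row with \<open>q a = 1\<close>. The last property comes from \<open>Ec_at_site\<close>:
  if all \<open>h i\<close> vanish at z_s - 1, they vanish at z_s.\<close>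

theorem dop_polynomial:
  fixes e :: "'k \<Rightarrow> nat \<Rightarrow> nat \<Rightarrow> 'i lop"
  assumes N: "1 \<le> N" and sites: "gl_sites N e (set ss)" and dist: "distinct ss"
    and units: "\<And>s. s \<in> set ss \<Longrightarrow> matrix_units N (e s)"
    and gen: "generic_sites z (set ss)"
    and p: "\<And>i. \<exists>P. degree P \<le> d \<and> (\<forall>u. p u i = poly P u)"
  obtains h where
    "\<And>u i. good_point N z (set ss) u \<Longrightarrow> poly (h i) u = ppi z ss u * dop N (Mt N e z q ss) p u i"
    "\<And>i. h i = 0 \<or> int (degree (h i)) \<le> int d + int (length ss) - int (card {a\<in>{1..N}. q a = 1})"
    "\<And>s. s \<in> set ss \<Longrightarrow> \<exists>K :: 'i lop. \<forall>i. poly (h i) (z s)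
       = - (K \<triangleright> (\<lambda>i. poly (h i) (z s - 1) / ppi z ss (z s - 1))) i"
proof -
  let ?M = "site_op N e z q ss" and ?g = "\<lambda>u. 1 / ppi z ss u"
  let ?F = "\<lambda>u. vac (p u)"
  have "\<exists>P. \<forall>u. shift_coeff N e z q ss p k u i = poly P u" for k i
    using shift_coeff_in[OF fun_class_poly, of p N e z q ss k i] p unfolding is_poly_def by blast
  then obtain P where P: "\<And>k i u. shift_coeff N e z q ss p k u i = poly (P k i) u" by metis
  \<comment> \<open>Labels of the known zeros z_s + j, 1 \<le> j < k, of the coefficient with k
    shifts. Genericity of z makes these points distinct, so their product divides the
    coefficient.\<close>
  define B where "B = (\<lambda>k. set ss \<times> {1..<k::nat})"
  define \<phi> where "\<phi> = (\<lambda>(s, j :: nat). z s + of_nat j)"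
  have inj: "inj_on \<phi> (B k)" for k
  proof (rule inj_onI)
    fix b c assume bc: "b \<in> B k" "c \<in> B k" "\<phi> b = \<phi> c"
    obtain s j t l where [simp]: "b = (s, j)" "c = (t, l)" by (cases b; cases c) auto
    have "z s - z t = of_int (int l - int j)" using bc(3) by (simp add: \<phi>_def algebra_simps)
    then have "z s - z t \<in> \<int>" by simp
    then have "s = t" using gen bc(1,2) unfolding generic_sites_def B_def by auto
    then show "b = c" using bc(3) by (simp add: \<phi>_def)
  qed
  have van: "poly (P k i) (\<phi> b) = 0" if b: "b \<in> B k" for k i b
  proof -
    obtain s j where [simp]: "b = (s, j)" by (cases b) auto
    have sj: "s \<in> set ss" "1 \<le> j" "j < k" using b by (auto simp: B_def)
    obtain xs ys where xy: "ss = xs @ s # ys" using split_list[OF sj(1)] by blast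
    have "Vc N ?M [1..<N+1] ?F k (z s + of_nat j) = 0"
      by (rule Vc_vanish[OF N xy sites dist units[OF sj(1)], where q = q])
        (use sj in \<open>auto simp: fun_eq_iff site_op_def\<close>)
    then show ?thesis unfolding P[symmetric] shift_coeff_def by (simp add: \<phi>_def)
  qed
  define D where "D = (\<lambda>k. \<Prod>b\<in>B k. [:- \<phi> b, 1:] :: complex poly)"
  have "\<exists>P'. P k i = D k * P'" for k i
    unfolding D_def by (rule poly_dvd_prod_roots) (use inj van in \<open>auto simp: B_def\<close>)
  then obtain P' where P': "\<And>k i. P k i = D k * P' k i" by metis
  have D: "poly (D (Suc k)) u * gprod ?g k (u - 1) = 1" if "\<forall>j\<in>{1..k}. ppi z ss (u - of_nat j) \<noteq> 0" for k u
  proof -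
    have "poly (D (Suc k)) u = (\<Prod>j\<in>{1..<Suc k}. ppi z ss (u - of_nat j))"
      unfolding D_def B_def poly_prod ppi_prod[OF dist]
      by (subst prod.swap, subst prod.cartesian_product) (auto simp: \<phi>_def algebra_simps intro!: prod.cong)
    also have "\<dots> = (\<Prod>i<k. ppi z ss (u - 1 - of_nat i))"
      by (rule prod.reindex_bij_witness[of _ Suc "\<lambda>j. j - 1"]) (auto simp: of_nat_diff algebra_simps)
    finally have "poly (D (Suc k)) u * gprod ?g k (u - 1)
      = (\<Prod>i<k. ppi z ss (u - 1 - of_nat i) * (1 / ppi z ss (u - 1 - of_nat i)))"
      by (simp only: gprod_def prod.distrib)
    also have "\<dots> = 1"
    proof (rule prod.neutral, rule ballI)
      fix i assume "i \<in> {..<k}"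
      then have "Suc i \<in> {1..k}" by simp
      from bspec[OF that this] have "ppi z ss (u - of_nat (Suc i)) \<noteq> 0" .
      then show "ppi z ss (u - 1 - of_nat i) * (1 / ppi z ss (u - 1 - of_nat i)) = 1"
        by (simp add: diff_diff_eq)
    qed
    finally show ?thesis .
  qed
  have P'_eq: "poly (P' (Suc k) i) u = gprod ?g k (u - 1) * shift_coeff N e z q ss p (Suc k) u i"
    if "\<forall>j\<in>{1..k}. ppi z ss (u - of_nat j) \<noteq> 0" for k u i
    using D[OF that] by (simp add: P P' mult_ac)
  define pol where "pol = (\<Prod>s\<leftarrow>ss. [:- z s, 1:] :: complex poly)"
  have pol: "poly pol u = ppi z ss u" for u by (simp add: pol_def ppi_poly)
  \<comment> \<open>The term without shift is multiplied by \<open>ppi\<close>. In the other terms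
    \<open>ppi\<close> cancels against \<open>g u\<close>, and the quotient \<open>P'\<close>
    already accounts for the denominators at u - 1, u - 2, ...\<close>
  define h where "h = (\<lambda>i. pol * P 0 i + (\<Sum>k<N. P' (Suc k) i))"
  have h_eq: "poly (h i) u = ppi z ss u * p u i
      + (\<Sum>k<N. gprod ?g k (u - 1) * shift_coeff N e z q ss p (Suc k) u i)"
    if "\<forall>j\<in>{1..<N}. ppi z ss (u - of_nat j) \<noteq> 0" for u i
  proof -
    have "poly (P' (Suc k) i) u = gprod ?g k (u - 1) * shift_coeff N e z q ss p (Suc k) u i" if "k < N" for k
      by (rule P'_eq) (use that \<open>\<forall>j\<in>{1..<N}. _\<close> in auto)
    then show ?thesis by (simp add: h_def poly_sum pol P[symmetric] shift_coeff_0)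
  qed
  have good: "poly (h i) u = ppi z ss u * dop N (Mt N e z q ss) p u i" if "good_point N z (set ss) u" for u i
  proof -
    have nz: "ppi z ss (u - of_nat j) \<noteq> 0" if "j < N" for j
      using \<open>good_point _ _ _ _\<close> that by (auto simp: ppi_0_iff good_point_def)
    have "dop N (Mt N e z q ss) p u i = (\<Sum>k\<le>N. gprod ?g k u * shift_coeff N e z q ss p k u i)"
      by (simp add: dop_shift_coeff sum_apply ap_sc)
    also have "\<dots> = p u i + (\<Sum>k<N. gprod ?g (Suc k) u * shift_coeff N e z q ss p (Suc k) u i)"
      unfolding lessThan_Suc_atMost[symmetric] sum.lessThan_Suc_shift by (simp add: gprod_def shift_coeff_0)
    finally have "ppi z ss u * dop N (Mt N e z q ss) p u i = ppi z ss u * p u i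
      + (\<Sum>k<N. gprod ?g k (u - 1) * shift_coeff N e z q ss p (Suc k) u i)"
      using nz[of 0] N by (simp add: gprod_Suc distrib_left sum_distrib_left)
    then show ?thesis using h_eq[of u i] nz by simp
  qed
  \<comment> \<open>By genericity the denominators do not vanish at z_s - 1, z_s - 2, ..., so
    \<open>h_eq\<close> can be used at u = z_s itself.\<close>
  have nz1: "ppi z ss (z s - of_nat j) \<noteq> 0" if "s \<in> set ss" "1 \<le> j" for s j
  proof
    assume "ppi z ss (z s - of_nat j) = 0"
    then obtain t where t: "t \<in> set ss" "z s - of_nat j = z t" by (auto simp: ppi_0_iff)
    then have "z s - z t = of_int (int j)" by (simp add: algebra_simps)
    then have "z s - z t \<in> \<int>" by simp
    then have "s = t" using gen t that unfolding generic_sites_def by auto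
    then show False using t that by simp
  qed
  show thesis
  proof (rule that[of h, OF good])
    fix i
    have "vec_order (int d) p"
      unfolding vec_order_def
    proof
      fix i
      obtain P where "degree P \<le> d" "\<And>u. p u i = poly P u" using p by blast
      then show "rat_order (int d) (\<lambda>u. p u i)" using rat_order_poly[of P "int d"] by simp
    qed
    from vec_order_dop[OF this, where N = N and q = q and e = e and z = z and ss = ss]
    have 1: "rat_order (int d - int (card {a\<in>{1..N}. q a = 1})) (\<lambda>u. dop N (Mt N e z q ss) p u i)"
      unfolding vec_order_def by blast
    have 2: "rat_order (int (length ss)) (\<lambda>u. ppi z ss u)"
      using rat_order_poly[of pol "int (length ss)"] ppi_degree[of z ss] by (simp add: pol_def ppi_poly[abs_def])
    have "h i = 0 \<or> int (degree (h i)) \<le> int (length ss) + (int d - int (card {a\<in>{1..N}. q a = 1}))"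
    proof (rule rat_order_degree[OF rat_order_mult[OF 2 1]])
      show "(\<Prod>s\<in>set ss. \<Prod>k<N. [:- (z s + of_nat k), 1:]) \<noteq> (0 :: complex poly)" by simp
      fix u assume "poly (\<Prod>s\<in>set ss. \<Prod>k<N. [:- (z s + of_nat k), 1:]) u \<noteq> 0"
      then have "good_point N z (set ss) u"
        by (auto simp: poly_prod good_point_def algebra_simps)
      then show "ppi z ss u * dop N (Mt N e z q ss) p u i = poly (h i) u" by (simp add: good)
    qed
    then show "h i = 0 \<or> int (degree (h i)) \<le> int d + int (length ss) - int (card {a\<in>{1..N}. q a = 1})"
      by linarith
  next
    fix s assume s: "s \<in> set ss"
    obtain xs ys where xy: "ss = xs @ s # ys" using split_list[OF s] by blast
    have gp: "good_point N z (set ss) (z s - 1)"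
      unfolding good_point_def
    proof (intro ballI allI impI notI)
      fix t k assume t: "t \<in> set ss" "z s - 1 - of_nat k = z t"
      then have "ppi z ss (z s - of_nat (Suc k)) = 0" by (auto simp: ppi_0_iff algebra_simps)
      then show False using nz1[OF s, of "Suc k"] by simp
    qed
    have dop1: "dop N (Mt N e z q ss) p (z s - 1) = (\<lambda>i. poly (h i) (z s - 1) / ppi z ss (z s - 1))"
      using good[OF gp] nz1[OF s, of 1] by (intro ext) simp
    define K where "K = local_K N e z xs ys s q"
    have Ms: "?M = (\<lambda>u a b. sc (q a) * Tt N e z ss u a b)" by (simp add: fun_eq_iff site_op_def)
    have "Ec N ?M ?g [1..<N+1] ?F (z s) {1..N} = - (K \<triangleright> dop N (Mt N e z q ss) p (z s - 1))"
      unfolding dop_def Mt_site_op K_def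
      by (subst Ec_at_site[OF N xy sites dist units[OF s] Ms]) (simp add: fap_def)
    moreover have "Ec N ?M ?g [1..<N+1] ?F (z s) {1..N}
      = (\<Sum>k<N. sc (gprod ?g k (z s - 1)) \<triangleright> shift_coeff N e z q ss p (Suc k) (z s))"
      unfolding Ec_Vc by (simp only: sum_apply fap_def shift_coeff_def length_upt diff_add_inverse2)
    ultimately have "(\<Sum>k<N. gprod ?g k (z s - 1) * shift_coeff N e z q ss p (Suc k) (z s) i)
      = - (K \<triangleright> dop N (Mt N e z q ss) p (z s - 1)) i" for i
      by (metis (mono_tags, lifting) ap_sc sum.cong sum_apply uminus_apply)
    moreover have "ppi z ss (z s) = 0" using s by (auto simp: ppi_0_iff)
    ultimately have "poly (h i) (z s) = - (K \<triangleright> dop N (Mt N e z q ss) p (z s - 1)) i" for i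
      using h_eq[of "z s" i] nz1[OF s] by simp
    then show "\<exists>K :: 'i lop. \<forall>i. poly (h i) (z s)
       = - (K \<triangleright> (\<lambda>i. poly (h i) (z s - 1) / ppi z ss (z s - 1))) i"
      unfolding dop1 by blast
  qed
qed

section \<open>Linear systems\<close>

text \<open>Dimension counts enter only in this form. It serves for generic vector sites, for the
  Gram matrix of an embedded module and for the evaluation on S_i.\<close>

lemma injective_square_system:
  fixes L :: "('a \<Rightarrow> complex) \<Rightarrow> 'b \<Rightarrow> complex"
  assumes fin: "finite A" "finite B" "card A = card B"
    and add: "\<And>x y b. b \<in> B \<Longrightarrow> L (\<lambda>a. x a + y a) b = L x b + L y b"
    and scale: "\<And>c x b. b \<in> B \<Longrightarrow> L (\<lambda>a. c * x a) b = c * L x b"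
    and inj: "\<And>x. (\<forall>a. a \<notin> A \<longrightarrow> x a = 0) \<Longrightarrow> (\<forall>b\<in>B. L x b = 0) \<Longrightarrow> (\<forall>a\<in>A. x a = 0)"
  shows "\<exists>x. (\<forall>a. a \<notin> A \<longrightarrow> x a = 0) \<and> (\<forall>b\<in>B. L x b = y b)"
proof -
  define n where "n = card A"
  obtain \<alpha> where \<alpha>: "bij_betw \<alpha> {..<n} A"
    using fin(1) by (metis n_def ex_bij_betw_nat_finite atLeast0LessThan)
  obtain \<beta> where \<beta>: "bij_betw \<beta> {..<n} B"
    using fin by (metis n_def ex_bij_betw_nat_finite atLeast0LessThan)
  define unit where "unit = (\<lambda>a a' :: 'a. if a' = a then 1 else 0 :: complex)"
  define M where "M = mat n n (\<lambda>(i, j). L (unit (\<alpha> j)) (\<beta> i))"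
  define emb where "emb = (\<lambda>v :: complex vec. \<lambda>a. if a \<in> A then v $ (the_inv_into {..<n} \<alpha> a) else 0)"
  have M: "M \<in> carrier_mat n n" by (simp add: M_def)
  have emb_\<alpha>: "emb v (\<alpha> j) = v $ j" if "j < n" for v j
    using that \<alpha> by (auto simp: emb_def bij_betw_def the_inv_into_f_f)
  have zero: "L (\<lambda>a. 0) b = 0" if "b \<in> B" for b
    using scale[OF that, of 0 "\<lambda>a. 0"] by simp
  have Lsum: "L (\<lambda>a. \<Sum>j\<in>J. c j * f j a) b = (\<Sum>j\<in>J. c j * L (f j) b)"
    if "b \<in> B" "finite J" for J :: "nat set" and c f b
    using that(2)
  proof (induction J rule: finite_induct)
    case empty
    then show ?case using zero[OF that(1)] by simp
  next
    case (insert j J)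
    then show ?case using add[OF that(1)] scale[OF that(1)] by simp
  qed
  have emb_sum: "emb v = (\<lambda>a. \<Sum>j<n. v $ j * unit (\<alpha> j) a)" for v
  proof
    fix a
    show "emb v a = (\<Sum>j<n. v $ j * unit (\<alpha> j) a)"
    proof (cases "a \<in> A")
      case True
      then obtain k where k: "k < n" "a = \<alpha> k" using \<alpha> by (auto simp: bij_betw_def)
      have "(\<Sum>j<n. v $ j * unit (\<alpha> j) a) = (\<Sum>j<n. if j = k then v $ j else 0)"
        using k \<alpha> by (intro sum.cong) (auto simp: unit_def bij_betw_def inj_on_def)
      then show ?thesis using k emb_\<alpha> by simp
    next
      case False
      then have "(\<Sum>j<n. v $ j * unit (\<alpha> j) a) = 0"
        using \<alpha> by (intro sum.neutral) (auto simp: unit_def bij_betw_def)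
      then show ?thesis using False by (simp add: emb_def)
    qed
  qed
  have LM: "L (emb v) (\<beta> i) = (M *\<^sub>v v) $ i" if "i < n" "v \<in> carrier_vec n" for v i
  proof -
    have "\<beta> i \<in> B" using \<beta> that by (auto simp: bij_betw_def)
    then show ?thesis unfolding emb_sum
      using that by (simp add: Lsum M_def scalar_prod_def atLeast0LessThan mult.commute)
  qed
  have "det M \<noteq> 0"
  proof
    assume "det M = 0"
    then obtain v where v: "v \<in> carrier_vec n" "v \<noteq> 0\<^sub>v n" "M *\<^sub>v v = 0\<^sub>v n"
      using det_0_iff_vec_prod_zero_field[OF M] by blast
    have "\<forall>a\<in>A. emb v a = 0"
    proof (rule inj)
      show "\<forall>b\<in>B. L (emb v) b = 0"
        using \<beta> LM[OF _ v(1)] v(3) by (auto simp: bij_betw_def)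
    qed (simp add: emb_def)
    then have "v $ j = 0" if "j < n" for j
      using emb_\<alpha>[OF that, of v] \<alpha> that by (auto simp: bij_betw_def)
    then have "v = 0\<^sub>v n" using v(1) by (intro eq_vecI) auto
    with v(2) show False by simp
  qed
  from det_non_zero_imp_unit[OF M this, of "()"]
  obtain M' where M': "M' \<in> carrier_mat n n" "M * M' = 1\<^sub>m n"
    unfolding Units_def ring_mat_def by auto
  define c where "c = vec n (\<lambda>i. y (\<beta> i))"
  have c: "c \<in> carrier_vec n" by (simp add: c_def)
  define x where "x = M' *\<^sub>v c"
  have x: "x \<in> carrier_vec n" using M' c by (simp add: x_def)
  have "M *\<^sub>v x = c"
    unfolding x_def using assoc_mult_mat_vec[OF M M'(1) c] M'(2) c by simp
  then have "L (emb x) b = y b" if "b \<in> B" for b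
    using that \<beta> LM[OF _ x] by (auto simp: bij_betw_def c_def)
  then show ?thesis by (intro exI[of _ "emb x"]) (simp add: emb_def)
qed

section \<open>Quasi-exponentials\<close>

text \<open>The shift minus multiplication by a chosen base Q0 lowers the degree at Q0 and raises no
  other. At another base Q it multiplies the leading coefficient by Q - Q0, so nothing is lost
  there. The induction is on the total degree, counted so that the zero polynomial weighs less than
  a constant.\<close>

lemma exp_poly_independent:
  fixes P :: "complex \<Rightarrow> complex poly"
  assumes "finite A" "0 \<notin> A" "\<And>j :: nat. (\<Sum>Q\<in>A. Q ^ j * poly (P Q) (of_nat j)) = 0"
  shows "\<forall>Q\<in>A. P Q = 0"
  using assms(3)
proof (induction "\<Sum>Q\<in>A. if P Q = 0 then 0 else Suc (degree (P Q))" arbitrary: P rule: less_induct)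
  case less
  define m where "m = (\<lambda>P :: complex \<Rightarrow> complex poly. \<lambda>Q. if P Q = 0 then 0 else Suc (degree (P Q)))"
  show ?case
  proof (rule ccontr)
    assume "\<not> (\<forall>Q\<in>A. P Q = 0)"
    then obtain Q0 where Q0: "Q0 \<in> A" "P Q0 \<noteq> 0" by blast
    define P' where "P' = (\<lambda>Q. Polynomial.smult Q (pcompose (P Q) [:1, 1:]) - Polynomial.smult Q0 (P Q))"
    have sh: "degree (pcompose R [:1, 1:]) = degree R" "lead_coeff (pcompose R [:1, 1:]) = lead_coeff R"
      for R :: "complex poly"
      using lead_coeff_comp[of "[:1, 1:]" R] by (simp_all add: degree_pcompose)
    have deg: "degree (P' Q) \<le> degree (P Q)" for Q
      unfolding P'_def by (intro degree_diff_le order.trans[OF degree_smult_le]) (simp_all add: sh)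
    have lc: "coeff (P' Q) (degree (P Q)) = (Q - Q0) * lead_coeff (P Q)" for Q
      using sh[of "P Q"] by (simp add: P'_def left_diff_distrib)
    have le: "m P' Q \<le> m P Q" for Q
    proof (cases "P Q = 0")
      case True
      then have "P' Q = 0" by (simp add: P'_def)
      then show ?thesis by (simp add: m_def)
    next
      case False
      then show ?thesis using deg[of Q] by (simp add: m_def)
    qed
    have lt: "m P' Q0 < m P Q0"
    proof (cases "P' Q0 = 0")
      case False
      have "coeff (P' Q0) (degree (P Q0)) = 0" using lc[of Q0] by simp
      then have "degree (P' Q0) \<noteq> degree (P Q0)" using False by (metis leading_coeff_0_iff)
      then show ?thesis using deg[of Q0] Q0 False by (simp add: m_def)
    qed (use Q0 in \<open>simp add: m_def\<close>)
    have smaller: "(\<Sum>Q\<in>A. m P' Q) < (\<Sum>Q\<in>A. m P Q)"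
      using le lt Q0(1) assms(1) by (intro sum_strict_mono_ex1) auto
    have rec: "(\<Sum>Q\<in>A. Q ^ j * poly (P' Q) (of_nat j)) = 0" for j
    proof -
      have "(\<Sum>Q\<in>A. Q ^ j * poly (P' Q) (of_nat j))
        = (\<Sum>Q\<in>A. Q ^ Suc j * poly (P Q) (of_nat (Suc j))) - Q0 * (\<Sum>Q\<in>A. Q ^ j * poly (P Q) (of_nat j))"
        unfolding sum_distrib_left sum_subtractf[symmetric]
        by (intro sum.cong refl) (simp add: P'_def poly_pcompose algebra_simps)
      then show ?thesis using less.prems[of j] less.prems[of "Suc j"] by simp
    qed
    have P'0: "\<forall>Q\<in>A. P' Q = 0"
      by (rule less.hyps[OF smaller[unfolded m_def] rec])
    have other: "P Q = 0" if "Q \<in> A" "Q \<noteq> Q0" for Q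
    proof -
      have "(Q - Q0) * lead_coeff (P Q) = 0" unfolding lc[symmetric] using P'0 that(1) by simp
      then show ?thesis using that(2) by simp
    qed
    have "poly (P Q0) (of_nat j) = 0" for j
    proof -
      have "(\<Sum>Q\<in>A. Q ^ j * poly (P Q) (of_nat j)) = (\<Sum>Q\<in>{Q0}. Q ^ j * poly (P Q) (of_nat j))"
        using assms(1) Q0 other by (intro sum.mono_neutral_right) auto
      then show ?thesis using less.prems[of j] Q0(1) assms(2) by auto
    qed
    then have "range (of_nat :: nat \<Rightarrow> complex) \<subseteq> {u. poly (P Q0) u = 0}" by auto
    moreover have "infinite (range (of_nat :: nat \<Rightarrow> complex))"
      by (simp add: inj_of_nat finite_image_iff)
    ultimately show False using Q0(2) poly_roots_finite finite_subset by blast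
  qed
qed

definition qsum :: "complex set \<Rightarrow> (complex \<Rightarrow> real) \<Rightarrow> nat \<Rightarrow> (complex \<Rightarrow> nat \<Rightarrow> 'i \<Rightarrow> complex) \<Rightarrow> complex \<Rightarrow> 'i \<Rightarrow> complex" where
  "qsum A \<theta> d C u = (\<lambda>i. \<Sum>Q\<in>A. power_with_arg \<theta> Q u * (\<Sum>k\<le>d. u ^ k * C Q k i))"

definition has_args :: "complex set \<Rightarrow> (complex \<Rightarrow> real) \<Rightarrow> bool" where
  "has_args A \<theta> \<longleftrightarrow> finite A \<and> (\<forall>Q\<in>A. Q \<noteq> 0 \<and> rcis (cmod Q) (\<theta> Q) = Q)"

lemma power_with_arg_Suc:
  assumes "Q \<noteq> 0" "rcis (cmod Q) (\<theta> Q) = Q"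
  shows "power_with_arg \<theta> Q (u + 1) = power_with_arg \<theta> Q u * Q"
proof -
  have "exp (Complex (ln (cmod Q)) (\<theta> Q)) = Q"
    unfolding exp_eq_polar using assms by (simp add: rcis_def)
  then show ?thesis by (simp add: power_with_arg_def distrib_right exp_add)
qed

lemma power_with_arg_nat:
  assumes "Q \<noteq> 0" "rcis (cmod Q) (\<theta> Q) = Q"
  shows "power_with_arg \<theta> Q (u + of_nat j) = power_with_arg \<theta> Q u * Q ^ j"
proof (induction j)
  case (Suc j)
  then show ?case using power_with_arg_Suc[where Q = Q and \<theta> = \<theta>, OF assms, of "u + of_nat j"] by (simp add: add_ac)
qed simp

lemma power_with_arg_nonzero: "power_with_arg \<theta> Q u \<noteq> 0"
  by (simp add: power_with_arg_def)

text \<open>Along w, w + 1, w + 2, ... the powers with fixed argument become ordinary powers of Q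
  times a non-zero factor, so the choice of arguments does not interfere. A half-lattice is exactly
  the set on which the recursions produce zeros.\<close>

lemma qsum_coeff_zero:
  assumes A: "has_args A \<theta>"
    and zero: "\<And>j :: nat. qsum A \<theta> d C (w + of_nat j) i = 0"
    and Q: "Q \<in> A" "k \<le> d"
  shows "C Q k i = 0"
proof -
  define R where "R = (\<lambda>Q. \<Sum>k\<le>d. monom (C Q k i) k)"
  have R: "poly (R Q) u = (\<Sum>k\<le>d. u ^ k * C Q k i)" for Q u
    by (simp add: R_def poly_sum poly_monom mult.commute)
  define P where "P = (\<lambda>Q. Polynomial.smult (power_with_arg \<theta> Q w) (pcompose (R Q) [:w, 1:]))"
  have "(\<Sum>Q\<in>A. Q ^ j * poly (P Q) (of_nat j)) = 0" for j
  proof -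
    have "(\<Sum>Q\<in>A. Q ^ j * poly (P Q) (of_nat j)) = qsum A \<theta> d C (w + of_nat j) i"
      unfolding qsum_def using A
      by (intro sum.cong) (auto simp: P_def poly_pcompose R has_args_def power_with_arg_nat)
    then show ?thesis using zero by simp
  qed
  then have "\<forall>Q\<in>A. P Q = 0"
    using exp_poly_independent[of A P] A by (auto simp: has_args_def)
  then have "pcompose (R Q) [:w, 1:] = 0"
    using Q power_with_arg_nonzero[of \<theta> Q w] by (auto simp: P_def)
  then have "R Q = 0" by (simp add: pcompose_eq_0_iff)
  moreover have "coeff (R Q) k = C Q k i"
    using Q by (simp add: R_def coeff_sum sum.delta)
  ultimately show ?thesis by simp
qed

lemma qsum_zero:
  assumes "has_args A \<theta>" "\<And>j :: nat. qsum A \<theta> d C (w + of_nat j) i = 0"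
  shows "qsum A \<theta> d C u i = 0"
  using qsum_coeff_zero[OF assms] by (simp add: qsum_def)

section \<open>Elementary properties of the operator\<close>

lemma dop_add: "dop N M (\<lambda>u. f u + g u) u = dop N M f u + dop N M g u"
proof -
  have "(\<lambda>u. vac (f u + g u)) = (\<lambda>u. vac (f u)) + (\<lambda>u. vac (g u))"
    by (rule ext) (simp add: vac_add)
  then show ?thesis by (simp add: dop_def Phi_add del: upt_Suc)
qed

lemma dop_0: "dop N M (\<lambda>u. 0) u = 0"
proof -
  have "dop N M (\<lambda>u. 0 + 0) u = dop N M (\<lambda>u. 0) u + dop N M (\<lambda>u. 0) u"
    by (rule dop_add)
  then show ?thesis by (simp del: pw)
qed

lemma dop_sum: "dop N M (\<lambda>u. \<Sum>i\<in>S. f i u) u = (\<Sum>i\<in>S. dop N M (f i) u)"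
proof (induction S rule: infinite_finite_induct)
  case (insert i S)
  then show ?case using dop_add[of N M "f i" "\<lambda>u. \<Sum>i\<in>S. f i u" u] by (simp del: pw)
qed (simp_all add: dop_0 del: pw)

text \<open>Conjugation by Q^u divides the matrix by Q. The polynomial part at the base Q thus meets
  the twists q_a / Q, and as many of them equal 1 as Q has multiplicity.\<close>

lemma Phi_exp:
  assumes "\<And>u. g u = g (u - 1) * Q" "\<And>u a b. M u a b = sc Q * M' u a b"
  shows "Phi N M as (\<lambda>u. fap (sc (g u)) (F u)) u = fap (sc (g u)) (Phi N M' as F u)"
proof (induction as arbitrary: u)
  case (Cons a as)
  have 1: "Phi N M as (\<lambda>u. fap (sc (g u)) (F u)) = (\<lambda>u. fap (sc (g u)) (Phi N M' as F u))"
    by (rule ext) (rule Cons.IH)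
  have "nu N (M u) a (fap (sc (g (u - 1))) G) = fap (sc (g u)) (nu N (M' u) a G)" for G
  proof -
    have "M u = (\<lambda>a b. sc Q * M' u a b)" by (intro ext) (rule assms(2))
    then show ?thesis by (simp add: nu_fap_sc nu_sc fap_times[symmetric] sc_mult[symmetric] assms(1)[of u] mult.commute)
  qed
  then show ?case by (simp add: 1 phi_def psi_fap fap_diff del: pw)
qed simp

lemma dop_exp:
  assumes "\<And>u. g u = g (u - 1) * Q" "\<And>u a b. M u a b = sc Q * M' u a b"
  shows "dop N M (\<lambda>u. sc (g u) \<triangleright> f u) u = sc (g u) \<triangleright> dop N M' f u"
proof -
  have "(\<lambda>u. vac (sc (g u) \<triangleright> f u)) = (\<lambda>u. fap (sc (g u)) (vac (f u)))"
    by (rule ext) (simp add: fap_vac)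
  then have "dop N M (\<lambda>u. sc (g u) \<triangleright> f u) u = Phi N M [1..<N+1] (\<lambda>u. fap (sc (g u)) (vac (f u))) u {1..N}"
    unfolding dop_def by simp
  also have "\<dots> = fap (sc (g u)) (Phi N M' [1..<N+1] (\<lambda>u. vac (f u)) u) {1..N}"
    by (subst Phi_exp[where g = g and M = M, OF assms]) auto
  finally show ?thesis by (simp add: dop_def fap_def del: upt_Suc)
qed

lemma dop_scale: "dop N M (\<lambda>u. sc c \<triangleright> f u) u = sc c \<triangleright> dop N M f u"
  by (rule dop_exp[of "\<lambda>_. c" 1]) auto

lemma Vc_zero:
  assumes "F (u - of_nat k) = 0"
  shows "Vc N M as F k u = 0"
  using assms
proof (induction as arbitrary: k u)
  case Nil
  then show ?case by (auto simp del: pw)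
next
  case (Cons a as)
  have "Vc N M as F (k - 1) (u - 1) = 0" if "k \<noteq> 0"
    by (rule Cons.IH) (use that Cons.prems in \<open>simp add: of_nat_diff\<close>)
  then show ?case using Cons by (simp del: pw)
qed

lemma shift_coeff_zero: "f (u - of_nat k) = 0 \<Longrightarrow> shift_coeff N e z q ss f k u = 0"
  unfolding shift_coeff_def by (subst Vc_zero) auto

text \<open>The coefficient without shift is the identity, so the equation at u expresses f(u)
  through the N values to the left of it.\<close>

lemma forward_zero:
  assumes ker: "\<And>j :: nat. dop N (Mt N e z q ss) f (w + of_nat j) = 0"
    and init: "\<And>j. j \<in> {1..N} \<Longrightarrow> f (w - of_nat j) = 0"
  shows "f (w + of_nat j) = 0"
proof (induction j rule: less_induct)
  case (less j)
  have prev: "f (w + of_nat j - of_nat k) = 0" if k: "1 \<le> k" "k \<le> N" for k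
  proof (cases "k \<le> j")
    case True
    then have eq: "w + of_nat j - of_nat k = w + of_nat (j - k)" by (simp add: of_nat_diff)
    show ?thesis unfolding eq by (rule less) (use k True in simp)
  next
    case False
    then have eq: "w + of_nat j - of_nat k = w - of_nat (k - j)" by (simp add: of_nat_diff)
    show ?thesis unfolding eq by (rule init) (use False k in auto)
  qed
  have "0 = (\<Sum>k\<le>N. sc (gprod (\<lambda>u. 1 / ppi z ss u) k (w + of_nat j)) \<triangleright> shift_coeff N e z q ss f k (w + of_nat j))"
    using ker[of j] by (simp add: dop_shift_coeff)
  also have "\<dots> = (\<Sum>k\<in>{0}. sc (gprod (\<lambda>u. 1 / ppi z ss u) k (w + of_nat j)) \<triangleright> shift_coeff N e z q ss f k (w + of_nat j))"
    by (rule sum.mono_neutral_right) (use prev in \<open>auto simp: shift_coeff_zero\<close>)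
  also have "\<dots> = f (w + of_nat j)" by (simp add: shift_coeff_0 gprod_def)
  finally show ?case by simp
qed

text \<open>A finite-dimensional space is modelled as the functions supported on a finite index set
  inside a possibly infinite type; such operators preserve it.\<close>

definition op_supp :: "'i set \<Rightarrow> 'i lop \<Rightarrow> bool" where
  "op_supp I A \<longleftrightarrow> (\<forall>x. (\<forall>i. i \<notin> I \<longrightarrow> x i = 0) \<longrightarrow> (\<forall>i. i \<notin> I \<longrightarrow> (A \<triangleright> x) i = 0))"

lemma op_suppD: "op_supp I A \<Longrightarrow> (\<And>i. i \<notin> I \<Longrightarrow> x i = 0) \<Longrightarrow> i \<notin> I \<Longrightarrow> (A \<triangleright> x) i = 0"
  unfolding op_supp_def by blast

lemma op_supp_sc: "op_supp I (sc c)" by (simp add: op_supp_def ap_sc)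
lemma op_supp_0: "op_supp I 0" by (simp add: op_supp_def)
lemma op_supp_1: "op_supp I 1" by (simp add: op_supp_def)
lemma op_supp_add: "op_supp I A \<Longrightarrow> op_supp I B \<Longrightarrow> op_supp I (A + B)"
  by (simp add: op_supp_def ap_plus)
lemma op_supp_mult: "op_supp I A \<Longrightarrow> op_supp I B \<Longrightarrow> op_supp I (A * B)"
  by (simp add: op_supp_def ap_times)
lemma op_supp_sum: "(\<And>i. i \<in> S \<Longrightarrow> op_supp I (A i)) \<Longrightarrow> op_supp I (\<Sum>i\<in>S. A i)"
  by (induction S rule: infinite_finite_induct) (auto intro: op_supp_add op_supp_0)

lemma op_supp_Tt:
  assumes "\<And>s a b. s \<in> set ss \<Longrightarrow> a \<in> {1..N} \<Longrightarrow> b \<in> {1..N} \<Longrightarrow> op_supp I (e s a b)"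
    "a \<in> {1..N}" "b \<in> {1..N}"
  shows "op_supp I (Tt N e z ss u a b)"
  using assms
proof (induction ss arbitrary: a b)
  case (Cons s ss)
  have "op_supp I (Lt e z s u a c)" if "c \<in> {1..N}" for c
    using Cons.prems that by (auto simp: Lt_def intro!: op_supp_add op_supp_sc op_supp_0)
  with Cons show ?case by (auto intro!: op_supp_sum op_supp_mult)
qed (auto simp: op_supp_0 op_supp_1)

lemma Phi_supp:
  assumes M: "\<And>u a b. a \<in> {1..N} \<Longrightarrow> b \<in> {1..N} \<Longrightarrow> op_supp I (M u a b)"
    and "set as \<subseteq> {1..N}" "\<And>u S i. i \<notin> I \<Longrightarrow> F u S i = 0" "i \<notin> I"
  shows "Phi N M as F u S i = 0"
  using assms(2,4)
proof (induction as arbitrary: u S i)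
  case Nil
  then show ?case using assms(3) by simp
next
  case (Cons a as)
  have psi: "psi b (Phi N M as F u) S i = 0" if "i \<notin> I" for b u S i
    using Cons that by (auto simp: psi_def fermi_def)
  have "nu N (M u) a (Phi N M as F (u - 1)) S i = 0"
    unfolding nu_def sum_apply fap_def
  proof (intro sum.neutral ballI)
    fix b assume "b \<in> {1..N}"
    then have "op_supp I (M u a b)" using M Cons.prems by auto
    then show "(M u a b \<triangleright> psi b (Phi N M as F (u - 1)) S) i = 0"
      by (rule op_suppD) (use psi Cons.prems in auto)
  qed
  then show ?case using psi[OF Cons.prems(2)] by (simp add: phi_def)
qed

lemma dop_supp:
  assumes "\<And>s a b. s \<in> set ss \<Longrightarrow> a \<in> {1..N} \<Longrightarrow> b \<in> {1..N} \<Longrightarrow> op_supp I (e s a b)"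
    "\<And>u i. i \<notin> I \<Longrightarrow> f u i = 0" "i \<notin> I"
  shows "dop N (Mt N e z q ss) f u i = 0"
  unfolding dop_def
proof (rule Phi_supp[OF _ _ _ assms(3)])
  fix u a b assume "a \<in> {1..N}" "b \<in> {1..N}"
  then show "op_supp I (Mt N e z q ss u a b)"
    unfolding Mt_def using assms(1) by (intro op_supp_mult op_supp_sc op_supp_Tt) auto
qed (use assms(2) in \<open>auto simp: vac_def\<close>)

section \<open>Solutions for vector sites in general position\<close>

lemma exists_nodes:
  fixes S F :: "complex set"
  assumes "finite S" "finite F" "S \<inter> F = {}" "card S \<le> m"
  obtains Y where "finite Y" "card Y = m" "S \<subseteq> Y" "Y \<inter> F = {}"
proof -
  have "infinite (UNIV - (S \<union> F))" using assms by (simp add: infinite_UNIV_char_0)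
  then obtain B where B: "finite B" "card B = m - card S" "B \<subseteq> UNIV - (S \<union> F)"
    using infinite_arbitrarily_large by blast
  have "card (S \<union> B) = card S + card B" using B assms by (intro card_Un_disjoint) auto
  then show thesis using that[of "S \<union> B"] B assms by auto
qed

lemma not_good_points_finite: "finite S \<Longrightarrow> finite {u. \<not> good_point N z S u}"
proof -
  assume "finite S"
  have sub: "{u. \<not> good_point N z S u} \<subseteq> (\<Union>s\<in>S. \<Union>k\<in>{..<N}. {z s + of_nat k})"
    by (auto simp: good_point_def algebra_simps)
  show ?thesis by (rule finite_subset[OF sub]) (use \<open>finite S\<close> in auto)
qed

lemma good_point_not_site: "good_point N z S u \<Longrightarrow> 1 \<le> N \<Longrightarrow> s \<in> S \<Longrightarrow> u \<noteq> z s"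
  unfolding good_point_def by (auto dest!: bspec spec[of _ 0])

lemma good_point_pred_site:
  assumes "generic_sites z S" "s \<in> S"
  shows "good_point N z S (z s - 1)"
  unfolding good_point_def
proof (intro ballI allI impI notI)
  fix t k assume t: "t \<in> S" "z s - 1 - of_nat k = z t"
  then have "z s - z t = of_int (int k + 1)" by (simp add: algebra_simps)
  then have "z s - z t \<in> \<int>" by (simp only: Ints_of_int)
  then have "s = t" using assms t unfolding generic_sites_def by auto
  then have "1 + of_nat k = (0 :: complex)" using t(2) by (simp add: algebra_simps)
  then show False by (metis of_nat_Suc of_nat_eq_0_iff nat.distinct(1))
qed

lemma good_point_generic:
  assumes "\<And>s. s \<in> S \<Longrightarrow> w - z s \<notin> \<int>"
  shows "good_point N z S (w + of_nat j)"
  unfolding good_point_def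
proof (intro ballI allI impI notI)
  fix s k assume s: "s \<in> S" "w + of_nat j - of_nat k = z s"
  then have "w - z s = of_int (int k - int j)" by (simp add: algebra_simps)
  then have "w - z s \<in> \<int>" by (simp only: Ints_of_int)
  then show False using assms s by blast
qed

context
  fixes N :: nat and e :: "'k \<Rightarrow> nat \<Rightarrow> nat \<Rightarrow> 'i lop" and ss :: "'k list" and I :: "'i set"
    and q :: "nat \<Rightarrow> complex" and \<theta> :: "complex \<Rightarrow> real"
  assumes N: "1 \<le> N" and sites: "gl_sites N e (set ss)" and dist: "distinct ss"
    and units: "\<And>s. s \<in> set ss \<Longrightarrow> matrix_units N (e s)"
    and finI: "finite I"
    and supp: "\<And>s a b. s \<in> set ss \<Longrightarrow> a \<in> {1..N} \<Longrightarrow> b \<in> {1..N} \<Longrightarrow> op_supp I (e s a b)"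
    and args: "has_args (q ` {1..N}) \<theta>"
begin

text \<open>Let \<mu> be the number of \<open>q' a\<close> equal to 1 and n the number of sites. The
  cleared polynomial has degree at most d + n - \<mu>. It vanishes at the d + 1 - \<mu> nodes and,
  since these include every z_s - 1, at the n points z_s as well: one zero too many.\<close>

lemma dop_poly_zero:
  fixes p :: "complex \<Rightarrow> 'i \<Rightarrow> complex"
  assumes gen: "generic_sites z (set ss)"
    and p: "\<And>i. \<exists>P. degree P \<le> d \<and> (\<forall>u. p u i = poly P u)"
    and Y: "finite Y" "card Y + card {a\<in>{1..N}. q' a = 1} = d + 1" "\<And>s. s \<in> set ss \<Longrightarrow> z s - 1 \<in> Y"
      "\<And>y. y \<in> Y \<Longrightarrow> good_point N z (set ss) y"
    and zero: "\<And>y. y \<in> Y \<Longrightarrow> dop N (Mt N e z q' ss) p y = 0"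
    and u: "good_point N z (set ss) u"
  shows "dop N (Mt N e z q' ss) p u = 0"
proof -
  obtain h where h: "\<And>u i. good_point N z (set ss) u \<Longrightarrow> poly (h i) u = ppi z ss u * dop N (Mt N e z q' ss) p u i"
    "\<And>i. h i = 0 \<or> int (degree (h i)) \<le> int d + int (length ss) - int (card {a\<in>{1..N}. q' a = 1})"
    "\<And>s. s \<in> set ss \<Longrightarrow> \<exists>K :: 'i lop. \<forall>i. poly (h i) (z s)
       = - (K \<triangleright> (\<lambda>i. poly (h i) (z s - 1) / ppi z ss (z s - 1))) i"
    by (rule dop_polynomial[where q = q' and p = p and d = d, OF N sites dist units gen p]) blast+
  have hY: "poly (h i) y = 0" if "y \<in> Y" for y i
    using h(1)[OF Y(4)[OF that], of i] zero[OF that] by simp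
  have hz: "poly (h i) (z s) = 0" if s: "s \<in> set ss" for s i
  proof -
    obtain K :: "'i lop" where K: "\<And>i. poly (h i) (z s)
       = - (K \<triangleright> (\<lambda>i. poly (h i) (z s - 1) / ppi z ss (z s - 1))) i" using h(3)[OF s] by blast
    have "(\<lambda>i. poly (h i) (z s - 1) / ppi z ss (z s - 1)) = 0"
      by (rule ext) (simp add: hY[OF Y(3)[OF s]])
    then show ?thesis using K[of i] by simp
  qed
  have inj: "inj_on z (set ss)"
  proof (rule inj_onI, rule ccontr)
    fix s t assume "s \<in> set ss" "t \<in> set ss" "z s = z t" "s \<noteq> t"
    moreover from this have "z s - z t \<notin> \<int>" using gen unfolding generic_sites_def by blast
    ultimately show False by simp
  qed
  have "h i = 0" for i
  proof (rule ccontr)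
    assume nz: "h i \<noteq> 0"
    have "Y \<inter> z ` set ss = {}"
      using good_point_not_site[OF Y(4) N] by fastforce
    then have "card (Y \<union> z ` set ss) = card Y + length ss"
      using Y(1) inj dist by (simp add: card_Un_disjoint card_image distinct_card)
    moreover have "card (Y \<union> z ` set ss) \<le> card {u. poly (h i) u = 0}"
      using hY hz by (intro card_mono poly_roots_finite[OF nz]) auto
    moreover have "card {u. poly (h i) u = 0} \<le> degree (h i)" by (rule card_poly_roots_bound[OF nz])
    ultimately show False using h(2)[of i] nz Y(2) by simp
  qed
  then have "ppi z ss u * dop N (Mt N e z q' ss) p u i = 0" for i
    using h(1)[OF u, of i] by simp
  moreover have "ppi z ss u \<noteq> 0"
    using good_point_not_site[OF u N] by (auto simp: ppi_0_iff)
  ultimately show ?thesis by (intro ext) simp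
qed

lemma dop_qsum:
  assumes "A = q ` {1..N}"
  shows "dop N (Mt N e z q ss) (qsum A \<theta> d C) u
    = (\<Sum>Q\<in>A. sc (power_with_arg \<theta> Q u) \<triangleright> dop N (Mt N e z (\<lambda>a. q a / Q) ss) (\<lambda>u i. \<Sum>k\<le>d. u ^ k * C Q k i) u)"
proof -
  have "qsum A \<theta> d C = (\<lambda>u. \<Sum>Q\<in>A. sc (power_with_arg \<theta> Q u) \<triangleright> (\<lambda>i. \<Sum>k\<le>d. u ^ k * C Q k i))"
    by (intro ext) (simp add: qsum_def sum_apply ap_sc)
  moreover have "dop N (Mt N e z q ss) (\<lambda>u. sc (power_with_arg \<theta> Q u) \<triangleright> (\<lambda>i. \<Sum>k\<le>d. u ^ k * C Q k i)) u
    = sc (power_with_arg \<theta> Q u) \<triangleright> dop N (Mt N e z (\<lambda>a. q a / Q) ss) (\<lambda>u i. \<Sum>k\<le>d. u ^ k * C Q k i) u"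
    if "Q \<in> A" for Q
  proof -
    have Q: "Q \<noteq> 0" "rcis (cmod Q) (\<theta> Q) = Q" using args that assms by (auto simp: has_args_def)
    have g: "power_with_arg \<theta> Q u = power_with_arg \<theta> Q (u - 1) * Q" for u
      using power_with_arg_Suc[of Q \<theta> "u - 1"] Q by simp
    have M: "Mt N e z q ss u a b = sc Q * Mt N e z (\<lambda>a. q a / Q) ss u a b" for u a b
      using Q by (simp add: Mt_def mult.assoc[symmetric] sc_mult[symmetric])
    show ?thesis
      by (rule dop_exp[where g = "power_with_arg \<theta> Q" and M = "Mt N e z q ss", OF g M])
  qed
  ultimately show ?thesis by (simp add: dop_sum del: pw)
qed

lemma qsum_unique:
  assumes "\<And>s. s \<in> set ss \<Longrightarrow> w - z s \<notin> \<int>"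
    and ker: "\<And>u. good_point N z (set ss) u \<Longrightarrow> dop N (Mt N e z q ss) (qsum (q ` {1..N}) \<theta> d C) u = 0"
    and init: "\<And>j. j \<in> {1..N} \<Longrightarrow> qsum (q ` {1..N}) \<theta> d C (w - of_nat j) = 0"
    and "Q \<in> q ` {1..N}" "k \<le> d"
  shows "C Q k i = 0"
proof (rule qsum_coeff_zero[where w = w and C = C and i = i, OF args _ assms(4,5)])
  fix j :: nat
  have "qsum (q ` {1..N}) \<theta> d C (w + of_nat j) = 0"
    by (rule forward_zero[OF ker init]) (use assms(1) in \<open>auto intro: good_point_generic\<close>)
  then show "qsum (q ` {1..N}) \<theta> d C (w + of_nat j) i = 0" by simp
qed

text \<open>The unknowns are d + 1 vectors for each base Q. The equations are the vanishing at d + 1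
  - \<open>\<mu> Q\<close> nodes for each Q, and N initial values. The multiplicities add up to N,
  so the system is square; a solution of the homogeneous system is in the kernel by
  \<open>dop_poly_zero\<close> and is zero by forward recursion from w.\<close>

theorem generic_solution:
  assumes gen: "generic_sites z (set ss)" and w: "\<And>s. s \<in> set ss \<Longrightarrow> w - z s \<notin> \<int>"
    and v: "\<And>j i. i \<notin> I \<Longrightarrow> v j i = 0"
  shows "\<exists>C. (\<forall>Q k i. i \<notin> I \<longrightarrow> C Q k i = 0) \<and>
     (\<forall>u. good_point N z (set ss) u \<longrightarrow>
        dop N (Mt N e z q ss) (qsum (q ` {1..N}) \<theta> (N + length ss) C) u = 0) \<and>
     (\<forall>j\<in>{1..N}. qsum (q ` {1..N}) \<theta> (N + length ss) C (w - of_nat j) = v j)"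
proof -
  define A where "A = q ` {1..N}"
  \<comment> \<open>Large enough for the d + 1 - \<open>\<mu> Q\<close> nodes to accommodate all the
    points z_s - 1.\<close>
  define d where "d = N + length ss"
  define \<mu> where "\<mu> = (\<lambda>Q. card {a\<in>{1..N}. q a = Q})"
  have finA: "finite A" by (simp add: A_def)
  have \<mu>: "\<mu> Q \<le> N" for Q
  proof -
    have "{a\<in>{1..N}. q a = Q} \<subseteq> {1..N}" by auto
    from card_mono[OF _ this] show ?thesis by (simp add: \<mu>_def)
  qed
  have "\<exists>Y. finite Y \<and> card Y = d + 1 - \<mu> Q \<and> (\<forall>s\<in>set ss. z s - 1 \<in> Y) \<and> (\<forall>y\<in>Y. good_point N z (set ss) y)" for Q
  proof -
    have "card ((\<lambda>s. z s - 1) ` set ss) \<le> d + 1 - \<mu> Q"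
      using card_image_le[of "set ss" "\<lambda>s. z s - 1"] card_length[of ss] \<mu>[of Q] by (simp add: d_def)
    moreover have "(\<lambda>s. z s - 1) ` set ss \<inter> {u. \<not> good_point N z (set ss) u} = {}"
      using good_point_pred_site[OF gen] by auto
    ultimately obtain Y where "finite Y" "card Y = d + 1 - \<mu> Q" "(\<lambda>s. z s - 1) ` set ss \<subseteq> Y"
      "Y \<inter> {u. \<not> good_point N z (set ss) u} = {}"
      using exists_nodes[of "(\<lambda>s. z s - 1) ` set ss" "{u. \<not> good_point N z (set ss) u}" "d + 1 - \<mu> Q"]
        not_good_points_finite[of "set ss" N z] by auto
    then show ?thesis by (intro exI[of _ Y]) auto
  qed
  then obtain Y where Y: "\<And>Q. finite (Y Q)" "\<And>Q. card (Y Q) = d + 1 - \<mu> Q"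
    "\<And>Q s. s \<in> set ss \<Longrightarrow> z s - 1 \<in> Y Q" "\<And>Q y. y \<in> Y Q \<Longrightarrow> good_point N z (set ss) y"
    by metis
  define X where "X = A \<times> {..d} \<times> I"
  define B where "B = ((SIGMA Q:A. Y Q) \<times> I) <+> ({1..N} \<times> I)"
  define coef where "coef = (\<lambda>(x :: complex \<times> nat \<times> 'i \<Rightarrow> complex) Q k i. x (Q, k, i))"
  define p where "p = (\<lambda>x Q u i. \<Sum>k\<le>d. u ^ k * coef x Q k i)"
  define L where "L = (\<lambda>x b. case b of
      Inl ((Q, y), i) \<Rightarrow> dop N (Mt N e z (\<lambda>a. q a / Q) ss) (p x Q) y i
    | Inr (j, i) \<Rightarrow> qsum A \<theta> d (coef x) (w - of_nat j) i)"
  have p_add: "p (\<lambda>a. x a + y a) Q = (\<lambda>u. p x Q u + p y Q u)" for x y Q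
    by (intro ext) (simp add: p_def coef_def distrib_left sum.distrib)
  have p_scale: "p (\<lambda>a. c * x a) Q = (\<lambda>u. sc c \<triangleright> p x Q u)" for c x Q
    by (intro ext) (simp add: p_def coef_def ap_sc sum_distrib_left mult.left_commute)
  have q_add: "qsum A \<theta> d (coef (\<lambda>a. x a + y a)) u i = qsum A \<theta> d (coef x) u i + qsum A \<theta> d (coef y) u i" for x y u i
    by (simp add: qsum_def coef_def distrib_left sum.distrib)
  have q_scale: "qsum A \<theta> d (coef (\<lambda>a. c * x a)) u i = c * qsum A \<theta> d (coef x) u i" for c x u i
    by (simp add: qsum_def coef_def sum_distrib_left mult.left_commute)
  have p_poly: "\<exists>P. degree P \<le> d \<and> (\<forall>u. p x Q u i = poly P u)" for x Q i
  proof (intro exI conjI allI)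
    show "degree (\<Sum>k\<le>d. monom (coef x Q k i) k) \<le> d"
      by (intro degree_sum_le) (auto intro: order.trans[OF degree_monom_le])
    show "p x Q u i = poly (\<Sum>k\<le>d. monom (coef x Q k i) k) u" for u
      by (simp add: p_def poly_sum poly_monom mult.commute)
  qed
  have kernel: "dop N (Mt N e z q ss) (qsum A \<theta> d (coef x)) u = 0"
    if x: "\<forall>a. a \<notin> X \<longrightarrow> x a = 0" and Lx: "\<And>Q y i. Q \<in> A \<Longrightarrow> y \<in> Y Q \<Longrightarrow> i \<in> I \<Longrightarrow> L x (Inl ((Q, y), i)) = 0"
      and u: "good_point N z (set ss) u" for x u
  proof -
    have psupp: "p x Q u i = 0" if "i \<notin> I" for Q u i
      using x that by (auto simp: p_def coef_def X_def intro!: sum.neutral)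
    have "dop N (Mt N e z (\<lambda>a. q a / Q) ss) (p x Q) u = 0" if Q: "Q \<in> A" for Q
    proof (rule dop_poly_zero[OF gen p_poly Y(1)])
      have "Q \<noteq> 0" using args Q by (auto simp: has_args_def A_def)
      then have "{a\<in>{1..N}. q a / Q = 1} = {a\<in>{1..N}. q a = Q}" by auto
      then show "card (Y Q) + card {a\<in>{1..N}. q a / Q = 1} = d + 1"
        using Y(2)[of Q] \<mu>[of Q] by (simp add: \<mu>_def d_def)
      show "dop N (Mt N e z (\<lambda>a. q a / Q) ss) (p x Q) y = 0" if "y \<in> Y Q" for y
      proof
        fix i
        show "dop N (Mt N e z (\<lambda>a. q a / Q) ss) (p x Q) y i = 0 i"
        proof (cases "i \<in> I")
          case True
          then show ?thesis using Lx[OF Q that] by (simp add: L_def)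
        next
          case False
          then show ?thesis using dop_supp[of ss N I e "p x Q" i] supp psupp by simp
        qed
      qed
    qed (use Y u in auto)
    then show ?thesis
      unfolding dop_qsum[OF A_def] by (simp add: p_def del: pw)
  qed
  have card: "card X = card B"
  proof -
    have "(\<Sum>Q\<in>A. \<mu> Q) = (\<Sum>Q\<in>A. \<Sum>a | a \<in> {1..N} \<and> q a = Q. 1)" by (simp add: \<mu>_def)
    also have "\<dots> = (\<Sum>a\<in>{1..N}. 1)" by (rule sum.group) (auto simp: A_def)
    finally have "(\<Sum>Q\<in>A. \<mu> Q) = N" by simp
    moreover have "(\<Sum>Q\<in>A. d + 1 - \<mu> Q) + (\<Sum>Q\<in>A. \<mu> Q) = (\<Sum>Q\<in>A. d + 1)"
      unfolding sum.distrib[symmetric] using \<mu> by (intro sum.cong) (simp_all add: d_def trans_le_add1 le_SucI)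
    ultimately have *: "(\<Sum>Q\<in>A. d + 1 - \<mu> Q) + N = card A * (d + 1)" by simp
    have "card B = (\<Sum>Q\<in>A. d + 1 - \<mu> Q) * card I + N * card I"
      unfolding B_def using finA finI Y(1,2)
      by (subst card_Plus) (auto simp: card_cartesian_product)
    also have "\<dots> = card A * (d + 1) * card I" unfolding *[symmetric] by (simp add: distrib_right)
    finally show ?thesis by (simp add: X_def card_cartesian_product algebra_simps)
  qed
  define y where "y = (\<lambda>b. case b of Inl ((Q :: complex, y :: complex), i :: 'i) \<Rightarrow> 0 | Inr (j, i) \<Rightarrow> v j i)"
  have "\<exists>x. (\<forall>a. a \<notin> X \<longrightarrow> x a = 0) \<and> (\<forall>b\<in>B. L x b = y b)"
  proof (rule injective_square_system)
    show "finite X" "finite B" using finA finI Y(1) by (auto simp: X_def B_def)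
    show "card X = card B" by (rule card)
    show "L (\<lambda>a. x a + x' a) b = L x b + L x' b" for x x' b
      by (auto simp: L_def p_add q_add dop_add split: sum.split)
    show "L (\<lambda>a. c * x a) b = c * L x b" for c x b
      by (auto simp: L_def p_scale q_scale dop_scale ap_sc split: sum.split)
    fix x :: "complex \<times> nat \<times> 'i \<Rightarrow> complex"
    assume x: "\<forall>a. a \<notin> X \<longrightarrow> x a = 0" and Lx: "\<forall>b\<in>B. L x b = 0"
    have init: "qsum A \<theta> d (coef x) (w - of_nat j) = 0" if j: "j \<in> {1..N}" for j
    proof
      fix i
      show "qsum A \<theta> d (coef x) (w - of_nat j) i = 0 i"
      proof (cases "i \<in> I")
        case True
        then have "Inr (j, i) \<in> B" using j by (auto simp: B_def)
        then have "L x (Inr (j, i)) = 0" using Lx by blast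
        then show ?thesis by (simp add: L_def)
      next
        case False
        then show ?thesis using x by (auto simp: qsum_def coef_def X_def intro!: sum.neutral)
      qed
    qed
    have ker: "dop N (Mt N e z q ss) (qsum A \<theta> d (coef x)) u = 0" if "good_point N z (set ss) u" for u
      by (rule kernel[OF x _ that]) (use Lx in \<open>auto simp: B_def\<close>)
    have "coef x Q k i = 0" if "Q \<in> A" "k \<le> d" for Q k i
      using qsum_unique[OF w ker[unfolded A_def] init[unfolded A_def], of Q k i] that by (simp add: A_def)
    then show "\<forall>a\<in>X. x a = 0" by (auto simp: X_def coef_def)
  qed
  then obtain x where x: "\<forall>a. a \<notin> X \<longrightarrow> x a = 0" "\<forall>b\<in>B. L x b = y b" by blast
  show ?thesis
  proof (intro exI[of _ "coef x"] conjI allI impI ballI; (fold A_def d_def)?)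
    fix Q k i assume "i \<notin> I"
    then show "coef x Q k i = 0" using x(1) by (auto simp: coef_def X_def)
  next
    fix u assume u: "good_point N z (set ss) u"
    show "dop N (Mt N e z q ss) (qsum A \<theta> d (coef x)) u = 0"
    proof (rule kernel[OF x(1) _ u])
      fix Q y' i assume "Q \<in> A" "y' \<in> Y Q" "i \<in> I"
      then have "Inl ((Q, y'), i) \<in> B" by (auto simp: B_def)
      from bspec[OF x(2) this] show "L x (Inl ((Q, y'), i)) = 0" by (simp add: y_def)
    qed
  next
    fix j assume j: "j \<in> {1..N}"
    show "qsum A \<theta> d (coef x) (w - of_nat j) = v j"
    proof
      fix i
      show "qsum A \<theta> d (coef x) (w - of_nat j) i = v j i"
      proof (cases "i \<in> I")
        case True
        then have "Inr (j, i) \<in> B" using j by (auto simp: B_def)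
        from bspec[OF x(2) this] show ?thesis by (simp add: L_def y_def)
      next
        case False
        then show ?thesis using x(1) v by (auto simp: qsum_def coef_def X_def intro!: sum.neutral)
      qed
    qed
  qed
qed

end

section \<open>Solutions for vector sites in arbitrary position\<close>

definition vconv :: "(nat \<Rightarrow> 'i \<Rightarrow> complex) \<Rightarrow> ('i \<Rightarrow> complex) \<Rightarrow> bool" where
  "vconv x y \<longleftrightarrow> (\<forall>i. (\<lambda>m. x m i) \<longlonglongrightarrow> y i)"

definition fconv :: "(nat \<Rightarrow> 'i form) \<Rightarrow> 'i form \<Rightarrow> bool" where
  "fconv F G \<longleftrightarrow> (\<forall>S. vconv (\<lambda>m. F m S) (G S))"

lemma vconv_const [simp]: "vconv (\<lambda>m. x) x" by (simp add: vconv_def)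
lemma vconv_add: "vconv x y \<Longrightarrow> vconv x' y' \<Longrightarrow> vconv (\<lambda>m. x m + x' m) (y + y')"
  unfolding vconv_def by (auto intro: tendsto_add)
lemma vconv_neg: "vconv x y \<Longrightarrow> vconv (\<lambda>m. - x m) (- y)"
  unfolding vconv_def by (auto intro: tendsto_minus)
lemma vconv_diff: "vconv x y \<Longrightarrow> vconv x' y' \<Longrightarrow> vconv (\<lambda>m. x m - x' m) (y - y')"
  unfolding vconv_def by (auto intro: tendsto_diff)
lemma vconv_sum: "(\<And>i. i \<in> S \<Longrightarrow> vconv (x i) (y i)) \<Longrightarrow> vconv (\<lambda>m. \<Sum>i\<in>S. x i m) (\<Sum>i\<in>S. y i)"
  unfolding vconv_def by (auto simp: sum_apply intro: tendsto_sum)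
lemma vconv_sc: "c \<longlonglongrightarrow> c' \<Longrightarrow> vconv x y \<Longrightarrow> vconv (\<lambda>m. sc (c m) \<triangleright> x m) (sc c' \<triangleright> y)"
  unfolding vconv_def ap_sc by (auto intro: tendsto_mult)
lemma vconv_unique: "vconv x y \<Longrightarrow> vconv x y' \<Longrightarrow> y = y'"
  unfolding vconv_def by (intro ext) (blast intro: LIMSEQ_unique)

lemma vconv_ap: "vconv x y \<Longrightarrow> vconv (\<lambda>m. A \<triangleright> x m) (A \<triangleright> y)"
  unfolding vconv_def
proof
  fix i assume x: "\<forall>i. (\<lambda>m. x m i) \<longlonglongrightarrow> y i"
  obtain S K where SK: "finite S" "\<And>x. (A \<triangleright> x) i = (\<Sum>j\<in>S. K j * x j)"
    by (rule lop_kernel[of A i]) blast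
  show "(\<lambda>m. (A \<triangleright> x m) i) \<longlonglongrightarrow> (A \<triangleright> y) i"
    unfolding SK(2) by (intro tendsto_sum tendsto_mult tendsto_const x[rule_format])
qed

context
  fixes N :: nat and e :: "'k \<Rightarrow> nat \<Rightarrow> nat \<Rightarrow> 'i lop" and zm :: "nat \<Rightarrow> 'k \<Rightarrow> complex" and z :: "'k \<Rightarrow> complex"
    and ss :: "'k list" and q :: "nat \<Rightarrow> complex"
  assumes z: "\<And>s. s \<in> set ss \<Longrightarrow> (\<lambda>m. zm m s) \<longlonglongrightarrow> z s"
begin

lemma vconv_Tt:
  assumes "vconv x y" "u \<longlonglongrightarrow> u'" "set ts \<subseteq> set ss"
  shows "vconv (\<lambda>m. Tt N e (zm m) ts (u m) a b \<triangleright> x m) (Tt N e z ts u' a b \<triangleright> y)"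
  using assms(3)
proof (induction ts arbitrary: a b)
  case Nil
  show ?case using assms(1) by (cases "a = b") simp_all
next
  case (Cons s ts)
  have L: "vconv (\<lambda>m. Lt e (zm m) s (u m) a c \<triangleright> x' m) (Lt e z s u' a c \<triangleright> y')"
    if "vconv x' y'" for x' y' c
  proof (cases "a = c")
    case True
    show ?thesis unfolding Lt_def ap_plus if_P[OF True]
      by (intro vconv_add vconv_sc vconv_ap tendsto_diff that assms(2) z) (use Cons in auto)
  next
    case False
    then show ?thesis using that by (simp add: Lt_def vconv_ap)
  qed
  show ?case unfolding Tt.simps sum_ap ap_times
    by (intro vconv_sum L Cons.IH) (use Cons.prems in auto)
qed

lemma tendsto_ppi:
  assumes "u \<longlonglongrightarrow> u'" "set ts \<subseteq> set ss"
  shows "(\<lambda>m. ppi (zm m) ts (u m)) \<longlonglongrightarrow> ppi z ts u'"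
  using assms(2)
proof (induction ts)
  case (Cons s ts)
  then show ?case using assms(1) z[of s] by (auto simp: ppi_def intro!: tendsto_mult tendsto_diff)
qed (simp add: ppi_def)

lemma fconv_psi: "fconv F G \<Longrightarrow> fconv (\<lambda>m. psi b (F m)) (psi b G)"
proof -
  assume F: "fconv F G"
  have "vconv (\<lambda>m. psi b (F m) S) (psi b G S)" for S
    using F by (cases "b \<in> S"; cases "even (card {c\<in>S. c < b})")
      (simp_all add: psi_def fermi_def fconv_def vconv_neg del: pw)
  then show ?thesis by (simp add: fconv_def)
qed

lemma fconv_Phi:
  assumes "\<And>k. k \<le> length as \<Longrightarrow> fconv (\<lambda>m. F m (u m - of_nat k)) (G (u' - of_nat k))"
    and "\<And>k. k < length as \<Longrightarrow> ppi z ss (u' - of_nat k) \<noteq> 0" "u \<longlonglongrightarrow> u'"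
  shows "fconv (\<lambda>m. Phi N (Mt N e (zm m) q ss) as (F m) (u m)) (Phi N (Mt N e z q ss) as G u')"
  using assms
proof (induction as arbitrary: u u')
  case Nil
  then show ?case using Nil(1)[of 0] by simp
next
  case (Cons a as)
  have 1: "fconv (\<lambda>m. Phi N (Mt N e (zm m) q ss) as (F m) (u m)) (Phi N (Mt N e z q ss) as G u')"
    by (rule Cons.IH) (use Cons.prems in auto)
  have 2: "fconv (\<lambda>m. Phi N (Mt N e (zm m) q ss) as (F m) (u m - 1)) (Phi N (Mt N e z q ss) as G (u' - 1))"
  proof (rule Cons.IH)
    fix k assume "k \<le> length as"
    then show "fconv (\<lambda>m. F m (u m - 1 - of_nat k)) (G (u' - 1 - of_nat k))"
      using Cons.prems(1)[of "Suc k"] by (simp add: diff_diff_eq)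
  next
    fix k assume "k < length as"
    then show "ppi z ss (u' - 1 - of_nat k) \<noteq> 0"
      using Cons.prems(2)[of "Suc k"] by (simp add: diff_diff_eq)
  next
    show "(\<lambda>m. u m - 1) \<longlonglongrightarrow> u' - 1" using Cons.prems(3) by (intro tendsto_diff tendsto_const)
  qed
  have p: "ppi z ss u' \<noteq> 0" using Cons.prems(2)[of 0] by simp
  have M: "vconv (\<lambda>m. Mt N e (zm m) q ss (u m) a b \<triangleright> x m) (Mt N e z q ss u' a b \<triangleright> y)"
    if "vconv x y" for x y b
    unfolding Mt_def ap_times
    by (intro vconv_sc vconv_Tt that Cons.prems(3) tendsto_divide tendsto_const tendsto_ppi p) auto
  show ?case unfolding fconv_def
  proof
    fix S
    have "vconv (\<lambda>m. psi b (Phi N (Mt N e (zm m) q ss) as (F m) (u m - 1)) S)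
      (psi b (Phi N (Mt N e z q ss) as G (u' - 1)) S)" for b
      using fconv_psi[OF 2, of b] by (simp add: fconv_def)
    from M[OF this] have "vconv (\<lambda>m. nu N (Mt N e (zm m) q ss (u m)) a (Phi N (Mt N e (zm m) q ss) as (F m) (u m - 1)) S)
      (nu N (Mt N e z q ss u') a (Phi N (Mt N e z q ss) as G (u' - 1)) S)"
      unfolding nu_def sum_apply[where x = S] fap_def by (intro vconv_sum)
    moreover have "vconv (\<lambda>m. psi a (Phi N (Mt N e (zm m) q ss) as (F m) (u m)) S)
      (psi a (Phi N (Mt N e z q ss) as G u') S)"
      using fconv_psi[OF 1, of a] by (simp add: fconv_def)
    ultimately show "vconv (\<lambda>m. Phi N (Mt N e (zm m) q ss) (a # as) (F m) (u m) S)
      (Phi N (Mt N e z q ss) (a # as) G u' S)"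
      unfolding Phi_Cons phi_def minus_apply[where x = S] by (rule vconv_diff[rotated])
  qed
qed

text \<open>At a good point the operator is continuous in u and in the sites simultaneously. With
  moving sites this gives the passage to arbitrary z; with constant sites it removes exceptional
  values of u.\<close>

lemma vconv_dop:
  assumes "\<And>k. k \<le> N \<Longrightarrow> vconv (\<lambda>m. f m (u m - of_nat k)) (g (u' - of_nat k))"
    and "good_point N z (set ss) u'" "u \<longlonglongrightarrow> u'"
  shows "vconv (\<lambda>m. dop N (Mt N e (zm m) q ss) (f m) (u m)) (dop N (Mt N e z q ss) g u')"
proof -
  have "fconv (\<lambda>m. Phi N (Mt N e (zm m) q ss) [1..<N+1] (\<lambda>u. vac (f m u)) (u m))
    (Phi N (Mt N e z q ss) [1..<N+1] (\<lambda>u. vac (g u)) u')"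
  proof (rule fconv_Phi[OF _ _ assms(3)])
    fix k assume "k \<le> length [1..<N+1]"
    then have "k \<le> N" by (simp del: upt_Suc)
    then have "vconv (\<lambda>m. f m (u m - of_nat k)) (g (u' - of_nat k))" by (rule assms(1))
    then show "fconv (\<lambda>m. vac (f m (u m - of_nat k))) (vac (g (u' - of_nat k)))"
      by (auto simp: fconv_def vac_def)
  next
    fix k assume "k < length [1..<N+1]"
    then have "k < N" by (simp del: upt_Suc)
    then show "ppi z ss (u' - of_nat k) \<noteq> 0"
      using assms(2) by (auto simp: ppi_0_iff good_point_def)
  qed
  then show ?thesis unfolding dop_def fconv_def by blast
qed

end

lemma real_bounded_subseq:
  fixes a :: "nat \<Rightarrow> real"
  assumes "\<And>m. \<bar>a m\<bar> \<le> 1"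
  obtains r where "strict_mono r" "convergent (a \<circ> r)"
proof -
  obtain r where r: "strict_mono r" "monoseq (\<lambda>n. a (r n))" using seq_monosub[of a] by blast
  have "Bseq (\<lambda>n. a (r n))" by (rule BseqI'[of _ 1]) (use assms in auto)
  then have "convergent (\<lambda>n. a (r n))" using r(2) by (rule Bseq_monoseq_convergent)
  then show thesis using that r(1) by (simp add: o_def)
qed

lemma complex_bounded_subseq:
  fixes a :: "nat \<Rightarrow> complex"
  assumes "\<And>m. cmod (a m) \<le> 1"
  obtains r where "strict_mono r" "convergent (a \<circ> r)"
proof -
  obtain r where r: "strict_mono r" "convergent ((\<lambda>m. Re (a m)) \<circ> r)"
    by (rule real_bounded_subseq[of "\<lambda>m. Re (a m)"]) (use assms abs_Re_le_cmod order_trans in blast)+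
  obtain r' where r': "strict_mono r'" "convergent ((\<lambda>m. Im (a (r m))) \<circ> r')"
    by (rule real_bounded_subseq[of "\<lambda>m. Im (a (r m))"]) (use assms abs_Im_le_cmod order_trans in blast)+
  obtain x y where x: "(\<lambda>m. Re (a (r m))) \<longlonglongrightarrow> x" and y: "(\<lambda>m. Im (a (r (r' m)))) \<longlonglongrightarrow> y"
    using r(2) r'(2) by (auto simp: convergent_def o_def)
  have "(\<lambda>m. Re (a (r (r' m)))) \<longlonglongrightarrow> x"
    using LIMSEQ_subseq_LIMSEQ[OF x r'(1)] by (simp add: o_def)
  then have "(\<lambda>m. Complex (Re (a (r (r' m)))) (Im (a (r (r' m))))) \<longlonglongrightarrow> Complex x y"
    using y by (rule tendsto_Complex)
  then have "convergent (a \<circ> (r \<circ> r'))" by (auto simp: convergent_def o_def)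
  moreover have "strict_mono (r \<circ> r')" using r(1) r'(1) by (rule strict_mono_o)
  ultimately show thesis using that by blast
qed

lemma bounded_family_subseq:
  fixes y :: "nat \<Rightarrow> 'x \<Rightarrow> complex"
  assumes "finite X" "\<And>m x. x \<in> X \<Longrightarrow> cmod (y m x) \<le> 1"
  shows "\<exists>r. strict_mono r \<and> (\<forall>x\<in>X. convergent (\<lambda>m. y (r m) x))"
  using assms
proof (induction X rule: finite_induct)
  case empty
  show ?case by (intro exI[of _ id]) (simp add: strict_mono_def)
next
  case (insert x X)
  then obtain r where r: "strict_mono r" "\<forall>x\<in>X. convergent (\<lambda>m. y (r m) x)" by auto
  obtain r' where r': "strict_mono r'" "convergent ((\<lambda>m. y (r m) x) \<circ> r')"
    by (rule complex_bounded_subseq[of "\<lambda>m. y (r m) x"]) (use insert.prems in blast)+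
  have "convergent (\<lambda>m. y (r (r' m)) x')" if "x' \<in> X" for x'
    using convergent_subseq_convergent[OF r(2)[rule_format, OF that] r'(1)] by (simp add: o_def)
  moreover have "strict_mono (r \<circ> r')" using r(1) r'(1) by (rule strict_mono_o)
  ultimately show ?case using r'(2) by (intro exI[of _ "r \<circ> r'"]) (auto simp: o_def)
qed

text \<open>For 0 < t < 1 the integers that can occur are bounded by |c| + |d|, and each of them
  determines t because d is non-zero.\<close>

lemma shifted_Ints_finite:
  fixes c d :: complex
  assumes "d \<noteq> 0"
  shows "finite {t :: real. 0 < t \<and> t < 1 \<and> c + of_real t * d \<in> \<int>}"
proof -
  define M where "M = cmod c + cmod d"
  have "{t :: real. 0 < t \<and> t < 1 \<and> c + of_real t * d \<in> \<int>}
    \<subseteq> (\<lambda>k. Re ((of_int k - c) / d)) ` {k :: int. \<bar>real_of_int k\<bar> \<le> M}"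
  proof
    fix t :: real assume t: "t \<in> {t :: real. 0 < t \<and> t < 1 \<and> c + of_real t * d \<in> \<int>}"
    then obtain k where k: "c + of_real t * d = of_int k" by (auto elim: Ints_cases)
    have "cmod (of_int k) \<le> cmod c + cmod (of_real t * d)" unfolding k[symmetric] by (rule norm_triangle_ineq)
    also have "cmod (of_real t * d) \<le> cmod d" using t by (simp add: norm_mult mult_left_le_one_le)
    finally have "\<bar>real_of_int k\<bar> \<le> M" by (simp add: M_def)
    moreover have "(of_int k - c) / d = of_real t" using assms unfolding k[symmetric] by simp
    then have "t = Re ((of_int k - c) / d)" by simp
    ultimately show "t \<in> (\<lambda>k. Re ((of_int k - c) / d)) ` {k :: int. \<bar>real_of_int k\<bar> \<le> M}" by blast
  qed
  moreover have "{k :: int. \<bar>real_of_int k\<bar> \<le> M} \<subseteq> {- \<lfloor>M\<rfloor>..\<lfloor>M\<rfloor>}"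
  proof
    fix k assume "k \<in> {k :: int. \<bar>real_of_int k\<bar> \<le> M}"
    then have "k \<le> \<lfloor>M\<rfloor>" "- k \<le> \<lfloor>M\<rfloor>" by (simp_all add: le_floor_iff)
    then show "k \<in> {- \<lfloor>M\<rfloor>..\<lfloor>M\<rfloor>}" by simp
  qed
  then have "finite {k :: int. \<bar>real_of_int k\<bar> \<le> M}" by (rule finite_subset) simp
  ultimately show ?thesis using finite_subset by blast
qed

theorem vector_solution:
  fixes N :: nat and e :: "'k \<Rightarrow> nat \<Rightarrow> nat \<Rightarrow> 'i lop" and ss :: "'k list" and I :: "'i set"
    and q :: "nat \<Rightarrow> complex" and \<theta> :: "complex \<Rightarrow> real"
  assumes N: "1 \<le> N" and sites: "gl_sites N e (set ss)" and dist: "distinct ss"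
    and units: "\<And>s. s \<in> set ss \<Longrightarrow> matrix_units N (e s)"
    and finI: "finite I"
    and supp: "\<And>s a b. s \<in> set ss \<Longrightarrow> a \<in> {1..N} \<Longrightarrow> b \<in> {1..N} \<Longrightarrow> op_supp I (e s a b)"
    and args: "has_args (q ` {1..N}) \<theta>"
    and w: "\<And>s. s \<in> set ss \<Longrightarrow> w - z s \<notin> \<int>"
    and v: "\<And>j i. i \<notin> I \<Longrightarrow> v j i = 0"
  shows "\<exists>C d. (\<forall>Q k i. i \<notin> I \<longrightarrow> C Q k i = 0) \<and>
     (\<forall>u. good_point N z (set ss) u \<longrightarrow> dop N (Mt N e z q ss) (qsum (q ` {1..N}) \<theta> d C) u = 0) \<and>
     (\<forall>j\<in>{1..N}. qsum (q ` {1..N}) \<theta> d C (w - of_nat j) = v j)"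
proof -
  define A where "A = q ` {1..N}"
  define d where "d = N + length ss"
  have finA: "finite A" by (simp add: A_def)
  obtain idx :: "'k \<Rightarrow> nat" where idx: "inj_on idx (set ss)" "\<And>s. idx s > 0"
  proof -
    obtain f :: "'k \<Rightarrow> nat" and n where "inj_on f (set ss)"
      using finite_imp_inj_to_nat_seg[of "set ss"] by auto
    then show thesis using that[of "\<lambda>s. Suc (f s)"] by (auto simp: inj_on_def)
  qed
  \<comment> \<open>The site z_s is moved at the speed \<open>idx s\<close>. The speeds are distinct
    and positive, so every z_s - z_t and every w - z_s really moves, and genericity fails at
    finitely many times only.\<close>
  define bad where "bad = (\<Union>(s, t)\<in>{(s, t)\<in>set ss \<times> set ss. s \<noteq> t}.
      {\<tau> :: real. 0 < \<tau> \<and> \<tau> < 1 \<and> (z s - z t) + of_real \<tau> * (of_nat (idx s) - of_nat (idx t)) \<in> \<int>})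
    \<union> (\<Union>s\<in>set ss. {\<tau> :: real. 0 < \<tau> \<and> \<tau> < 1 \<and> (w - z s) + of_real \<tau> * (- of_nat (idx s)) \<in> \<int>})"
  have "finite bad"
  proof -
    have "finite {\<tau> :: real. 0 < \<tau> \<and> \<tau> < 1 \<and> (z s - z t) + of_real \<tau> * (of_nat (idx s) - of_nat (idx t)) \<in> \<int>}"
      if "s \<in> set ss" "t \<in> set ss" "s \<noteq> t" for s t
      by (rule shifted_Ints_finite) (use idx(1) that in \<open>auto simp: inj_on_def\<close>)
    moreover have "finite {\<tau> :: real. 0 < \<tau> \<and> \<tau> < 1 \<and> (w - z s) + of_real \<tau> * (- of_nat (idx s)) \<in> \<int>}" for s
      by (rule shifted_Ints_finite) (use idx(2)[of s] in simp)
    moreover have "finite {(s, t)\<in>set ss \<times> set ss. s \<noteq> t}"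
      by (rule finite_subset[of _ "set ss \<times> set ss"]) auto
    ultimately show ?thesis unfolding bad_def by (intro finite_UnI finite_UN_I) auto
  qed
  have "\<exists>\<tau>. 0 < \<tau> \<and> \<tau> < inverse (real (Suc m)) \<and> \<tau> \<notin> bad" for m
  proof -
    have "infinite ({0<..<inverse (real (Suc m))} - bad)"
      using \<open>finite bad\<close> by (intro Diff_infinite_finite infinite_Ioo) auto
    then obtain \<tau> where "\<tau> \<in> {0<..<inverse (real (Suc m))} - bad" using infinite_imp_nonempty by blast
    then show ?thesis by auto
  qed
  then obtain \<tau> where \<tau>: "\<And>m. 0 < \<tau> m" "\<And>m. \<tau> m < inverse (real (Suc m))" "\<And>m. \<tau> m \<notin> bad" by metis
  have \<tau>1: "\<tau> m < 1" for m
    using \<tau>(2)[of m] by (rule less_le_trans) (simp add: field_simps)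
  have \<tau>0: "\<tau> \<longlonglongrightarrow> 0"
    by (rule tendsto_sandwich[of "\<lambda>_. 0" _ _ "\<lambda>m. inverse (real (Suc m))"])
      (use \<tau> LIMSEQ_inverse_real_of_nat in \<open>auto intro!: always_eventually less_imp_le\<close>)
  define zm where "zm = (\<lambda>m s. z s + of_real (\<tau> m) * of_nat (idx s))"
  have zm: "(\<lambda>m. zm m s) \<longlonglongrightarrow> z s" for s
    using tendsto_add[OF tendsto_const[of "z s"] tendsto_mult[OF tendsto_of_real[OF \<tau>0, where 'a = complex] tendsto_const[of "of_nat (idx s)"]]]
    by (simp add: zm_def)
  have gen: "generic_sites (zm m) (set ss)" for m
    unfolding generic_sites_def
  proof (intro ballI impI notI)
    fix s t assume st: "s \<in> set ss" "t \<in> set ss" "s \<noteq> t" "zm m s - zm m t \<in> \<int>"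
    then have "(z s - z t) + of_real (\<tau> m) * (of_nat (idx s) - of_nat (idx t)) \<in> \<int>"
      by (simp add: zm_def algebra_simps)
    then show False using \<tau>(1,3)[of m] \<tau>1[of m] st unfolding bad_def by auto
  qed
  have wm: "w - zm m s \<notin> \<int>" if "s \<in> set ss" for m s
  proof
    assume "w - zm m s \<in> \<int>"
    then have "(w - z s) + of_real (\<tau> m) * (- of_nat (idx s)) \<in> \<int>"
      by (simp add: zm_def algebra_simps)
    then show False using \<tau>(1,3)[of m] \<tau>1[of m] that unfolding bad_def by auto
  qed
  have "\<exists>C. (\<forall>Q k i. i \<notin> I \<longrightarrow> C Q k i = 0) \<and>
     (\<forall>u. good_point N (zm m) (set ss) u \<longrightarrow> dop N (Mt N e (zm m) q ss) (qsum A \<theta> d C) u = 0) \<and>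
     (\<forall>j\<in>{1..N}. qsum A \<theta> d C (w - of_nat j) = v j)" for m
    unfolding A_def d_def
    by (rule generic_solution[OF N sites dist units finI supp args gen wm v])
  then obtain Cm where Cm: "\<And>m Q k i. i \<notin> I \<Longrightarrow> Cm m Q k i = 0"
     "\<And>m u. good_point N (zm m) (set ss) u \<Longrightarrow> dop N (Mt N e (zm m) q ss) (qsum A \<theta> d (Cm m)) u = 0"
     "\<And>m j. j \<in> {1..N} \<Longrightarrow> qsum A \<theta> d (Cm m) (w - of_nat j) = v j"
    by metis
  define X where "X = A \<times> {..d} \<times> I"
  have finX: "finite X" using finA finI by (simp add: X_def)
  define cm where "cm = (\<lambda>m. \<Sum>(Q, k, i)\<in>X. cmod (Cm m Q k i))"
  have cm: "cm m \<ge> 0" for m unfolding cm_def by (intro sum_nonneg) auto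
  \<comment> \<open>Normalization: the scale and the absolute values of the scaled coefficients add
    up to 1. Hence a subsequence converges, and its limit is not zero. The entry \<open>None\<close>
    of \<open>y\<close> remembers the scale by which the initial values have been
    multiplied.\<close>
  define sm where "sm = (\<lambda>m. 1 / (1 + cm m))"
  have sm: "sm m > 0" "sm m * (1 + cm m) = 1" for m
    using cm[of m] by (auto simp: sm_def)
  define y where "y = (\<lambda>m x. case x of None \<Rightarrow> complex_of_real (sm m)
     | Some (Q, k, i) \<Rightarrow> complex_of_real (sm m) * Cm m Q k i)"
  have total: "(\<Sum>x\<in>insert None (Some ` X). cmod (y m x)) = 1" for m
  proof -
    have "(\<Sum>x\<in>insert None (Some ` X). cmod (y m x)) = sm m + (\<Sum>x\<in>X. cmod (y m (Some x)))"
      using finX sm(1)[of m] by (subst sum.insert) (auto simp: y_def sum.reindex)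
    also have "(\<Sum>x\<in>X. cmod (y m (Some x))) = sm m * cm m"
      unfolding cm_def sum_distrib_left using sm(1)[of m]
      by (intro sum.cong) (auto simp: y_def norm_mult)
    finally show ?thesis using sm(2)[of m] by (simp add: distrib_left)
  qed
  have "cmod (y m x) \<le> 1" if "x \<in> insert None (Some ` X)" for m x
    unfolding total[of m, symmetric] using finX that by (intro member_le_sum) auto
  then obtain r where r: "strict_mono r" "\<forall>x\<in>insert None (Some ` X). convergent (\<lambda>m. y (r m) x)"
    using bounded_family_subseq[of "insert None (Some ` X)" y] finX by auto
  define l where "l = (\<lambda>x. lim (\<lambda>m. y (r m) x))"
  have l: "(\<lambda>m. y (r m) x) \<longlonglongrightarrow> l x" if "x \<in> insert None (Some ` X)" for x
    using r(2) that unfolding l_def convergent_LIMSEQ_iff by blast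
  have l_total: "(\<Sum>x\<in>insert None (Some ` X). cmod (l x)) = 1"
  proof (rule LIMSEQ_unique)
    show "(\<lambda>m. \<Sum>x\<in>insert None (Some ` X). cmod (y (r m) x)) \<longlonglongrightarrow> (\<Sum>x\<in>insert None (Some ` X). cmod (l x))"
      by (intro tendsto_sum tendsto_norm l)
    show "(\<lambda>m. \<Sum>x\<in>insert None (Some ` X). cmod (y (r m) x)) \<longlonglongrightarrow> 1"
      unfolding total by simp
  qed
  define C where "C = (\<lambda>Q k i. if (Q, k, i) \<in> X then l (Some (Q, k, i)) else 0)"
  define D where "D = (\<lambda>m Q k i. complex_of_real (sm m) * Cm m Q k i)"
  have qD: "qsum A \<theta> d (D m) u = sc (complex_of_real (sm m)) \<triangleright> qsum A \<theta> d (Cm m) u" for m u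
    by (intro ext) (simp add: qsum_def D_def ap_sc sum_distrib_left mult.left_commute)
  have conv: "vconv (\<lambda>m. qsum A \<theta> d (D (r m)) u) (qsum A \<theta> d C u)" for u
    unfolding vconv_def
  proof
    fix i
    show "(\<lambda>m. qsum A \<theta> d (D (r m)) u i) \<longlonglongrightarrow> qsum A \<theta> d C u i"
    proof (cases "i \<in> I")
      case True
      have "(\<lambda>m. D (r m) Q k i) \<longlonglongrightarrow> C Q k i" if "Q \<in> A" "k \<le> d" for Q k
        using l[of "Some (Q, k, i)"] that True by (simp add: C_def D_def X_def y_def)
      then show ?thesis unfolding qsum_def
        by (intro tendsto_sum tendsto_mult tendsto_const) auto
    next
      case False
      then show ?thesis using Cm(1) by (simp add: qsum_def D_def C_def X_def)
    qed
  qed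
  have zr: "(\<lambda>m. zm (r m) s) \<longlonglongrightarrow> z s" for s
    using LIMSEQ_subseq_LIMSEQ[OF zm r(1)] by (simp add: o_def)
  have ker: "dop N (Mt N e z q ss) (qsum A \<theta> d C) u = 0" if u: "good_point N z (set ss) u" for u
  proof (rule vconv_unique)
    show "vconv (\<lambda>m. dop N (Mt N e (zm (r m)) q ss) (qsum A \<theta> d (D (r m))) u) (dop N (Mt N e z q ss) (qsum A \<theta> d C) u)"
      by (rule vconv_dop[OF zr conv u tendsto_const])
    have "\<forall>\<^sub>F m in sequentially. good_point N (zm (r m)) (set ss) u"
      unfolding good_point_def
    proof (intro eventually_ball_finite ballI finite_set)
      fix s assume s: "s \<in> set ss"
      have "\<forall>\<^sub>F m in sequentially. \<forall>k\<in>{..<N}. u - of_nat k \<noteq> zm (r m) s"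
      proof (intro eventually_ball_finite ballI)
        fix k assume "k \<in> {..<N}"
        then have "z s \<noteq> u - of_nat k" using u s unfolding good_point_def by (metis lessThan_iff)
        from tendsto_imp_eventually_ne[OF zr this]
        show "\<forall>\<^sub>F m in sequentially. u - of_nat k \<noteq> zm (r m) s"
          by (rule eventually_mono) auto
      qed simp
      then show "\<forall>\<^sub>F m in sequentially. \<forall>k<N. u - of_nat k \<noteq> zm (r m) s"
        by (rule eventually_mono) auto
    qed
    then have "\<forall>\<^sub>F m in sequentially. dop N (Mt N e (zm (r m)) q ss) (qsum A \<theta> d (D (r m))) u = 0"
    proof (rule eventually_mono)
      fix m assume g: "good_point N (zm (r m)) (set ss) u"
      have "qsum A \<theta> d (D (r m)) = (\<lambda>u. sc (complex_of_real (sm (r m))) \<triangleright> qsum A \<theta> d (Cm (r m)) u)"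
        by (rule ext) (rule qD)
      then show "dop N (Mt N e (zm (r m)) q ss) (qsum A \<theta> d (D (r m))) u = 0"
        using Cm(2)[OF g] by (simp add: dop_scale del: pw)
    qed
    then show "vconv (\<lambda>m. dop N (Mt N e (zm (r m)) q ss) (qsum A \<theta> d (D (r m))) u) 0"
      unfolding vconv_def by (auto intro!: tendsto_eventually elim: eventually_mono)
  qed
  have init: "qsum A \<theta> d C (w - of_nat j) = sc (l None) \<triangleright> v j" if j: "j \<in> {1..N}" for j
  proof (rule vconv_unique[OF conv])
    have "(\<lambda>m. complex_of_real (sm (r m))) \<longlonglongrightarrow> l None"
      using l[of None] by (simp add: y_def)
    then show "vconv (\<lambda>m. qsum A \<theta> d (D (r m)) (w - of_nat j)) (sc (l None) \<triangleright> v j)"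
      unfolding qD Cm(3)[OF j] by (intro vconv_sc vconv_const)
  qed
  \<comment> \<open>If the scale tended to 0, the limit would be a solution with zero initial
    values. Uniqueness needs only w off the lattices and no genericity of z, so the limit would be
    zero, against the normalization.\<close>
  have nz: "l None \<noteq> 0"
  proof
    assume 0: "l None = 0"
    have C0: "C Q k i = 0" if "Q \<in> A" "k \<le> d" for Q k i
    proof (rule qsum_unique[where C = C and d = d and w = w and z = z and q = q and \<theta> = \<theta>, OF N sites dist units finI supp args w])
      show "dop N (Mt N e z q ss) (qsum (q ` {1..N}) \<theta> d C) u = 0" if "good_point N z (set ss) u" for u
        using ker[OF that] by (simp add: A_def)
      show "qsum (q ` {1..N}) \<theta> d C (w - of_nat j) = 0" if "j \<in> {1..N}" for j
        using init[OF that] 0 by (simp add: A_def del: pw)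
    qed (use that in \<open>auto simp: A_def\<close>)
    have "l (Some x) = 0" if x: "x \<in> X" for x
    proof -
      obtain Q k i where Qki: "x = (Q, k, i)" by (cases x)
      have "C Q k i = 0" by (rule C0) (use x Qki in \<open>auto simp: X_def\<close>)
      then show ?thesis using x Qki by (simp add: C_def)
    qed
    then have "(\<Sum>x\<in>insert None (Some ` X). cmod (l x)) = 0" using 0 by (intro sum.neutral) auto
    then show False using l_total by simp
  qed
  define C' where "C' = (\<lambda>Q k i. 1 / l None * C Q k i)"
  have qC': "qsum A \<theta> d C' = (\<lambda>u. sc (1 / l None) \<triangleright> qsum A \<theta> d C u)"
    by (intro ext) (simp only: qsum_def C'_def ap_sc sum_distrib_left mult.left_commute)
  have "C' Q k i = 0" if "i \<notin> I" for Q k i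
    using that by (simp add: C'_def C_def X_def)
  moreover have "dop N (Mt N e z q ss) (qsum A \<theta> d C') u = 0" if "good_point N z (set ss) u" for u
    unfolding qC' dop_scale ker[OF that] by simp
  moreover have "qsum A \<theta> d C' (w - of_nat j) = v j" if "j \<in> {1..N}" for j
    unfolding qC' init[OF that] ap_sc_sc using nz by simp
  ultimately show ?thesis unfolding A_def by blast
qed

section \<open>Tensor powers of the vector representation\<close>

text \<open>The matrix unit E_ab in position \<open>j\<close> of a tensor power of the vector
  representation. Coordinates are indexed by words of all lengths at once; the k-th power consists
  of the functions supported on \<open>words N k\<close>.\<close>

lift_definition letter :: "nat \<Rightarrow> nat \<Rightarrow> nat \<Rightarrow> nat list lop" is
  "\<lambda>j a b x ws. if j < length ws \<and> ws ! j = a then x (ws[j := b]) else 0"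
proof (rule row_finiteI)
  fix j a b :: nat and ws :: "nat list"
  show "\<exists>S K. finite S \<and> (\<forall>x :: nat list \<Rightarrow> complex. (if j < length ws \<and> ws ! j = a then x (ws[j := b]) else 0)
    = (\<Sum>w\<in>S. K w * x w))"
  proof (cases "j < length ws \<and> ws ! j = a")
    case True
    have "finite {ws[j := b]} \<and> (\<forall>x :: nat list \<Rightarrow> complex. (if j < length ws \<and> ws ! j = a then x (ws[j := b]) else 0)
      = (\<Sum>w\<in>{ws[j := b]}. 1 * x w))" using True by simp
    then show ?thesis by (intro exI)
  next
    case False
    have "finite {} \<and> (\<forall>x :: nat list \<Rightarrow> complex. (if j < length ws \<and> ws ! j = a then x (ws[j := b]) else 0)
      = (\<Sum>w\<in>{}. 0 * x w))" using False by auto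
    then show ?thesis by (intro exI)
  qed
qed

lemma letter_ap: "(letter j a b \<triangleright> x) ws = (if j < length ws \<and> ws ! j = a then x (ws[j := b]) else 0)"
  by transfer simp

lemma letter_units: "letter j a b * letter j c d = (if b = c then letter j a d else 0)"
  by (rule lop_eqI, rule ext) (auto simp: ap_times letter_ap)

lemma letter_comm: "i \<noteq> j \<Longrightarrow> letter i a b * letter j c d = letter j c d * letter i a b"
  by (rule lop_eqI, rule ext) (auto simp: ap_times letter_ap list_update_swap)

definition gl_total :: "nat \<Rightarrow> nat \<Rightarrow> nat \<Rightarrow> nat list lop" where
  "gl_total k a b = (\<Sum>j<k. letter j a b)"

text \<open>Summed over a and b, E_ab in position j times E_ba in position t is the flip of the two
  positions on words over \<open>{1..N}\<close>. Thus this is the Jucys-Murphy element, the sum of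
  the transpositions of t with all earlier positions.\<close>

definition murphy :: "nat \<Rightarrow> nat \<Rightarrow> nat list lop" where
  "murphy N t = (\<Sum>a=1..N. \<Sum>b=1..N. gl_total t a b * letter t b a)"

lemma gl_total_Suc: "gl_total (Suc k) a b = gl_total k a b + letter k a b"
  by (simp add: gl_total_def)

lemma gl_total_letter_comm: "k \<le> j \<Longrightarrow> gl_total k a b * letter j c d = letter j c d * gl_total k a b"
  unfolding gl_total_def sum_distrib_left sum_distrib_right
  by (intro sum.cong refl letter_comm) auto

lemma gl_total_rel: "gl_total k a b * gl_total k c d
  = gl_total k c d * gl_total k a b + (if b = c then gl_total k a d else 0) - (if a = d then gl_total k c b else 0)"
proof (induction k)
  case (Suc k)
  have 1: "gl_total k a b * letter k c d = letter k c d * gl_total k a b" "letter k a b * gl_total k c d = gl_total k c d * letter k a b"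
    by (simp_all add: gl_total_letter_comm)
  have 2: "letter k a b * letter k c d = letter k c d * letter k a b
    + (if b = c then letter k a d else 0) - (if a = d then letter k c b else 0)"
    by (auto simp: letter_units)
  show ?case unfolding gl_total_Suc distrib_left distrib_right Suc 1 2 by simp
qed (simp add: gl_total_def)

lemma murphy_later: "t < j \<Longrightarrow> murphy N t * letter j c d = letter j c d * murphy N t"
proof -
  assume t: "t < j"
  have "gl_total t a b * letter t b a * letter j c d = letter j c d * (gl_total t a b * letter t b a)" for a b
    using gl_total_letter_comm[of t j a b c d] letter_comm[of t j b a c d] t by (metis less_imp_le mult.assoc nat_neq_iff)
  then show ?thesis by (simp add: murphy_def sum_distrib_left sum_distrib_right)
qed

text \<open>Flips commute with the diagonal action: the commutator terms produced by the first
  \<open>t\<close> positions are the negatives of those produced by position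
  \<open>t\<close>.\<close>

lemma murphy_total:
  assumes "a \<in> {1..N}" "b \<in> {1..N}"
  shows "murphy N t * gl_total (Suc t) a b = gl_total (Suc t) a b * murphy N t"
proof -
  have summand: "gl_total (Suc t) a b * (gl_total t c d * letter t d c) = (gl_total t c d * letter t d c) * gl_total (Suc t) a b
    + ((if c = b then gl_total t a d * letter t d b else 0) - (if d = a then gl_total t c b * letter t a c else 0))
    + ((if d = b then gl_total t c b * letter t a c else 0) - (if c = a then gl_total t a d * letter t d b else 0))" for c d
  proof -
    have 1: "gl_total t a b * gl_total t c d = gl_total t c d * gl_total t a b + (if b = c then gl_total t a d else 0) - (if a = d then gl_total t c b else 0)"
      by (rule gl_total_rel)
    have 2: "letter t a b * letter t d c = letter t d c * letter t a b
      + (if b = d then letter t a c else 0) - (if a = c then letter t d b else 0)"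
      by (auto simp: letter_units)
    have "gl_total (Suc t) a b * (gl_total t c d * letter t d c)
      = (gl_total t a b * gl_total t c d) * letter t d c + gl_total t c d * (letter t a b * letter t d c)"
      using gl_total_letter_comm[of t t c d a b] by (simp add: gl_total_Suc distrib_right mult.assoc[symmetric])
    also have "\<dots> = (gl_total t c d * gl_total t a b) * letter t d c + gl_total t c d * (letter t d c * letter t a b)
      + ((if c = b then gl_total t a d * letter t d b else 0) - (if d = a then gl_total t c b * letter t a c else 0))
      + ((if d = b then gl_total t c b * letter t a c else 0) - (if c = a then gl_total t a d * letter t d b else 0))"
      unfolding 1 2 by (auto simp: distrib_left distrib_right right_diff_distrib left_diff_distrib)
    also have "(gl_total t c d * gl_total t a b) * letter t d c = (gl_total t c d * letter t d c) * gl_total t a b"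
      using gl_total_letter_comm[of t t a b d c] by (simp add: mult.assoc)
    finally show ?thesis by (simp add: gl_total_Suc distrib_left mult.assoc)
  qed
  have "gl_total (Suc t) a b * murphy N t = (\<Sum>c=1..N. \<Sum>d=1..N. (gl_total t c d * letter t d c) * gl_total (Suc t) a b
    + ((if c = b then gl_total t a d * letter t d b else 0) - (if d = a then gl_total t c b * letter t a c else 0))
    + ((if d = b then gl_total t c b * letter t a c else 0) - (if c = a then gl_total t a d * letter t d b else 0)))"
    unfolding murphy_def sum_distrib_left by (intro sum.cong refl summand)
  also have "\<dots> = murphy N t * gl_total (Suc t) a b
    + ((\<Sum>d=1..N. gl_total t a d * letter t d b) - (\<Sum>c=1..N. gl_total t c b * letter t a c))
    + ((\<Sum>c=1..N. gl_total t c b * letter t a c) - (\<Sum>d=1..N. gl_total t a d * letter t d b))"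
  proof -
    have "(\<Sum>c=1..N. \<Sum>d=1..N. if c = x then f d else 0) = (\<Sum>d=1..N. f d)" if "x \<in> {1..N}" for x and f :: "nat \<Rightarrow> nat list lop"
      by (subst sum.swap) (use that in simp)
    then show ?thesis using assms
      by (simp add: sum.distrib sum_subtractf murphy_def sum_distrib_right)
  qed
  finally show ?thesis by simp
qed

lemma murphy_total_le:
  assumes "t < k" "a \<in> {1..N}" "b \<in> {1..N}"
  shows "murphy N t * gl_total k a b = gl_total k a b * murphy N t"
proof -
  have "murphy N t * gl_total (Suc t + m) a b = gl_total (Suc t + m) a b * murphy N t" for m
  proof (induction m)
    case 0
    then show ?case using murphy_total[OF assms(2,3)] by simp
  next
    case (Suc m)
    then show ?case using murphy_later[of t "Suc t + m" N a b]
      by (simp add: gl_total_Suc distrib_left distrib_right)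
  qed
  from this[of "k - Suc t"] show ?thesis using assms(1) by simp
qed

text \<open>
  On common eigenvectors of the Jucys--Murphy operators the product of the \<open>L\<close>-operators with
  parameters shifted by the eigenvalues fuses into a single \<open>L\<close>-operator.
\<close>

lemma Tt_fusion:
  assumes "\<And>t. t < k \<Longrightarrow> murphy N t \<triangleright> x = sc (c t) \<triangleright> x"
    and "\<And>t. t < k \<Longrightarrow> z t = \<zeta> - c t" "a \<in> {1..N}" "b \<in> {1..N}"
  shows "sc (u - \<zeta>) \<triangleright> Tt N letter z [0..<k] u a b \<triangleright> x
    = sc (ppi z [0..<k] u) \<triangleright> ((if a = b then sc (u - \<zeta>) \<triangleright> x else 0) + gl_total k b a \<triangleright> x)"
  using assms
proof (induction k arbitrary: x b)
  case 0
  then show ?case by (simp add: ppi_def gl_total_def del: pw)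
next
  case (Suc k)
  let ?v = "u - z k"
  have L: "Tt N letter z [k] u h b = Lt letter z k u h b" if "h \<in> {1..N}" for h
    using Suc.prems(4) by (simp add: if_distrib cong: if_cong)
  have IH: "sc (u - \<zeta>) \<triangleright> Tt N letter z [0..<k] u a h \<triangleright> Lt letter z k u h b \<triangleright> x
    = sc (ppi z [0..<k] u) \<triangleright> ((if a = h then sc (u - \<zeta>) \<triangleright> Lt letter z k u h b \<triangleright> x else 0)
        + gl_total k h a \<triangleright> Lt letter z k u h b \<triangleright> x)" if h: "h \<in> {1..N}" for h
  proof (rule Suc.IH)
    fix t assume t: "t < k"
    have "murphy N t * Lt letter z k u h b = Lt letter z k u h b * murphy N t"
      by (rule Lt_comm) (rule murphy_later[OF t])
    then have "murphy N t \<triangleright> Lt letter z k u h b \<triangleright> x = Lt letter z k u h b \<triangleright> murphy N t \<triangleright> x"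
      by (metis ap_times)
    then show "murphy N t \<triangleright> Lt letter z k u h b \<triangleright> x = sc (c t) \<triangleright> Lt letter z k u h b \<triangleright> x"
      using Suc.prems(1)[of t] t by (simp add: ap_sc_comm)
  qed (use Suc.prems h in auto)
  \<comment> \<open>The cross terms between the first k letters and the new one add up to the
    Jucys-Murphy operator, which acts on x by \<open>c k\<close>. The shift
    \<open>z k = \<zeta> - c k\<close> is chosen so that u - \<zeta> + c k becomes u - z k.\<close>
  have Om: "(\<Sum>c=1..N. gl_total k c a * letter k b c) = letter k b a * murphy N k"
  proof -
    have "letter k b a * murphy N k = (\<Sum>c=1..N. \<Sum>d=1..N. if d = a then gl_total k c a * letter k b c else 0)"
      unfolding murphy_def sum_distrib_left
    proof (intro sum.cong refl)
      fix c d
      have "letter k b a * (gl_total k c d * letter k d c) = gl_total k c d * (letter k b a * letter k d c)"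
        using gl_total_letter_comm[of k k c d b a] by (simp add: mult.assoc[symmetric])
      then show "letter k b a * (gl_total k c d * letter k d c) = (if d = a then gl_total k c a * letter k b c else 0)"
        by (auto simp: letter_units)
    qed
    then show ?thesis using Suc.prems(3) by simp
  qed
  have tot: "(\<Sum>c=1..N. gl_total k c a \<triangleright> Lt letter z k u c b \<triangleright> x)
    = sc ?v \<triangleright> gl_total k b a \<triangleright> x + sc (c k) \<triangleright> letter k b a \<triangleright> x"
  proof -
    have "(\<Sum>c=1..N. gl_total k c a \<triangleright> Lt letter z k u c b \<triangleright> x)
      = (\<Sum>c=1..N. (if c = b then sc ?v \<triangleright> gl_total k b a \<triangleright> x else 0) + (gl_total k c a * letter k b c) \<triangleright> x)"
      by (intro sum.cong refl) (auto simp: Lt_def ap_plus ap_add ap_times ap_sc_comm)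
    also have "\<dots> = sc ?v \<triangleright> gl_total k b a \<triangleright> x + (\<Sum>c=1..N. gl_total k c a * letter k b c) \<triangleright> x"
      using Suc.prems(4) by (simp add: sum.distrib sum_ap del: pw)
    finally show ?thesis unfolding Om ap_times using Suc.prems(1)[of k] by (simp add: ap_sc_comm)
  qed
  have "sc (u - \<zeta>) \<triangleright> Tt N letter z [0..<Suc k] u a b \<triangleright> x
    = (\<Sum>c=1..N. sc (u - \<zeta>) \<triangleright> Tt N letter z [0..<k] u a c \<triangleright> Lt letter z k u c b \<triangleright> x)"
    using Suc.prems(3,4) by (simp add: Tt_append L sum_ap ap_sum ap_times del: Tt.simps)
  also have "\<dots> = (\<Sum>c=1..N. sc (ppi z [0..<k] u) \<triangleright> ((if a = c then sc (u - \<zeta>) \<triangleright> Lt letter z k u c b \<triangleright> x else 0)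
        + gl_total k c a \<triangleright> Lt letter z k u c b \<triangleright> x))"
    by (intro sum.cong refl IH)
  also have "\<dots> = sc (ppi z [0..<k] u) \<triangleright> (sc (u - \<zeta>) \<triangleright> Lt letter z k u a b \<triangleright> x
      + (sc ?v \<triangleright> gl_total k b a \<triangleright> x + sc (c k) \<triangleright> letter k b a \<triangleright> x))"
    unfolding ap_sum[symmetric] sum.distrib tot using Suc.prems(3) by simp
  also have "sc (u - \<zeta>) \<triangleright> Lt letter z k u a b \<triangleright> x + (sc ?v \<triangleright> gl_total k b a \<triangleright> x + sc (c k) \<triangleright> letter k b a \<triangleright> x)
    = sc ?v \<triangleright> ((if a = b then sc (u - \<zeta>) \<triangleright> x else 0) + gl_total (Suc k) b a \<triangleright> x)"
    using Suc.prems(2)[of k]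
    by (intro ext) (auto simp: Lt_def ap_plus ap_sc gl_total_Suc algebra_simps)
  finally show ?case by (simp add: ap_sc_sc ppi_def del: pw)
qed

section \<open>Words as coordinates and the Hermitian form on tensor powers\<close>

definition words :: "nat \<Rightarrow> nat \<Rightarrow> nat list set" where
  "words N k = {ws. length ws = k \<and> set ws \<subseteq> {1..N}}"

lemma finite_words: "finite (words N k)"
  unfolding words_def using finite_lists_length_eq[of "{1..N}" k] by (simp add: conj_commute)

definition wsupp :: "nat \<Rightarrow> nat \<Rightarrow> (nat list \<Rightarrow> complex) \<Rightarrow> bool" where
  "wsupp N k x \<longleftrightarrow> (\<forall>ws. ws \<notin> words N k \<longrightarrow> x ws = 0)"

lemma words_update: "ws[j := b] \<in> words N k \<Longrightarrow> j < length ws \<Longrightarrow> ws ! j \<in> {1..N} \<Longrightarrow> ws \<in> words N k"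
proof -
  assume w: "ws[j := b] \<in> words N k" "j < length ws" "ws ! j \<in> {1..N}"
  have "set ws \<subseteq> {1..N}"
  proof
    fix y assume "y \<in> set ws"
    then obtain i where i: "i < length ws" "ws ! i = y" by (auto simp: in_set_conv_nth)
    show "y \<in> {1..N}"
    proof (cases "i = j")
      case False
      then have "ws[j := b] ! i = y" using i by simp
      then have "y \<in> set (ws[j := b])" using i by (metis length_list_update nth_mem)
      then show ?thesis using w(1) by (auto simp: words_def)
    qed (use i w in auto)
  qed
  then show ?thesis using w(1) by (simp add: words_def)
qed

lemma words_list_update: "ws \<in> words N k \<Longrightarrow> b \<in> {1..N} \<Longrightarrow> ws[j := b] \<in> words N k"
  using set_update_subset_insert[of ws j b] by (auto simp: words_def)

lemma words_length: "ws \<in> words N k \<Longrightarrow> length ws = k"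
  by (simp add: words_def)

lemma wsupp_letter: "wsupp N k x \<Longrightarrow> a \<in> {1..N} \<Longrightarrow> wsupp N k (letter j a b \<triangleright> x)"
  unfolding wsupp_def letter_ap using words_update by (metis (no_types, lifting))

lemma wsupp_add: "wsupp N k x \<Longrightarrow> wsupp N k y \<Longrightarrow> wsupp N k (x + y)" by (simp add: wsupp_def)
lemma wsupp_diff: "wsupp N k x \<Longrightarrow> wsupp N k y \<Longrightarrow> wsupp N k (x - y)" by (simp add: wsupp_def)
lemma wsupp_sc: "wsupp N k x \<Longrightarrow> wsupp N k (sc c \<triangleright> x)" by (simp add: wsupp_def ap_sc)
lemma wsupp_sum: "(\<And>i. i \<in> S \<Longrightarrow> wsupp N k (x i)) \<Longrightarrow> wsupp N k (\<Sum>i\<in>S. x i)"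
  by (auto simp: wsupp_def sum_apply)
lemma wsupp_total: "wsupp N k x \<Longrightarrow> a \<in> {1..N} \<Longrightarrow> wsupp N k (gl_total m a b \<triangleright> x)"
  unfolding gl_total_def sum_ap by (intro wsupp_sum wsupp_letter)

text \<open>The standard Hermitian form, for which E_ab and E_ba are adjoint. It does the work of
  complete reducibility: vectors are shown to be zero by being orthogonal to themselves.\<close>

definition ip :: "nat \<Rightarrow> nat \<Rightarrow> (nat list \<Rightarrow> complex) \<Rightarrow> (nat list \<Rightarrow> complex) \<Rightarrow> complex" where
  "ip N k x y = (\<Sum>ws\<in>words N k. x ws * cnj (y ws))"

lemma ip_add_left: "ip N k (x + x') y = ip N k x y + ip N k x' y"
  by (simp add: ip_def distrib_right sum.distrib)
lemma ip_sc_left: "ip N k (sc c \<triangleright> x) y = c * ip N k x y"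
  by (simp add: ip_def ap_sc sum_distrib_left mult.assoc)
lemma ip_add_right: "ip N k x (y + y') = ip N k x y + ip N k x y'"
  by (simp add: ip_def distrib_left sum.distrib)
lemma ip_sc_right: "ip N k x (sc c \<triangleright> y) = cnj c * ip N k x y"
  by (simp add: ip_def ap_sc sum_distrib_left mult_ac)
lemma ip_0_left [simp]: "ip N k 0 y = 0" by (simp add: ip_def)
lemma ip_0_right [simp]: "ip N k x 0 = 0" by (simp add: ip_def)
lemma ip_sum_left: "ip N k (\<Sum>i\<in>S. x i) y = (\<Sum>i\<in>S. ip N k (x i) y)"
  by (induction S rule: infinite_finite_induct) (auto simp: ip_add_left simp del: pw)
lemma ip_sum_right: "ip N k x (\<Sum>i\<in>S. y i) = (\<Sum>i\<in>S. ip N k x (y i))"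
  by (induction S rule: infinite_finite_induct) (auto simp: ip_add_right simp del: pw)

lemma ip_self_zero:
  assumes "ip N k x x = 0" "wsupp N k x"
  shows "x = 0"
proof
  fix ws
  have "(\<Sum>ws\<in>words N k. (cmod (x ws))\<^sup>2) = 0"
  proof -
    have "complex_of_real (\<Sum>ws\<in>words N k. (cmod (x ws))\<^sup>2) = ip N k x x"
      unfolding ip_def of_real_sum by (intro sum.cong refl complex_norm_square)
    then have "complex_of_real (\<Sum>ws\<in>words N k. (cmod (x ws))\<^sup>2) = 0" using assms(1) by (rule trans)
    then show ?thesis by (simp only: of_real_eq_0_iff)
  qed
  then have "\<forall>ws\<in>words N k. (cmod (x ws))\<^sup>2 = 0"
    by (subst (asm) sum_nonneg_eq_0_iff) (auto simp: finite_words)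
  then show "x ws = 0 ws" using assms(2) by (auto simp: wsupp_def)
qed

lemma ip_letter:
  assumes "a \<in> {1..N}" "b \<in> {1..N}"
  shows "ip N k (letter j a b \<triangleright> x) y = ip N k x (letter j b a \<triangleright> y)"
proof -
  let ?A = "{ws \<in> words N k. j < length ws \<and> ws ! j = a}" and ?B = "{ws \<in> words N k. j < length ws \<and> ws ! j = b}"
  have "ip N k (letter j a b \<triangleright> x) y = (\<Sum>ws\<in>?A. x (ws[j := b]) * cnj (y ws))"
    unfolding ip_def letter_ap by (rule sum.mono_neutral_cong_right) (auto simp: finite_words)
  also have "\<dots> = (\<Sum>ws\<in>?B. x ws * cnj (y (ws[j := a])))"
    by (rule sum.reindex_bij_witness[of _ "\<lambda>ws. ws[j := a]" "\<lambda>ws. ws[j := b]"])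
      (use assms in \<open>auto simp: words_length intro: words_list_update\<close>)
  also have "\<dots> = ip N k x (letter j b a \<triangleright> y)"
    unfolding ip_def letter_ap by (rule sum.mono_neutral_cong_left) (auto simp: finite_words)
  finally show ?thesis .
qed

lemma ip_total:
  assumes "a \<in> {1..N}" "b \<in> {1..N}"
  shows "ip N k (gl_total m a b \<triangleright> x) y = ip N k x (gl_total m b a \<triangleright> y)"
  by (simp add: gl_total_def sum_ap ip_sum_left ip_sum_right ip_letter[OF assms])

section \<open>Singular vectors in tensor powers\<close>

definition snoc :: "nat \<Rightarrow> (nat list \<Rightarrow> complex) \<Rightarrow> nat list \<Rightarrow> complex" where
  "snoc b x ws = (if ws \<noteq> [] \<and> last ws = b then x (butlast ws) else 0)"

lemma snoc_add: "snoc b (x + y) = snoc b x + snoc b y" by (rule ext) (simp add: snoc_def)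
lemma snoc_0: "snoc b 0 = 0" by (rule ext) (simp add: snoc_def)
lemma snoc_sc: "snoc b (sc c \<triangleright> x) = sc c \<triangleright> snoc b x" by (rule ext) (simp add: snoc_def ap_sc)
lemma snoc_diff: "snoc b (x - y) = snoc b x - snoc b y" by (rule ext) (simp add: snoc_def)
lemma snoc_sum: "snoc b (\<Sum>i\<in>S. x i) = (\<Sum>i\<in>S. snoc b (x i))"
  by (induction S rule: infinite_finite_induct) (auto simp: snoc_add snoc_0 simp del: pw)

lemma wsupp_snoc: "wsupp N k x \<Longrightarrow> b \<in> {1..N} \<Longrightarrow> wsupp N (Suc k) (snoc b x)"
  unfolding wsupp_def
proof (intro allI impI)
  fix ws assume x: "\<forall>ws. ws \<notin> words N k \<longrightarrow> x ws = 0" "b \<in> {1..N}" "ws \<notin> words N (Suc k)"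
  show "snoc b x ws = 0"
  proof (cases ws rule: rev_cases)
    case (snoc vs c)
    then show ?thesis using x by (auto simp: words_def snoc_def)
  qed (simp add: snoc_def)
qed

lemma letter_snoc_last:
  assumes "wsupp N k x"
  shows "letter k c d \<triangleright> snoc b x = (if d = b then snoc c x else 0)"
proof
  fix ws
  show "(letter k c d \<triangleright> snoc b x) ws = (if d = b then snoc c x else 0) ws"
  proof (cases ws rule: rev_cases)
    case (snoc vs h)
    show ?thesis
    proof (cases "length vs = k")
      case True
      then have "(vs @ [h])[k := d] = vs @ [d]" by (metis list_update_length)
      then show ?thesis using snoc True by (auto simp: letter_ap snoc_def nth_append)
    next
      case False
      then have "x vs' = 0" if "length vs' = length vs" for vs'
        using assms that by (auto simp: wsupp_def words_def)
      then show ?thesis using snoc by (auto simp: letter_ap snoc_def)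
    qed
  qed (simp add: letter_ap snoc_def)
qed

lemma letter_snoc:
  assumes "wsupp N k x" "j < k"
  shows "letter j c d \<triangleright> snoc b x = snoc b (letter j c d \<triangleright> x)"
proof
  fix ws
  show "(letter j c d \<triangleright> snoc b x) ws = snoc b (letter j c d \<triangleright> x) ws"
  proof (cases ws rule: rev_cases)
    case (snoc vs h)
    show ?thesis
    proof (cases "length vs = k")
      case True
      then show ?thesis using snoc assms(2) by (auto simp: letter_ap snoc_def nth_append list_update_append)
    next
      case False
      then have "x vs' = 0" if "length vs' = length vs" for vs'
        using assms that by (auto simp: wsupp_def words_def)
      then show ?thesis using snoc by (auto simp: letter_ap snoc_def)
    qed
  qed (simp add: letter_ap snoc_def)
qed

lemma gl_total_snoc:
  assumes "wsupp N k x" "m \<le> k"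
  shows "gl_total m c d \<triangleright> snoc b x = snoc b (gl_total m c d \<triangleright> x)"
  using assms by (simp add: gl_total_def sum_ap snoc_sum letter_snoc)

lemma gl_total_Suc_snoc:
  assumes "wsupp N k x"
  shows "gl_total (Suc k) c d \<triangleright> snoc b x = snoc b (gl_total k c d \<triangleright> x) + (if d = b then snoc c x else 0)"
  using assms by (simp add: gl_total_Suc ap_plus gl_total_snoc letter_snoc_last)

lemma murphy_snoc:
  assumes "wsupp N k x" "t < k"
  shows "murphy N t \<triangleright> snoc b x = snoc b (murphy N t \<triangleright> x)"
proof -
  have "(gl_total t c d * letter t d c) \<triangleright> snoc b x = snoc b ((gl_total t c d * letter t d c) \<triangleright> x)"
    if "c \<in> {1..N}" "d \<in> {1..N}" for c d
    unfolding ap_times letter_snoc[OF assms]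
    by (rule gl_total_snoc[where k = k]) (use assms that in \<open>auto intro: wsupp_letter\<close>)
  then show ?thesis by (simp add: murphy_def sum_ap snoc_sum)
qed

text \<open>Flipping the final letter \<open>b\<close> with an earlier letter d puts d at the end
  and \<open>b\<close> in the place of d, which on the first part of the word is the action of
  E_bd.\<close>

lemma murphy_snoc_last:
  assumes "wsupp N k x" "b \<in> {1..N}"
  shows "murphy N k \<triangleright> snoc b x = (\<Sum>d=1..N. snoc d (gl_total k b d \<triangleright> x))"
proof -
  have "murphy N k \<triangleright> snoc b x = (\<Sum>c=1..N. \<Sum>d=1..N. if c = b then snoc d (gl_total k b d \<triangleright> x) else 0)"
    unfolding murphy_def sum_ap
    using assms(1) by (intro sum.cong refl) (simp add: ap_times letter_snoc_last[OF assms(1)] gl_total_snoc)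
  also have "\<dots> = (\<Sum>d=1..N. snoc d (gl_total k b d \<triangleright> x))"
    by (subst sum.swap) (use assms(2) in simp)
  finally show ?thesis .
qed

definition singular :: "nat \<Rightarrow> nat \<Rightarrow> (nat \<Rightarrow> nat) \<Rightarrow> (nat list \<Rightarrow> complex) \<Rightarrow> bool" where
  "singular N k hw x \<longleftrightarrow> wsupp N k x \<and> x \<noteq> 0 \<and>
     (\<forall>a\<in>{1..N}. \<forall>b\<in>{1..N}. a < b \<longrightarrow> gl_total k a b \<triangleright> x = 0) \<and>
     (\<forall>a\<in>{1..N}. gl_total k a a \<triangleright> x = sc (of_nat (hw a)) \<triangleright> x)"

text \<open>The squared norm of E_cb x is the pairing of x with E_bc E_cb x. As E_bc kills x, the
  commutator leaves the factor \<open>hw b\<close> - \<open>hw c\<close>, which is 0.\<close>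

lemma singular_equal_weights:
  assumes x: "singular N k hw x" and bc: "b \<in> {1..N}" "c \<in> {1..N}" "b < c" "hw b = hw c"
  shows "gl_total k c b \<triangleright> x = 0"
proof (rule ip_self_zero)
  show "wsupp N k (gl_total k c b \<triangleright> x)" using x bc by (auto simp: singular_def wsupp_total)
  have "gl_total k b c \<triangleright> gl_total k c b \<triangleright> x
    = gl_total k c b \<triangleright> gl_total k b c \<triangleright> x + gl_total k b b \<triangleright> x - gl_total k c c \<triangleright> x"
    unfolding ap_times[symmetric] ap_plus[symmetric] ap_minus[symmetric] using gl_total_rel[of k b c c b] by simp
  also have "\<dots> = 0" using x bc by (simp add: singular_def del: pw)
  finally have *: "gl_total k b c \<triangleright> gl_total k c b \<triangleright> x = 0" .
  show "ip N k (gl_total k c b \<triangleright> x) (gl_total k c b \<triangleright> x) = 0"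
    unfolding ip_total[OF bc(2,1)] * by simp
qed

lemma gl_total_swap:
  "gl_total k a b \<triangleright> gl_total k c d \<triangleright> x = gl_total k c d \<triangleright> gl_total k a b \<triangleright> x
     + (if b = c then gl_total k a d \<triangleright> x else 0) - (if a = d then gl_total k c b \<triangleright> x else 0)"
  unfolding ap_times[symmetric] by (subst gl_total_rel) (auto simp: ap_plus ap_minus simp del: pw)

text \<open>
  Adding a box in row \<open>a\<close> to a diagram all of whose columns but the last reach row \<open>a\<close>, and
  whose last column ends in row \<open>a - 1\<close>.
\<close>

lemma singular_add_box:
  assumes x: "singular N k hw x" and a: "a \<in> {1..N}"
    and col: "\<And>b. b \<in> {1..<a} \<Longrightarrow> hw b = Suc (hw a)"
    and mur: "\<And>t. t < k \<Longrightarrow> murphy N t \<triangleright> x = sc (c t) \<triangleright> x"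
  defines "x' \<equiv> snoc a x - (\<Sum>b\<in>{1..<a}. snoc b (gl_total k a b \<triangleright> x))"
  shows "singular N (Suc k) (hw(a := Suc (hw a))) x'"
    and "t < k \<Longrightarrow> murphy N t \<triangleright> x' = sc (c t) \<triangleright> x'"
    and "murphy N k \<triangleright> x' = sc (of_nat (hw a) + 1 - of_nat a) \<triangleright> x'"
proof -
  let ?E = "gl_total k"
  have supp: "wsupp N k x" and raise: "\<And>c d. c \<in> {1..N} \<Longrightarrow> d \<in> {1..N} \<Longrightarrow> c < d \<Longrightarrow> ?E c d \<triangleright> x = 0"
    and wt: "\<And>c. c \<in> {1..N} \<Longrightarrow> ?E c c \<triangleright> x = sc (of_nat (hw c)) \<triangleright> x"
    using x by (auto simp: singular_def)
  have suppE: "wsupp N k (?E a b \<triangleright> x)" for b using supp a by (rule wsupp_total)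
  have ltN: "b \<in> {1..N}" if "b \<in> {1..<a}" for b using that a by auto
  have inner: "?E c b \<triangleright> x = (if b = c then sc (of_nat (hw c)) \<triangleright> x else 0)" if "b \<in> {1..<a}" "c \<in> {1..<a}" for b c
  proof -
    have "?E c b \<triangleright> x = 0" if "b < c"
      by (rule singular_equal_weights[OF x]) (use \<open>b \<in> {1..<a}\<close> \<open>c \<in> {1..<a}\<close> col a that in auto)
    then show ?thesis using wt[of c] raise[of c b] that ltN by (cases b c rule: linorder_cases) auto
  qed
  have expand: "gl_total (Suc k) c d \<triangleright> x' = snoc a (?E c d \<triangleright> x) + (if d = a then snoc c x else 0)
    - (\<Sum>b\<in>{1..<a}. snoc b (?E c d \<triangleright> ?E a b \<triangleright> x) + (if d = b then snoc c (?E a b \<triangleright> x) else 0))" for c d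
    unfolding x'_def ap_diff ap_sum gl_total_Suc_snoc[OF supp] gl_total_Suc_snoc[OF suppE] ..
  have swap: "?E c d \<triangleright> ?E a b \<triangleright> x = ?E a b \<triangleright> ?E c d \<triangleright> x + (if d = a then ?E c b \<triangleright> x else 0) - (if c = b then ?E a d \<triangleright> x else 0)" for b c d
    by (rule gl_total_swap)
  have sel: "(\<Sum>b\<in>{1..<a}. if c = b then f b else 0) = (if c < a then f c else 0)"
    if "1 \<le> c" for c and f :: "nat \<Rightarrow> nat list \<Rightarrow> complex"
    using that by simp
  have raise': "gl_total (Suc k) c d \<triangleright> x' = 0" if cd: "c \<in> {1..N}" "d \<in> {1..N}" "c < d" for c d
  proof -
    have summand: "snoc b (?E c d \<triangleright> ?E a b \<triangleright> x) + (if d = b then snoc c (?E a b \<triangleright> x) else 0)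
      = (if d = a then snoc b (?E c b \<triangleright> x) else 0) - (if c = b then snoc b (?E a d \<triangleright> x) else 0)
        + (if d = b then snoc c (?E a b \<triangleright> x) else 0)" for b
      unfolding swap raise[OF cd] by (auto simp: snoc_diff snoc_0 simp del: pw)
    have "(\<Sum>b\<in>{1..<a}. snoc b (?E c d \<triangleright> ?E a b \<triangleright> x) + (if d = b then snoc c (?E a b \<triangleright> x) else 0))
      = (if d = a then \<Sum>b\<in>{1..<a}. snoc b (?E c b \<triangleright> x) else 0)
        - (if c < a then snoc c (?E a d \<triangleright> x) else 0) + (if d < a then snoc c (?E a d \<triangleright> x) else 0)"
      unfolding summand sum.distrib sum_subtractf using sel[of c] sel[of d] cd by simp
    also have "\<dots> = (if d = a then snoc c x else 0)"
    proof (cases d a rule: linorder_cases)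
      case less
      then show ?thesis using cd by (simp del: pw)
    next
      case greater
      then show ?thesis using cd a raise[of a d] by (simp add: snoc_0 del: pw)
    next
      \<comment> \<open>The new letter contributes \<open>snoc c x\<close> once, the correction
        terms contribute it \<open>hw c\<close> - \<open>hw a\<close> times. The hypothesis on the
        columns makes this difference 1, which is why the correction in x' has the coefficient
        -1.\<close>
      case equal
      then have ca: "c \<in> {1..<a}" using cd by auto
      have "(\<Sum>b\<in>{1..<a}. snoc b (?E c b \<triangleright> x)) = (\<Sum>b\<in>{1..<a}. if c = b then sc (of_nat (hw c)) \<triangleright> snoc c x else 0)"
        by (intro sum.cong refl) (auto simp: inner[OF _ ca] snoc_sc snoc_0)
      also have "\<dots> = sc (of_nat (hw c)) \<triangleright> snoc c x" using ca sel[of c] by simp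
      finally show ?thesis using equal ca wt[OF a] col[OF ca]
        by (intro ext) (simp add: snoc_sc ap_sc algebra_simps)
    qed
    finally show ?thesis unfolding expand raise[OF cd] by (simp add: snoc_0 del: pw)
  qed
  have weight': "gl_total (Suc k) c c \<triangleright> x' = sc (of_nat ((hw(a := Suc (hw a))) c)) \<triangleright> x'" if c: "c \<in> {1..N}" for c
  proof -
    have summand: "snoc b (?E c c \<triangleright> ?E a b \<triangleright> x) + (if c = b then snoc c (?E a b \<triangleright> x) else 0)
      = sc (of_nat ((hw(a := Suc (hw a))) c)) \<triangleright> snoc b (?E a b \<triangleright> x)" if "b \<in> {1..<a}" for b
      unfolding swap wt[OF c] ap_sc_comm
      using that by (intro ext) (auto simp: snoc_diff snoc_add snoc_sc snoc_0 ap_sc algebra_simps)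
    have sums: "(\<Sum>b\<in>{1..<a}. snoc b (?E c c \<triangleright> ?E a b \<triangleright> x) + (if c = b then snoc c (?E a b \<triangleright> x) else 0))
      = (\<Sum>b\<in>{1..<a}. sc (of_nat ((hw(a := Suc (hw a))) c)) \<triangleright> snoc b (?E a b \<triangleright> x))"
      by (intro sum.cong refl summand)
    show ?thesis
      unfolding expand wt[OF c] sums
      by (intro ext) (auto simp: x'_def snoc_sc ap_diff ap_sum[symmetric] ap_sc algebra_simps)
  qed
  have supp': "wsupp N (Suc k) x'"
    unfolding x'_def using a ltN by (intro wsupp_diff wsupp_sum wsupp_snoc supp suppE) auto
  have "x' \<noteq> 0"
  proof
    assume 0: "x' = 0"
    have "x ws = 0" for ws
    proof -
      have "x' (ws @ [a]) = x ws" by (auto simp: x'_def snoc_def sum_apply intro!: sum.neutral)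
      then show ?thesis using 0 by simp
    qed
    then show False using x by (auto simp: singular_def)
  qed
  then show "singular N (Suc k) (hw(a := Suc (hw a))) x'"
    using supp' raise' weight' by (simp add: singular_def)
  show "murphy N t \<triangleright> x' = sc (c t) \<triangleright> x'" if t: "t < k"
  proof -
    have "murphy N t \<triangleright> ?E a b \<triangleright> x = sc (c t) \<triangleright> ?E a b \<triangleright> x" if "b \<in> {1..N}" for b
    proof -
      have "murphy N t \<triangleright> ?E a b \<triangleright> x = ?E a b \<triangleright> murphy N t \<triangleright> x"
        using murphy_total_le[OF t a that] by (metis ap_times)
      then show ?thesis by (simp add: mur[OF t] ap_sc_comm)
    qed
    then show ?thesis unfolding x'_def ap_diff ap_sum
      using ltN by (simp add: murphy_snoc[OF supp t] murphy_snoc[OF suppE t] mur[OF t] snoc_sc del: pw)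
  qed
  \<comment> \<open>It remains to find the eigenvalue for the new position: it is the content of the
    new box, its column \<open>hw a\<close> + 1 minus its row a.\<close>
  define S where "S = (\<Sum>b\<in>{1..<a}. snoc b (?E a b \<triangleright> x))"
  have diag: "(\<Sum>d=1..N. snoc d (?E a d \<triangleright> x)) = S + sc (of_nat (hw a)) \<triangleright> snoc a x"
  proof -
    have "(\<Sum>d=1..N. snoc d (?E a d \<triangleright> x)) = (\<Sum>d\<in>insert a {1..<a}. snoc d (?E a d \<triangleright> x))"
    proof (rule sum.mono_neutral_right)
      show "\<forall>d\<in>{1..N} - insert a {1..<a}. snoc d (?E a d \<triangleright> x) = 0"
      proof
        fix d assume "d \<in> {1..N} - insert a {1..<a}"
        then have "?E a d \<triangleright> x = 0" using raise[of a d] a by auto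
        then show "snoc d (?E a d \<triangleright> x) = 0" by (simp only: snoc_0)
      qed
    qed (use a in auto)
    then show ?thesis using wt[OF a] by (simp add: S_def snoc_sc add.commute)
  qed
  have m1: "murphy N k \<triangleright> snoc a x = S + sc (of_nat (hw a)) \<triangleright> snoc a x"
    unfolding murphy_snoc_last[OF supp a] diag ..
  have m2: "murphy N k \<triangleright> snoc b (?E a b \<triangleright> x)
    = sc (of_nat (hw a) + 1) \<triangleright> snoc b (?E a b \<triangleright> x) + sc (of_nat (hw a) + 1) \<triangleright> snoc a x
      - (S + sc (of_nat (hw a)) \<triangleright> snoc a x)" if b: "b \<in> {1..<a}" for b
  proof -
    have wb: "?E b b \<triangleright> x = sc (of_nat (hw a) + 1) \<triangleright> x"
      using wt[OF ltN[OF b]] col[OF b] by (simp add: add.commute)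
    have Ebd: "?E b d \<triangleright> x = (if d = b then sc (of_nat (hw a) + 1) \<triangleright> x else 0)" if "d \<in> {1..N}" for d
    proof (cases "d < a")
      case True
      then show ?thesis using inner[of d b] b that wb by auto
    next
      case False
      then show ?thesis using raise[of b d] b that ltN[OF b] by auto
    qed
    have summand: "snoc d (?E b d \<triangleright> ?E a b \<triangleright> x)
      = (if d = b then sc (of_nat (hw a) + 1) \<triangleright> snoc b (?E a b \<triangleright> x) else 0)
        + (if d = a then sc (of_nat (hw a) + 1) \<triangleright> snoc a x else 0) - snoc d (?E a d \<triangleright> x)" if "d \<in> {1..N}" for d
      unfolding gl_total_swap[of k b d a b] Ebd[OF that] wb
      using b by (auto simp: snoc_diff snoc_add snoc_sc snoc_0 ap_sc_comm simp del: pw)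
    have "murphy N k \<triangleright> snoc b (?E a b \<triangleright> x) = (\<Sum>d=1..N. snoc d (?E b d \<triangleright> ?E a b \<triangleright> x))"
      by (rule murphy_snoc_last[OF suppE ltN[OF b]])
    also have "\<dots> = (\<Sum>d=1..N. (if d = b then sc (of_nat (hw a) + 1) \<triangleright> snoc b (?E a b \<triangleright> x) else 0)
        + (if d = a then sc (of_nat (hw a) + 1) \<triangleright> snoc a x else 0) - snoc d (?E a d \<triangleright> x))"
      by (intro sum.cong refl summand)
    also have "\<dots> = sc (of_nat (hw a) + 1) \<triangleright> snoc b (?E a b \<triangleright> x) + sc (of_nat (hw a) + 1) \<triangleright> snoc a x
      - (S + sc (of_nat (hw a)) \<triangleright> snoc a x)"
      unfolding diag[symmetric] sum.distrib sum_subtractf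
      using a ltN[OF b] by simp
    finally show ?thesis .
  qed
  have "murphy N k \<triangleright> S = (\<Sum>b\<in>{1..<a}. sc (of_nat (hw a) + 1) \<triangleright> snoc b (?E a b \<triangleright> x) + sc (of_nat (hw a) + 1) \<triangleright> snoc a x
      - (S + sc (of_nat (hw a)) \<triangleright> snoc a x))"
    unfolding S_def[THEN arg_cong[where f = "\<lambda>y. murphy N k \<triangleright> y"]] ap_sum
    by (intro sum.cong refl m2)
  also have "\<dots> = sc (of_nat (hw a) + 1) \<triangleright> S + sc (of_nat (a - 1)) \<triangleright> (snoc a x - S)"
    unfolding sum.distrib sum_subtractf ap_sum[symmetric] S_def[symmetric]
    by (intro ext) (simp add: ap_sc sum_apply algebra_simps)
  finally have mS: "murphy N k \<triangleright> S = sc (of_nat (hw a) + 1) \<triangleright> S + sc (of_nat (a - 1)) \<triangleright> (snoc a x - S)" .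
  show "murphy N k \<triangleright> x' = sc (of_nat (hw a) + 1 - of_nat a) \<triangleright> x'"
    unfolding x'_def S_def[symmetric] ap_diff m1 mS using a
    by (intro ext) (simp add: ap_sc of_nat_diff algebra_simps)
qed

text \<open>The diagram is filled column by column, so that each box is added in the situation of
  \<open>singular_add_box\<close>. This order also keeps the vector a common eigenvector of all
  Jucys-Murphy operators, with the contents of the boxes as eigenvalues.\<close>

lemma singular_exists:
  assumes "\<And>a. a \<in> {1..<N} \<Longrightarrow> hw (Suc a) \<le> hw a"
  shows "\<exists>k x c. singular N k hw x \<and> (\<forall>t<k. murphy N t \<triangleright> x = sc (c t) \<triangleright> x)"
  using assms
proof (induction "\<Sum>a=1..N. hw a" arbitrary: hw rule: less_induct)
  case less
  show ?case
  proof (cases "\<forall>a\<in>{1..N}. hw a = 0")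
    case True
    define x where "x = (\<lambda>ws :: nat list. if ws = [] then 1 else 0 :: complex)"
    have "x \<noteq> 0" by (auto simp: x_def fun_eq_iff)
    then have "singular N 0 hw x"
      using True by (simp add: singular_def wsupp_def words_def gl_total_def x_def)
    then show ?thesis by (intro exI[of _ 0] exI[of _ x]) auto
  next
    case False
    have anti: "hw b \<le> hw a" if "1 \<le> a" "a \<le> b" "b \<le> N" for a b
      using that(2,3)
    proof (induction b rule: dec_induct)
      case (step b)
      then show ?case using less.prems[of b] that(1) by auto
    qed simp
    from False have N: "1 \<le> N" and pos: "0 < hw 1" using anti by force+
    \<comment> \<open>The last row of maximal length: its final box is the bottom of the last column
      and is the one to be removed.\<close>
    define a where "a = Max {a\<in>{1..N}. hw a = hw 1}"
    have mem: "a \<in> {a\<in>{1..N}. hw a = hw 1}"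
      unfolding a_def by (rule Max_in) (use N in auto)
    have max: "b \<le> a" if "b \<in> {1..N}" "hw b = hw 1" for b
      unfolding a_def by (rule Max_ge) (use that in auto)
    have a: "a \<in> {1..N}" "hw a = hw 1" using mem by auto
    define \<mu> where "\<mu> = hw(a := hw a - 1)"
    have mu_hw: "\<mu>(a := Suc (\<mu> a)) = hw" using a pos by (auto simp: \<mu>_def)
    have "(\<Sum>a=1..N. \<mu> a) < (\<Sum>a=1..N. hw a)"
      using a pos by (intro sum_strict_mono_ex1) (auto simp: \<mu>_def intro!: bexI[of _ a])
    moreover have "\<mu> (Suc b) \<le> \<mu> b" if b: "b \<in> {1..<N}" for b
    proof (cases "b = a")
      case True
      then have "hw (Suc a) \<noteq> hw 1" using max[of "Suc a"] b by auto
      moreover have "hw (Suc a) \<le> hw 1" using anti[of 1 "Suc a"] b True by auto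
      ultimately show ?thesis using True a by (simp add: \<mu>_def)
    next
      case False
      then show ?thesis using less.prems[OF b] by (auto simp: \<mu>_def)
    qed
    ultimately obtain k x c where kx: "singular N k \<mu> x" "\<forall>t<k. murphy N t \<triangleright> x = sc (c t) \<triangleright> x"
      using less.hyps[of \<mu>] by blast
    have col: "\<mu> b = Suc (\<mu> a)" if "b \<in> {1..<a}" for b
    proof -
      have "hw a \<le> hw b" "hw b \<le> hw 1" using anti[of b a] anti[of 1 b] that a by auto
      then show ?thesis using that a pos by (simp add: \<mu>_def)
    qed
    define x' where "x' = snoc a x - (\<Sum>b\<in>{1..<a}. snoc b (gl_total k a b \<triangleright> x))"
    note box = singular_add_box[OF kx(1) a(1) col, of c]
    have "singular N (Suc k) hw x'"
      using box(1) kx(2) unfolding mu_hw x'_def by blast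
    moreover have "murphy N t \<triangleright> x' = sc ((c(k := of_nat (\<mu> a) + 1 - of_nat a)) t) \<triangleright> x'" if "t < Suc k" for t
    proof (cases "t = k")
      case True
      then show ?thesis using box(3) kx(2) unfolding x'_def by simp
    next
      case False
      then show ?thesis using box(2)[of t] kx(2) that unfolding x'_def by simp
    qed
    ultimately show ?thesis by blast
  qed
qed

section \<open>Embedding irreducible modules into tensor powers\<close>

lift_definition kop :: "'i set \<Rightarrow> ('i \<Rightarrow> 'i \<Rightarrow> complex) \<Rightarrow> 'i lop" is
  "\<lambda>S K x i. \<Sum>l\<in>S. K i l * x l"
proof (rule row_finiteI)
  fix S and K :: "'i \<Rightarrow> 'i \<Rightarrow> complex" and i
  have "finite (if finite S then S else {}) \<and>
    (\<forall>x. (\<Sum>l\<in>S. K i l * x l) = (\<Sum>l\<in>(if finite S then S else {}). K i l * x l))" by auto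
  then show "\<exists>T L. finite T \<and> (\<forall>x. (\<Sum>l\<in>S. K i l * x l) = (\<Sum>l\<in>T. L l * x l))" by (intro exI)
qed

lemma kop_ap: "(kop S K \<triangleright> x) i = (\<Sum>l\<in>S. K i l * x l)" by transfer simp

definition mop :: "nat \<Rightarrow> complex mat \<Rightarrow> nat lop" where
  "mop r A = kop {..<r} (\<lambda>i l. if i < r then A $$ (i, l) else 0)"

lemma mop_ap: "(mop r A \<triangleright> x) i = (if i < r then \<Sum>l<r. A $$ (i, l) * x l else 0)"
  by (simp add: mop_def kop_ap)

lemma mop_mult:
  assumes "A \<in> carrier_mat r r" "B \<in> carrier_mat r r"
  shows "mop r (A * B) = mop r A * mop r B"
proof (rule lop_eqI, rule ext)
  fix x :: "nat \<Rightarrow> complex" and i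
  show "(mop r (A * B) \<triangleright> x) i = ((mop r A * mop r B) \<triangleright> x) i"
  proof (cases "i < r")
    case True
    have "(\<Sum>l<r. (A * B) $$ (i, l) * x l) = (\<Sum>l<r. \<Sum>m<r. A $$ (i, m) * (B $$ (m, l) * x l))"
      using assms True by (intro sum.cong refl)
        (simp add: scalar_prod_def sum_distrib_right mult.assoc atLeast0LessThan)
    also have "\<dots> = (\<Sum>m<r. A $$ (i, m) * (\<Sum>l<r. B $$ (m, l) * x l))"
      unfolding sum_distrib_left by (rule sum.swap)
    finally show ?thesis using True by (simp add: ap_times mop_ap)
  qed (simp add: ap_times mop_ap)
qed

lemma mop_diff:
  assumes "A \<in> carrier_mat r r" "B \<in> carrier_mat r r"
  shows "mop r (A - B) = mop r A - mop r B"
  by (rule lop_eqI, rule ext) (use assms in \<open>simp add: mop_ap ap_minus sum_subtractf left_diff_distrib\<close>)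

lemma mop_zero: "mop r (0\<^sub>m r r) = 0"
  by (rule lop_eqI, rule ext) (auto simp: mop_ap)

lemma mop_gl_rel:
  assumes "gl_module N r e"
  shows "gl_rel N (\<lambda>a b. mop r (e a b))"
  unfolding gl_rel_def
proof (intro ballI)
  fix a b c d assume *: "a \<in> {1..N}" "b \<in> {1..N}" "c \<in> {1..N}" "d \<in> {1..N}"
  have C: "\<And>a b. a \<in> {1..N} \<Longrightarrow> b \<in> {1..N} \<Longrightarrow> e a b \<in> carrier_mat r r"
    and R: "e a b * e c d - e c d * e a b =
          (if b = c then e a d else 0\<^sub>m r r) - (if a = d then e c b else 0\<^sub>m r r)"
    using assms * by (auto simp: gl_module_def)
  have "mop r (e a b * e c d - e c d * e a b) = mop r (e a b) * mop r (e c d) - mop r (e c d) * mop r (e a b)"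
    unfolding mop_diff[OF mult_carrier_mat[OF C[OF *(1,2)] C[OF *(3,4)]] mult_carrier_mat[OF C[OF *(3,4)] C[OF *(1,2)]]]
      mop_mult[OF C[OF *(1,2)] C[OF *(3,4)]] mop_mult[OF C[OF *(3,4)] C[OF *(1,2)]] ..
  moreover have "mop r ((if b = c then e a d else 0\<^sub>m r r) - (if a = d then e c b else 0\<^sub>m r r))
    = (if b = c then mop r (e a d) else 0) - (if a = d then mop r (e c b) else 0)"
    using C * by (auto simp: mop_diff mop_zero)
  ultimately show "mop r (e a b) * mop r (e c d) - mop r (e c d) * mop r (e a b)
    = (if b = c then mop r (e a d) else 0) - (if a = d then mop r (e c b) else 0)" using R by simp
qed

definition fsupp :: "nat \<Rightarrow> (nat \<Rightarrow> complex) \<Rightarrow> bool" where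
  "fsupp r y \<longleftrightarrow> (\<forall>i\<ge>r. y i = 0)"

lemma fsupp_vec_eq: "fsupp r y \<Longrightarrow> fsupp r y' \<Longrightarrow> vec r y = vec r y' \<Longrightarrow> y = y'"
  unfolding fsupp_def by (intro ext) (metis index_vec not_le)

lemma mop_mult_vec: "A \<in> carrier_mat r r \<Longrightarrow> vec r (mop r A \<triangleright> y) = A *\<^sub>v vec r y"
  by (rule eq_vecI) (auto simp: mop_ap scalar_prod_def atLeast0LessThan)

lemma fsupp_mop: "fsupp r (mop r A \<triangleright> y)"
  by (simp add: fsupp_def mop_ap)

text \<open>Irreducibility in the form in which it is applied, to three conditions on y: that y is
  paired with 0, that y is paired with some x, and that the quantum determinant acts on y by the
  expected scalar.\<close>

lemma irreducible_dichotomy: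
  assumes irr: "gl_irreducible N r e"
    and supp: "\<And>y. Y y \<Longrightarrow> fsupp r y" and z: "Y 0"
    and add: "\<And>y y'. Y y \<Longrightarrow> Y y' \<Longrightarrow> Y (y + y')" and scale: "\<And>c y. Y y \<Longrightarrow> Y (sc c \<triangleright> y)"
    and act: "\<And>a b y. a \<in> {1..N} \<Longrightarrow> b \<in> {1..N} \<Longrightarrow> Y y \<Longrightarrow> Y (mop r (e a b) \<triangleright> y)"
  shows "(\<forall>y. Y y \<longrightarrow> y = 0) \<or> (\<forall>y. fsupp r y \<longrightarrow> Y y)"
proof -
  define W where "W = vec r ` Collect Y"
  have W: "subspace class_ring W (module_vec TYPE(complex) r)"
  proof (intro subspace.intro submodule.intro)
    show "vectorspace class_ring (module_vec TYPE(complex) r)" by (rule vec_vs)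
    show "Module.module class_ring (module_vec TYPE(complex) r)" by (rule vec_module)
    show "W \<subseteq> carrier (module_vec TYPE(complex) r)" by (auto simp: W_def module_vec_simps)
    show "\<zero>\<^bsub>module_vec TYPE(complex) r\<^esub> \<in> W"
      using z by (auto simp: W_def module_vec_simps intro!: image_eqI[of _ _ 0])
    fix v w assume "v \<in> W" "w \<in> W"
    then obtain y y' where "v = vec r y" "w = vec r y'" "Y y" "Y y'" by (auto simp: W_def)
    then show "v \<oplus>\<^bsub>module_vec TYPE(complex) r\<^esub> w \<in> W"
      using add by (auto simp: W_def module_vec_simps intro!: image_eqI[of _ _ "y + y'"])
  next
    fix c :: complex and v assume "v \<in> W"
    then obtain y where "v = vec r y" "Y y" by (auto simp: W_def)
    then show "c \<odot>\<^bsub>module_vec TYPE(complex) r\<^esub> v \<in> W"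
      using scale by (auto simp: W_def module_vec_simps ap_sc intro!: image_eqI[of _ _ "sc c \<triangleright> y"])
  qed
  have C: "\<And>a b. a \<in> {1..N} \<Longrightarrow> b \<in> {1..N} \<Longrightarrow> e a b \<in> carrier_mat r r"
    using irr by (auto simp: gl_irreducible_def gl_module_def)
  have "\<forall>a\<in>{1..N}. \<forall>b\<in>{1..N}. \<forall>w\<in>W. e a b *\<^sub>v w \<in> W"
    using act by (auto simp: W_def mop_mult_vec[OF C, symmetric])
  with W irr consider "W = {0\<^sub>v r}" | "W = carrier_vec r" unfolding gl_irreducible_def by blast
  then show ?thesis
  proof cases
    case 1
    have "y = 0" if y: "Y y" for y
    proof (rule fsupp_vec_eq[OF supp[OF y] supp[OF z]])
      have "vec r y \<in> W" "vec r 0 \<in> W" using y z by (auto simp: W_def)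
      then show "vec r y = vec r 0" using 1 by simp
    qed
    then show ?thesis by simp
  next
    case 2
    have "Y y" if y: "fsupp r y" for y
    proof -
      have "vec r y \<in> W" using 2 by simp
      then obtain y' where "Y y'" "vec r y = vec r y'" by (auto simp: W_def)
      then show ?thesis using fsupp_vec_eq[OF y supp] by metis
    qed
    then show ?thesis by simp
  qed
qed

text \<open>
  The submodule generated by the pair \<open>(x0, y0)\<close> of highest weight vectors of two modules; for modules
  of the same highest weight it is the graph of an isomorphism.
\<close>

inductive paired :: "nat \<Rightarrow> (nat \<Rightarrow> nat \<Rightarrow> 'i lop) \<Rightarrow> (nat \<Rightarrow> nat \<Rightarrow> 'j lop) \<Rightarrow>
    ('i \<Rightarrow> complex) \<Rightarrow> ('j \<Rightarrow> complex) \<Rightarrow> ('i \<Rightarrow> complex) \<Rightarrow> ('j \<Rightarrow> complex) \<Rightarrow> bool"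
  for N A B x0 y0 where
  paired_base: "paired N A B x0 y0 x0 y0"
| paired_add: "paired N A B x0 y0 x y \<Longrightarrow> paired N A B x0 y0 x' y' \<Longrightarrow> paired N A B x0 y0 (x + x') (y + y')"
| paired_sc: "paired N A B x0 y0 x y \<Longrightarrow> paired N A B x0 y0 (sc c \<triangleright> x) (sc c \<triangleright> y)"
| paired_lower: "paired N A B x0 y0 x y \<Longrightarrow> c \<in> {1..N} \<Longrightarrow> d \<in> {1..N} \<Longrightarrow> d < c \<Longrightarrow>
    paired N A B x0 y0 (A c d \<triangleright> x) (B c d \<triangleright> y)"

text \<open>The part of \<open>paired\<close> reached by at least one lowering step. Every pair is a
  multiple of \<open>(x0, y0)\<close> plus such a part; the two summands are kept apart by depth in
  the second component and by orthogonality in the first.\<close>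

inductive lowered :: "nat \<Rightarrow> (nat \<Rightarrow> nat \<Rightarrow> 'i lop) \<Rightarrow> (nat \<Rightarrow> nat \<Rightarrow> 'j lop) \<Rightarrow>
    ('i \<Rightarrow> complex) \<Rightarrow> ('j \<Rightarrow> complex) \<Rightarrow> ('i \<Rightarrow> complex) \<Rightarrow> ('j \<Rightarrow> complex) \<Rightarrow> bool"
  for N A B x0 y0 where
  lowered_0: "lowered N A B x0 y0 0 0"
| lowered_add: "lowered N A B x0 y0 x y \<Longrightarrow> lowered N A B x0 y0 x' y' \<Longrightarrow> lowered N A B x0 y0 (x + x') (y + y')"
| lowered_sc: "lowered N A B x0 y0 x y \<Longrightarrow> lowered N A B x0 y0 (sc c \<triangleright> x) (sc c \<triangleright> y)"
| lowered_lower: "paired N A B x0 y0 x y \<Longrightarrow> c \<in> {1..N} \<Longrightarrow> d \<in> {1..N} \<Longrightarrow> d < c \<Longrightarrow>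
    lowered N A B x0 y0 (A c d \<triangleright> x) (B c d \<triangleright> y)"

lemma gl_rel_swap_ap:
  assumes "gl_rel N e" "a \<in> {1..N}" "b \<in> {1..N}" "c \<in> {1..N}" "d \<in> {1..N}"
  shows "e a b \<triangleright> e c d \<triangleright> x = e c d \<triangleright> e a b \<triangleright> x + (if b = c then e a d \<triangleright> x else 0) - (if a = d then e c b \<triangleright> x else 0)"
  unfolding ap_times[symmetric] by (subst gl_rel_swap[OF assms]) (auto simp: ap_plus ap_minus simp del: pw)

lemma paired_decompose:
  "paired N A B x0 y0 x y \<Longrightarrow> \<exists>c x' y'. lowered N A B x0 y0 x' y' \<and> x = sc c \<triangleright> x0 + x' \<and> y = sc c \<triangleright> y0 + y'"
proof (induction rule: paired.induct)
  case paired_base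
  show ?case by (rule exI[of _ 1], rule exI[of _ 0], rule exI[of _ 0]) (simp add: lowered_0 ap_one del: pw)
next
  case (paired_add x y x' y')
  then obtain c u v c' u' v' where
    "lowered N A B x0 y0 u v" "x = sc c \<triangleright> x0 + u" "y = sc c \<triangleright> y0 + v"
    "lowered N A B x0 y0 u' v'" "x' = sc c' \<triangleright> x0 + u'" "y' = sc c' \<triangleright> y0 + v'" by blast
  then show ?case
    by (intro exI[of _ "c + c'"] exI[of _ "u + u'"] exI[of _ "v + v'"])
      (simp add: lowered_add sc_add ap_plus add_ac del: pw)
next
  case (paired_sc x y c')
  then obtain c u v where "lowered N A B x0 y0 u v" "x = sc c \<triangleright> x0 + u" "y = sc c \<triangleright> y0 + v" by blast
  then show ?case
    by (intro exI[of _ "c' * c"] exI[of _ "sc c' \<triangleright> u"] exI[of _ "sc c' \<triangleright> v"])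
      (simp add: lowered_sc sc_mult ap_times ap_add del: pw)
next
  case (paired_lower x y c d)
  have "lowered N A B x0 y0 (A c d \<triangleright> x) (B c d \<triangleright> y)" by (rule lowered_lower[where A = A and B = B, OF paired_lower.hyps])
  then show ?case by (intro exI[of _ 0] exI[of _ "A c d \<triangleright> x"] exI[of _ "B c d \<triangleright> y"]) (simp del: pw add: ap_zero)
qed

lemma paired_diff: "paired N A B x0 y0 x y \<Longrightarrow> paired N A B x0 y0 x' y' \<Longrightarrow> paired N A B x0 y0 (x - x') (y - y')"
proof -
  assume "paired N A B x0 y0 x y" "paired N A B x0 y0 x' y'"
  from paired_add[OF this(1) paired_sc[OF this(2), of "-1"]]
  show ?thesis by (simp add: sc_neg ap_uminus ap_one del: pw)
qed

lemma paired_zero: "paired N A B x0 y0 0 0"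
  using paired_sc[OF paired_base[of N A B x0 y0], of 0] by (simp add: ap_zero del: pw)

lemma paired_sum: "(\<And>i. i \<in> S \<Longrightarrow> paired N A B x0 y0 (x i) (y i)) \<Longrightarrow>
    paired N A B x0 y0 (\<Sum>i\<in>S. x i) (\<Sum>i\<in>S. y i)"
  by (induction S rule: infinite_finite_induct) (auto simp: paired_zero paired_add simp del: pw)

text \<open>Although only lowering operators generate the span, it is stable under all generators: a
  generator is commuted past the outermost lowering operator, and the commutator consists of
  generators again, covered by the induction hypothesis.\<close>

lemma paired_act:
  assumes A: "gl_rel N A" and B: "gl_rel N B"
    and up: "\<And>a b. a \<in> {1..N} \<Longrightarrow> b \<in> {1..N} \<Longrightarrow> a < b \<Longrightarrow> A a b \<triangleright> x0 = 0 \<and> B a b \<triangleright> y0 = 0"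
    and wt: "\<And>a. a \<in> {1..N} \<Longrightarrow> A a a \<triangleright> x0 = sc (wt a) \<triangleright> x0 \<and> B a a \<triangleright> y0 = sc (wt a) \<triangleright> y0"
    and p: "paired N A B x0 y0 x y" and ab: "a \<in> {1..N}" "b \<in> {1..N}"
  shows "paired N A B x0 y0 (A a b \<triangleright> x) (B a b \<triangleright> y)"
  using p ab
proof (induction arbitrary: a b rule: paired.induct)
  case paired_base
  show ?case
  proof (cases a b rule: linorder_cases)
    case less
    then have "A a b \<triangleright> x0 = 0" "B a b \<triangleright> y0 = 0" using up paired_base by auto
    then show ?thesis by (simp only: paired_zero)
  next
    case equal
    then have "A a b \<triangleright> x0 = sc (wt a) \<triangleright> x0" "B a b \<triangleright> y0 = sc (wt a) \<triangleright> y0" using wt[of a] paired_base by auto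
    then show ?thesis by (simp only: paired.paired_sc[OF paired.paired_base])
  next
    case greater
    show ?thesis
      by (rule paired.paired_lower[where A = A and B = B, OF paired.paired_base paired_base greater])
  qed
next
  case (paired_add x y x' y')
  then show ?case unfolding ap_add by (intro paired.paired_add) auto
next
  case (paired_sc x y c)
  then show ?case unfolding ap_sc_comm[of "A a b"] ap_sc_comm[of "B a b"] by (intro paired.paired_sc) auto
next
  case (paired_lower x y c d)
  have 1: "paired N A B x0 y0 (A c d \<triangleright> A a b \<triangleright> x) (B c d \<triangleright> B a b \<triangleright> y)"
    by (rule paired.paired_lower[where A = A and B = B, OF paired_lower.IH[OF paired_lower.prems] paired_lower.hyps(2-4)])
  have 2: "paired N A B x0 y0 (if b = c then A a d \<triangleright> x else 0) (if b = c then B a d \<triangleright> y else 0)"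
    "paired N A B x0 y0 (if a = d then A c b \<triangleright> x else 0) (if a = d then B c b \<triangleright> y else 0)"
    using paired_lower by (auto intro: paired_zero)
  show ?case
    unfolding gl_rel_swap_ap[OF A paired_lower.prems paired_lower.hyps(2,3)]
      gl_rel_swap_ap[OF B paired_lower.prems paired_lower.hyps(2,3)]
    by (rule paired_diff[OF paired_add[OF 1 2(1)] 2(2)])
qed

section \<open>Depth below the highest weight\<close>

context
  fixes N :: nat and B :: "nat \<Rightarrow> nat \<Rightarrow> 'j lop" and y0 :: "'j \<Rightarrow> complex" and wt :: "nat \<Rightarrow> complex"
  assumes B: "gl_rel N B" and wt: "\<And>a. a \<in> {1..N} \<Longrightarrow> B a a \<triangleright> y0 = sc (wt a) \<triangleright> y0"
begin

text \<open>The sum of a e_aa over a has the eigenvalue \<Sum> a wt_a on the highest weight vector,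
  and a lowering operator e_cd raises it by c - d. Vectors of depth k are those annihilated by
  \<open>depth_op k\<close>.\<close>

definition depth_op :: "nat \<Rightarrow> 'j lop" where
  "depth_op k = (\<Sum>a=1..N. sc (of_nat a) * B a a) - sc ((\<Sum>a=1..N. of_nat a * wt a) + of_nat k)"

definition depth_prod :: "nat list \<Rightarrow> 'j lop" where
  "depth_prod ks = prod_list (map depth_op ks)"

lemma depth_op_comm: "depth_op j * depth_op k = depth_op k * depth_op j"
proof -
  have "(X - sc s) * (X - sc t) = (X - sc t) * (X - sc s)" for X :: "'j lop" and s t
    unfolding left_diff_distrib right_diff_distrib sc_comm[of X] sc_mult[symmetric] mult.commute[of s t] by simp
  then show ?thesis unfolding depth_op_def .
qed

lemma depth_prod_op_comm: "depth_op k * depth_prod ks = depth_prod ks * depth_op k"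
proof (induction ks)
  case (Cons j ks)
  have "depth_op k * depth_prod (j # ks) = depth_op k * depth_op j * depth_prod ks"
    by (simp add: depth_prod_def mult.assoc)
  also have "\<dots> = depth_op j * (depth_op k * depth_prod ks)"
    unfolding depth_op_comm[of k j] by (rule mult.assoc)
  finally show ?case unfolding Cons.IH by (simp add: depth_prod_def mult.assoc)
qed (simp add: depth_prod_def)

lemma depth_prod_comm: "depth_prod ks * depth_prod ls = depth_prod ls * depth_prod ks"
proof (induction ks)
  case (Cons k ks)
  have "depth_prod (k # ks) = depth_op k * depth_prod ks" by (simp add: depth_prod_def)
  then show ?case using Cons by (metis depth_prod_op_comm mult.assoc)
qed (simp add: depth_prod_def)

lemma depth_op_lower:
  assumes "c \<in> {1..N}" "d \<in> {1..N}" "d < c"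
  shows "depth_op (k + (c - d)) * B c d = B c d * depth_op k"
proof -
  have "(\<Sum>a=1..N. sc (of_nat a) * B a a) * B c d
    = (\<Sum>a=1..N. B c d * (sc (of_nat a) * B a a) + ((if a = c then sc (of_nat c) * B c d else 0)
      - (if a = d then sc (of_nat d) * B c d else 0)))"
    unfolding sum_distrib_right
  proof (intro sum.cong refl)
    fix a assume a: "a \<in> {1..N}"
    show "sc (of_nat a) * B a a * B c d = B c d * (sc (of_nat a) * B a a) + ((if a = c then sc (of_nat c) * B c d else 0)
      - (if a = d then sc (of_nat d) * B c d else 0))"
      unfolding mult.assoc gl_rel_swap[OF B a a assms(1,2)] sc_left_comm
      using assms(3) by (auto simp: algebra_simps)
  qed
  also have "\<dots> = B c d * (\<Sum>a=1..N. sc (of_nat a) * B a a) + (sc (of_nat c) * B c d - sc (of_nat d) * B c d)"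
    using assms by (simp add: sum.distrib sum_subtractf sum_distrib_left)
  finally have 1: "(\<Sum>a=1..N. sc (of_nat a) * B a a) * B c d
    = B c d * (\<Sum>a=1..N. sc (of_nat a) * B a a) + (sc (of_nat c) * B c d - sc (of_nat d) * B c d)" .
  show ?thesis
    unfolding depth_op_def left_diff_distrib right_diff_distrib 1
    using assms by (simp add: sc_comm[of "B c d"] sc_add of_nat_diff sc_diff algebra_simps)
qed

text \<open>Stands for being a sum of vectors whose depths lie in \<open>K\<close>, without any
  decomposition into eigenspaces: some product of the operators \<open>depth_op k\<close>, k in
  \<open>K\<close>, annihilates the vector.\<close>

definition killed :: "nat set \<Rightarrow> ('j \<Rightarrow> complex) \<Rightarrow> bool" where
  "killed K y \<longleftrightarrow> (\<exists>ks. set ks \<subseteq> K \<and> depth_prod ks \<triangleright> y = 0)"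

lemma killed_sum:
  assumes "killed K y" "killed K y'"
  shows "killed K (y + y')"
proof -
  obtain ks ls where *: "set ks \<subseteq> K" "depth_prod ks \<triangleright> y = 0" "set ls \<subseteq> K" "depth_prod ls \<triangleright> y' = 0"
    using assms by (auto simp: killed_def)
  have "depth_prod (ks @ ls) = depth_prod ks * depth_prod ls" by (simp add: depth_prod_def)
  then have "depth_prod (ks @ ls) \<triangleright> (y + y') = 0"
    unfolding ap_add using * depth_prod_comm[of ks ls] by (metis ap_0 ap_times add.right_neutral)
  then show ?thesis using * unfolding killed_def by (intro exI[of _ "ks @ ls"]) auto
qed

lemma killed_scale: "killed K y \<Longrightarrow> killed K (sc c \<triangleright> y)"
  unfolding killed_def ap_sc_comm by (metis ap_0)

lemma killed_lower:
  assumes "killed UNIV y" "c \<in> {1..N}" "d \<in> {1..N}" "d < c"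
  shows "killed {1..} (B c d \<triangleright> y)"
proof -
  obtain ks where ks: "depth_prod ks \<triangleright> y = 0" using assms(1) by (auto simp: killed_def)
  have "depth_prod (map (\<lambda>k. k + (c - d)) ks) * B c d = B c d * depth_prod ks" for ks
  proof (induction ks)
    case (Cons k ks)
    let ?f = "\<lambda>k. k + (c - d)"
    have "depth_prod (map ?f (k # ks)) * B c d = depth_op (?f k) * (depth_prod (map ?f ks) * B c d)"
      by (simp add: depth_prod_def mult.assoc)
    also have "\<dots> = depth_op (?f k) * B c d * depth_prod ks" unfolding Cons.IH by (rule mult.assoc[symmetric])
    also have "\<dots> = B c d * (depth_op k * depth_prod ks)"
      unfolding depth_op_lower[OF assms(2-4)] by (rule mult.assoc)
    finally show ?case by (simp add: depth_prod_def)
  qed (simp add: depth_prod_def)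
  then have "depth_prod (map (\<lambda>k. k + (c - d)) ks) \<triangleright> B c d \<triangleright> y = 0" using ks by (metis ap_times ap_0)
  then show ?thesis using assms(4) unfolding killed_def by (intro exI[of _ "map (\<lambda>k. k + (c - d)) ks"]) auto
qed

lemma depth_op_base: "depth_op k \<triangleright> y0 = sc (- of_nat k) \<triangleright> y0"
proof -
  have "(\<Sum>a=1..N. sc (of_nat a) * B a a) \<triangleright> y0 = (\<Sum>a=1..N. sc (of_nat a * wt a) \<triangleright> y0)"
    unfolding sum_ap by (intro sum.cong refl) (simp add: ap_times wt sc_mult del: pw)
  also have "\<dots> = sc (\<Sum>a=1..N. of_nat a * wt a) \<triangleright> y0"
    by (rule ext) (simp add: sum_apply ap_sc sum_distrib_right)
  finally show ?thesis by (intro ext) (simp add: depth_op_def ap_minus ap_sc algebra_simps)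
qed

text \<open>The vector \<open>y0\<close> has depth 0, where \<open>depth_op k\<close> is the scalar
  -k, which is invertible for positive k.\<close>

lemma killed_base: "killed {1..} y0 \<Longrightarrow> y0 = 0"
proof -
  have "set ks \<subseteq> {1..} \<Longrightarrow> depth_prod ks \<triangleright> y0 = 0 \<Longrightarrow> y0 = 0" for ks
  proof (induction ks)
    case Nil
    then show ?case by (simp add: depth_prod_def ap_one del: pw)
  next
    case (Cons k ks)
    have "depth_prod (k # ks) \<triangleright> y0 = (depth_prod ks * depth_op k) \<triangleright> y0"
      using depth_prod_op_comm[of k ks] by (simp add: depth_prod_def)
    also have "\<dots> = sc (- of_nat k) \<triangleright> depth_prod ks \<triangleright> y0" by (simp only: ap_times depth_op_base ap_sc_comm)
    finally have "sc (- of_nat k) \<triangleright> depth_prod ks \<triangleright> y0 = 0" unfolding Cons.prems(2) by (rule sym)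
    then have "depth_prod ks \<triangleright> y0 = 0" using Cons.prems(1) by (auto simp: fun_eq_iff ap_sc)
    then show ?case using Cons by auto
  qed
  then show "killed {1..} y0 \<Longrightarrow> y0 = 0" by (auto simp: killed_def)
qed

lemma paired_killed: "paired N A B x0 y0 x y \<Longrightarrow> killed UNIV y"
proof (induction rule: paired.induct)
  case paired_base
  have "depth_prod [0] \<triangleright> y0 = 0" using depth_op_base[of 0] by (simp add: depth_prod_def ap_zero del: pw)
  then show ?case unfolding killed_def by blast
next
  case (paired_lower x y c d)
  have "killed {1..} (B c d \<triangleright> y)" by (rule killed_lower[OF paired_lower.IH paired_lower.hyps(2-4)])
  then show ?case unfolding killed_def by blast
qed (auto intro: killed_sum killed_scale simp del: pw)

lemma lowered_killed: "lowered N A B x0 y0 x y \<Longrightarrow> killed {1..} y"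
proof (induction rule: lowered.induct)
  case lowered_0
  show ?case unfolding killed_def by (intro exI[of _ "[]"]) (simp add: depth_prod_def ap_one del: pw)
next
  case (lowered_lower x y c d)
  show ?case by (rule killed_lower[OF paired_killed[OF lowered_lower.hyps(1)] lowered_lower.hyps(2-4)])
qed (auto intro: killed_sum killed_scale simp del: pw)

lemma not_lowered_multiple:
  assumes "lowered N A B x0 y0 x y" "y = sc c \<triangleright> y0" "y0 \<noteq> 0"
  shows "c = 0"
proof (rule ccontr)
  assume c: "c \<noteq> 0"
  have "y0 = sc (1 / c) \<triangleright> y" using c assms(2) by (auto simp: fun_eq_iff ap_sc)
  then have "killed {1..} y0" using killed_scale[OF lowered_killed[OF assms(1)]] by metis
  then show False using killed_base assms(3) by simp
qed

end

lemma mult_if_one: "x * (if P then 1 else 0) = (if P then x else (0 :: complex))"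
  by simp

lemma highest_weight_coords:
  assumes M: "irreducible_highest_weight_module N \<Lambda> r e"
  shows "\<exists>y. fsupp r y \<and> y \<noteq> 0 \<and> (\<forall>a\<in>{1..N}. mop r (e a a) \<triangleright> y = sc (\<Lambda> a) \<triangleright> y) \<and>
    (\<forall>a\<in>{1..N}. \<forall>b\<in>{1..N}. a < b \<longrightarrow> mop r (e a b) \<triangleright> y = 0)"
proof -
  obtain v where v: "highest_weight_vector N r e \<Lambda> v" and irr: "gl_irreducible N r e"
    using M by (auto simp: irreducible_highest_weight_module_def)
  then have C: "\<And>a b. a \<in> {1..N} \<Longrightarrow> b \<in> {1..N} \<Longrightarrow> e a b \<in> carrier_mat r r"
    by (auto simp: gl_irreducible_def gl_module_def)
  define y where "y = (\<lambda>i. if i < r then v $ i else 0)"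
  have vy: "vec r y = v" using v by (auto simp: y_def highest_weight_vector_def)
  have fy: "fsupp r y" by (simp add: fsupp_def y_def)
  have f0: "fsupp r 0" by (simp add: fsupp_def)
  have "y \<noteq> 0"
  proof
    assume "y = 0"
    then have "v = 0\<^sub>v r" unfolding vy[symmetric] by auto
    then show False using v by (simp add: highest_weight_vector_def)
  qed
  moreover have "mop r (e a a) \<triangleright> y = sc (\<Lambda> a) \<triangleright> y" if "a \<in> {1..N}" for a
  proof (rule fsupp_vec_eq[where r = r])
    show "vec r (mop r (e a a) \<triangleright> y) = vec r (sc (\<Lambda> a) \<triangleright> y)"
      unfolding mop_mult_vec[OF C[OF that that]] vy using v that
      by (auto simp: highest_weight_vector_def ap_sc y_def)
    show "fsupp r (sc (\<Lambda> a) \<triangleright> y)" using fy by (simp add: fsupp_def ap_sc)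
  qed (rule fsupp_mop)
  moreover have "mop r (e a b) \<triangleright> y = 0" if "a \<in> {1..N}" "b \<in> {1..N}" "a < b" for a b
  proof (rule fsupp_vec_eq[where r = r])
    show "vec r (mop r (e a b) \<triangleright> y) = vec r 0"
      unfolding mop_mult_vec[OF C[OF that(1,2)]] vy using v that
      by (auto simp: highest_weight_vector_def)
  qed (rule fsupp_mop, rule f0)
  ultimately show ?thesis using fy by (intro exI[of _ y]) simp
qed

text \<open>The adjoint of a lowering operator is a raising operator, and raising operators kill
  \<open>x0\<close>.\<close>

lemma lowered_orthogonal:
  assumes "lowered N (gl_total k) B x0 y0 x y"
    and up: "\<And>a b. a \<in> {1..N} \<Longrightarrow> b \<in> {1..N} \<Longrightarrow> a < b \<Longrightarrow> gl_total k a b \<triangleright> x0 = 0"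
  shows "ip N k x x0 = 0"
  using assms(1)
proof (induction rule: lowered.induct)
  case (lowered_lower x y c d)
  then show ?case by (simp only: ip_total up ip_0_right)
qed (simp_all add: ip_add_left ip_sc_left del: pw)

text \<open>The relation \<open>paired\<close> is a graph in both directions. That x determines y
  follows from irreducibility of the given module. The submodule of the tensor power generated by
  \<open>x0\<close> is not known to be irreducible, so that y determines x is derived from the
  Hermitian form. Jucys-Murphy eigenvalues pass from \<open>x0\<close> to all x because these
  operators commute with gl_N.\<close>

lemma module_embedding:
  assumes M: "irreducible_highest_weight_module N \<Lambda> r e"
    and hw: "\<And>a. a \<in> {1..N} \<Longrightarrow> \<Lambda> a = of_nat (hw a)" "\<And>a. a \<in> {1..<N} \<Longrightarrow> hw (Suc a) \<le> hw a"
  shows "\<exists>k c \<iota>. (\<forall>l<r. wsupp N k (\<iota> l)) \<and> (\<forall>l<r. \<forall>t<k. murphy N t \<triangleright> \<iota> l = sc (c t) \<triangleright> \<iota> l) \<and>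
    (\<forall>l<r. \<forall>a\<in>{1..N}. \<forall>b\<in>{1..N}. gl_total k a b \<triangleright> \<iota> l = (\<Sum>m<r. sc (e a b $$ (m, l)) \<triangleright> \<iota> m)) \<and>
    (\<forall>y. fsupp r y \<longrightarrow> (\<Sum>l<r. sc (y l) \<triangleright> \<iota> l) = 0 \<longrightarrow> y = 0)"
proof -
  obtain k x0 c where x0: "singular N k hw x0" and mur0: "\<And>t. t < k \<Longrightarrow> murphy N t \<triangleright> x0 = sc (c t) \<triangleright> x0"
    using singular_exists[of N hw, OF hw(2)] by blast
  have irr: "gl_irreducible N r e" using M by (simp add: irreducible_highest_weight_module_def)
  then have gm: "gl_module N r e" by (simp add: gl_irreducible_def)
  define B where "B = (\<lambda>a b. mop r (e a b))"
  obtain y0 where fy0: "fsupp r y0" and y0: "y0 \<noteq> 0"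
    and wtB: "\<And>a. a \<in> {1..N} \<Longrightarrow> B a a \<triangleright> y0 = sc (\<Lambda> a) \<triangleright> y0"
    and upB: "\<And>a b. a \<in> {1..N} \<Longrightarrow> b \<in> {1..N} \<Longrightarrow> a < b \<Longrightarrow> B a b \<triangleright> y0 = 0"
    using highest_weight_coords[OF M] unfolding B_def by blast
  have fB: "fsupp r (B a b \<triangleright> y)" for a b y by (simp add: B_def fsupp_mop)
  have relB: "gl_rel N B" unfolding B_def by (rule mop_gl_rel[OF gm])
  have relA: "gl_rel N (gl_total k)" unfolding gl_rel_def
    by (intro ballI, subst gl_total_rel) (simp add: algebra_simps)
  have upA: "gl_total k a b \<triangleright> x0 = 0" if "a \<in> {1..N}" "b \<in> {1..N}" "a < b" for a b
    using x0 that by (auto simp: singular_def)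
  have wtA: "gl_total k a a \<triangleright> x0 = sc (\<Lambda> a) \<triangleright> x0" if "a \<in> {1..N}" for a
    using x0 that hw(1) by (auto simp: singular_def)
  let ?P = "paired N (gl_total k) B x0 y0"
  let ?L = "lowered N (gl_total k) B x0 y0"
  have low_orth: "ip N k x x0 = 0" if "?L x y" for x y
    by (rule lowered_orthogonal[OF that]) (rule upA)
  have act: "?P (gl_total k a b \<triangleright> x) (B a b \<triangleright> y)" if "?P x y" "a \<in> {1..N}" "b \<in> {1..N}" for x y a b
    by (rule paired_act[where wt = \<Lambda>, OF relA relB _ _ that]) (use upA upB wtA wtB in auto)
  have x0n: "ip N k x0 x0 \<noteq> 0" using x0 ip_self_zero[of N k x0] by (auto simp: singular_def)
  have fP: "fsupp r y" if "?P x y" for x y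
    using that by (induction rule: paired.induct) (auto simp: fy0 fB, auto simp: fsupp_def ap_sc)
  have zero_left: "y = 0" if "?P 0 y" for y
  proof -
    have "(\<forall>y. ?P 0 y \<longrightarrow> y = 0) \<or> (\<forall>y. fsupp r y \<longrightarrow> ?P 0 y)"
    proof (rule irreducible_dichotomy[OF irr])
      show "?P 0 (y + y')" if "?P 0 y" "?P 0 y'" for y y'
        using paired_add[where A = "gl_total k" and B = B, OF that] by simp
      show "?P 0 (sc c \<triangleright> y)" if "?P 0 y" for c y
        using paired_sc[where A = "gl_total k" and B = B and c = c, OF that] by simp
      show "?P 0 (mop r (e a b) \<triangleright> y)" if "a \<in> {1..N}" "b \<in> {1..N}" "?P 0 y" for a b y
        using act[OF that(3,1,2)] by (simp add: B_def)
    qed (auto intro: fP paired_zero)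
    moreover have "\<not> ?P 0 y0"
    proof
      assume "?P 0 y0"
      then obtain d x' y' where d: "?L x' y'" "0 = sc d \<triangleright> x0 + x'" "y0 = sc d \<triangleright> y0 + y'"
        using paired_decompose by blast
      have "ip N k (sc d \<triangleright> x0 + x') x0 = 0" unfolding d(2)[symmetric] by simp
      then have "d * ip N k x0 x0 = 0"
        unfolding ip_add_left ip_sc_left low_orth[OF d(1)] by simp
      then have "y' = sc 1 \<triangleright> y0" using d(3) x0n by simp
      from not_lowered_multiple[OF relB wtB d(1) this y0] show False by simp
    qed
    ultimately show ?thesis using fy0 that by blast
  qed
  \<comment> \<open>Induction on the generation of x': a lowering operator on x' moves to x as its
    adjoint, and the result is again paired with 0. In the base case, x has no component along
    \<open>x0\<close> and is orthogonal to it by \<open>low_orth\<close>.\<close>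
  have orth: "ip N k x x' = 0" if "?P x' y'" "?P x 0" for x x' y'
    using that
  proof (induction arbitrary: x rule: paired.induct)
    case paired_base
    then obtain d w y' where d: "?L w y'" "x = sc d \<triangleright> x0 + w" "0 = sc d \<triangleright> y0 + y'"
      using paired_decompose by blast
    have "y' = sc (- d) \<triangleright> y0" using d(3) unfolding sc_neg ap_uminus by (simp add: eq_neg_iff_add_eq_0 add.commute del: pw)
    from not_lowered_multiple[OF relB wtB d(1) this y0] have "d = 0" by simp
    then have "x = w" using d(2) by (simp del: pw)
    then show ?case using low_orth[OF d(1)] by simp
  next
    case (paired_lower x' y c d)
    have "?P (gl_total k d c \<triangleright> x) (B d c \<triangleright> 0)"
      by (rule act[OF paired_lower.prems paired_lower.hyps(3,2)])
    then have "?P (gl_total k d c \<triangleright> x) 0" by (simp del: pw)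
    from paired_lower.IH[OF this] show ?case unfolding ip_total[OF paired_lower.hyps(3,2)] .
  qed (simp_all add: ip_add_right ip_sc_right del: pw)
  have wsP: "wsupp N k x" if "?P x y" for x y
    using that
  proof (induction rule: paired.induct)
    case paired_base
    show ?case using x0 by (simp add: singular_def)
  qed (auto intro: wsupp_add wsupp_sc wsupp_total simp del: pw)
  have zero_right: "x = 0" if "?P x 0" for x
    by (rule ip_self_zero[OF orth[OF that that] wsP[OF that]])
  have murP: "murphy N t \<triangleright> x = sc (c t) \<triangleright> x" if "?P x y" "t < k" for x y t
    using that
  proof (induction rule: paired.induct)
    case (paired_lower x y a b)
    have "murphy N t \<triangleright> gl_total k a b \<triangleright> x = gl_total k a b \<triangleright> murphy N t \<triangleright> x"
      using murphy_total_le[OF paired_lower.prems paired_lower.hyps(2,3)] by (metis ap_times)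
    then show ?case
      unfolding paired_lower.IH[OF paired_lower.prems] ap_sc_comm[of "gl_total k a b"] .
  next
    case (paired_sc x y d)
    show ?case unfolding ap_sc_comm[of "murphy N t"] paired_sc.IH[OF paired_sc.prems] by (rule ap_sc_comm)
  next
    case (paired_add x y x' y')
    show ?case unfolding ap_add paired_add.IH(1)[OF paired_add.prems] paired_add.IH(2)[OF paired_add.prems] ..
  qed (rule mur0)
  have all: "\<exists>x. ?P x y" if "fsupp r y" for y
  proof -
    have "(\<forall>y. (\<exists>x. ?P x y) \<longrightarrow> y = 0) \<or> (\<forall>y. fsupp r y \<longrightarrow> (\<exists>x. ?P x y))"
    proof (rule irreducible_dichotomy[OF irr])
      show "\<exists>x. ?P x (y + y')" if "\<exists>x. ?P x y" "\<exists>x. ?P x y'" for y y'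
        using that paired_add by blast
      show "\<exists>x. ?P x (sc c \<triangleright> y)" if "\<exists>x. ?P x y" for c y
        using that paired_sc by blast
      show "\<exists>x. ?P x (mop r (e a b) \<triangleright> y)" if "a \<in> {1..N}" "b \<in> {1..N}" "\<exists>x. ?P x y" for a b y
        using act that unfolding B_def by blast
    qed (auto intro: fP paired_zero)
    moreover have "?P x0 y0" by (rule paired_base)
    ultimately show ?thesis using y0 that by blast
  qed
  define bas where "bas = (\<lambda>(l :: nat) (i :: nat). if i = l then 1 else 0 :: complex)"
  have fbas: "fsupp r (bas l)" if "l < r" for l using that by (auto simp: fsupp_def bas_def)
  obtain \<iota> where \<iota>: "\<And>l. l < r \<Longrightarrow> ?P (\<iota> l) (bas l)" using all[OF fbas] by metis
  have comb: "?P (\<Sum>l<r. sc (y l) \<triangleright> \<iota> l) y" if "fsupp r y" for y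
  proof -
    have "?P (\<Sum>l<r. sc (y l) \<triangleright> \<iota> l) (\<Sum>l<r. sc (y l) \<triangleright> bas l)"
      by (rule paired_sum) (use \<iota> in \<open>auto intro: paired_sc\<close>)
    moreover have "(\<Sum>l<r. sc (y l) \<triangleright> bas l) = y"
    proof
      fix i show "(\<Sum>l<r. sc (y l) \<triangleright> bas l) i = y i"
        using that by (cases "i < r") (simp_all add: sum_apply ap_sc bas_def fsupp_def mult_if_one)
    qed
    ultimately show ?thesis by (simp only:)
  qed
  have glk: "gl_total k a b \<triangleright> \<iota> l = (\<Sum>m<r. sc (e a b $$ (m, l)) \<triangleright> \<iota> m)"
    if "l < r" "a \<in> {1..N}" "b \<in> {1..N}" for l a b
  proof -
    have "(B a b \<triangleright> bas l) m = (if m < r then e a b $$ (m, l) else 0)" for m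
      using that(1) by (simp add: B_def mop_ap bas_def mult_if_one)
    then have "(\<Sum>m<r. sc ((B a b \<triangleright> bas l) m) \<triangleright> \<iota> m) = (\<Sum>m<r. sc (e a b $$ (m, l)) \<triangleright> \<iota> m)"
      by (intro sum.cong refl) simp
    with comb[OF fB, of a b "bas l"] have "?P (\<Sum>m<r. sc (e a b $$ (m, l)) \<triangleright> \<iota> m) (B a b \<triangleright> bas l)"
      by (simp only:)
    from paired_diff[OF act[OF \<iota>[OF that(1)] that(2,3)] this]
    have "?P (gl_total k a b \<triangleright> \<iota> l - (\<Sum>m<r. sc (e a b $$ (m, l)) \<triangleright> \<iota> m)) 0" by (simp del: pw)
    from zero_right[OF this] show ?thesis by (simp only: eq_iff_diff_eq_0[symmetric])
  qed
  have inde: "y = 0" if "fsupp r y" "(\<Sum>l<r. sc (y l) \<triangleright> \<iota> l) = 0" for y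
    by (rule zero_left, rule comb[OF that(1), unfolded that(2)])
  show ?thesis
  proof (rule exI[of _ k], rule exI[of _ c], rule exI[of _ \<iota>], intro conjI allI impI ballI)
    fix l assume l: "l < r"
    show "wsupp N k (\<iota> l)" by (rule wsP[OF \<iota>[OF l]])
    show "murphy N t \<triangleright> \<iota> l = sc (c t) \<triangleright> \<iota> l" if "t < k" for t by (rule murP[OF \<iota>[OF l] that])
    show "gl_total k a b \<triangleright> \<iota> l = (\<Sum>m<r. sc (e a b $$ (m, l)) \<triangleright> \<iota> m)" if "a \<in> {1..N}" "b \<in> {1..N}" for a b
      by (rule glk[OF l that])
  next
    fix y assume "fsupp r y" "(\<Sum>l<r. sc (y l) \<triangleright> \<iota> l) = 0"
    then show "y = 0" by (rule inde)
  qed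
qed

text \<open>Each factor of a \<open>tensor\<close> is indexed by natural numbers, so words are
  encoded by \<open>list_encode\<close>. A factor can then carry either a module or a whole tensor
  power of the vector representation.\<close>

lift_definition wop :: "nat list lop \<Rightarrow> nat lop" is
  "\<lambda>F x i. F (\<lambda>w. x (list_encode w)) (list_decode i)"
proof (rule row_finiteI)
  fix F :: "(nat list \<Rightarrow> complex) \<Rightarrow> nat list \<Rightarrow> complex" and i assume "row_finite F"
  then obtain S K where SK: "finite S" "\<And>x. F x (list_decode i) = (\<Sum>j\<in>S. K j * x j)"
    unfolding row_finite_def by metis
  have inj: "inj_on list_encode S" by (rule inj_on_inverseI[where g = list_decode]) simp
  have "finite (list_encode ` S) \<and> (\<forall>x. F (\<lambda>w. x (list_encode w)) (list_decode i)
    = (\<Sum>j\<in>list_encode ` S. K (list_decode j) * x j))"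
    using SK by (simp add: sum.reindex[OF inj])
  then show "\<exists>S K. finite S \<and> (\<forall>x. F (\<lambda>w. x (list_encode w)) (list_decode i) = (\<Sum>j\<in>S. K j * x j))"
    by (intro exI)
qed

lemma wop_ap: "(wop A \<triangleright> x) i = (A \<triangleright> (\<lambda>w. x (list_encode w))) (list_decode i)"
  by transfer simp

lemma wop_mult: "wop (A * B) = wop A * wop B"
  by (rule lop_eqI, rule ext) (simp add: ap_times wop_ap)
lemma wop_add: "wop (A + B) = wop A + wop B"
  by (rule lop_eqI, rule ext) (simp add: ap_plus wop_ap)
lemma wop_0: "wop 0 = 0" by (rule lop_eqI, rule ext) (simp add: wop_ap)
lemma wop_1: "wop 1 = 1" by (rule lop_eqI, rule ext) (simp add: wop_ap)
lemma wop_sc: "wop (sc c) = sc c" by (rule lop_eqI, rule ext) (simp add: wop_ap ap_sc)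
lemma wop_sum: "wop (\<Sum>i\<in>S. A i) = (\<Sum>i\<in>S. wop (A i))"
  by (induction S rule: infinite_finite_induct) (auto simp: wop_add wop_0)

lift_definition slot :: "nat \<Rightarrow> nat lop \<Rightarrow> (nat \<Rightarrow> nat) lop" is
  "\<lambda>s F x p. F (\<lambda>w. x (p(s := w))) (p s)"
proof (rule row_finiteI)
  fix s :: nat and F :: "(nat \<Rightarrow> complex) \<Rightarrow> nat \<Rightarrow> complex" and p :: "nat \<Rightarrow> nat" assume "row_finite F"
  then obtain S K where SK: "finite S" "\<And>x. F x (p s) = (\<Sum>j\<in>S. K j * x j)"
    unfolding row_finite_def by metis
  have inj: "inj_on (\<lambda>j. p(s := j)) S" by (auto simp: inj_on_def dest: fun_upd_eqD)
  have "finite ((\<lambda>j. p(s := j)) ` S) \<and> (\<forall>x. F (\<lambda>w. x (p(s := w))) (p s)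
    = (\<Sum>j\<in>(\<lambda>j. p(s := j)) ` S. K (j s) * x j))"
    using SK by (simp add: sum.reindex[OF inj])
  then show "\<exists>S K. finite S \<and> (\<forall>x. F (\<lambda>w. x (p(s := w))) (p s) = (\<Sum>j\<in>S. K j * x j))"
    by (intro exI)
qed

lemma slot_ap: "(slot s A \<triangleright> x) p = (A \<triangleright> (\<lambda>w. x (p(s := w)))) (p s)"
  by transfer simp

lemma slot_mult: "slot s (A * B) = slot s A * slot s B"
  by (rule lop_eqI, rule ext) (simp add: ap_times slot_ap)
lemma slot_add: "slot s (A + B) = slot s A + slot s B"
  by (rule lop_eqI, rule ext) (simp add: ap_plus slot_ap)
lemma slot_diff: "slot s (A - B) = slot s A - slot s B"
  by (rule lop_eqI, rule ext) (simp add: ap_minus slot_ap)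
lemma slot_0: "slot s 0 = 0" by (rule lop_eqI, rule ext) (simp add: slot_ap)
lemma slot_1: "slot s 1 = 1" by (rule lop_eqI, rule ext) (simp add: slot_ap)
lemma slot_sc: "slot s (sc c) = sc c" by (rule lop_eqI, rule ext) (simp add: slot_ap ap_sc)
lemma slot_sum: "slot s (\<Sum>i\<in>S. A i) = (\<Sum>i\<in>S. slot s (A i))"
  by (induction S rule: infinite_finite_induct) (auto simp: slot_add slot_0)

lemma slot_comm:
  assumes "s \<noteq> t"
  shows "slot s A * slot t B = slot t B * slot s A"
proof (rule lop_eqI, rule ext)
  fix x and p :: "nat \<Rightarrow> nat"
  obtain S K where A: "\<And>y. (A \<triangleright> y) (p s) = (\<Sum>j\<in>S. K j * y j)" by (rule lop_kernel[of A "p s"]) blast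
  obtain T L where B: "\<And>y. (B \<triangleright> y) (p t) = (\<Sum>j\<in>T. L j * y j)" by (rule lop_kernel[of B "p t"]) blast
  have "((slot s A * slot t B) \<triangleright> x) p = (\<Sum>j\<in>S. \<Sum>l\<in>T. K j * L l * x (p(s := j, t := l)))"
    using assms by (simp add: ap_times slot_ap A B sum_distrib_left mult.assoc)
  also have "\<dots> = (\<Sum>l\<in>T. \<Sum>j\<in>S. L l * K j * x (p(t := l, s := j)))"
    by (subst sum.swap) (simp add: fun_upd_twist[OF assms] mult.commute)
  also have "\<dots> = ((slot t B * slot s A) \<triangleright> x) p"
    using assms by (simp add: ap_times slot_ap A B sum_distrib_left mult.assoc)
  finally show "((slot s A * slot t B) \<triangleright> x) p = ((slot t B * slot s A) \<triangleright> x) p" .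
qed

definition slots :: "(nat \<Rightarrow> nat lop) \<Rightarrow> nat list \<Rightarrow> (nat \<Rightarrow> nat) lop" where
  "slots A ss = prod_list (map (\<lambda>s. slot s (A s)) ss)"

lemma slots_comm: "t \<notin> set ss \<Longrightarrow> slot t B * slots A ss = slots A ss * slot t B"
proof (induction ss)
  case (Cons s ss)
  have "slot t B * slots A (s # ss) = slot t B * slot s (A s) * slots A ss" by (simp add: slots_def mult.assoc)
  also have "\<dots> = slot s (A s) * (slot t B * slots A ss)"
    using slot_comm[of t s B "A s"] Cons.prems by (simp add: mult.assoc)
  also have "\<dots> = slot s (A s) * (slots A ss * slot t B)" using Cons by simp
  finally show ?case by (simp add: slots_def mult.assoc)
qed (simp add: slots_def)

lemma slots_mult: "distinct ss \<Longrightarrow> slots A ss * slots B ss = slots (\<lambda>s. A s * B s) ss"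
proof (induction ss)
  case (Cons s ss)
  have "slots A (s # ss) * slots B (s # ss) = slot s (A s) * (slots A ss * slot s (B s)) * slots B ss"
    by (simp add: slots_def mult.assoc)
  also have "\<dots> = slot s (A s * B s) * (slots A ss * slots B ss)"
    using Cons.prems slots_comm[of s ss "B s" A, symmetric] by (simp add: slot_mult mult.assoc)
  finally show ?case using Cons by (simp add: slots_def)
qed (simp add: slots_def)

text \<open>The embedding as an operator \<open>I\<close> together with a linear left inverse
  \<open>K\<close>, taken from the orthogonal projection onto the image. The two support conditions
  say where the values of \<open>I\<close> and \<open>K\<close> live.\<close>

lemma embedding_ops:
  assumes M: "irreducible_highest_weight_module N \<Lambda> r e"
    and hw: "\<And>a. a \<in> {1..N} \<Longrightarrow> \<Lambda> a = of_nat (hw a)" "\<And>a. a \<in> {1..<N} \<Longrightarrow> hw (Suc a) \<le> hw a"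
  shows "\<exists>k c I K. (\<forall>t<k. wop (murphy N t) * I = sc (c t) * I) \<and>
    (\<forall>a\<in>{1..N}. \<forall>b\<in>{1..N}. wop (gl_total k a b) * I = I * mop r (e a b)) \<and>
    K * I = mop r (1\<^sub>m r) \<and> (\<forall>x i. list_decode i \<notin> words N k \<longrightarrow> (I \<triangleright> x) i = 0) \<and>
    (\<forall>x i. r \<le> i \<longrightarrow> (K \<triangleright> x) i = 0)"
proof -
  obtain k c \<iota> where emb: "(\<forall>l<r. wsupp N k (\<iota> l)) \<and> (\<forall>l<r. \<forall>t<k. murphy N t \<triangleright> \<iota> l = sc (c t) \<triangleright> \<iota> l) \<and>
    (\<forall>l<r. \<forall>a\<in>{1..N}. \<forall>b\<in>{1..N}. gl_total k a b \<triangleright> \<iota> l = (\<Sum>m<r. sc (e a b $$ (m, l)) \<triangleright> \<iota> m)) \<and>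
    (\<forall>y. fsupp r y \<longrightarrow> (\<Sum>l<r. sc (y l) \<triangleright> \<iota> l) = 0 \<longrightarrow> y = 0)"
  proof -
    note * = module_embedding[of N \<Lambda> r e hw, OF M]
    show thesis by (rule *[THEN exE], rule hw(1), assumption, rule hw(2), assumption, elim exE) (rule that)
  qed
  note ws = emb[THEN conjunct1, rule_format]
    and mur = emb[THEN conjunct2, THEN conjunct1, rule_format]
    and gl = emb[THEN conjunct2, THEN conjunct2, THEN conjunct1, rule_format]
    and ind = emb[THEN conjunct2, THEN conjunct2, THEN conjunct2, rule_format]
  define I where "I = kop {..<r} (\<lambda>i l. \<iota> l (list_decode i))"
  have I: "wop A \<triangleright> I \<triangleright> x = (\<lambda>i. (\<Sum>l<r. sc (x l) \<triangleright> A \<triangleright> \<iota> l) (list_decode i))" for A x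
  proof
    fix i
    have "(\<lambda>w. (I \<triangleright> x) (list_encode w)) = (\<Sum>l<r. sc (x l) \<triangleright> \<iota> l)"
      by (rule ext) (simp add: I_def kop_ap sum_apply ap_sc mult.commute)
    then show "(wop A \<triangleright> I \<triangleright> x) i = (\<Sum>l<r. sc (x l) \<triangleright> A \<triangleright> \<iota> l) (list_decode i)"
      by (simp add: wop_ap ap_sum ap_sc_comm)
  qed
  have I1: "I \<triangleright> x = (\<lambda>i. (\<Sum>l<r. sc (x l) \<triangleright> \<iota> l) (list_decode i))" for x
    using I[of 1 x] by (simp add: wop_1)
  have 1: "wop (murphy N t) * I = sc (c t) * I" if "t < k" for t
  proof (rule lop_eqI)
    fix x show "(wop (murphy N t) * I) \<triangleright> x = (sc (c t) * I) \<triangleright> x"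
      unfolding ap_times I unfolding I1 using mur[OF _ that] by (intro ext) (simp add: sum_apply ap_sc sum_distrib_left mult_ac)
  qed
  have 2: "wop (gl_total k a b) * I = I * mop r (e a b)" if "a \<in> {1..N}" "b \<in> {1..N}" for a b
  proof (rule lop_eqI, rule ext)
    fix x i
    have "((wop (gl_total k a b) * I) \<triangleright> x) i = (\<Sum>l<r. \<Sum>m<r. x l * (e a b $$ (m, l) * \<iota> m (list_decode i)))"
      unfolding ap_times I using gl[OF _ that] by (simp add: sum_apply ap_sc sum_distrib_left)
    also have "\<dots> = (\<Sum>m<r. (\<Sum>l<r. e a b $$ (m, l) * x l) * \<iota> m (list_decode i))"
      by (subst sum.swap) (simp add: sum_distrib_left sum_distrib_right mult_ac)
    also have "\<dots> = ((I * mop r (e a b)) \<triangleright> x) i"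
      unfolding ap_times I1 by (simp add: sum_apply ap_sc mop_ap)
    finally show "((wop (gl_total k a b) * I) \<triangleright> x) i = ((I * mop r (e a b)) \<triangleright> x) i" .
  qed
  \<comment> \<open>The coefficients of the dual family. The Gram matrix is invertible since the
    form is definite and the family independent.\<close>
  have "\<exists>d. (\<forall>l. l \<notin> {..<r} \<longrightarrow> d l = 0) \<and>
      (\<forall>m\<in>{..<r}. (\<Sum>l<r. d l * ip N k (\<iota> m) (\<iota> l)) = (if i = m then 1 else 0))" for i
  proof (rule injective_square_system)
    fix d :: "nat \<Rightarrow> complex"
    assume d: "\<forall>l. l \<notin> {..<r} \<longrightarrow> d l = 0" "\<forall>m\<in>{..<r}. (\<Sum>l<r. d l * ip N k (\<iota> m) (\<iota> l)) = 0"
    let ?y = "\<Sum>l<r. sc (cnj (d l)) \<triangleright> \<iota> l"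
    have "ip N k (\<iota> m) ?y = 0" if "m < r" for m using d(2) that by (simp add: ip_sum_right ip_sc_right)
    then have "ip N k ?y ?y = 0" unfolding ip_sum_left[of _ _ _ _ ?y] ip_sc_left by simp
    then have "?y = 0" by (rule ip_self_zero) (use ws in \<open>auto intro!: wsupp_sum wsupp_sc\<close>)
    then have "(\<lambda>l. cnj (d l)) = 0" by (intro ind) (use d(1) in \<open>auto simp: fsupp_def\<close>)
    then show "\<forall>l\<in>{..<r}. d l = 0" by (auto simp: fun_eq_iff)
  qed (auto simp: distrib_right sum.distrib sum_distrib_left mult.assoc)
  then obtain d where d: "\<And>i m. m < r \<Longrightarrow> (\<Sum>l<r. d i l * ip N k (\<iota> m) (\<iota> l)) = (if i = m then 1 else 0)"
    by (metis lessThan_iff)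
  define K where "K = kop (list_encode ` words N k)
    (\<lambda>i w. if i < r then \<Sum>l<r. d i l * cnj (\<iota> l (list_decode w)) else 0)"
  have inj: "inj_on list_encode A" for A by (rule inj_on_inverseI[where g = list_decode]) simp
  have 3: "K * I = mop r (1\<^sub>m r)"
  proof (rule lop_eqI, rule ext)
    fix x i
    show "((K * I) \<triangleright> x) i = (mop r (1\<^sub>m r) \<triangleright> x) i"
    proof (cases "i < r")
      case True
      have "((K * I) \<triangleright> x) i = (\<Sum>ws\<in>words N k. (\<Sum>l<r. d i l * cnj (\<iota> l ws)) * (\<Sum>m<r. x m * \<iota> m ws))"
        unfolding ap_times I1 using True
        by (simp add: K_def kop_ap sum.reindex[OF inj] sum_apply ap_sc)
      also have "\<dots> = (\<Sum>ws\<in>words N k. \<Sum>m<r. \<Sum>l<r. x m * (d i l * (\<iota> m ws * cnj (\<iota> l ws))))"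
        unfolding sum_product by (subst sum.swap, intro sum.cong refl) (simp add: mult_ac)
      also have "\<dots> = (\<Sum>m<r. \<Sum>l<r. \<Sum>ws\<in>words N k. x m * (d i l * (\<iota> m ws * cnj (\<iota> l ws))))"
        by (subst sum.swap, intro sum.cong refl, rule sum.swap)
      also have "\<dots> = (\<Sum>m<r. x m * (if i = m then 1 else 0))"
        by (intro sum.cong refl) (simp add: ip_def d[symmetric] sum_distrib_left)
      also have "\<dots> = (mop r (1\<^sub>m r) \<triangleright> x) i"
        using True by (auto simp: mop_ap intro!: sum.cong)
      finally show ?thesis .
    qed (simp add: ap_times K_def kop_ap mop_ap)
  qed
  have 4: "(I \<triangleright> x) i = 0" if "list_decode i \<notin> words N k" for x i
    unfolding I1 using ws that by (simp add: sum_apply ap_sc wsupp_def)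
  have 5: "(K \<triangleright> x) i = 0" if "r \<le> i" for x i using that by (simp add: K_def kop_ap)
  show ?thesis
    by (rule exI[of _ k], rule exI[of _ c], rule exI[of _ I], rule exI[of _ K]) (simp add: 1 2 3 4 5)
qed

lemma fusion:
  assumes "\<And>t. t < k \<Longrightarrow> wop (murphy N t) * I = sc (c t) * I"
    and "wop (gl_total k b a) * I = I * X" "a \<in> {1..N}" "b \<in> {1..N}"
    and "\<And>t. t < k \<Longrightarrow> z t = \<zeta> - c t"
  shows "sc (u - \<zeta>) * wop (Tt N letter z [0..<k] u a b) * I
    = sc (ppi z [0..<k] u) * (I * ((if a = b then sc (u - \<zeta>) else 0) + X))"
proof (rule lop_eqI)
  fix x
  define y where "y = (\<lambda>w. (I \<triangleright> x) (list_encode w))"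
  have W: "wop A \<triangleright> I \<triangleright> x = (\<lambda>i. (A \<triangleright> y) (list_decode i))" for A
    by (rule ext) (simp add: wop_ap y_def)
  have m: "murphy N t \<triangleright> y = sc (c t) \<triangleright> y" if "t < k" for t
  proof
    fix w
    have "(wop (murphy N t) \<triangleright> I \<triangleright> x) (list_encode w) = (sc (c t) \<triangleright> I \<triangleright> x) (list_encode w)"
      using assms(1)[OF that] by (metis ap_times)
    then show "(murphy N t \<triangleright> y) w = (sc (c t) \<triangleright> y) w" unfolding W by (simp add: ap_sc y_def)
  qed
  have "(sc (u - \<zeta>) * wop (Tt N letter z [0..<k] u a b) * I) \<triangleright> x
    = (\<lambda>i. (sc (u - \<zeta>) \<triangleright> Tt N letter z [0..<k] u a b \<triangleright> y) (list_decode i))"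
    by (rule ext) (simp add: ap_times W ap_sc)
  also have "\<dots> = (\<lambda>i. (sc (ppi z [0..<k] u) \<triangleright> ((if a = b then sc (u - \<zeta>) \<triangleright> y else 0) + gl_total k b a \<triangleright> y)) (list_decode i))"
    by (subst Tt_fusion[where c = c, OF m assms(5,3,4)]) auto
  also have "\<dots> = sc (ppi z [0..<k] u) \<triangleright> ((if a = b then sc (u - \<zeta>) \<triangleright> I \<triangleright> x else 0) + wop (gl_total k b a) \<triangleright> I \<triangleright> x)"
    by (rule ext) (simp add: W ap_sc y_def)
  also have "\<dots> = (sc (ppi z [0..<k] u) * (I * ((if a = b then sc (u - \<zeta>) else 0) + X))) \<triangleright> x"
    using arg_cong[OF assms(2), of "\<lambda>A. A \<triangleright> x"]
    by (simp add: ap_times ap_plus ap_add ap_sc_comm[of I] del: pw)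
  finally show "(sc (u - \<zeta>) * wop (Tt N letter z [0..<k] u a b) * I) \<triangleright> x
    = (sc (ppi z [0..<k] u) * (I * ((if a = b then sc (u - \<zeta>) else 0) + X))) \<triangleright> x" .
qed

lemma Tt_slot:
  "Tt N (\<lambda>p a b. slot (fst p) (wop (letter (snd p) a b))) z (map (Pair s) js) u a b
    = slot s (wop (Tt N letter (\<lambda>j. z (s, j)) js u a b))"
  by (induction js arbitrary: a)
    (auto simp: wop_0 wop_1 slot_0 slot_1 Lt_def wop_sum slot_sum wop_mult slot_mult wop_add slot_add wop_sc slot_sc
      intro!: sum.cong)

lemma ppi_append: "ppi z (xs @ ys) u = ppi z xs u * ppi z ys u"
  by (simp add: ppi_def)

definition box_sites :: "(nat \<Rightarrow> nat) \<Rightarrow> nat list \<Rightarrow> (nat \<times> nat) list" where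
  "box_sites k ss = concat (map (\<lambda>s. map (Pair s) [0..<k s]) ss)"

definition box_op :: "nat \<times> nat \<Rightarrow> nat \<Rightarrow> nat \<Rightarrow> (nat \<Rightarrow> nat) lop" where
  "box_op p a b = slot (fst p) (wop (letter (snd p) a b))"

lemma fusion_step:
  assumes "B * S = S * B" "sc a * A * S = sc a' * (S * L)" "sc b * B * J = sc b' * (J * T)" "L * J = J * L"
  shows "sc (a * b) * (A * B) * (S * J) = sc (a' * b') * ((S * J) * (L * T))"
proof -
  have "sc (a * b) * (A * B) * (S * J) = sc a * (sc b * (A * (B * S * J)))" by (simp add: sc_mult mult.assoc)
  also have "\<dots> = (sc a * A * S) * (sc b * B * J)"
    unfolding assms(1) mult.assoc sc_left_comm[of A b] sc_left_comm[of S b] ..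
  also have "\<dots> = (sc a' * (S * L)) * (sc b' * (J * T))" by (simp only: assms(2,3))
  also have "\<dots> = sc (a' * b') * (S * (L * J) * T)"
    unfolding sc_mult mult.assoc sc_left_comm[of L b'] sc_left_comm[of S b'] ..
  finally show ?thesis unfolding assms(4) by (simp add: mult.assoc)
qed

text \<open>A site is replaced by one box for each letter of its tensor power, at z_s minus the
  Jucys-Murphy eigenvalue. Fusion at each site, and commutation of operators at different sites,
  carry the embedding through the product. Both denominators are multiplied out, so the identity
  holds for every u.\<close>

lemma box_intertwine:
  assumes "distinct ss"
    and "\<And>s t. s \<in> set ss \<Longrightarrow> t < k s \<Longrightarrow> wop (murphy N t) * I s = sc (c s t) * I s"
    and "\<And>s a b. s \<in> set ss \<Longrightarrow> a \<in> {1..N} \<Longrightarrow> b \<in> {1..N} \<Longrightarrow> wop (gl_total (k s) a b) * I s = I s * X s a b"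
    and "a \<in> {1..N}" "b \<in> {1..N}"
  shows "sc (ppi z ss u) * Tt N box_op (\<lambda>p. z (fst p) - c (fst p) (snd p)) (box_sites k ss) u a b * slots I ss
    = sc (ppi (\<lambda>p. z (fst p) - c (fst p) (snd p)) (box_sites k ss) u)
      * (slots I ss * Tt N (\<lambda>s a b. slot s (X s a b)) z ss u a b)"
  using assms
proof (induction ss arbitrary: a)
  case Nil
  then show ?case by (simp add: box_sites_def ppi_def slots_def)
next
  case (Cons s ss)
  let ?z = "\<lambda>p :: nat \<times> nat. z (fst p) - c (fst p) (snd p)" and ?e = "\<lambda>s a b. slot s (X s a b)"
  let ?B = "map (Pair s) [0..<k s]"
  have sites: "box_sites k (s # ss) = ?B @ box_sites k ss" by (simp add: box_sites_def)
  have blk: "sc (u - z s) * Tt N box_op ?z ?B u a d * slot s (I s)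
    = sc (ppi ?z ?B u) * (slot s (I s) * Lt ?e z s u a d)" if "d \<in> {1..N}" for d
  proof -
    have "sc (u - z s) * wop (Tt N letter (\<lambda>j. ?z (s, j)) [0..<k s] u a d) * I s
      = sc (ppi (\<lambda>j. ?z (s, j)) [0..<k s] u) * (I s * ((if a = d then sc (u - z s) else 0) + X s d a))"
      by (rule fusion[where c = "c s"]) (use Cons.prems that in auto)
    from arg_cong[OF this, of "slot s"] show ?thesis
      unfolding box_op_def Tt_slot
      by (auto simp: slot_mult slot_add slot_sc slot_0 Lt_def ppi_def comp_def)
  qed
  have comm: "Tt N box_op ?z (box_sites k ss) u d b * slot s (I s) = slot s (I s) * Tt N box_op ?z (box_sites k ss) u d b"
    if "d \<in> {1..N}" for d
  proof (rule Tt_comm[symmetric])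
    fix p a b assume "p \<in> set (box_sites k ss)"
    then have "fst p \<noteq> s" using Cons.prems(1) by (auto simp: box_sites_def)
    then show "slot s (I s) * box_op p a b = box_op p a b * slot s (I s)"
      unfolding box_op_def by (intro slot_comm) simp
  qed (use that Cons.prems in auto)
  have IH: "sc (ppi z ss u) * Tt N box_op ?z (box_sites k ss) u d b * slots I ss
    = sc (ppi ?z (box_sites k ss) u) * (slots I ss * Tt N ?e z ss u d b)" if "d \<in> {1..N}" for d
    by (rule Cons.IH) (use Cons.prems that in auto)
  have summand: "sc (ppi z (s # ss) u) * (Tt N box_op ?z ?B u a d * Tt N box_op ?z (box_sites k ss) u d b) * slots I (s # ss)
    = sc (ppi ?z (box_sites k (s # ss)) u) * (slots I (s # ss) * (Lt ?e z s u a d * Tt N ?e z ss u d b))"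
    if d: "d \<in> {1..N}" for d
  proof -
    have sl: "Lt ?e z s u a d * slots I ss = slots I ss * Lt ?e z s u a d"
    proof -
      have "Lt ?e z s u a d = slot s ((if a = d then sc (u - z s) else 0) + X s d a)"
        by (simp add: Lt_def slot_add slot_sc slot_0)
      then show ?thesis using slots_comm[of s ss] Cons.prems(1) by simp
    qed
    have *: "ppi z (s # ss) u = (u - z s) * ppi z ss u" "slots I (s # ss) = slot s (I s) * slots I ss"
      by (simp_all add: ppi_def slots_def)
    show ?thesis unfolding * sites ppi_append by (rule fusion_step[OF comm[OF d] blk[OF d] IH[OF d] sl])
  qed
  have "sc (ppi z (s # ss) u) * Tt N box_op ?z (box_sites k (s # ss)) u a b * slots I (s # ss)
    = (\<Sum>d=1..N. sc (ppi z (s # ss) u) * (Tt N box_op ?z ?B u a d * Tt N box_op ?z (box_sites k ss) u d b) * slots I (s # ss))"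
    unfolding sites Tt_append[OF Cons.prems(4,5)] by (simp add: sum_distrib_left sum_distrib_right mult.assoc)
  also have "\<dots> = sc (ppi ?z (box_sites k (s # ss)) u) * (slots I (s # ss) * Tt N ?e z (s # ss) u a b)"
    by (subst sum.cong[OF refl summand]) (simp_all add: sum_distrib_left)
  finally show ?case .
qed

section \<open>Comparison of the two descriptions of the operator\<close>

lemma foldr_psi_neg: "foldr psi xs (- F) = - foldr psi xs F"
  by (induction xs) (simp_all add: psi_neg del: pw)

lemma psi_foldr: "psi b (foldr psi ys F) = (if even (length ys) then foldr psi ys (psi b F) else - foldr psi ys (psi b F))"
proof (induction ys)
  case (Cons y ys)
  have "psi b (foldr psi (y # ys) F) = - psi y (psi b (foldr psi ys F))"
    unfolding foldr.simps comp_apply by (rule psi_anticomm)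
  then show ?case unfolding Cons by (simp add: psi_neg del: pw)
qed simp

lemma foldr_psi_swap: "foldr psi (xs @ b # ys @ c # zs) F = - foldr psi (xs @ c # ys @ b # zs) F"
proof -
  have "foldr psi (b # ys @ c # zs) F = - foldr psi (c # ys @ b # zs) F"
    using psi_foldr[of b ys "psi c (foldr psi zs F)"] psi_foldr[of c ys "psi b (foldr psi zs F)"]
      psi_anticomm[of b c "foldr psi zs F"]
    by (simp add: foldr_psi_neg del: pw)
  then show ?thesis using foldr_psi_neg[of xs] by (simp del: pw)
qed

lemma foldr_psi_not_distinct: "\<not> distinct bs \<Longrightarrow> foldr psi bs F = 0"
proof -
  assume "\<not> distinct bs"
  then obtain xs ys zs y where "bs = xs @ y # ys @ y # zs" by (auto dest: not_distinct_decomp)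
  then show ?thesis using foldr_psi_swap[of xs y ys y zs F] by (auto intro: fun_double_zero simp del: foldr_append foldr.simps pw)
qed

lemma foldr_psi_transpose:
  assumes "distinct bs" "b \<in> set bs" "c \<in> set bs" "b \<noteq> c"
  shows "foldr psi (map (Transposition.transpose b c) bs) F = - foldr psi bs F"
proof -
  have id: "map (Transposition.transpose b c) xs = xs" if "b \<notin> set xs" "c \<notin> set xs" for xs
    using that by (intro map_idI) (metis transpose_apply_other)
  have main: "foldr psi (map (Transposition.transpose b c) bs) F = - foldr psi bs F"
    if "bs = xs @ b' # ys @ c' # zs" "(b' = b \<and> c' = c) \<or> (b' = c \<and> c' = b)" for xs ys zs b' c'
  proof -
    have "map (Transposition.transpose b c) bs = xs @ c' # ys @ b' # zs"
      using that assms(1) id[of xs] id[of ys] id[of zs] by auto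
    then show ?thesis unfolding that(1) by (simp only: foldr_psi_swap[of xs b' ys c' zs] minus_minus)
  qed
  obtain xs zs where bs: "bs = xs @ b # zs" using assms(2) by (meson split_list)
  consider "c \<in> set xs" | "c \<in> set zs" using assms(3,4) bs by auto
  then show ?thesis
  proof cases
    case 1
    then obtain us vs where "xs = us @ c # vs" by (meson split_list)
    then show ?thesis using bs by (intro main[of us c vs b zs]) auto
  next
    case 2
    then obtain us vs where "zs = us @ c # vs" by (meson split_list)
    then show ?thesis using bs by (intro main[of xs b us c vs]) auto
  qed
qed

lemma foldr_psi_permutes:
  assumes "\<sigma> permutes {1..N}"
  shows "foldr psi (map \<sigma> [1..<N+1]) (vac x) {1..N} = sc (of_int (sign \<sigma>)) \<triangleright> x"
proof -
  have fin: "finite {1..N}" by simp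
  from assms fin show ?thesis
  proof (induction \<sigma> rule: permutes_induct)
    case id
    show ?case using foldr_psi_top[of N x] by (simp del: upt_Suc)
  next
    case (swap a b p)
    have "distinct (map p [1..<N+1])" using permutes_inj_on[OF swap.hyps(4)] by (simp add: distinct_map del: upt_Suc)
    moreover have "set (map p [1..<N+1]) = {1..N}"
      using permutes_image[OF swap.hyps(4)] by (simp add: atLeastLessThanSuc_atLeastAtMost del: upt_Suc)
    ultimately have *: "foldr psi (map (Transposition.transpose a b) (map p [1..<N+1])) (vac x)
      = - foldr psi (map p [1..<N+1]) (vac x)" if "a \<noteq> b"
      using swap.hyps that by (intro foldr_psi_transpose) auto
    show ?case
    proof (cases "a = b")
      case True
      then show ?thesis using swap.IH by simp
    next
      case False
      have "permutation p" using swap.hyps(4) fin by (metis permutation_permutes)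
      then have "sign (Transposition.transpose a b \<circ> p) = - sign p"
        using False by (simp add: sign_compose permutation_swap_id sign_swap_id)
      then show ?thesis using *[OF False] swap.IH by (simp add: sc_neg ap_uminus comp_def del: upt_Suc)
    qed
  qed
qed

definition entry :: "(complex \<Rightarrow> nat \<Rightarrow> nat \<Rightarrow> 'i lop) \<Rightarrow> nat \<Rightarrow> nat \<Rightarrow> (complex \<Rightarrow> 'i \<Rightarrow> complex) \<Rightarrow> complex \<Rightarrow> 'i \<Rightarrow> complex" where
  "entry M a b f = (\<lambda>u. (if a = b then f u else 0) - M u a b \<triangleright> f (u - 1))"

text \<open>Fixing the points outside \<open>A\<close> makes an injective choice on
  \<open>{1..N}\<close> a permutation in the sense of \<open>permutes\<close>.\<close>

definition choices :: "nat set \<Rightarrow> nat \<Rightarrow> (nat \<Rightarrow> nat) set" where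
  "choices A N = {\<sigma>. (\<forall>x\<in>A. \<sigma> x \<in> {1..N}) \<and> (\<forall>x. x \<notin> A \<longrightarrow> \<sigma> x = x)}"

lemma finite_choices: "finite A \<Longrightarrow> finite (choices A N)"
proof -
  assume A: "finite A"
  have "choices A N \<subseteq> (\<lambda>\<tau> x. if x \<in> A then \<tau> x else x) ` PiE A (\<lambda>_. {1..N})"
  proof
    fix \<sigma> assume "\<sigma> \<in> choices A N"
    then show "\<sigma> \<in> (\<lambda>\<tau> x. if x \<in> A then \<tau> x else x) ` PiE A (\<lambda>_. {1..N})"
      by (intro image_eqI[of _ _ "restrict \<sigma> A"]) (auto simp: choices_def)
  qed
  then show ?thesis using A by (meson finite_PiE finite_atLeastAtMost finite_imageI finite_subset)
qed

lemma sum_choices_insert: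
  assumes "a \<notin> A"
  shows "(\<Sum>\<sigma>\<in>choices (insert a A) N. G \<sigma>) = (\<Sum>b=1..N. \<Sum>\<sigma>\<in>choices A N. G (\<sigma>(a := b)))"
proof -
  have "(\<Sum>b=1..N. \<Sum>\<sigma>\<in>choices A N. G (\<sigma>(a := b))) = (\<Sum>(b, \<sigma>)\<in>{1..N} \<times> choices A N. G (\<sigma>(a := b)))"
    by (simp add: sum.cartesian_product)
  also have "\<dots> = (\<Sum>\<sigma>\<in>choices (insert a A) N. G \<sigma>)"
    by (rule sum.reindex_bij_witness[of _ "\<lambda>\<sigma>. (\<sigma> a, \<sigma>(a := a))" "\<lambda>(b, \<sigma>). \<sigma>(a := b)"])
      (use assms in \<open>auto simp: choices_def fun_eq_iff\<close>)
  finally show ?thesis ..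
qed

lemma phi_entry:
  assumes "a \<in> {1..N}"
  shows "phi N M a (\<lambda>u. \<Sum>\<sigma>\<in>S. foldr psi (bs \<sigma>) (vac (h \<sigma> u))) u
    = (\<Sum>b=1..N. \<Sum>\<sigma>\<in>S. foldr psi (b # bs \<sigma>) (vac (entry M a b (h \<sigma>) u)))"
proof -
  have foldr_diff: "foldr psi xs (vac (x - y)) = foldr psi xs (vac x) - foldr psi xs (vac y)" for xs :: "nat list" and x y :: "'a \<Rightarrow> complex"
  proof (induction xs)
    case Nil
    show ?case by (rule ext) (simp add: vac_def zero_fun_def fun_diff_def)
  qed (simp add: psi_diff del: pw)
  have foldr_fap: "fap A (foldr psi xs (vac x)) = foldr psi xs (vac (A \<triangleright> x))" for A xs and x :: "'a \<Rightarrow> complex"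
    by (induction xs) (simp_all add: fap_vac psi_fap[symmetric])
  have foldr_0: "foldr psi xs (0 :: nat set \<Rightarrow> 'a \<Rightarrow> complex) = 0" for xs
    by (induction xs) (simp_all del: pw)
  have "(\<Sum>b=1..N. foldr psi (b # xs) (vac (entry M a b g u)))
    = psi a (foldr psi xs (vac (g u))) - nu N (M u) a (foldr psi xs (vac (g (u - 1))))" for xs g
  proof -
    have "foldr psi (b # xs) (vac (entry M a b g u)) = (if b = a then psi a (foldr psi xs (vac (g u))) else 0)
      - fap (M u a b) (psi b (foldr psi xs (vac (g (u - 1)))))" for b
      using foldr_fap[of "M u a b" "b # xs" "g (u - 1)"]
      by (simp add: entry_def foldr_diff foldr_0 psi_diff del: pw)
    then show ?thesis using assms by (simp add: sum_subtractf nu_def del: pw)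
  qed
  then show ?thesis
    by (subst sum.swap) (simp add: phi_def psi_sum nu_sum sum_subtractf del: pw)
qed

lemma Phi_entries:
  assumes "distinct as" "set as \<subseteq> {1..N}"
  shows "Phi N M as (\<lambda>u. vac (f u)) u
    = (\<Sum>\<sigma>\<in>choices (set as) N. foldr psi (map \<sigma> as) (vac (foldr (\<lambda>a. entry M a (\<sigma> a)) as f u)))"
  using assms
proof (induction as arbitrary: u)
  case Nil
  have "choices {} N = {\<lambda>x. x}" by (auto simp: choices_def)
  then show ?case by (simp del: pw)
next
  case (Cons a as)
  have IH: "Phi N M as (\<lambda>u. vac (f u)) = (\<lambda>u. \<Sum>\<sigma>\<in>choices (set as) N.
      foldr psi (map \<sigma> as) (vac (foldr (\<lambda>a. entry M a (\<sigma> a)) as f u)))"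
    by (rule ext, rule Cons.IH) (use Cons.prems in auto)
  have a: "a \<notin> set as" "a \<in> {1..N}" using Cons.prems by auto
  have m: "map (\<sigma>(a := b)) as = map \<sigma> as" for \<sigma> b using a by (simp add: map_idI)
  have F: "foldr (\<lambda>a'. entry M a' ((\<sigma>(a := b)) a')) as f = foldr (\<lambda>a. entry M a (\<sigma> a)) as f" for \<sigma> b
    by (rule foldr_cong) (use a in auto)
  show ?case
    unfolding Phi_Cons IH phi_entry[OF a(2)] list.set sum_choices_insert[OF a(1)]
    by (intro sum.cong refl) (simp only: m F foldr.simps comp_apply fun_upd_same list.map)
qed

text \<open>Expanding the product of one-forms gives a term for every choice of columns. A repeated
  column gives 0, and a permutation contributes its sign.\<close>

lemma dop_permutations:
  "dop N M f u = (\<Sum>\<sigma> | \<sigma> permutes {1..N}. sc (of_int (sign \<sigma>)) \<triangleright> foldr (\<lambda>a. entry M a (\<sigma> a)) [1..<N+1] f u)"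
proof -
  let ?as = "[1..<N+1]"
  have set: "set ?as = {1..N}" by (auto simp del: upt_Suc)
  let ?G = "\<lambda>\<sigma>. foldr psi (map \<sigma> ?as) (vac (foldr (\<lambda>a. entry M a (\<sigma> a)) ?as f u)) {1..N}"
  have "dop N M f u = (\<Sum>\<sigma>\<in>choices {1..N} N. ?G \<sigma>)"
    unfolding dop_def by (subst Phi_entries) (use set in \<open>simp_all add: sum_apply del: upt_Suc\<close>)
  also have "\<dots> = (\<Sum>\<sigma> | \<sigma> permutes {1..N}. ?G \<sigma>)"
  proof (rule sum.mono_neutral_right)
    show "finite (choices {1..N} N)" by (simp add: finite_choices)
    show "{\<sigma>. \<sigma> permutes {1..N}} \<subseteq> choices {1..N} N"
    proof
      fix \<sigma> assume "\<sigma> \<in> {\<sigma>. \<sigma> permutes {1..N}}"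
      then have "\<sigma> permutes {1..N}" by simp
      from permutes_in_image[OF this] permutes_not_in[OF this] show "\<sigma> \<in> choices {1..N} N"
        by (simp add: choices_def)
    qed
    show "\<forall>\<sigma>\<in>choices {1..N} N - {\<sigma>. \<sigma> permutes {1..N}}. ?G \<sigma> = 0"
    proof
      fix \<sigma> assume \<sigma>: "\<sigma> \<in> choices {1..N} N - {\<sigma>. \<sigma> permutes {1..N}}"
      have "\<not> inj_on \<sigma> {1..N}"
      proof
        assume inj: "inj_on \<sigma> {1..N}"
        have "\<sigma> ` {1..N} \<subseteq> {1..N}" using \<sigma> by (auto simp: choices_def)
        then have "bij_betw \<sigma> {1..N} {1..N}" using inj by (simp add: bij_betw_def endo_inj_surj)
        then have "\<sigma> permutes {1..N}" using \<sigma> by (intro bij_imp_permutes) (auto simp: choices_def)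
        then show False using \<sigma> by simp
      qed
      then have "\<not> distinct (map \<sigma> ?as)" unfolding distinct_map set by blast
      show "?G \<sigma> = 0" unfolding foldr_psi_not_distinct[OF \<open>\<not> distinct (map \<sigma> ?as)\<close>] by simp
    qed
  qed
  also have "\<dots> = (\<Sum>\<sigma> | \<sigma> permutes {1..N}. sc (of_int (sign \<sigma>)) \<triangleright> foldr (\<lambda>a. entry M a (\<sigma> a)) ?as f u)"
    by (intro sum.cong refl foldr_psi_permutes) simp
  finally show ?thesis .
qed

section \<open>Tensor products of modules\<close>

definition mod_op :: "(nat \<Rightarrow> nat) \<Rightarrow> (nat \<Rightarrow> nat \<Rightarrow> nat \<Rightarrow> complex mat) \<Rightarrow> nat \<Rightarrow> nat \<Rightarrow> nat \<Rightarrow> (nat \<Rightarrow> nat) lop" where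
  "mod_op r e s a b = slot s (mop (r s) (e s a b))"

lemma multi_indices_upd:
  assumes "p \<notin> multi_indices n r" "p s < r s" "s \<in> {1..n}"
  shows "p(s := k) \<notin> multi_indices n r"
proof
  assume "p(s := k) \<in> multi_indices n r"
  then have *: "\<And>t. t \<in> {1..n} \<Longrightarrow> (p(s := k)) t < r t" "\<And>t. t \<notin> {1..n} \<Longrightarrow> (p(s := k)) t = undefined"
    by (auto simp: multi_indices_def PiE_iff extensional_def)
  have "p t < r t" if "t \<in> {1..n}" for t using *(1)[OF that] assms(2) by (cases "t = s") auto
  moreover have "p t = undefined" if "t \<notin> {1..n}" for t
    using *(2)[OF that] assms(3) that by (cases "t = s") auto
  ultimately show False using assms(1) by (auto simp: multi_indices_def PiE_iff extensional_def)
qed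

text \<open>Outside the multi-indices \<open>on_factor\<close> is 0 by definition. There
  \<open>slot\<close> gives 0 as well on a vector of the tensor space, because changing a coordinate
  that is already in range cannot turn a function into a multi-index.\<close>

lemma on_factor_slot:
  assumes "x \<in> tensor_space n r" "s \<in> {1..n}"
  shows "on_factor n r s A x = slot s (mop (r s) A) \<triangleright> x"
proof
  fix p
  show "on_factor n r s A x p = (slot s (mop (r s) A) \<triangleright> x) p"
  proof (cases "p \<in> multi_indices n r")
    case True
    then have "p s < r s" using assms(2) by (auto simp: multi_indices_def)
    then show ?thesis using True by (simp add: on_factor_def slot_ap mop_ap)
  next
    case False
    then show ?thesis using assms(1) multi_indices_upd[OF False _ assms(2)]
      by (auto simp: on_factor_def slot_ap mop_ap tensor_space_def)
  qed
qed

lemma tensor_space_iff: "x \<in> tensor_space n r \<longleftrightarrow> (\<forall>p. p \<notin> multi_indices n r \<longrightarrow> x p = 0)"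
  by (simp add: tensor_space_def)

lemma op_supp_mod_op:
  assumes "s \<in> {1..n}"
  shows "op_supp (multi_indices n r) (mod_op r e s a b)"
  unfolding op_supp_def mod_op_def
proof (intro allI impI)
  fix x p assume "\<forall>p. p \<notin> multi_indices n r \<longrightarrow> x p = (0 :: complex)" "p \<notin> multi_indices n r"
  then have "on_factor n r s (e s a b) x p = 0" "x \<in> tensor_space n r" by (auto simp: on_factor_def tensor_space_def)
  then show "(slot s (mop (r s) (e s a b)) \<triangleright> x) p = 0" using on_factor_slot[OF _ assms] by metis
qed

lemma finite_multi_indices: "finite (multi_indices n r)"
  by (auto simp: multi_indices_def intro: finite_PiE)

text \<open>Descending, since \<open>T_partial\<close> puts the L-operator of the newest site on the
  left and \<open>Tt\<close> puts the head of the list there.\<close>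

definition site_list :: "nat \<Rightarrow> nat list" where
  "site_list n = rev [1..<n+1]"

lemma set_site_list: "set (site_list n) = {1..n}" by (auto simp: site_list_def simp del: upt_Suc)
lemma distinct_site_list: "distinct (site_list n)" by (simp add: site_list_def del: upt_Suc)

lemma tensor_add: "x \<in> tensor_space n r \<Longrightarrow> y \<in> tensor_space n r \<Longrightarrow> x + y \<in> tensor_space n r"
  by (simp add: tensor_space_iff)
lemma tensor_diff: "x \<in> tensor_space n r \<Longrightarrow> y \<in> tensor_space n r \<Longrightarrow> x - y \<in> tensor_space n r"
  by (simp add: tensor_space_iff)
lemma tensor_0: "0 \<in> tensor_space n r" by (simp add: tensor_space_iff)
lemma tensor_sc: "x \<in> tensor_space n r \<Longrightarrow> sc c \<triangleright> x \<in> tensor_space n r"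
  by (simp add: tensor_space_iff ap_sc)

lemma op_supp_tensor: "op_supp (multi_indices n r) A \<Longrightarrow> x \<in> tensor_space n r \<Longrightarrow> A \<triangleright> x \<in> tensor_space n r"
  by (auto simp: tensor_space_iff op_supp_def)

context
  fixes N n :: nat and r :: "nat \<Rightarrow> nat" and e :: "nat \<Rightarrow> nat \<Rightarrow> nat \<Rightarrow> complex mat" and z :: "nat \<Rightarrow> complex"
begin

lemma tensor_Tt:
  assumes "set ss \<subseteq> {1..n}" "a \<in> {1..N}" "b \<in> {1..N}" "x \<in> tensor_space n r"
  shows "Tt N (mod_op r e) z ss u a b \<triangleright> x \<in> tensor_space n r"
  by (rule op_supp_tensor[OF op_supp_Tt assms(4)]) (use assms op_supp_mod_op in auto)

lemma T_partial_Tt: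
  assumes "x \<in> tensor_space n r" "k \<le> n" "a \<in> {1..N}" "b \<in> {1..N}"
    and "\<And>s. s \<in> {1..n} \<Longrightarrow> u \<noteq> z s"
  shows "T_partial N n r e z k a b u x = sc (1 / ppi z (site_list k) u) \<triangleright> Tt N (mod_op r e) z (site_list k) u a b \<triangleright> x"
  using assms(2,3)
proof (induction k arbitrary: a)
  case 0
  then show ?case by (intro ext) (simp add: site_list_def ppi_def ap_sc)
next
  case (Suc k)
  have sl: "site_list (Suc k) = Suc k # site_list k" by (simp add: site_list_def)
  let ?g = "1 / ppi z (site_list k) u" and ?T = "\<lambda>c. Tt N (mod_op r e) z (site_list k) u c b \<triangleright> x"
  have nz: "u - z (Suc k) \<noteq> 0" using assms(5)[of "Suc k"] Suc.prems by simp
  have mem: "sc ?g \<triangleright> ?T c \<in> tensor_space n r" if "c \<in> {1..N}" for c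
    using that Suc.prems assms by (intro tensor_sc tensor_Tt) (auto simp: set_site_list)
  have L: "L_op n r e z (Suc k) a c u (sc ?g \<triangleright> ?T c)
    = sc (1 / (u - z (Suc k)) * ?g) \<triangleright> Lt (mod_op r e) z (Suc k) u a c \<triangleright> ?T c" if "c \<in> {1..N}" for c
  proof -
    have "on_factor n r (Suc k) (e (Suc k) c a) (sc ?g \<triangleright> ?T c) = sc ?g \<triangleright> mod_op r e (Suc k) c a \<triangleright> ?T c"
      using on_factor_slot[OF mem[OF that], of "Suc k"] Suc.prems by (simp add: mod_op_def ap_sc_comm)
    moreover have "ppi z (site_list k) u \<noteq> 0"
      using assms(5) Suc.prems by (auto simp: ppi_0_iff set_site_list)
    ultimately show ?thesis using nz
      by (intro ext) (auto simp: L_op_def Lt_def ap_sc ap_plus field_simps)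
  qed
  show ?case
  proof
    fix p
    have "T_partial N n r e z (Suc k) a b u x p = (\<Sum>c=1..N. L_op n r e z (Suc k) a c u (sc ?g \<triangleright> ?T c) p)"
      using Suc.IH Suc.prems by (auto intro!: sum.cong)
    also have "\<dots> = (\<Sum>c=1..N. (sc (1 / (u - z (Suc k)) * ?g) \<triangleright> Lt (mod_op r e) z (Suc k) u a c \<triangleright> ?T c) p)"
      using L by (intro sum.cong refl) simp
    also have "\<dots> = (sc (1 / ppi z (site_list (Suc k)) u) \<triangleright> Tt N (mod_op r e) z (site_list (Suc k)) u a b \<triangleright> x) p"
      by (simp add: sl ppi_def sum_ap sum_apply ap_times ap_sc sum_distrib_left)
    finally show "T_partial N n r e z (Suc k) a b u x p
      = (sc (1 / ppi z (site_list (Suc k)) u) \<triangleright> Tt N (mod_op r e) z (site_list (Suc k)) u a b \<triangleright> x) p" .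
  qed
qed

abbreviation "MM q \<equiv> Mt N (mod_op r e) z q (site_list n)"

lemma tensor_Mt:
  assumes "a \<in> {1..N}" "b \<in> {1..N}" "x \<in> tensor_space n r"
  shows "MM q u a b \<triangleright> x \<in> tensor_space n r"
  unfolding Mt_def ap_times using assms by (intro tensor_sc tensor_Tt) (auto simp: set_site_list)

lemma X_op_entry:
  assumes "\<And>u. f u \<in> tensor_space n r" "a \<in> {1..N}" "b \<in> {1..N}" "\<And>s. s \<in> {1..n} \<Longrightarrow> u \<noteq> z s"
  shows "X_op N n r e z (diagonal q) a b f u = entry (MM q) a b f u"
proof
  fix p
  have "(\<Sum>c=1..N. diagonal q a c * T_op N n r e z c b u (f (u - 1)) p)
    = (\<Sum>c=1..N. if c = a then q a * T_op N n r e z a b u (f (u - 1)) p else 0)"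
    by (intro sum.cong refl) (simp add: diagonal_def)
  also have "\<dots> = q a * T_op N n r e z a b u (f (u - 1)) p" using assms(2) by simp
  also have "\<dots> = (MM q u a b \<triangleright> f (u - 1)) p"
    unfolding T_op_def by (subst T_partial_Tt) (use assms in \<open>auto simp: Mt_def ap_times ap_sc\<close>)
  finally show "X_op N n r e z (diagonal q) a b f u p = entry (MM q) a b f u p"
    by (simp add: X_op_def entry_def)
qed

lemma tensor_entry:
  assumes "\<And>u. g u \<in> tensor_space n r" "a \<in> {1..N}" "b \<in> {1..N}"
  shows "entry (MM q) a b g u \<in> tensor_space n r"
  unfolding entry_def
proof (rule tensor_diff)
  show "(if a = b then g u else 0) \<in> tensor_space n r" using assms(1) tensor_0 by (cases "a = b") auto
qed (rule tensor_Mt[OF assms(2,3,1)])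

lemma X_op_local: "f u = g u \<Longrightarrow> f (u - 1) = g (u - 1) \<Longrightarrow> X_op N n r e z Q a b f u = X_op N n r e z Q a b g u"
  by (simp add: X_op_def cong: if_cong)

text \<open>Membership in the tensor space is carried along, at every u, because the comparison of a
  single entry relies on it. The equality is restricted to u whose relevant shifts avoid the sites:
  at a pole the two descriptions have different junk values.\<close>

lemma foldr_X_op:
  assumes "\<And>u. f u \<in> tensor_space n r" "set as \<subseteq> {1..N}" "\<And>a. a \<in> set as \<Longrightarrow> \<sigma> a \<in> {1..N}"
  shows "foldr (\<lambda>a. entry (MM q) a (\<sigma> a)) as f u \<in> tensor_space n r \<and>
    ((\<forall>k<length as. \<forall>s\<in>{1..n}. u - of_nat k \<noteq> z s) \<longrightarrow>
    foldr (\<lambda>a. X_op N n r e z (diagonal q) a (\<sigma> a)) as f u = foldr (\<lambda>a. entry (MM q) a (\<sigma> a)) as f u)"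
  using assms(2,3)
proof (induction as arbitrary: u)
  case Nil
  then show ?case using assms(1) by simp
next
  case (Cons a as)
  let ?g = "foldr (\<lambda>a. entry (MM q) a (\<sigma> a)) as f" and ?h = "foldr (\<lambda>a. X_op N n r e z (diagonal q) a (\<sigma> a)) as f"
  have g: "?g u \<in> tensor_space n r" and eq: "(\<forall>k<length as. \<forall>s\<in>{1..n}. u - of_nat k \<noteq> z s) \<Longrightarrow> ?h u = ?g u" for u
    using Cons by auto
  have a: "a \<in> {1..N}" "\<sigma> a \<in> {1..N}" using Cons.prems by auto
  have mem: "entry (MM q) a (\<sigma> a) ?g u \<in> tensor_space n r"
    by (rule tensor_entry[OF g a])
  moreover have "X_op N n r e z (diagonal q) a (\<sigma> a) ?h u = entry (MM q) a (\<sigma> a) ?g u"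
    if u: "\<forall>k<length (a # as). \<forall>s\<in>{1..n}. u - of_nat k \<noteq> z s"
  proof -
    have "?h u = ?g u" by (rule eq) (use u in auto)
    moreover have "?h (u - 1) = ?g (u - 1)"
    proof (rule eq, intro allI impI ballI)
      fix k s assume "k < length as" "s \<in> {1..n}"
      then show "u - 1 - of_nat k \<noteq> z s" using u[rule_format, of "Suc k" s] by (simp add: algebra_simps)
    qed
    ultimately have "X_op N n r e z (diagonal q) a (\<sigma> a) ?h u = X_op N n r e z (diagonal q) a (\<sigma> a) ?g u"
      by (rule X_op_local)
    also have "\<dots> = entry (MM q) a (\<sigma> a) ?g u"
      by (rule X_op_entry) (use g a u[rule_format, of 0] in auto)
    finally show ?thesis .
  qed
  ultimately show ?case by simp
qed

lemma universal_difference_operator_dop: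
  assumes "\<And>u. f u \<in> tensor_space n r" "good_point N z {1..n} u"
  shows "universal_difference_operator N n r e z (diagonal q) f u = dop N (MM q) f u"
proof
  fix p
  have "foldr (\<lambda>a. X_op N n r e z (diagonal q) a (\<sigma> a)) [1..<N+1] f u
    = foldr (\<lambda>a. entry (MM q) a (\<sigma> a)) [1..<N+1] f u" if "\<sigma> permutes {1..N}" for \<sigma>
  proof (rule foldr_X_op[THEN conjunct2, rule_format])
    show "\<sigma> a \<in> {1..N}" if "a \<in> set [1..<N+1]" for a
      using that permutes_in_image[OF \<open>\<sigma> permutes {1..N}\<close>, of a] by (auto simp del: upt_Suc)
  qed (use assms in \<open>auto simp: good_point_def simp del: upt_Suc\<close>)
  then show "universal_difference_operator N n r e z (diagonal q) f u p = dop N (MM q) f u p"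
    unfolding universal_difference_operator_def dop_permutations
    by (simp add: sum_apply ap_sc del: upt_Suc)
qed

lemma in_difference_kernel_dop:
  assumes "\<And>u. f u \<in> tensor_space n r"
  shows "in_difference_kernel N n r e z (diagonal q) f
    \<longleftrightarrow> (\<forall>u. good_point N z {1..n} u \<longrightarrow> dop N (MM q) f u = 0)"
  unfolding in_difference_kernel_def good_point_def[symmetric]
  using universal_difference_operator_dop[OF assms] by (auto simp: zero_fun_def)

end

section \<open>Existence of solutions with prescribed initial values\<close>

text \<open>Support in a product of sets, one for each coordinate. In this form an operator on one
  factor replaces a single set, so the effect of \<open>slots\<close> can be followed site by
  site.\<close>

definition vanishes :: "(nat \<Rightarrow> nat set) \<Rightarrow> tensor \<Rightarrow> bool" where
  "vanishes D x \<longleftrightarrow> (\<forall>p. (\<exists>t. p t \<notin> D t) \<longrightarrow> x p = 0)"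

lemma slot_vanishes:
  assumes "vanishes D x" "\<And>y i. i \<notin> R \<Longrightarrow> (A \<triangleright> y) i = 0"
  shows "vanishes (D(s := R)) (slot s A \<triangleright> x)"
  unfolding vanishes_def
proof (intro allI impI)
  fix p assume "\<exists>t. p t \<notin> (D(s := R)) t"
  then obtain t where t: "p t \<notin> (D(s := R)) t" by blast
  show "(slot s A \<triangleright> x) p = 0"
  proof (cases "t = s")
    case True
    then show ?thesis using t assms(2) by (simp add: slot_ap)
  next
    case False
    then have "x (p(s := w)) = 0" for w using assms(1) t unfolding vanishes_def by (metis fun_upd_apply)
    then have "(\<lambda>w. x (p(s := w))) = 0" by auto
    then show ?thesis by (simp only: slot_ap ap_0 zero_fun_apply)
  qed
qed

lemma slots_vanishes:
  assumes "vanishes D x" "\<And>s y i. s \<in> set ss \<Longrightarrow> i \<notin> R s \<Longrightarrow> (A s \<triangleright> y) i = 0"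
  shows "vanishes (\<lambda>t. if t \<in> set ss then R t else D t) (slots A ss \<triangleright> x)"
  using assms(2)
proof (induction ss)
  case Nil
  then show ?case using assms(1) by (simp add: slots_def)
next
  case (Cons s ss)
  have "vanishes ((\<lambda>t. if t \<in> set ss then R t else D t)(s := R s)) (slot s (A s) \<triangleright> slots A ss \<triangleright> x)"
    by (rule slot_vanishes) (use Cons in auto)
  moreover have "(\<lambda>t. if t \<in> set ss then R t else D t)(s := R s) = (\<lambda>t. if t \<in> set (s # ss) then R t else D t)" by (rule ext) simp
  ultimately show ?case by (simp add: slots_def ap_times)
qed

lemma PiE_iff_all: "p \<in> PiE A R \<longleftrightarrow> (\<forall>t. p t \<in> (if t \<in> A then R t else {undefined}))"
  by (auto simp: PiE_iff extensional_def)

lemma tensor_vanishes: "x \<in> tensor_space n r \<longleftrightarrow> vanishes (\<lambda>t. if t \<in> {1..n} then {..<r t} else {undefined}) x"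
  unfolding tensor_space_def vanishes_def multi_indices_def PiE_iff_all by (simp del: atLeastAtMost_iff)

lemma slots_one:
  assumes "x \<in> tensor_space n r" "set ss \<subseteq> {1..n}"
  shows "slots (\<lambda>s. mop (r s) (1\<^sub>m (r s))) ss \<triangleright> x = x"
  using assms(2)
proof (induction ss)
  case (Cons s ss)
  have "slot s (mop (r s) (1\<^sub>m (r s))) \<triangleright> x = x"
  proof
    fix p
    show "(slot s (mop (r s) (1\<^sub>m (r s))) \<triangleright> x) p = x p"
    proof (cases "p s < r s")
      case True
      then have "(\<Sum>l<r s. 1\<^sub>m (r s) $$ (p s, l) * x (p(s := l))) = (\<Sum>l<r s. if p s = l then x (p(s := l)) else 0)"
        by (intro sum.cong refl) auto
      then show ?thesis using True by (simp add: slot_ap mop_ap)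
    next
      case False
      then have "p \<notin> multi_indices n r" using Cons.prems by (auto simp: multi_indices_def)
      then show ?thesis using False assms(1) by (simp add: slot_ap mop_ap tensor_space_def)
    qed
  qed
  then show ?case using Cons by (simp add: slots_def ap_times)
qed (simp add: slots_def)

definition embeds where
  "embeds N r e k c I K \<longleftrightarrow> (\<forall>t<k. wop (murphy N t) * I = sc (c t) * I) \<and>
    (\<forall>a\<in>{1..N}. \<forall>b\<in>{1..N}. wop (gl_total k a b) * I = I * mop r (e a b)) \<and>
    K * I = mop r (1\<^sub>m r) \<and> (\<forall>x i. list_decode i \<notin> words N k \<longrightarrow> (I \<triangleright> x) i = 0) \<and>
    (\<forall>x i. r \<le> i \<longrightarrow> (K \<triangleright> x) i = 0)"

lemma dominant_weight_nat:
  assumes "integral_dominant N \<Lambda>" "\<Lambda> N = 0"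
  obtains hw where "\<And>a. a \<in> {1..N} \<Longrightarrow> \<Lambda> a = of_nat (hw a)" "\<And>a. a \<in> {1..<N} \<Longrightarrow> hw (Suc a) \<le> hw a"
proof -
  have nat: "\<Lambda> a \<in> \<nat>" if "1 \<le> a" "a \<le> N" for a
    using that(2,1)
  proof (induction a rule: inc_induct)
    case base
    then show ?case using assms(2) by simp
  next
    case (step a)
    have "\<Lambda> a - \<Lambda> (a + 1) \<in> \<nat>" using assms(1) step by (auto simp: integral_dominant_def)
    then have "\<Lambda> a - \<Lambda> (a + 1) + \<Lambda> (a + 1) \<in> \<nat>" using step by (intro Nats_add) auto
    then show ?case by simp
  qed
  define hw where "hw = (\<lambda>a. nat \<lfloor>Re (\<Lambda> a)\<rfloor>)"
  have hw: "\<Lambda> a = of_nat (hw a)" if "a \<in> {1..N}" for a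
    using nat[of a] that by (auto elim!: Nats_cases simp: hw_def)
  moreover have "hw (Suc a) \<le> hw a" if a: "a \<in> {1..<N}" for a
  proof -
    have "\<Lambda> a - \<Lambda> (a + 1) \<in> \<nat>" using assms(1) a by (auto simp: integral_dominant_def)
    then obtain d where "of_nat (hw a) - of_nat (hw (Suc a)) = (of_nat d :: complex)"
      using hw[of a] hw[of "Suc a"] a by (auto elim: Nats_cases)
    then have "of_nat (hw a) = (of_nat (d + hw (Suc a)) :: complex)" by (simp add: algebra_simps)
    then have "hw a = d + hw (Suc a)" by (simp only: of_nat_eq_iff)
    then show ?thesis by simp
  qed
  ultimately show ?thesis by (rule that)
qed

lemma box_op_units: "matrix_units N (box_op p)"
  unfolding matrix_units_def box_op_def
  by (auto simp: slot_mult[symmetric] wop_mult[symmetric] letter_units wop_0 slot_0)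

lemma box_op_sites: "gl_sites N box_op S"
  unfolding gl_sites_def
proof (intro conjI ballI impI)
  show "gl_rel N (box_op p)" for p by (rule matrix_units_gl_rel[OF box_op_units])
  fix p p' :: "nat \<times> nat" and a b c d assume "p \<noteq> p'"
  then consider "fst p \<noteq> fst p'" | "fst p = fst p'" "snd p \<noteq> snd p'" by (auto simp: prod_eq_iff)
  then show "box_op p a b * box_op p' c d = box_op p' c d * box_op p a b"
  proof cases
    case 1
    then show ?thesis unfolding box_op_def by (rule slot_comm)
  next
    case 2
    then show ?thesis unfolding box_op_def by (simp add: slot_mult[symmetric] wop_mult[symmetric] letter_comm)
  qed
qed

lemma op_supp_box_op:
  assumes "s \<in> A" "a \<in> {1..N}" "b \<in> {1..N}"
  shows "op_supp (PiE A (\<lambda>s. list_encode ` words N (k s))) (box_op (s, j) a b)"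
  unfolding op_supp_def
proof (intro allI impI)
  let ?I = "PiE A (\<lambda>s. list_encode ` words N (k s))"
  fix x :: tensor and p assume x: "\<forall>p. p \<notin> ?I \<longrightarrow> x p = 0" and p: "p \<notin> ?I"
  let ?w = "list_decode (p s)"
  have "x (p(s := list_encode (?w[j := b]))) = 0" if "j < length ?w" "?w ! j = a"
  proof (rule x[rule_format], rule notI)
    assume m: "p(s := list_encode (?w[j := b])) \<in> ?I"
    then have "list_encode (?w[j := b]) \<in> list_encode ` words N (k s)" using assms(1) by (auto dest: PiE_mem[where x = s])
    then have "?w[j := b] \<in> words N (k s)" by (metis imageE list_encode_inverse)
    then have "?w \<in> words N (k s)" by (rule words_update) (use that assms in auto)
    then have "p s \<in> list_encode ` words N (k s)" by (metis image_eqI list_decode_inverse)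
    then have "p \<in> ?I" using m assms(1) unfolding PiE_iff_all by (metis fun_upd_apply)
    then show False using p by simp
  qed
  then show "(box_op (s, j) a b \<triangleright> x) p = 0" by (simp add: box_op_def slot_ap wop_ap letter_ap)
qed

lemma distinct_box_sites: "distinct ss \<Longrightarrow> distinct (box_sites k ss)"
  by (induction ss) (auto simp: box_sites_def distinct_map inj_on_def)

lemma Phi_intertwine:
  assumes "\<And>k a b. k < length as \<Longrightarrow> a \<in> {1..N} \<Longrightarrow> b \<in> {1..N} \<Longrightarrow> M' (u - of_nat k) a b * J = J * M (u - of_nat k) a b"
    and "set as \<subseteq> {1..N}"
  shows "Phi N M' as (\<lambda>u. fap J (F u)) u = fap J (Phi N M as F u)"
  using assms
proof (induction as arbitrary: u)
  case (Cons a as)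
  have 1: "Phi N M' as (\<lambda>u. fap J (F u)) u = fap J (Phi N M as F u)"
    by (rule Cons.IH) (use Cons.prems in auto)
  have 2: "Phi N M' as (\<lambda>u. fap J (F u)) (u - 1) = fap J (Phi N M as F (u - 1))"
  proof (rule Cons.IH)
    fix k a b assume "k < length as" "a \<in> {1..N}" "b \<in> {1..N}"
    then show "M' (u - 1 - of_nat k) a b * J = J * M (u - 1 - of_nat k) a b"
      using Cons.prems(1)[of "Suc k" a b] by (simp add: algebra_simps)
  qed (use Cons.prems in auto)
  have "nu N (M' u) a (fap J G) = fap J (nu N (M u) a G)" for G
    unfolding nu_def fap_sum
    using Cons.prems(1)[of 0 a] Cons.prems(2) by (intro sum.cong refl) (simp add: psi_fap fap_times[symmetric])
  then show ?case by (simp add: phi_def 1 2 psi_fap fap_diff del: pw)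
qed simp

lemma dop_intertwine:
  assumes "\<And>k a b. k < N \<Longrightarrow> a \<in> {1..N} \<Longrightarrow> b \<in> {1..N} \<Longrightarrow> M' (u - of_nat k) a b * J = J * M (u - of_nat k) a b"
  shows "dop N M' (\<lambda>u. J \<triangleright> g u) u = J \<triangleright> dop N M g u"
proof -
  have "Phi N M' [1..<N+1] (\<lambda>u. fap J (vac (g u))) u = fap J (Phi N M [1..<N+1] (\<lambda>u. vac (g u)) u)"
    by (rule Phi_intertwine) (use assms in \<open>auto simp del: upt_Suc\<close>)
  then show ?thesis unfolding dop_def fap_vac by (simp add: fap_def del: upt_Suc)
qed

lemma dop_leading:
  assumes "\<And>k. k \<in> {1..N} \<Longrightarrow> h (u - of_nat k) = 0"
  shows "dop N (Mt N e z q ss) h u = h u"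
proof -
  have "dop N (Mt N e z q ss) h u = (\<Sum>k\<in>{0}. sc (gprod (\<lambda>u. 1 / ppi z ss u) k u) \<triangleright> shift_coeff N e z q ss h k u)"
    unfolding dop_shift_coeff by (rule sum.mono_neutral_right) (use assms in \<open>auto simp: shift_coeff_zero\<close>)
  then show ?thesis by (simp add: shift_coeff_0 gprod_def)
qed

lemma qsum_ap: "qsum A \<theta> d (\<lambda>Q k. B \<triangleright> C Q k) u = B \<triangleright> qsum A \<theta> d C u"
proof -
  have eq: "qsum A \<theta> d C u = (\<Sum>Q\<in>A. sc (power_with_arg \<theta> Q u) \<triangleright> (\<Sum>k\<le>d. sc (u ^ k) \<triangleright> C Q k))" for C :: "complex \<Rightarrow> nat \<Rightarrow> 'i \<Rightarrow> complex"
    by (rule ext) (simp add: qsum_def sum_apply ap_sc)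
  show ?thesis unfolding eq ap_sum ap_sc_comm[of B] ..
qed

lemma qsum_diff: "qsum A \<theta> d (\<lambda>Q k. C Q k - C' Q k) u = qsum A \<theta> d C u - qsum A \<theta> d C' u"
  by (rule ext) (simp add: qsum_def sum_subtractf right_diff_distrib)

lemma qsum_cont: "isCont (\<lambda>u. qsum A \<theta> d C u i) u"
  unfolding qsum_def power_with_arg_def by (intro continuous_intros)

text \<open>A purely imaginary w whose imaginary part exceeds all |Im p| differs from every p by a
  non-real number.\<close>

lemma non_integer_shift:
  assumes "finite (P :: complex set)"
  shows "\<exists>w. \<forall>p\<in>P. w - p \<notin> \<int>"
proof (intro exI ballI notI)
  fix p assume p: "p \<in> P" and "Complex 0 (1 + (\<Sum>p\<in>P. \<bar>Im p\<bar>)) - p \<in> \<int>"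
  then obtain k where k: "Complex 0 (1 + (\<Sum>p\<in>P. \<bar>Im p\<bar>)) - p = of_int k" by (auto elim: Ints_cases)
  have "Im (Complex 0 (1 + (\<Sum>p\<in>P. \<bar>Im p\<bar>)) - p) = 0" unfolding k by simp
  moreover have "\<bar>Im p\<bar> \<le> (\<Sum>p\<in>P. \<bar>Im p\<bar>)" by (rule member_le_sum) (use p assms in auto)
  ultimately show False by simp
qed

text \<open>Every good point is a limit of points outside a finite set, and the operator is
  continuous there. This disposes of the poles of the boxes that are not poles of the
  module.\<close>

lemma dop_zero_continuous:
  assumes "\<And>i u. isCont (\<lambda>u. g u i) u" "finite S"
    and "\<And>u. u \<notin> S \<Longrightarrow> dop N (Mt N e z q ss) g u = 0" "good_point N z (set ss) u"
  shows "dop N (Mt N e z q ss) g u = 0"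
proof -
  define t where "t = (\<lambda>m. u + 1 / of_nat (Suc m))"
  have inj: "inj t" by (auto simp: t_def inj_def)
  have "finite {m. t m \<in> S}" using finite_vimageI[OF assms(2) inj] by (simp add: vimage_def)
  then obtain m0 where m0: "\<And>m. t m \<in> S \<Longrightarrow> m < m0" by (metis (mono_tags, lifting) finite_nat_set_iff_bounded mem_Collect_eq)
  have "(\<lambda>m. 1 / of_nat (Suc m) :: complex) \<longlonglongrightarrow> 0"
    using LIMSEQ_Suc[OF lim_1_over_n] by simp
  then have "t \<longlonglongrightarrow> u + 0" unfolding t_def by (intro tendsto_add tendsto_const)
  then have t: "(\<lambda>m. t (m + m0)) \<longlonglongrightarrow> u" using LIMSEQ_ignore_initial_segment by fastforce
  have "vconv (\<lambda>m. dop N (Mt N e z q ss) g (t (m + m0))) (dop N (Mt N e z q ss) g u)"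
  proof (rule vconv_dop[where f = "\<lambda>_. g" and zm = "\<lambda>_. z", OF _ _ _ t])
    show "vconv (\<lambda>m. g (t (m + m0) - of_nat k)) (g (u - of_nat k))" for k
      unfolding vconv_def using t
      by (auto intro!: isCont_tendsto_compose[OF assms(1)] tendsto_diff)
  qed (use assms(4) in auto)
  moreover have "dop N (Mt N e z q ss) g (t (m + m0)) = 0" for m
    by (rule assms(3)) (use m0[of "m + m0"] in auto)
  ultimately show ?thesis using vconv_unique[of "\<lambda>m. 0"] by (metis (no_types, lifting) ext vconv_const)
qed

text \<open>The initial values are embedded by \<open>J\<close>, solved for on the boxes and
  projected back by \<open>P\<close>. The point is that the solution never leaves the image of
  \<open>J\<close>, so that projecting it does not destroy the equation.\<close>

lemma module_solution:
  assumes N: "1 \<le> N"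
    and args: "has_args (q ` {1..N}) \<theta>"
    and dom: "\<And>s. s \<in> {1..n} \<Longrightarrow> integral_dominant N (\<Lambda> s)" "\<And>s. s \<in> {1..n} \<Longrightarrow> \<Lambda> s N = 0"
    and irr: "\<And>s. s \<in> {1..n} \<Longrightarrow> irreducible_highest_weight_module N (\<Lambda> s) (r s) (e s)"
  shows "\<exists>w. (\<forall>s\<in>{1..n}. w - z s \<notin> \<int>) \<and> (\<forall>v. (\<forall>j. v j \<in> tensor_space n r) \<longrightarrow>
    (\<exists>C d. (\<forall>Q k. C Q k \<in> tensor_space n r) \<and>
      (\<forall>u. good_point N z {1..n} u \<longrightarrow> dop N (Mt N (mod_op r e) z q (site_list n)) (qsum (q ` {1..N}) \<theta> d C) u = 0) \<and>
      (\<forall>j\<in>{1..N}. qsum (q ` {1..N}) \<theta> d C (w - of_nat j) = v j)))"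
proof -
  let ?ss = "site_list n" and ?A = "q ` {1..N}"
  have "\<exists>k c I K. s \<in> {1..n} \<longrightarrow> embeds N (r s) (e s) k c I K" for s
  proof (cases "s \<in> {1..n}")
    case True
    obtain hw where hw: "\<And>a. a \<in> {1..N} \<Longrightarrow> \<Lambda> s a = of_nat (hw a)" "\<And>a. a \<in> {1..<N} \<Longrightarrow> hw (Suc a) \<le> hw a"
      using dominant_weight_nat[OF dom(1)[OF True] dom(2)[OF True]] by blast
    have "\<exists>k c I K. embeds N (r s) (e s) k c I K"
      unfolding embeds_def by (rule embedding_ops[OF irr[OF True], of hw]) (use hw in auto)
    then show ?thesis by blast
  next
    case False
    then show ?thesis by blast
  qed
  then obtain k c I K where emb: "\<And>s. s \<in> {1..n} \<Longrightarrow> embeds N (r s) (e s) (k s) (c s) (I s) (K s)" by metis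
  define bs where "bs = box_sites k ?ss"
  define zV where "zV = (\<lambda>p :: nat \<times> nat. z (fst p) - c (fst p) (snd p))"
  define J where "J = slots I ?ss"
  define P where "P = slots K ?ss"
  define IV where "IV = PiE {1..n} (\<lambda>s. list_encode ` words N (k s))"
  let ?V = "Mt N box_op zV q bs" and ?M = "Mt N (mod_op r e) z q ?ss"
  note set_site_list[simp] distinct_site_list[simp]
  obtain w where w0: "\<forall>p\<in>z ` {1..n} \<union> zV ` set bs. w - p \<notin> \<int>"
    using non_integer_shift[of "z ` {1..n} \<union> zV ` set bs"] by auto
  then have w: "\<And>s. s \<in> {1..n} \<Longrightarrow> w - z s \<notin> \<int>" "\<And>s. s \<in> set bs \<Longrightarrow> w - zV s \<notin> \<int>" by auto
  have finIV: "finite IV" unfolding IV_def by (intro finite_PiE finite_imageI finite_words) auto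
  have bs_fst: "fst p \<in> {1..n}" if "p \<in> set bs" for p using that by (auto simp: bs_def box_sites_def)
  have PJ: "P \<triangleright> J \<triangleright> x = x" if "x \<in> tensor_space n r" for x
  proof -
    have "P * J = slots (\<lambda>s. K s * I s) ?ss" unfolding P_def J_def by (rule slots_mult) simp
    also have "\<dots> = slots (\<lambda>s. mop (r s) (1\<^sub>m (r s))) ?ss"
      unfolding slots_def using emb by (intro arg_cong[of _ _ prod_list] map_cong refl) (auto simp: embeds_def)
    finally show ?thesis using slots_one[OF that, of ?ss] by (simp add: ap_times[symmetric])
  qed
  have J_supp: "(J \<triangleright> x) p = 0" if x: "x \<in> tensor_space n r" and p: "p \<notin> IV" for x p
  proof -
    have "vanishes (\<lambda>t. if t \<in> set ?ss then list_encode ` words N (k t) else (if t \<in> {1..n} then {..<r t} else {undefined})) (J \<triangleright> x)"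
      unfolding J_def
    proof (rule slots_vanishes[OF x[unfolded tensor_vanishes]])
      fix s y i assume s: "s \<in> set ?ss" "i \<notin> list_encode ` words N (k s)"
      have "list_decode i \<notin> words N (k s)" using s(2) by (metis image_eqI list_decode_inverse)
      then show "(I s \<triangleright> y) i = 0" using emb[of s] s(1) by (auto simp: embeds_def)
    qed
    moreover have "\<exists>t. p t \<notin> (if t \<in> {1..n} then list_encode ` words N (k t) else {undefined})"
      using p unfolding IV_def PiE_iff_all by blast
    then have "\<exists>t. p t \<notin> (if t \<in> set ?ss then list_encode ` words N (k t) else (if t \<in> {1..n} then {..<r t} else {undefined}))"
      by (auto split: if_splits)
    ultimately show ?thesis unfolding vanishes_def by blast
  qed
  have P_supp: "P \<triangleright> y \<in> tensor_space n r" if "\<And>p. p \<notin> IV \<Longrightarrow> y p = 0" for y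
  proof -
    have "vanishes (\<lambda>t. if t \<in> {1..n} then list_encode ` words N (k t) else {undefined}) y"
      unfolding vanishes_def using that unfolding IV_def PiE_iff_all by blast
    then have "vanishes (\<lambda>t. if t \<in> set ?ss then {..<r t} else (if t \<in> {1..n} then list_encode ` words N (k t) else {undefined})) (P \<triangleright> y)"
      unfolding P_def by (rule slots_vanishes) (use emb in \<open>auto simp: embeds_def\<close>)
    moreover have "(\<lambda>t. if t \<in> set ?ss then {..<r t} else (if t \<in> {1..n} then list_encode ` words N (k t) else {undefined}))
      = (\<lambda>t. if t \<in> {1..n} then {..<r t} else {undefined})" by (rule ext) simp
    ultimately show ?thesis unfolding tensor_vanishes by simp
  qed
  have inter: "?V u a b * J = J * ?M u a b"
    if "a \<in> {1..N}" "b \<in> {1..N}" "ppi z ?ss u \<noteq> 0" "ppi zV bs u \<noteq> 0" for u a b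
  proof -
    have *: "sc (ppi z ?ss u) * Tt N box_op zV bs u a b * J = sc (ppi zV bs u) * (J * Tt N (mod_op r e) z ?ss u a b)"
      unfolding J_def zV_def bs_def mod_op_def[abs_def]
      by (rule box_intertwine) (use that emb in \<open>auto simp: embeds_def\<close>)
    have "q a / (ppi z ?ss u * ppi zV bs u) * ppi z ?ss u = q a / ppi zV bs u" using that by simp
    then have "?V u a b * J = sc (q a / (ppi z ?ss u * ppi zV bs u) * ppi z ?ss u) * Tt N box_op zV bs u a b * J"
      unfolding Mt_def by (simp only:)
    also have "\<dots> = sc (q a / (ppi z ?ss u * ppi zV bs u)) * (sc (ppi z ?ss u) * Tt N box_op zV bs u a b * J)"
      by (simp only: sc_mult mult.assoc)
    also have "\<dots> = sc (q a / (ppi z ?ss u * ppi zV bs u)) * sc (ppi zV bs u) * (J * Tt N (mod_op r e) z ?ss u a b)"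
      unfolding * by (rule mult.assoc[symmetric])
    also have "\<dots> = J * ?M u a b"
      unfolding Mt_def sc_mult[symmetric] sc_left_comm[of J] using that by simp
    finally show ?thesis .
  qed
  have dop_inter: "dop N ?V (\<lambda>u. J \<triangleright> g u) u = J \<triangleright> dop N ?M g u"
    if "good_point N z {1..n} u" "good_point N zV (set bs) u" for g u
    by (rule dop_intertwine, rule inter) (use that in \<open>auto simp: ppi_0_iff good_point_def\<close>)
  have supV: "op_supp IV (box_op p a b)" if "p \<in> set bs" "a \<in> {1..N}" "b \<in> {1..N}" for p a b
    using op_supp_box_op[OF bs_fst[OF that(1)] that(2,3), of k "snd p"] by (simp add: IV_def)
  have dop_tensor: "dop N ?M g u \<in> tensor_space n r" if "\<And>u. g u \<in> tensor_space n r" for g u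
    unfolding tensor_space_def
  proof (intro CollectI allI impI, rule dop_supp)
    show "op_supp (multi_indices n r) (mod_op r e s a b)" if "s \<in> set ?ss" for s a b using that by (simp add: op_supp_mod_op)
    show "g u p = 0" if "p \<notin> multi_indices n r" for u p
      using \<open>\<And>u. g u \<in> tensor_space n r\<close> that by (auto simp: tensor_space_def)
  qed
  have gp: "good_point N z {1..n} (w + of_nat j)" "good_point N zV (set bs) (w + of_nat j)" for j
    using w by (auto intro!: good_point_generic)
  have "\<exists>C d. (\<forall>Q k. C Q k \<in> tensor_space n r) \<and>
      (\<forall>u. good_point N z {1..n} u \<longrightarrow> dop N ?M (qsum ?A \<theta> d C) u = 0) \<and>
      (\<forall>j\<in>{1..N}. qsum ?A \<theta> d C (w - of_nat j) = v j)" if v: "\<forall>j. v j \<in> tensor_space n r" for v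
  proof -
    obtain C d where C: "\<forall>Q k i. i \<notin> IV \<longrightarrow> C Q k i = 0"
      and ker: "\<forall>u. good_point N zV (set bs) u \<longrightarrow> dop N ?V (qsum ?A \<theta> d C) u = 0"
      and init: "\<forall>j\<in>{1..N}. qsum ?A \<theta> d C (w - of_nat j) = J \<triangleright> v j"
      using vector_solution[of N box_op bs IV q \<theta> w zV "\<lambda>j. J \<triangleright> v j", OF N box_op_sites _ box_op_units finIV supV args w(2)]
        J_supp v distinct_box_sites[of ?ss k] by (auto simp: bs_def)
    define f where "f = qsum ?A \<theta> d C"
    define g where "g = (\<lambda>u. P \<triangleright> f u)"
    have fIV: "f u p = 0" if "p \<notin> IV" for u p using C that by (simp add: f_def qsum_def)
    have gt: "g u \<in> tensor_space n r" for u unfolding g_def by (rule P_supp) (rule fIV)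
    have backward: "J \<triangleright> g (w - of_nat j) = f (w - of_nat j)" if "j \<in> {1..N}" for j
      using init that PJ v by (simp add: f_def g_def)
    \<comment> \<open>If f and J g agree at the N preceding points, the operator returns their
      difference unchanged. The equation then exhibits f at the new point as \<open>J\<close>
      applied to g - D g; so f lies there in the image of \<open>J\<close>, on which
      \<open>J\<close> after \<open>P\<close> is the identity.\<close>
    have fwd: "J \<triangleright> g (w + of_nat j) = f (w + of_nat j)" for j
    proof (induction j rule: less_induct)
      case (less j)
      let ?u = "w + of_nat j" and ?h = "\<lambda>u. f u - J \<triangleright> g u"
      have "?h (?u - of_nat l) = 0" if l: "l \<in> {1..N}" for l
      proof (cases "l \<le> j")
        case True
        then have eq: "?u - of_nat l = w + of_nat (j - l)" by (simp add: of_nat_diff)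
        have "j - l < j" using l True by auto
        then show ?thesis unfolding eq less.IH[OF \<open>j - l < j\<close>] by simp
      next
        case False
        then have eq: "?u - of_nat l = w - of_nat (l - j)" by (simp add: of_nat_diff)
        have "l - j \<in> {1..N}" using l False by auto
        then show ?thesis unfolding eq backward[OF \<open>l - j \<in> {1..N}\<close>] by simp
      qed
      then have "dop N ?V ?h ?u = ?h ?u" by (rule dop_leading)
      moreover have "dop N ?V (\<lambda>u. ?h u + J \<triangleright> g u) ?u = dop N ?V ?h ?u + dop N ?V (\<lambda>u. J \<triangleright> g u) ?u" by (rule dop_add)
      moreover have "dop N ?V (\<lambda>u. ?h u + J \<triangleright> g u) ?u = 0" using ker gp(2)[of j] by (simp add: f_def del: pw)
      ultimately have "0 = ?h ?u + J \<triangleright> dop N ?M g ?u" unfolding dop_inter[OF gp] by simp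
      then have "f ?u = J \<triangleright> (g ?u - dop N ?M g ?u)"
        unfolding ap_diff by (simp add: algebra_simps eq_diff_eq del: pw)
      moreover have "g ?u - dop N ?M g ?u \<in> tensor_space n r" by (intro tensor_diff gt dop_tensor)
      ultimately show ?case unfolding g_def using PJ by metis
    qed
    \<comment> \<open>The difference is a quasi-exponential with the same bases that vanishes on the
      half-lattice w, w + 1, ..., hence everywhere.\<close>
    have fg: "f u = J \<triangleright> g u" for u
    proof
      fix p
      have eq: "qsum ?A \<theta> d (\<lambda>Q k. C Q k - (J * P) \<triangleright> C Q k) u = f u - J \<triangleright> g u" for u
        unfolding qsum_diff qsum_ap f_def g_def ap_times ..
      have "qsum ?A \<theta> d (\<lambda>Q k. C Q k - (J * P) \<triangleright> C Q k) u p = 0"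
        by (rule qsum_zero[OF args, of _ _ w], unfold eq fwd) simp
      then show "f u p = (J \<triangleright> g u) p" unfolding eq by simp
    qed
    have gq: "qsum ?A \<theta> d (\<lambda>Q k. P \<triangleright> C Q k) = g" by (rule ext) (simp add: qsum_ap g_def f_def)
    have both: "dop N ?M g u = 0" if "good_point N z {1..n} u" "good_point N zV (set bs) u" for u
    proof -
      have "J \<triangleright> dop N ?M g u = dop N ?V f u"
        unfolding dop_inter[OF that, symmetric] using fg by presburger
      also have "\<dots> = 0" using ker that(2) by (simp add: f_def)
      finally have "P \<triangleright> J \<triangleright> dop N ?M g u = 0" by simp
      then show ?thesis using PJ[OF dop_tensor[OF gt]] by simp
    qed
    have "dop N ?M g u = 0" if "good_point N z {1..n} u" for u
    proof (rule dop_zero_continuous[where S = "{u. \<not> good_point N z {1..n} u} \<union> {u. \<not> good_point N zV (set bs) u}"])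
      show "isCont (\<lambda>u. g u i) u" for i u unfolding gq[symmetric] by (rule qsum_cont)
    qed (use that both not_good_points_finite[of "set bs" N zV] not_good_points_finite[of "{1..n}" N z] in auto)
    moreover have "P \<triangleright> C Q k \<in> tensor_space n r" for Q k by (rule P_supp) (use C in auto)
    moreover have "g (w - of_nat j) = v j" if "j \<in> {1..N}" for j
      using init that PJ v by (simp add: f_def g_def)
    ultimately show ?thesis unfolding gq[symmetric]
      by (intro exI[of _ "\<lambda>Q k. P \<triangleright> C Q k"] exI[of _ d]) blast
  qed
  then show ?thesis using w(1) by (intro exI[of _ w]) blast
qed

section \<open>The quantum determinant\<close>

text \<open>Contraction, the left derivative with respect to \<open>\<psi>\<^sub>c\<close>; with
  \<open>psi\<close> it satisfies the Clifford relation \<open>iota_psi\<close>.\<close>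

definition iota :: "nat \<Rightarrow> 'i form \<Rightarrow> 'i form" where
  "iota c F = (\<lambda>S. if c \<in> S then 0 else fermi S c (F (insert c S)))"

lemma fermi_cong: "{x\<in>S. x < b} = {x\<in>S'. x < b} \<Longrightarrow> fermi S b = fermi S' b"
  by (rule ext) (simp add: fermi_def)

lemma fermi_diff_self: "fermi (S - {b}) b = fermi S b" "fermi (insert b S) b = fermi S b"
  by (rule fermi_cong; auto)+

lemma iota_psi: "iota c (psi b F) = (if b = c then F else 0) - psi b (iota c F)"
proof
  fix S
  show "iota c (psi b F) S = ((if b = c then F else 0) - psi b (iota c F)) S"
  proof (cases "b = c")
    case True
    then show ?thesis
      by (cases "c \<in> S") (simp_all add: iota_def psi_def fermi_diff_self fermi_simps insert_absorb minus_apply)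
  next
    case False
    have "fermi S c (fermi (insert c S) b x) = - fermi S b (fermi (S - {b}) c x)" if "b \<in> S" "c \<notin> S" for x :: "'a \<Rightarrow> complex"
    proof -
      have A: "fermi (insert c S) b x = (if c < b then - fermi S b x else fermi S b x)"
        using fermi_remove[of c "insert c S" b x] that by (auto simp del: pw)
      have B: "fermi (S - {b}) c x = (if b < c then - fermi S c x else fermi S c x)"
        by (rule fermi_remove[OF that(1)])
      show ?thesis unfolding A B using False fermi_simps(6)[of S c S b x]
        by (cases "b < c") (simp_all add: fermi_simps(2) del: pw)
    qed
    moreover have "insert c S - {b} = insert c (S - {b})" using False by auto
    ultimately show ?thesis using False
      by (simp add: iota_def psi_def fermi_simps del: pw)
        (simp add: minus_apply[of _ _ S] uminus_apply[of _ S] zero_fun_apply[of S] fermi_simps del: pw)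
  qed
qed

definition deriv_form :: "nat \<Rightarrow> nat \<Rightarrow> 'i form \<Rightarrow> 'i form" where
  "deriv_form d c F = psi d (iota c F)"

lemma deriv_form_psi: "deriv_form d c (psi b F) = psi b (deriv_form d c F) + (if b = c then psi d F else 0)"
proof -
  have "deriv_form d c (psi b F) = (if b = c then psi d F else 0) - psi d (psi b (iota c F))"
    unfolding deriv_form_def iota_psi psi_diff by (simp del: pw)
  also have "psi d (psi b (iota c F)) = - psi b (psi d (iota c F))" by (rule psi_anticomm)
  finally show ?thesis by (simp add: deriv_form_def add.commute del: pw)
qed

lemma deriv_form_fap: "deriv_form d c (fap A F) = fap A (deriv_form d c F)"
proof -
  have "iota c (fap A F) = fap A (iota c F)" by (rule ext) (simp add: iota_def fap_def fermi_simps)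
  then show ?thesis by (simp add: deriv_form_def psi_fap)
qed

lemma deriv_form_add: "deriv_form d c (F + G) = deriv_form d c F + deriv_form d c G"
proof -
  have "iota c (F + G) = iota c F + iota c G"
  proof
    fix S
    show "iota c (F + G) S = (iota c F + iota c G) S"
      unfolding plus_fun_apply[of "iota c F"]
      by (cases "c \<in> S") (simp_all only: iota_def plus_fun_apply[of F G] fermi_simps(1) if_True if_False add_0_left)
  qed
  then show ?thesis by (simp add: deriv_form_def psi_add)
qed

lemma deriv_form_0: "deriv_form d c 0 = 0"
  using deriv_form_add[of d c 0 0] by (simp del: pw)

lemma deriv_form_sum: "deriv_form d c (\<Sum>i\<in>S. F i) = (\<Sum>i\<in>S. deriv_form d c (F i))"
  by (induction S rule: infinite_finite_induct) (simp_all add: deriv_form_0 deriv_form_add del: pw)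

lemma deriv_form_diff: "deriv_form d c (F - G) = deriv_form d c F - deriv_form d c G"
  using deriv_form_add[of d c "F - G" G] by (simp add: algebra_simps del: pw)

lemma deriv_form_vac: "deriv_form d c (vac x) = 0"
proof -
  have "iota c (vac x) = 0" by (rule ext) (simp add: iota_def vac_def fermi_simps del: pw, simp add: zero_fun_apply)
  then show ?thesis by (simp add: deriv_form_def del: pw)
qed

lemma deriv_form_top:
  assumes "c \<in> S" "d \<in> S"
  shows "deriv_form d c F S = (if c = d then F S else 0)"
  using assms by (auto simp: deriv_form_def iota_def psi_def fermi_diff_self fermi_simps insert_absorb)

text \<open>The commutator of e_cd with an entry has one term that changes the column and one that
  changes the row. Subtracting the derivation cancels the column term, and passing a row then only
  replaces row \<open>c\<close> by row \<open>d\<close>.\<close>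

definition inner_form :: "'i lop \<Rightarrow> nat \<Rightarrow> nat \<Rightarrow> 'i form \<Rightarrow> 'i form" where
  "inner_form X d c F = fap X F - deriv_form d c F"

lemma inner_form_psi: "inner_form X d c (psi a F) = psi a (inner_form X d c F) - (if a = c then psi d F else 0)"
  unfolding inner_form_def deriv_form_psi psi_diff psi_fap[symmetric] by (simp add: algebra_simps del: pw)

lemma inner_form_diff: "inner_form X d c (F - G) = inner_form X d c F - inner_form X d c G"
  unfolding inner_form_def fap_diff deriv_form_diff by (simp add: algebra_simps del: pw)

lemma inner_form_nu:
  assumes "\<And>b. b \<in> {1..N} \<Longrightarrow> X * L b = L b * X + (if d = b then L c else 0) - (if c = a then L' b else 0)"
    and "c \<in> {1..N}" "d \<in> {1..N}"
    and "\<And>b. M a b = L b" "\<And>b. M d b = L' b"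
  shows "inner_form X d c (nu N M a F) = nu N M a (inner_form X d c F) - (if a = c then nu N M d F else 0)"
proof -
  have "fap X (nu N M a F) = (\<Sum>b=1..N. fap (L b) (psi b (fap X F)) + ((if d = b then fap (L c) (psi b F) else 0)
      - (if c = a then fap (L' b) (psi b F) else 0)))"
    unfolding nu_def fap_sum
  proof (intro sum.cong refl)
    fix b assume "b \<in> {1..N}"
    show "fap X (fap (M a b) (psi b F)) = fap (L b) (psi b (fap X F)) + ((if d = b then fap (L c) (psi b F) else 0)
      - (if c = a then fap (L' b) (psi b F) else 0))"
      unfolding fap_times[symmetric] assms(4) assms(1)[OF \<open>b \<in> {1..N}\<close>] psi_fap
      by (auto simp: fap_plus fap_minus fap_times simp del: pw)
  qed
  also have "\<dots> = nu N M a (fap X F) + fap (L c) (psi d F) - (if a = c then nu N M d F else 0)"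
    using assms(3) by (auto simp: sum.distrib sum_subtractf nu_def assms(4,5) simp del: pw)
  finally have 1: "fap X (nu N M a F) = nu N M a (fap X F) + fap (L c) (psi d F) - (if a = c then nu N M d F else 0)" .
  have 2: "deriv_form d c (nu N M a F) = nu N M a (deriv_form d c F) + fap (L c) (psi d F)"
  proof -
    have "deriv_form d c (nu N M a F) = (\<Sum>b=1..N. fap (L b) (psi b (deriv_form d c F)) + (if b = c then fap (L c) (psi d F) else 0))"
      unfolding nu_def deriv_form_sum deriv_form_fap deriv_form_psi assms(4)
      by (intro sum.cong refl) (auto simp: fap_add simp del: pw)
    then show ?thesis using assms(2) by (simp add: sum.distrib nu_def assms(4) del: pw)
  qed
  show ?thesis unfolding inner_form_def 1 2 nu_diff by (simp add: algebra_simps del: pw)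
qed

fun Nu :: "nat \<Rightarrow> (complex \<Rightarrow> nat \<Rightarrow> nat \<Rightarrow> 'i lop) \<Rightarrow> nat list \<Rightarrow> 'i form \<Rightarrow> complex \<Rightarrow> 'i form" where
  "Nu N M [] F u = F"
| "Nu N M (a # as) F u = nu N (M u) a (Nu N M as F (u - 1))"

text \<open>By \<open>Vc_Nu\<close> this is, up to the sign (-1)^N, the coefficient of the N-th
  power of the shift, which uses the matrix at u, u - 1, ..., u - N + 1.\<close>

definition qdet :: "nat \<Rightarrow> (complex \<Rightarrow> nat \<Rightarrow> nat \<Rightarrow> 'i lop) \<Rightarrow> complex \<Rightarrow> ('i \<Rightarrow> complex) \<Rightarrow> 'i \<Rightarrow> complex" where
  "qdet N M u x = Nu N M [1..<N+1] (vac x) u {1..N}"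

lemma Vc_Nu: "Vc N M as F (length as) u = (if even (length as) then Nu N M as (F (u - of_nat (length as))) u
    else - Nu N M as (F (u - of_nat (length as))) u)"
proof (induction as arbitrary: u)
  case (Cons a as)
  have "Vc N M as F (length (a # as)) u = 0" by (rule Vc_gt) simp
  moreover have "u - 1 - of_nat (length as) = u - of_nat (length (a # as))" by simp
  ultimately show ?case using Cons[of "u - 1"] by (simp add: nu_neg diff_diff_eq del: pw)
qed simp

lemma Nu_add: "Nu N M as (F + G) u = Nu N M as F u + Nu N M as G u"
  by (induction as arbitrary: u) (simp_all add: nu_add del: pw)

lemma Nu_neg: "Nu N M as (- F) u = - Nu N M as F u"
  by (induction as arbitrary: u) (simp_all add: nu_neg del: pw)

lemma Nu_sc: "Nu N M as (fap (sc c) F) u = fap (sc c) (Nu N M as F u)"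
  by (induction as arbitrary: u) (simp_all add: nu_fap_sc)

lemma qdet_add: "qdet N M u (x + y) = qdet N M u x + qdet N M u y"
  by (simp add: qdet_def vac_add Nu_add del: upt_Suc)

lemma qdet_sc: "qdet N M u (sc c \<triangleright> x) = sc c \<triangleright> qdet N M u x"
  unfolding qdet_def fap_vac[symmetric] Nu_sc by (simp add: fap_def)

lemma qdet_0: "qdet N M u 0 = 0"
  using qdet_add[of N M u 0 0] by (simp del: pw)

lemma Nu_append: "Nu N M (as @ bs) F u = Nu N M as (Nu N M bs F (u - of_nat (length as))) u"
  by (induction as arbitrary: u) (simp_all add: algebra_simps del: pw)

lemma Nu_swap:
  assumes "\<And>u. manin N (M u) (M (u - 1))" "a \<in> {1..N}" "b \<in> {1..N}"
  shows "Nu N M (as @ a # b # bs) F u = - Nu N M (as @ b # a # bs) F u"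
proof -
  have "Nu N M (a # b # bs) F v = - Nu N M (b # a # bs) F v" for v
    using manin_nu[OF assms] by simp
  then show ?thesis unfolding Nu_append by (simp add: Nu_neg del: Nu.simps)
qed

text \<open>Without repetitions, insertion sort by adjacent transpositions reduces to
  \<open>[1..<N+1]\<close>. With a repetition, adjacent transpositions bring the equal entries
  together, where both sides vanish.\<close>

lemma alternating_eq:
  fixes D D' :: "nat list \<Rightarrow> 'i form"
  assumes D: "\<And>l a b r. set (l @ a # b # r) \<subseteq> {1..N} \<Longrightarrow> D (l @ a # b # r) = - D (l @ b # a # r)"
    and D': "\<And>l a b r. set (l @ a # b # r) \<subseteq> {1..N} \<Longrightarrow> D' (l @ a # b # r) = - D' (l @ b # a # r)"
    and base: "D [1..<N+1] = D' [1..<N+1]" and xs: "set xs \<subseteq> {1..N}" "length xs = N"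
  shows "D xs = D' xs"
proof -
  have swap: "D (l @ a # b # r) = D' (l @ a # b # r) \<longleftrightarrow> D (l @ b # a # r) = D' (l @ b # a # r)"
    if "set (l @ a # b # r) \<subseteq> {1..N}" for l a b r
    using D[OF that] D'[OF that] by simp
  show ?thesis
  proof (cases "distinct xs")
    case False
    then obtain l m r y where eq: "xs = l @ y # m @ y # r" by (auto dest: not_distinct_decomp)
    have "D (l @ y # m @ y # r) = D' (l @ y # m @ y # r)" if "set (l @ y # m @ y # r) \<subseteq> {1..N}" for l
      using that
    proof (induction m arbitrary: l)
      case Nil
      have "D (l @ y # y # r) = 0" by (rule fun_double_zero, rule D) (use Nil in auto)
      moreover have "D' (l @ y # y # r) = 0" by (rule fun_double_zero, rule D') (use Nil in auto)
      ultimately show ?case by simp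
    next
      case (Cons x m)
      have "D (l @ x # y # m @ y # r) = D' (l @ x # y # m @ y # r)"
        using Cons.IH[of "l @ [x]"] Cons.prems by simp
      then show ?case using swap[of l x y "m @ y # r"] Cons.prems by simp
    qed
    then show ?thesis using xs eq by blast
  next
    case True
    have ins: "D (l @ insort x zs) = D' (l @ insort x zs) \<Longrightarrow> D (l @ x # zs) = D' (l @ x # zs)"
      if "set (l @ x # zs) \<subseteq> {1..N}" for l x zs
      using that
    proof (induction zs arbitrary: l)
      case (Cons y zs)
      show ?case
      proof (cases "x \<le> y")
        case False
        then have "D ((l @ [y]) @ x # zs) = D' ((l @ [y]) @ x # zs)" using Cons by (intro Cons.IH) auto
        then show ?thesis using swap[of l x y zs] Cons.prems by simp
      qed (use Cons in simp)
    qed simp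
    have "D (l @ sort ys) = D' (l @ sort ys) \<Longrightarrow> D (l @ ys) = D' (l @ ys)" if "set (l @ ys) \<subseteq> {1..N}" for l ys
      using that
    proof (induction ys arbitrary: l)
      case (Cons y ys)
      have "D (l @ y # sort ys) = D' (l @ y # sort ys)" by (rule ins) (use Cons.prems in auto)
      then show ?case using Cons.IH[of "l @ [y]"] Cons.prems by simp
    qed simp
    from this[of "[]" xs] have main: "D (sort xs) = D' (sort xs) \<Longrightarrow> D xs = D' xs" using xs by simp
    have "set xs = {1..N}" using xs True by (intro card_subset_eq) (auto simp: distinct_card)
    then have "sort xs = [1..<N+1]"
      by (intro sorted_distinct_set_unique)
        (simp_all add: True \<open>set xs = {1..N}\<close> atLeastLessThanSuc_atLeastAtMost del: upt_Suc)
    then show ?thesis using main base by simp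
  qed
qed

lemma Nu_supp:
  "\<not> (finite S \<and> S \<subseteq> {1..N} \<and> card S = length as) \<Longrightarrow> Nu N M as (vac x) u S = 0"
proof (induction as arbitrary: S u)
  case Nil
  then show ?case by (auto simp: vac_def)
next
  case (Cons a as)
  have "psi b (Nu N M as (vac x) (u - 1)) S = 0" if b: "b \<in> {1..N}" for b
  proof (cases "b \<in> S")
    case True
    have "\<not> (finite (S - {b}) \<and> S - {b} \<subseteq> {1..N} \<and> card (S - {b}) = length as)"
    proof
      assume *: "finite (S - {b}) \<and> S - {b} \<subseteq> {1..N} \<and> card (S - {b}) = length as"
      then have "finite S" "S \<subseteq> {1..N}" using b by auto
      moreover have "card S = Suc (card (S - {b}))" by (rule card_Suc_Diff1[symmetric, OF \<open>finite S\<close> True])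
      ultimately show False using Cons.prems * by simp
    qed
    then show ?thesis using Cons.IH[of "S - {b}" "u - 1"] True by (simp add: psi_def fermi_simps del: pw)
  qed (simp add: psi_def)
  then show ?case by (simp add: nu_def sum_apply fap_def)
qed

lemma foldr_psi_Nu: "set xs \<subseteq> {1..N} \<Longrightarrow> foldr psi xs F = Nu N (\<lambda>u a b. if a = b then 1 else 0) xs F u"
proof (induction xs arbitrary: u)
  case (Cons a xs)
  have "(\<Sum>b=1..N. fap (if a = b then 1 else 0) (psi b G)) = psi a G" for G :: "'a form"
  proof -
    have "(\<Sum>b=1..N. fap (if a = b then 1 else 0) (psi b G)) = (\<Sum>b=1..N. if b = a then psi a G else 0)"
      by (intro sum.cong refl) auto
    then show ?thesis using Cons.prems by (simp del: pw)
  qed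
  then show ?case using Cons by (simp add: nu_def del: pw)
qed simp

text \<open>Both sides alternate in the list of rows, the left one by the Manin relation, so it is
  enough to compare them in the standard order. A product of N rows is thus the quantum determinant
  with a sign, or zero.\<close>

lemma Nu_alternating:
  assumes M: "\<And>u. manin N (M u) (M (u - 1))" and xs: "set xs \<subseteq> {1..N}" "length xs = N"
  shows "Nu N M xs (vac x) u = foldr psi xs (vac (qdet N M u x))"
proof (rule alternating_eq[OF _ _ _ xs])
  show "Nu N M (l @ a # b # r) (vac x) u = - Nu N M (l @ b # a # r) (vac x) u" if "set (l @ a # b # r) \<subseteq> {1..N}" for l a b r
  proof (rule Nu_swap[where M = M and N = N])
    show "manin N (M u) (M (u - 1))" for u by (rule M)
  qed (use that in auto)
  show "foldr psi (l @ a # b # r) F = - foldr psi (l @ b # a # r) F" for l a b r and F :: "'a form"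
    using foldr_psi_swap[of l a "[]" b r F] by simp
  show "Nu N M [1..<N+1] (vac x) u = foldr psi [1..<N+1] (vac (qdet N M u x))"
  proof
    fix S
    have set: "set [1..<N+1] \<subseteq> {1..N}" by (auto simp del: upt_Suc)
    show "Nu N M [1..<N+1] (vac x) u S = foldr psi [1..<N+1] (vac (qdet N M u x)) S"
    proof (cases "S = {1..N}")
      case True
      then show ?thesis using foldr_psi_top[of N "qdet N M u x"] by (simp add: qdet_def del: upt_Suc)
    next
      case False
      have "\<not> (finite S \<and> S \<subseteq> {1..N} \<and> card S = length [1..<N+1])"
        using False card_subset_eq[of "{1..N}" S] by (auto simp del: upt_Suc)
      then show ?thesis unfolding foldr_psi_Nu[OF set, of _ u] by (simp add: Nu_supp del: upt_Suc)
    qed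
  qed
qed

fun entry_sum :: "nat \<Rightarrow> (complex \<Rightarrow> nat \<Rightarrow> nat \<Rightarrow> 'i lop) \<Rightarrow> nat list \<Rightarrow> (nat list \<Rightarrow> 'i form) \<Rightarrow> complex \<Rightarrow> 'i form" where
  "entry_sum N A [] G u = G []"
| "entry_sum N A (a # as) G u = (\<Sum>x=1..N. fap (A u a x) (entry_sum N A as (\<lambda>xs. G (x # xs)) (u - 1)))"

lemma entry_sum_cong:
  "(\<And>xs. set xs \<subseteq> {1..N} \<Longrightarrow> length xs = length as \<Longrightarrow> G xs = G' xs) \<Longrightarrow> entry_sum N A as G u = entry_sum N A as G' u"
proof (induction as arbitrary: G G' u)
  case (Cons a as)
  have "entry_sum N A as (\<lambda>xs. G (x # xs)) (u - 1) = entry_sum N A as (\<lambda>xs. G' (x # xs)) (u - 1)" if "x \<in> {1..N}" for x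
    by (rule Cons.IH, rule Cons.prems) (use that in auto)
  then show ?case by simp
qed simp

lemma nu_entry_sum:
  assumes "\<And>u a b y. a \<in> {1..N} \<Longrightarrow> b \<in> {1..N} \<Longrightarrow> y \<in> {1..N} \<Longrightarrow> C x y * A u a b = A u a b * C x y"
    and "set as \<subseteq> {1..N}"
  shows "nu N C x (entry_sum N A as G u) = entry_sum N A as (\<lambda>xs. nu N C x (G xs)) u"
  using assms(2)
proof (induction as arbitrary: G u)
  case (Cons a as)
  have "nu N C x (fap (A u a b) F) = fap (A u a b) (nu N C x F)" if "b \<in> {1..N}" for b F
    by (rule nu_fap, rule assms(1)) (use that Cons.prems in auto)
  then show ?case using Cons by (simp add: nu_sum del: pw)
qed simp

lemma Nu_product:
  assumes comm: "\<And>u v a b x y. a \<in> {1..N} \<Longrightarrow> b \<in> {1..N} \<Longrightarrow> x \<in> {1..N} \<Longrightarrow> y \<in> {1..N} \<Longrightarrow> C v x y * A u a b = A u a b * C v x y"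
    and M: "\<And>u a b. a \<in> {1..N} \<Longrightarrow> b \<in> {1..N} \<Longrightarrow> M u a b = (\<Sum>x=1..N. A u a x * C u x b)"
    and "set as \<subseteq> {1..N}"
  shows "Nu N M as F u = entry_sum N A as (\<lambda>xs. Nu N C xs F u) u"
  using assms(3)
proof (induction as arbitrary: u)
  case (Cons a as)
  then have a: "a \<in> {1..N}" "set as \<subseteq> {1..N}" by auto
  have nuM: "nu N (M u) a G = (\<Sum>x=1..N. fap (A u a x) (nu N (C u) x G))" for G
  proof -
    have "nu N (M u) a G = (\<Sum>b=1..N. \<Sum>x=1..N. fap (A u a x) (fap (C u x b) (psi b G)))"
      unfolding nu_def using M[OF a(1)] by (intro sum.cong refl) (simp add: sum_fap fap_times)
    also have "\<dots> = (\<Sum>x=1..N. fap (A u a x) (nu N (C u) x G))"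
      unfolding nu_def fap_sum by (rule sum.swap)
    finally show ?thesis .
  qed
  have "nu N (C u) x (entry_sum N A as G (u - 1)) = entry_sum N A as (\<lambda>xs. nu N (C u) x (G xs)) (u - 1)"
    if "x \<in> {1..N}" for x G
    by (rule nu_entry_sum[where C = "C u", OF comm a(2)]) (use that in auto)
  then show ?case using Cons.IH[OF a(2), of "u - 1"] by (simp add: nuM)
qed simp

text \<open>Once the entries of \<open>A\<close> are on the left, each remaining product of rows of
  \<open>C\<close> equals, by \<open>Nu_alternating\<close>, the same product for the identity
  matrix applied to the determinant of \<open>C\<close>. Reassembling the sum gives the determinant
  of \<open>A\<close>.\<close>

lemma qdet_product:
  assumes comm: "\<And>u v a b x y. a \<in> {1..N} \<Longrightarrow> b \<in> {1..N} \<Longrightarrow> x \<in> {1..N} \<Longrightarrow> y \<in> {1..N} \<Longrightarrow> C v x y * A u a b = A u a b * C v x y"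
    and M: "\<And>u a b. a \<in> {1..N} \<Longrightarrow> b \<in> {1..N} \<Longrightarrow> M u a b = (\<Sum>x=1..N. A u a x * C u x b)"
    and C: "\<And>u. manin N (C u) (C (u - 1))"
  shows "qdet N M u x = qdet N A u (qdet N C u x)"
proof -
  let ?as = "[1..<N+1]" and ?I = "\<lambda>(u :: complex) (a :: nat) (b :: nat). if a = b then 1 else 0 :: 'a lop"
  have as: "set ?as \<subseteq> {1..N}" "length ?as = N" by (auto simp del: upt_Suc)
  have "Nu N M ?as (vac x) u = entry_sum N A ?as (\<lambda>xs. Nu N C xs (vac x) u) u"
    by (rule Nu_product[OF comm M as(1)])
  also have "\<dots> = entry_sum N A ?as (\<lambda>xs. Nu N ?I xs (vac (qdet N C u x)) u) u"
  proof (rule entry_sum_cong)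
    fix xs assume xs: "set xs \<subseteq> {1..N}" "length xs = length ?as"
    then have "length xs = N" using as(2) by simp
    show "Nu N C xs (vac x) u = Nu N ?I xs (vac (qdet N C u x)) u"
      by (subst Nu_alternating[where M = C, OF _ xs(1) \<open>length xs = N\<close>], rule C, rule foldr_psi_Nu[OF xs(1)])
  qed
  also have "\<dots> = Nu N A ?as (vac (qdet N C u x)) u"
  proof (rule Nu_product[symmetric, OF _ _ as(1)])
    fix v a b assume "a \<in> {1..N}" "b \<in> {1..N}"
    have "(\<Sum>x=1..N. A v a x * ?I v x b) = (\<Sum>x=1..N. if x = b then A v a b else 0)"
      by (intro sum.cong refl) auto
    then show "A v a b = (\<Sum>x=1..N. A v a x * ?I v x b)" using \<open>b \<in> {1..N}\<close> by simp
  qed auto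
  finally show ?thesis by (simp only: qdet_def)
qed

lemma Nu_inner_form:
  assumes "\<And>v a b. a \<in> {1..N} \<Longrightarrow> b \<in> {1..N} \<Longrightarrow> X * M v a b = M v a b * X + (if d = b then M v a c else 0) - (if c = a then M v d b else 0)"
    and "c \<in> {1..N}" "d \<in> {1..N}" "distinct as" "set as \<subseteq> {1..N}"
  shows "inner_form X d c (Nu N M as F u) = Nu N M as (inner_form X d c F) u
    - (if c \<in> set as then Nu N M (map (\<lambda>a. if a = c then d else a) as) F u else 0)"
  using assms(4,5)
proof (induction as arbitrary: u)
  case (Cons a as)
  have step: "inner_form X d c (nu N (M u) a G) = nu N (M u) a (inner_form X d c G) - (if a = c then nu N (M u) d G else 0)" for G
    by (rule inner_form_nu[where L = "M u a" and L' = "M u d"]) (use assms Cons.prems in auto)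
  have id: "map (\<lambda>a. if a = c then d else a) as = as" if "c \<notin> set as" using that by (intro map_idI) auto
  show ?case
  proof (cases "a = c")
    case True
    then show ?thesis using Cons step id by (simp add: nu_diff del: pw)
  next
    case False
    then show ?thesis using Cons step by (simp add: nu_diff del: pw)
  qed
qed (simp del: pw)

text \<open>
  Corrected by the derivation \<open>\<psi>\<^sub>d \<partial>\<^sub>c\<close>, the generator \<open>e\<^sub>c\<^sub>d\<close> commutes with the one-forms up to
  replacing the row \<open>c\<close> by the row \<open>d\<close>, which makes the product vanish unless \<open>c = d\<close>.
\<close>

lemma qdet_central:
  assumes X: "\<And>v a b. a \<in> {1..N} \<Longrightarrow> b \<in> {1..N} \<Longrightarrow> X * M v a b = M v a b * X + (if d = b then M v a c else 0) - (if c = a then M v d b else 0)"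
    and M: "\<And>u. manin N (M u) (M (u - 1))" and cd: "c \<in> {1..N}" "d \<in> {1..N}"
  shows "X \<triangleright> qdet N M u y = qdet N M u (X \<triangleright> y)"
proof -
  let ?as = "[1..<N+1]" and ?m = "\<lambda>a. if a = c then d else a"
  have as: "distinct ?as" "set ?as \<subseteq> {1..N}" "c \<in> set ?as" "length ?as = N" using cd by (auto simp del: upt_Suc)
  have iv: "inner_form X d c (vac y) = vac (X \<triangleright> y)"
    unfolding inner_form_def deriv_form_vac fap_vac by (simp del: pw)
  have eq: "inner_form X d c (Nu N M ?as (vac y) u) = Nu N M ?as (vac (X \<triangleright> y)) u - Nu N M (map ?m ?as) (vac y) u"
    by (subst Nu_inner_form[where X = X and M = M, OF _ cd as(1,2)], rule X, assumption, assumption)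
      (simp only: as(3) iv if_True)
  have low: "Nu N M (map ?m ?as) (vac y) u {1..N} = (if c = d then qdet N M u y else 0)"
  proof (cases "c = d")
    case True
    then have "map ?m ?as = ?as" by (intro map_idI) auto
    then show ?thesis using True by (simp add: qdet_def)
  next
    case False
    have s: "set (map ?m ?as) \<subseteq> {1..N}" "length (map ?m ?as) = N" using as cd by (auto simp del: upt_Suc)
    have "\<not> distinct (map ?m ?as)"
    proof
      assume "distinct (map ?m ?as)"
      then have "inj_on ?m (set ?as)" by (simp only: distinct_map)
      then have "c = d" by (rule inj_onD) (use cd in \<open>auto simp del: upt_Suc\<close>)
      then show False using False by simp
    qed
    from foldr_psi_not_distinct[OF this, of "vac (qdet N M u y)"] show ?thesis
      using False by (subst Nu_alternating[where M = M, OF _ s], intro M) (simp only: zero_fun_apply if_False)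
  qed
  have "X \<triangleright> qdet N M u y - (if c = d then qdet N M u y else 0) = inner_form X d c (Nu N M ?as (vac y) u) {1..N}"
    unfolding inner_form_def minus_apply[of "fap X _"] deriv_form_top[OF cd] by (simp add: qdet_def fap_def del: upt_Suc pw)
  also have "\<dots> = qdet N M u (X \<triangleright> y) - (if c = d then qdet N M u y else 0)"
    unfolding eq minus_apply[of "Nu N M ?as _ u"] low by (simp only: qdet_def)
  finally show ?thesis by (simp del: pw)
qed

text \<open>On a highest weight vector the matrix is triangular: columns b < a give 0, and columns b
  > a are already taken by the later rows. Only diagonal entries survive, row i being evaluated at u
  - (i - a).\<close>

lemma Nu_highest:
  assumes "\<And>v a. a \<in> {1..N} \<Longrightarrow> M v a a \<triangleright> y = sc (v + \<mu> a) \<triangleright> y"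
    and "\<And>v a b. a \<in> {1..N} \<Longrightarrow> b \<in> {1..N} \<Longrightarrow> b < a \<Longrightarrow> M v a b \<triangleright> y = 0"
    and "1 \<le> a" "a \<le> N + 1"
  shows "Nu N M [a..<N+1] (vac y) u = fap (sc (\<Prod>i\<in>{a..N}. u - of_nat i + of_nat a + \<mu> i)) (foldr psi [a..<N+1] (vac y))"
  using assms(4,3)
proof (induction a arbitrary: u rule: inc_induct)
  case base
  show ?case by simp
next
  case (step a)
  let ?F = "foldr psi [Suc a..<N+1] (vac y)" and ?c = "\<Prod>i\<in>{Suc a..N}. (u - 1) - of_nat i + of_nat (Suc a) + \<mu> i"
  have aN: "a \<in> {1..N}" using step by auto
  have upt: "[a..<N+1] = a # [Suc a..<N+1]" using aN by (simp add: upt_conv_Cons del: upt_Suc)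
  have psi_0: "foldr psi xs (0 :: nat set \<Rightarrow> 'a \<Rightarrow> complex) = 0" for xs :: "nat list"
    by (induction xs) (simp_all del: pw)
  have fap_foldr: "fap A (foldr psi xs (vac y)) = foldr psi xs (vac (A \<triangleright> y))" for A xs
    by (induction xs) (simp_all add: fap_vac psi_fap[symmetric])
  have "fap (M u a b) (psi b ?F) = (if b = a then fap (sc (u + \<mu> a)) (psi a ?F) else 0)" if "b \<in> {1..N}" for b
  proof (cases b a rule: linorder_cases)
    case less
    then show ?thesis using assms(2)[OF aN that] fap_foldr[of "M u a b" "b # [Suc a..<N+1]"] psi_0[of "[Suc a..<N+1]"]
      by (simp del: pw upt_Suc)
  next
    case equal
    then show ?thesis using assms(1)[OF aN] fap_foldr[of "M u a a" "a # [Suc a..<N+1]"] fap_foldr[of "sc (u + \<mu> a)" "a # [Suc a..<N+1]"]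
      by (simp del: pw upt_Suc)
  next
    case greater
    then have "\<not> distinct (b # [Suc a..<N+1])" using that by (simp del: upt_Suc)
    from foldr_psi_not_distinct[OF this, of "vac y"] show ?thesis using greater by (simp del: pw upt_Suc)
  qed
  then have nuF: "nu N (M u) a ?F = fap (sc (u + \<mu> a)) (psi a ?F)"
    unfolding nu_def using aN by (simp del: pw upt_Suc)
  have prod: "(\<Prod>i\<in>{a..N}. u - of_nat i + of_nat a + \<mu> i) = ?c * (u + \<mu> a)"
  proof -
    have "{a..N} = insert a {Suc a..N}" using aN by auto
    moreover have "?c = (\<Prod>i\<in>{Suc a..N}. u - of_nat i + of_nat a + \<mu> i)" by (intro prod.cong refl) simp
    ultimately show ?thesis by simp
  qed
  have "Nu N M [Suc a..<N+1] (vac y) (u - 1) = fap (sc ?c) ?F" by (rule step.IH) simp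
  then have "Nu N M [a..<N+1] (vac y) u = fap (sc ?c) (nu N (M u) a ?F)"
    unfolding upt Nu.simps by (simp only: nu_fap_sc)
  also have "\<dots> = fap (sc (?c * (u + \<mu> a))) (foldr psi [a..<N+1] (vac y))"
    unfolding nuF sc_mult fap_times upt by simp
  finally show ?case unfolding prod .
qed

lemma qdet_highest:
  assumes "\<And>v a. a \<in> {1..N} \<Longrightarrow> M v a a \<triangleright> y = sc (v + \<mu> a) \<triangleright> y"
    and "\<And>v a b. a \<in> {1..N} \<Longrightarrow> b \<in> {1..N} \<Longrightarrow> b < a \<Longrightarrow> M v a b \<triangleright> y = 0"
  shows "qdet N M u y = sc (\<Prod>i\<in>{1..N}. u - of_nat i + 1 + \<mu> i) \<triangleright> y"
proof -
  have "Nu N M [1..<N+1] (vac y) u = fap (sc (\<Prod>i\<in>{1..N}. u - of_nat i + of_nat 1 + \<mu> i)) (foldr psi [1..<N+1] (vac y))"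
    by (rule Nu_highest[where \<mu> = \<mu>]) (use assms in auto)
  then show ?thesis unfolding qdet_def using foldr_psi_top[of N y] by (simp add: fap_def del: upt_Suc)
qed

text \<open>The vectors on which the determinant acts by this scalar form a submodule by
  \<open>qdet_central\<close>, and it contains the highest weight vector. The single site is indexed
  by \<open>unit\<close>.\<close>

lemma module_qdet:
  fixes \<zeta> :: complex
  assumes M: "irreducible_highest_weight_module N \<Lambda> r e" and y: "fsupp r y"
  defines "E \<equiv> \<lambda>_ :: unit. \<lambda>a b. mop r (e a b)"
  shows "qdet N (Lt E (\<lambda>_. \<zeta>) ()) u y = sc (\<Prod>i\<in>{1..N}. u - of_nat i + 1 + (\<Lambda> i - \<zeta>)) \<triangleright> y"
proof -
  let ?L = "Lt E (\<lambda>_. \<zeta>) ()" and ?c = "\<Prod>i\<in>{1..N}. u - of_nat i + 1 + (\<Lambda> i - \<zeta>)"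
  have irr: "gl_irreducible N r e" using M by (simp add: irreducible_highest_weight_module_def)
  have rel: "gl_rel N (E ())" unfolding E_def by (rule mop_gl_rel) (use irr in \<open>simp add: gl_irreducible_def\<close>)
  obtain y0 where y0: "fsupp r y0" "y0 \<noteq> 0" "\<And>a. a \<in> {1..N} \<Longrightarrow> mop r (e a a) \<triangleright> y0 = sc (\<Lambda> a) \<triangleright> y0"
    "\<And>a b. a \<in> {1..N} \<Longrightarrow> b \<in> {1..N} \<Longrightarrow> a < b \<Longrightarrow> mop r (e a b) \<triangleright> y0 = 0"
    using highest_weight_coords[OF M] by blast
  let ?Y = "\<lambda>y. fsupp r y \<and> qdet N ?L u y = sc ?c \<triangleright> y"
  have "(\<forall>y. ?Y y \<longrightarrow> y = 0) \<or> (\<forall>y. fsupp r y \<longrightarrow> ?Y y)"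
  proof (rule irreducible_dichotomy[OF irr])
    show "?Y (y + y')" if "?Y y" "?Y y'" for y y'
      using that by (simp add: qdet_add ap_add fsupp_def)
    show "?Y (sc c \<triangleright> y)" if "?Y y" for c y
      using that ap_sc_comm[of "sc c" ?c y] by (simp add: qdet_sc fsupp_def ap_sc)
    show "?Y (mop r (e a b) \<triangleright> y)" if ab: "a \<in> {1..N}" "b \<in> {1..N}" and Y: "?Y y" for a b y
    proof (rule conjI[OF fsupp_mop])
      have "mop r (e a b) \<triangleright> qdet N ?L u y = qdet N ?L u (mop r (e a b) \<triangleright> y)"
      proof (rule qdet_central[where M = ?L, OF _ _ ab])
        show "mop r (e a b) * ?L v a' b' = ?L v a' b' * mop r (e a b) + (if b = b' then ?L v a' a else 0)
          - (if a = a' then ?L v b b' else 0)" if "a' \<in> {1..N}" "b' \<in> {1..N}" for v a' b'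
          using Lt_total_comm[where e = E and s = "()" and z = "\<lambda>_. \<zeta>" and u = v, OF rel that ab] by (simp add: E_def)
        show "manin N (?L v) (?L (v - 1))" for v by (rule manin_Lt) (rule rel)
      qed
      then show "qdet N ?L u (mop r (e a b) \<triangleright> y) = sc ?c \<triangleright> mop r (e a b) \<triangleright> y"
        using Y by (simp add: ap_sc_comm[of "mop r (e a b)"])
    qed
  qed (simp_all add: qdet_0 fsupp_def del: pw, simp add: zero_fun_apply)
  moreover have "qdet N ?L u y0 = sc ?c \<triangleright> y0"
  proof (rule qdet_highest)
    show "?L v a a \<triangleright> y0 = sc (v + (\<Lambda> a - \<zeta>)) \<triangleright> y0" if "a \<in> {1..N}" for v a
      using y0(3)[OF that] by (intro ext) (simp add: Lt_def E_def ap_plus ap_sc algebra_simps)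
    show "?L v a b \<triangleright> y0 = 0" if "a \<in> {1..N}" "b \<in> {1..N}" "b < a" for v a b
      using y0(4)[OF that(2,1,3)] that(3) by (simp add: Lt_def E_def)
  qed
  ultimately show ?thesis using y y0 by blast
qed

lemma Nu_slot:
  fixes M :: "complex \<Rightarrow> nat \<Rightarrow> nat \<Rightarrow> nat lop" and p :: "nat \<Rightarrow> nat" and s :: nat
  defines "slice \<equiv> \<lambda>(F :: (nat \<Rightarrow> nat) form) S w. F S (p(s := w))"
  shows "slice (Nu N (\<lambda>u a b. slot s (M u a b)) as F u) = Nu N M as (slice F) u"
proof (induction as arbitrary: u)
  case (Cons a as)
  have psi: "slice (psi b F) = psi b (slice F)" for b F
    by (intro ext) (simp add: slice_def psi_def fermi_def)
  have fap: "slice (fap (slot s A) F) = fap A (slice F)" for A F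
    by (intro ext) (simp add: slice_def fap_def slot_ap)
  have sum: "slice (\<Sum>b\<in>B. G b) = (\<Sum>b\<in>B. slice (G b))" for B :: "nat set" and G
    by (intro ext) (simp add: slice_def sum_apply)
  show ?case by (simp add: nu_def sum fap psi Cons)
qed simp

lemma qdet_slot:
  "qdet N (\<lambda>u a b. slot s (M u a b)) u x p = qdet N M u (\<lambda>w. x (p(s := w))) (p s)"
proof -
  have v: "(\<lambda>S w. vac x S (p(s := w))) = vac (\<lambda>w. x (p(s := w)))"
    by (intro ext) (simp add: vac_def)
  have "qdet N (\<lambda>u a b. slot s (M u a b)) u x (p(s := p s)) = qdet N M u (\<lambda>w. x (p(s := w))) (p s)"
    unfolding qdet_def v[symmetric] Nu_slot[symmetric] ..
  then show ?thesis by simp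
qed

lemma finite_zero_cont:
  fixes h :: "complex \<Rightarrow> complex"
  assumes "isCont h u" "finite S" "\<And>v. v \<notin> S \<Longrightarrow> h v = 0"
  shows "h u = 0"
proof -
  have "eventually (\<lambda>v. \<forall>s\<in>S. v \<noteq> s) (at u)"
    by (rule eventually_ball_finite[OF assms(2)]) (simp add: eventually_neq_at_within)
  then have "eventually (\<lambda>v. h v = 0) (at u)" by (rule eventually_mono) (use assms(3) in blast)
  then have "h \<midarrow>u\<rightarrow> 0" by (rule tendsto_eventually)
  moreover have "h \<midarrow>u\<rightarrow> h u" using assms(1) by (simp add: isCont_def)
  ultimately show ?thesis using LIM_unique by blast
qed

text \<open>The substitution \<open>u \<mapsto> - u\<close> replaces every base \<open>Q\<close> by its inverse.\<close>

lemma qsum_zero_backward: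
  assumes A: "has_args A \<theta>" and zero: "\<And>j :: nat. qsum A \<theta> d C (w - of_nat j) i = 0"
  shows "qsum A \<theta> d C u i = 0"
proof -
  define \<theta>' where "\<theta>' = (\<lambda>Q. - \<theta> (inverse Q))"
  define C' where "C' = (\<lambda>Q k i. (- 1) ^ k * C (inverse Q) k i)"
  have A': "has_args (inverse ` A) \<theta>'"
    unfolding has_args_def
  proof (intro conjI ballI)
    show "finite (inverse ` A)" using A by (simp add: has_args_def)
    fix R assume "R \<in> inverse ` A"
    then obtain Q where Q: "R = inverse Q" "Q \<in> A" by blast
    then have *: "Q \<noteq> 0" "rcis (cmod Q) (\<theta> Q) = Q" using A by (auto simp: has_args_def)
    show "R \<noteq> 0" using * Q by simp
    have "rcis (cmod R) (\<theta>' R) = inverse (rcis (cmod Q) (\<theta> Q))"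
      unfolding rcis_inverse by (simp add: Q \<theta>'_def norm_inverse divide_inverse)
    then show "rcis (cmod R) (\<theta>' R) = R" using * Q by simp
  qed
  have refl: "qsum (inverse ` A) \<theta>' d C' v i = qsum A \<theta> d C (- v) i" for v
  proof -
    have "power_with_arg \<theta>' (inverse Q) v = power_with_arg \<theta> Q (- v)" if "Q \<in> A" for Q
    proof -
      have "Q \<noteq> 0" using A that by (auto simp: has_args_def)
      then have "ln (cmod (inverse Q)) = - ln (cmod Q)" by (simp add: norm_inverse ln_inverse)
      moreover have "Complex (- x) (- y) = - Complex x y" for x y by (simp add: complex_eq_iff)
      ultimately show ?thesis by (simp add: power_with_arg_def \<theta>'_def)
    qed
    moreover have "v ^ k * ((- 1) ^ k * C Q k i) = (- v) ^ k * C Q k i" for Q k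
      by (simp add: power_minus[of v])
    ultimately show ?thesis
      unfolding qsum_def C'_def by (subst sum.reindex) (auto intro!: sum.cong inj_onI)
  qed
  have "qsum (inverse ` A) \<theta>' d C' (- u) i = 0"
    by (rule qsum_zero[OF A', of _ _ "- w"]) (simp add: refl zero)
  then show ?thesis by (simp add: refl)
qed

lemma Phi_inner_form:
  assumes "\<And>v a b. a \<in> {1..N} \<Longrightarrow> b \<in> {1..N} \<Longrightarrow> X * M v a b = M v a b * X + (if c = b then M v a c else 0) - (if c = a then M v c b else 0)"
    and "c \<in> {1..N}" "distinct as" "set as \<subseteq> {1..N}"
  shows "inner_form X c c (Phi N M as F u) = Phi N M as (\<lambda>u. inner_form X c c (F u)) u
    - (if c \<in> set as then Phi N M as F u else 0)"
  using assms(3,4)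
proof (induction as arbitrary: u)
  case (Cons a as)
  have step: "inner_form X c c (nu N (M v) a G) = nu N (M v) a (inner_form X c c G) - (if a = c then nu N (M v) c G else 0)" for G v
    by (rule inner_form_nu[where L = "M v a" and L' = "M v c"]) (use assms Cons.prems in auto)
  show ?case
  proof (cases "a = c")
    case True
    have "inner_form X c c (nu N (M v) c G) = nu N (M v) c (inner_form X c c G) - nu N (M v) c G" for G v
      using step[where v = v and G = G] True by (simp del: pw)
    with True show ?thesis using Cons by (simp add: phi_def inner_form_diff inner_form_psi psi_diff nu_diff del: pw)
  next
    case False
    then show ?thesis using Cons by (simp add: phi_def inner_form_diff inner_form_psi step psi_diff nu_diff del: pw)
  qed
qed (simp del: pw)

text \<open>The argument of \<open>qdet_central\<close> for \<open>c = d\<close>, now for all powers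
  of the shift at once. The derivation on the top form and the row replaced by itself produce the
  same correction on both sides.\<close>

lemma dop_weight:
  assumes X: "\<And>v a b. a \<in> {1..N} \<Longrightarrow> b \<in> {1..N} \<Longrightarrow> X * M v a b = M v a b * X + (if c = b then M v a c else 0) - (if c = a then M v c b else 0)"
    and c: "c \<in> {1..N}"
  shows "dop N M (\<lambda>u. X \<triangleright> f u) u = X \<triangleright> dop N M f u"
proof -
  let ?as = "[1..<N+1]" and ?F = "\<lambda>u. vac (f u)"
  have as: "distinct ?as" "set ?as \<subseteq> {1..N}" "c \<in> set ?as" using c by (auto simp del: upt_Suc)
  have iv: "inner_form X c c (vac y) = vac (X \<triangleright> y)" for y
    unfolding inner_form_def deriv_form_vac fap_vac by (simp del: pw)
  have eq: "inner_form X c c (Phi N M ?as ?F u) = Phi N M ?as (\<lambda>u. vac (X \<triangleright> f u)) u - Phi N M ?as ?F u"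
    by (subst Phi_inner_form[where X = X and M = M, OF _ c as(1,2)], rule X, assumption, assumption)
      (simp only: as(3) iv if_True)
  have "X \<triangleright> dop N M f u - dop N M f u = inner_form X c c (Phi N M ?as ?F u) {1..N}"
    unfolding inner_form_def minus_apply[of "fap X _"] deriv_form_top[OF c c] by (simp add: dop_def fap_def del: upt_Suc pw)
  also have "\<dots> = dop N M (\<lambda>u. X \<triangleright> f u) u - dop N M f u"
    unfolding eq minus_apply[of "Phi N M ?as _ u"] by (simp only: dop_def)
  finally show ?thesis by (simp del: pw)
qed

lemma qsum_pad: "d \<le> d' \<Longrightarrow> qsum A \<theta> d C = qsum A \<theta> d' (\<lambda>Q k. if k \<le> d then C Q k else 0)"
proof (intro ext)
  fix u i assume d: "d \<le> d'"
  have "(\<Sum>k\<le>d. u ^ k * C Q k i) = (\<Sum>k\<le>d'. u ^ k * (if k \<le> d then C Q k else 0) i)" for Q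
    by (rule sum.mono_neutral_cong_left) (use d in auto)
  then show "qsum A \<theta> d C u i = qsum A \<theta> d' (\<lambda>Q k. if k \<le> d then C Q k else 0) u i"
    by (simp only: qsum_def)
qed

lemma Nu_row_scale:
  "Nu N (\<lambda>u a b. sc (q a) * M u a b) as F u = fap (sc (prod_list (map q as))) (Nu N M as F u)"
proof (induction as arbitrary: u)
  case (Cons a as)
  have "nu N (\<lambda>a b. sc (q a) * M u a b) a G = fap (sc (q a)) (nu N (M u) a G)" for G
    unfolding nu_def fap_sum fap_times ..
  then show ?case using Cons by (simp add: nu_fap_sc sc_mult fap_times) (rule fap_sc_comm)
qed simp

section \<open>Evaluation of solutions on S_i\<close>

locale evaluation_setting =
  fixes N n i :: nat
    and q :: "nat \<Rightarrow> complex" and \<theta> :: "complex \<Rightarrow> real"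
    and \<Lambda> :: "nat \<Rightarrow> nat \<Rightarrow> complex" and z :: "nat \<Rightarrow> complex"
    and r :: "nat \<Rightarrow> nat" and e :: "nat \<Rightarrow> nat \<Rightarrow> nat \<Rightarrow> complex mat"
  assumes N1: "N \<ge> 1"
    and q_nonzero: "\<And>a. a \<in> {1..N} \<Longrightarrow> q a \<noteq> 0"
    and q_arg: "\<And>a. a \<in> {1..N} \<Longrightarrow> rcis (cmod (q a)) (\<theta> (q a)) = q a"
    and dominant: "\<And>s. s \<in> {1..n} \<Longrightarrow> integral_dominant N (\<Lambda> s)"
    and last_zero: "\<And>s. s \<in> {1..n} \<Longrightarrow> \<Lambda> s N = 0"
    and irreducible: "\<And>s. s \<in> {1..n} \<Longrightarrow> irreducible_highest_weight_module N (\<Lambda> s) (r s) (e s)"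
    and i: "i \<in> {1..n}"
    and separated: "\<And>j. j \<in> {1..n} \<Longrightarrow> j \<noteq> i \<Longrightarrow> z i - z j \<notin> \<int>"
begin

abbreviation "H \<equiv> tensor_space n r"
abbreviation "A \<equiv> q ` {1..N}"
abbreviation "D \<equiv> dop N (Mt N (mod_op r e) z q (site_list n))"
abbreviation "pt \<equiv> eval_point N (\<Lambda> i) (z i)"

lemma args: "has_args A \<theta>"
  using q_nonzero q_arg by (auto simp: has_args_def)

lemma sites: "gl_sites N (mod_op r e) {1..n}"
  unfolding gl_sites_def
proof (intro conjI ballI impI)
  fix s assume s: "s \<in> {1..n}"
  then have "gl_rel N (\<lambda>a b. mop (r s) (e s a b))"
    using irreducible[OF s] by (intro mop_gl_rel) (simp add: irreducible_highest_weight_module_def gl_irreducible_def)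
  then show "gl_rel N (mod_op r e s)"
    unfolding gl_rel_def mod_op_def slot_mult[symmetric] slot_diff[symmetric]
    by (auto simp: slot_diff slot_0)
qed (simp add: mod_op_def slot_comm)

lemma site_qdet:
  assumes s: "s \<in> {1..n}" and x: "x \<in> H"
  shows "qdet N (Lt (mod_op r e) z s) u x = sc (\<Prod>a\<in>{1..N}. u - of_nat a + 1 + (\<Lambda> s a - z s)) \<triangleright> x"
proof
  fix p
  let ?L = "Lt (\<lambda>_ :: unit. \<lambda>a b. mop (r s) (e s a b)) (\<lambda>_. z s) ()"
  have L: "Lt (mod_op r e) z s = (\<lambda>u a b. slot s (?L u a b))"
    by (intro ext) (simp add: Lt_def mod_op_def slot_add slot_sc slot_0)
  have "fsupp (r s) (\<lambda>w. x (p(s := w)))"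
    unfolding fsupp_def
  proof (intro allI impI)
    fix w assume "r s \<le> w"
    then have "p(s := w) \<notin> multi_indices n r" using s by (auto simp: multi_indices_def dest: PiE_mem[where x = s])
    then show "x (p(s := w)) = 0" using x by (simp add: tensor_space_def)
  qed
  then show "qdet N (Lt (mod_op r e) z s) u x p = (sc (\<Prod>a\<in>{1..N}. u - of_nat a + 1 + (\<Lambda> s a - z s)) \<triangleright> x) p"
    unfolding L qdet_slot module_qdet[OF irreducible[OF s] \<open>fsupp (r s) _\<close>] ap_sc by simp
qed

lemma tensor_qdet:
  assumes "set ss \<subseteq> {1..n}" "distinct ss" "x \<in> H"
  shows "qdet N (Tt N (mod_op r e) z ss) u x
    = sc (\<Prod>s\<leftarrow>ss. \<Prod>a\<in>{1..N}. u - of_nat a + 1 + (\<Lambda> s a - z s)) \<triangleright> x"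
  using assms(1,2)
proof (induction ss)
  case Nil
  have as: "set [1..<N+1] \<subseteq> {1..N}" by (auto simp del: upt_Suc)
  have T: "Tt N (mod_op r e) z [] = (\<lambda>u a b. if a = b then 1 else 0)" by (intro ext) simp
  show ?case unfolding qdet_def T foldr_psi_Nu[OF as, symmetric] foldr_psi_top by simp
next
  case (Cons s ss)
  have "qdet N (Tt N (mod_op r e) z (s # ss)) u x = qdet N (Lt (mod_op r e) z s) u (qdet N (Tt N (mod_op r e) z ss) u x)"
  proof (rule qdet_product)
    fix u v :: complex and a b c d assume *: "a \<in> {1..N}" "b \<in> {1..N}" "c \<in> {1..N}" "d \<in> {1..N}"
    have "Lt (mod_op r e) z s u a b = slot s ((if a = b then sc (u - z s) else 0) + mop (r s) (e s b a))"
      by (simp add: Lt_def mod_op_def slot_add slot_sc slot_0)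
    then have "Lt (mod_op r e) z s u a b * Tt N (mod_op r e) z ss v c d = Tt N (mod_op r e) z ss v c d * Lt (mod_op r e) z s u a b"
      using Cons.prems * by (intro Tt_comm) (auto simp: mod_op_def intro!: slot_comm)
    then show "Tt N (mod_op r e) z ss v c d * Lt (mod_op r e) z s u a b = Lt (mod_op r e) z s u a b * Tt N (mod_op r e) z ss v c d"
      by simp
  next
    show "manin N (Tt N (mod_op r e) z ss v) (Tt N (mod_op r e) z ss (v - 1))" for v
      by (rule manin_Tt[OF sites]) (use Cons.prems in auto)
  qed simp
  also have "\<dots> = sc (\<Prod>s\<leftarrow>ss. \<Prod>a\<in>{1..N}. u - of_nat a + 1 + (\<Lambda> s a - z s)) \<triangleright>
      sc (\<Prod>a\<in>{1..N}. u - of_nat a + 1 + (\<Lambda> s a - z s)) \<triangleright> x"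
    using Cons site_qdet[OF _ assms(3)] by (simp add: qdet_sc)
  also have "\<dots> = sc (\<Prod>s\<leftarrow>s # ss. \<Prod>a\<in>{1..N}. u - of_nat a + 1 + (\<Lambda> s a - z s)) \<triangleright> x"
    by (rule ext) (simp add: ap_sc mult_ac)
  finally show ?case .
qed

text \<open>Kernel elements with values in the whole tensor product, weights disregarded; the number
  of free parameters is then N times the dimension of \<open>H\<close>.\<close>

definition solution :: "(complex \<Rightarrow> tensor) \<Rightarrow> bool" where
  "solution f \<longleftrightarrow> (\<exists>C d. (\<forall>Q k. C Q k \<in> H) \<and> f = qsum A \<theta> d C) \<and> (\<forall>u. good_point N z {1..n} u \<longrightarrow> D f u = 0)"

lemma solutionI:
  assumes "\<And>Q k. C Q k \<in> H" "f = qsum A \<theta> d C" "\<And>u. good_point N z {1..n} u \<Longrightarrow> D f u = 0"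
  shows "solution f"
  unfolding solution_def
proof (intro conjI allI impI)
  show "\<exists>C d. (\<forall>Q k. C Q k \<in> H) \<and> f = qsum A \<theta> d C"
    by (rule exI[of _ C], rule exI[of _ d]) (use assms(1,2) in simp)
qed (rule assms(3))

lemma solution_zero: "solution f \<Longrightarrow> good_point N z {1..n} u \<Longrightarrow> D f u = 0"
  by (simp add: solution_def)

lemma qsum_tensor: "(\<And>Q k. C Q k \<in> H) \<Longrightarrow> qsum A \<theta> d C u \<in> H"
  by (simp add: tensor_space_def qsum_def)

lemma solution_tensor: "solution f \<Longrightarrow> f u \<in> H"
  using qsum_tensor by (auto simp: solution_def)

lemma solution_cont: "solution f \<Longrightarrow> isCont (\<lambda>u. f u p) u"
  using qsum_cont by (auto simp: solution_def)

lemma solution_add: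
  assumes "solution f" "solution g"
  shows "solution (\<lambda>u. f u + g u)"
proof -
  obtain C d C' d' where C: "\<And>Q k. C Q k \<in> H" "f = qsum A \<theta> d C" "\<And>Q k. C' Q k \<in> H" "g = qsum A \<theta> d' C'"
    using assms by (auto simp: solution_def)
  let ?m = "max d d'" and ?c = "\<lambda>Q k. (if k \<le> d then C Q k else 0) + (if k \<le> d' then C' Q k else 0)"
  have "f = qsum A \<theta> ?m (\<lambda>Q k. if k \<le> d then C Q k else 0)" unfolding C(2) by (rule qsum_pad) simp
  moreover have "g = qsum A \<theta> ?m (\<lambda>Q k. if k \<le> d' then C' Q k else 0)" unfolding C(4) by (rule qsum_pad) simp
  ultimately have "(\<lambda>u. f u + g u) = qsum A \<theta> ?m ?c"
    by (intro ext) (simp add: qsum_def sum.distrib distrib_left)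
  then show ?thesis
  proof (rule solutionI[rotated])
    show "?c Q k \<in> H" for Q k
      by (rule tensor_add) (use C(1)[of Q k] C(3)[of Q k] tensor_0 in \<open>simp_all del: pw\<close>)
    show "D (\<lambda>u. f u + g u) u = 0" if "good_point N z {1..n} u" for u
      using solution_zero[OF assms(1) that] solution_zero[OF assms(2) that] by (simp only: dop_add add_0_left)
  qed
qed

lemma solution_ap:
  assumes "solution f" "\<And>x. x \<in> H \<Longrightarrow> B \<triangleright> x \<in> H" "\<And>u. D (\<lambda>u. B \<triangleright> f u) u = B \<triangleright> D f u"
  shows "solution (\<lambda>u. B \<triangleright> f u)"
proof -
  obtain C d where C: "\<And>Q k. C Q k \<in> H" "f = qsum A \<theta> d C" using assms(1) by (auto simp: solution_def)
  have "(\<lambda>u. B \<triangleright> f u) = qsum A \<theta> d (\<lambda>Q k. B \<triangleright> C Q k)" unfolding C(2) by (rule ext) (simp only: qsum_ap)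
  then show ?thesis
  proof (rule solutionI[rotated])
    show "B \<triangleright> C Q k \<in> H" for Q k by (rule assms(2), rule C(1))
    show "D (\<lambda>u. B \<triangleright> f u) u = 0" if "good_point N z {1..n} u" for u
      unfolding assms(3) solution_zero[OF assms(1) that] by (rule ap_0)
  qed
qed

lemma solution_scale: "solution f \<Longrightarrow> solution (\<lambda>u. sc c \<triangleright> f u)"
  by (rule solution_ap[where B = "sc c"]) (simp_all add: tensor_sc dop_scale)

lemma solution_diff: "solution f \<Longrightarrow> solution g \<Longrightarrow> solution (\<lambda>u. f u - g u)"
  using solution_add[OF _ solution_scale[of g "-1"], of f] by (simp add: sc_neg ap_uminus del: pw)

text \<open>The denominators are \<open>ppi\<close> at u, u - 1, ..., u - N + 1, and the coefficient
  with m shifts keeps those of index at least m. The cleared expression vanishes at all good points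
  and is continuous, so it vanishes also at the poles, which are the points used below.\<close>

lemma cleared_equation:
  assumes f: "solution f"
  shows "(\<Sum>m\<le>N. sc (\<Prod>k\<in>{m..<N}. ppi z (site_list n) (u - of_nat k)) \<triangleright>
    shift_coeff N (mod_op r e) z q (site_list n) f m u) = 0"
proof
  fix p
  let ?c = "\<lambda>m u. \<Prod>k\<in>{m..<N}. ppi z (site_list n) (u - of_nat k)"
  let ?S = "\<lambda>m u. shift_coeff N (mod_op r e) z q (site_list n) f m u"
  let ?h = "\<lambda>u. \<Sum>m\<le>N. ?c m u * ?S m u p"
  have "?h u = 0"
  proof (rule finite_zero_cont[where h = ?h and u = u and S = "{u. \<not> good_point N z {1..n} u}"])
    have "\<forall>u. isCont (\<lambda>u. ?S m u p) u" for m
    proof -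
      note * = shift_coeff_in[where \<C> = "\<lambda>g. \<forall>u. isCont g u" and f = f and e = "mod_op r e" and z = z
          and q = q and ss = "site_list n" and k = m and N = N and i = p, OF fun_class_isCont]
      show ?thesis by (rule *) (simp add: solution_cont[OF f])
    qed
    then show "isCont ?h u"
      unfolding ppi_poly by (intro continuous_intros) auto
    show "finite {u. \<not> good_point N z {1..n} u}" by (rule not_good_points_finite) simp
    fix v assume "v \<notin> {u. \<not> good_point N z {1..n} u}"
    then have v: "good_point N z {1..n} v" by simp
    have nz: "ppi z (site_list n) (v - of_nat k) \<noteq> 0" if "k < N" for k
      using v that by (auto simp: ppi_0_iff set_site_list good_point_def)
    have "?c m v = ?c 0 v * gprod (\<lambda>u. 1 / ppi z (site_list n) u) m v" if "m \<le> N" for m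
    proof -
      have "?c 0 v = (\<Prod>k<m. ppi z (site_list n) (v - of_nat k)) * ?c m v"
        using prod.atLeastLessThan_concat[of 0 m N "\<lambda>k. ppi z (site_list n) (v - of_nat k)"] that
        by (simp add: atLeast0LessThan)
      moreover have "(\<Prod>k<m. ppi z (site_list n) (v - of_nat k)) * gprod (\<lambda>u. 1 / ppi z (site_list n) u) m v = 1"
        unfolding gprod_def prod.distrib[symmetric] by (rule prod.neutral) (use nz that in auto)
      moreover have "X = Y * Z \<Longrightarrow> Y * W = 1 \<Longrightarrow> Z = X * W" for X Y Z W :: complex by (simp add: mult_ac)
      ultimately show ?thesis by blast
    qed
    then have "?h v = (\<Sum>m\<le>N. ?c 0 v * gprod (\<lambda>u. 1 / ppi z (site_list n) u) m v * ?S m v p)"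
      by (intro sum.cong refl) (metis atMost_iff)
    also have "\<dots> = ?c 0 v * D f v p"
      unfolding dop_shift_coeff sum_apply ap_sc sum_distrib_left by (simp only: mult.assoc)
    finally have "?h v = ?c 0 v * D f v p" .
    then show "?h v = 0" using f v by (simp add: solution_def)
  qed
  then show "(\<Sum>m\<le>N. sc (?c m u) \<triangleright> ?S m u) p = 0 p" by (simp add: sum_apply ap_sc)
qed

lemma last_shift_coeff:
  assumes f: "solution f"
  shows "\<exists>\<epsilon>. \<epsilon> \<noteq> 0 \<and> shift_coeff N (mod_op r e) z q (site_list n) f N u
    = sc (\<epsilon> * (\<Prod>s\<leftarrow>site_list n. \<Prod>a\<in>{1..N}. u - of_nat a + 1 + (\<Lambda> s a - z s))) \<triangleright> f (u - of_nat N)"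
proof -
  let ?as = "[1..<N+1]" and ?x = "f (u - of_nat N)"
  let ?k = "\<Prod>s\<leftarrow>site_list n. \<Prod>a\<in>{1..N}. u - of_nat a + 1 + (\<Lambda> s a - z s)"
  have len: "length ?as = N" by (simp del: upt_Suc)
  define Q where "Q = prod_list (map q ?as)"
  have Q0: "Q \<noteq> 0" using q_nonzero by (auto simp: Q_def prod_list_zero_iff simp del: upt_Suc)
  have so: "site_op N (mod_op r e) z q (site_list n) = (\<lambda>u a b. sc (q a) * Tt N (mod_op r e) z (site_list n) u a b)"
    by (intro ext) (simp add: site_op_def)
  have "Nu N (site_op N (mod_op r e) z q (site_list n)) ?as (vac ?x) u {1..N} = sc Q \<triangleright> qdet N (Tt N (mod_op r e) z (site_list n)) u ?x"
    unfolding so Nu_row_scale by (simp add: fap_def qdet_def Q_def del: upt_Suc)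
  also have "\<dots> = sc (Q * ?k) \<triangleright> ?x"
    by (subst tensor_qdet) (auto simp: set_site_list distinct_site_list solution_tensor[OF f] sc_mult ap_times)
  finally have nu: "Nu N (site_op N (mod_op r e) z q (site_list n)) ?as (vac ?x) u {1..N} = sc (Q * ?k) \<triangleright> ?x" .
  \<comment> \<open>The sign (-1)^N times the product of the q_a; invertibility of Q makes it
    non-zero.\<close>
  define \<epsilon> where "\<epsilon> = (if even N then Q else - Q)"
  have "shift_coeff N (mod_op r e) z q (site_list n) f N u = sc (\<epsilon> * ?k) \<triangleright> ?x"
    using Vc_Nu[of N "site_op N (mod_op r e) z q (site_list n)" ?as "\<lambda>u. vac (f u)" u] nu
    unfolding shift_coeff_def len \<epsilon>_def by (auto simp: sc_neg ap_uminus uminus_apply simp del: upt_Suc)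
  then show ?thesis using Q0 by (intro exI[of _ \<epsilon>]) (auto simp: \<epsilon>_def)
qed

lemma weights:
  assumes "s \<in> {1..n}"
  obtains hw where "\<And>a. a \<in> {1..N} \<Longrightarrow> \<Lambda> s a = of_nat (hw a)" "\<And>a. a \<in> {1..<N} \<Longrightarrow> hw (Suc a) \<le> hw a"
  using dominant_weight_nat[OF dominant[OF assms] last_zero[OF assms]] by blast

text \<open>
  At \<open>u = z i + N - k\<close> every term of the cleared equation but the last contains the factor
  \<open>ppi z (site_list n) (z i) = 0\<close> or one of the values \<open>f (z i - k')\<close>, \<open>1 \<le> k' < k\<close>.
\<close>

lemma solution_step:
  assumes f: "solution f" and "1 \<le> k" and prev: "\<And>k'. 1 \<le> k' \<Longrightarrow> k' < k \<Longrightarrow> f (z i - of_nat k') = 0"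
    and not_pt: "\<And>a. a \<in> {1..N} \<Longrightarrow> z i - of_nat k \<noteq> pt a"
  shows "f (z i - of_nat k) = 0"
proof -
  let ?u = "z i + of_nat N - of_nat k"
  let ?S = "\<lambda>m. shift_coeff N (mod_op r e) z q (site_list n) f m ?u"
  let ?c = "\<lambda>m. \<Prod>k\<in>{m..<N}. ppi z (site_list n) (?u - of_nat k)"
  have "sc (?c m) \<triangleright> ?S m = 0" if m: "m < N" for m
  proof (cases "k \<le> N - m")
    case True
    then have "?u - of_nat (N - k) = z i" by (simp add: of_nat_diff)
    moreover have "ppi z (site_list n) (z i) = 0" using i by (auto simp: ppi_0_iff set_site_list)
    ultimately have "ppi z (site_list n) (?u - of_nat (N - k)) = 0" by (simp only:)
    moreover have "N - k \<in> {m..<N}" using True m \<open>1 \<le> k\<close> by auto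
    ultimately have "?c m = 0" by (intro prod_zero) auto
    then show ?thesis by (simp only: sc_0 ap_zero)
  next
    case False
    then have eq: "?u - of_nat m = z i - of_nat (k - (N - m))" using m by (simp add: of_nat_diff)
    have "f (?u - of_nat m) = 0" unfolding eq by (rule prev) (use False m in auto)
    then have "?S m = 0" by (rule shift_coeff_zero)
    then show ?thesis by (simp only: ap_0)
  qed
  then have "(\<Sum>m\<le>N. sc (?c m) \<triangleright> ?S m) = (\<Sum>m\<in>{N}. sc (?c m) \<triangleright> ?S m)"
    by (intro sum.mono_neutral_right) auto
  then have SN: "?S N = 0" using cleared_equation[OF f, of ?u] by simp
  obtain \<epsilon> where \<epsilon>: "\<epsilon> \<noteq> 0" "?S N
    = sc (\<epsilon> * (\<Prod>s\<leftarrow>site_list n. \<Prod>a\<in>{1..N}. ?u - of_nat a + 1 + (\<Lambda> s a - z s))) \<triangleright> f (?u - of_nat N)"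
    using last_shift_coeff[OF f, of ?u] by blast
  \<comment> \<open>For s = i a zero of the factor means k = \<open>\<Lambda> i a\<close> + N - a +
    1, that is z_i - k = \<open>pt a\<close>. For other s all remaining terms are integers, so a
    zero would make z_i - z_s an integer.\<close>
  have "?u - of_nat a + 1 + (\<Lambda> s a - z s) \<noteq> 0" if sa: "s \<in> {1..n}" "a \<in> {1..N}" for s a
  proof (cases "s = i")
    case True
    then show ?thesis using not_pt[OF sa(2)] by (auto simp: eval_point_def algebra_simps)
  next
    case False
    obtain hw where hw: "\<And>a. a \<in> {1..N} \<Longrightarrow> \<Lambda> s a = of_nat (hw a)" using weights[OF sa(1)] by blast
    show ?thesis
    proof
      assume "?u - of_nat a + 1 + (\<Lambda> s a - z s) = 0"
      then have "z i - z s = of_int (int k + int a - int N - 1 - int (hw a))"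
        using hw[OF sa(2)] by (simp add: algebra_simps)
      then show False using separated[OF sa(1) False] by (metis Ints_of_int)
    qed
  qed
  then have "(\<Prod>s\<leftarrow>site_list n. \<Prod>a\<in>{1..N}. ?u - of_nat a + 1 + (\<Lambda> s a - z s)) \<noteq> 0"
    by (auto simp: prod_list_zero_iff set_site_list)
  then have "f (?u - of_nat N) = 0"
    using SN \<epsilon> by (auto simp: fun_eq_iff ap_sc)
  then show ?thesis by simp
qed

lemma solution_zeros:
  assumes f: "solution f" and pts: "\<And>k a. 1 \<le> k \<Longrightarrow> k \<le> K \<Longrightarrow> a \<in> {1..N} \<Longrightarrow> z i - of_nat k = pt a \<Longrightarrow> f (z i - of_nat k) = 0"
    and "1 \<le> k" "k \<le> K"
  shows "f (z i - of_nat k) = 0"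
  using assms(3,4)
proof (induction k rule: less_induct)
  case (less k)
  show ?case
  proof (cases "\<exists>a\<in>{1..N}. z i - of_nat k = pt a")
    case True
    then show ?thesis using pts less.prems by blast
  next
    case False
    show ?thesis by (rule solution_step[OF f less.prems(1)]) (use False less in auto)
  qed
qed

text \<open>The recursion runs to the left and yields zeros at z_i - 1, z_i - 2, ...; this
  half-lattice is enough by \<open>qsum_zero_backward\<close>.\<close>

lemma solution_unique:
  assumes f: "solution f" and pts: "\<And>a. a \<in> {1..N} \<Longrightarrow> f (pt a) = 0"
  shows "f = (\<lambda>u. 0)"
proof (intro ext)
  fix u p
  obtain C d where C: "f = qsum A \<theta> d C" using f by (auto simp: solution_def)
  have "f (z i - of_nat k) = 0" if "1 \<le> k" for k
    by (rule solution_zeros[OF f _ that, of k]) (use pts in auto)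
  from this[of "Suc _"] have "f (z i - 1 - of_nat j) = 0" for j by (simp add: diff_diff_eq)
  then have "qsum A \<theta> d C (z i - 1 - of_nat j) p = 0" for j unfolding C by simp
  then have "qsum A \<theta> d C u p = 0" by (rule qsum_zero_backward[OF args])
  then show "f u p = 0 p" using C by simp
qed

lemma pt_nat:
  assumes "\<And>a. a \<in> {1..N} \<Longrightarrow> \<Lambda> i a = of_nat (hw a)" "a \<in> {1..N}"
  shows "pt a = z i - of_nat (hw a + (N - a) + 1)"
  using assms by (simp add: eval_point_def of_nat_diff)

lemma solution_zeros_partial:
  assumes f: "solution f" and j: "j \<in> {1<..N}" and zero: "\<And>l. l \<in> {j..N} \<Longrightarrow> f (pt l) = 0"
    and k: "1 \<le> k" "real k \<le> Re (\<Lambda> i (j - 1)) + real N - real j + 1"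
  shows "f (z i - of_nat k) = 0"
proof -
  obtain hw where hw: "\<And>a. a \<in> {1..N} \<Longrightarrow> \<Lambda> i a = of_nat (hw a)" "\<And>a. a \<in> {1..<N} \<Longrightarrow> hw (Suc a) \<le> hw a"
    using weights[OF i] by blast
  have anti: "hw b \<le> hw a" if "1 \<le> a" "a \<le> b" "b \<le> N" for a b
    using that(2,3)
  proof (induction b rule: dec_induct)
    case (step b)
    then show ?case using hw(2)[of b] that(1) by auto
  qed simp
  have "j - 1 \<in> {1..N}" using j by auto
  then have "\<Lambda> i (j - 1) = of_nat (hw (j - 1))" by (rule hw(1))
  then have "real k \<le> real (hw (j - 1) + (N - j) + 1)" using k j by (simp add: of_nat_diff)
  then have K: "k \<le> hw (j - 1) + (N - j) + 1" by (simp only: of_nat_le_iff)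
  show ?thesis
  proof (rule solution_zeros[OF f _ k(1) K])
    fix l a assume l: "l \<le> hw (j - 1) + (N - j) + 1" and a: "a \<in> {1..N}" and eq: "z i - of_nat l = pt a"
    have "z i - of_nat l = z i - of_nat (hw a + (N - a) + 1)" unfolding eq by (rule pt_nat[OF hw(1) a])
    moreover have "b = c" if "z i - b = z i - c" for b c using that by simp
    ultimately have "(of_nat l :: complex) = of_nat (hw a + (N - a) + 1)" by blast
    then have la: "l = hw a + (N - a) + 1" by (simp only: of_nat_eq_iff)
    \<comment> \<open>For a < j the point \<open>pt a\<close> lies too far to the left: as the
      weight decreases, its distance from z_i is at least \<open>hw (j - 1)\<close> + N - j + 2, one
      more than the bound on l.\<close>
    have "j \<le> a"
    proof (rule ccontr)
      assume "\<not> j \<le> a"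
      then have "hw (j - 1) \<le> hw a" using a j by (intro anti) auto
      then show False using l la \<open>\<not> j \<le> a\<close> j a by auto
    qed
    then show "f (z i - of_nat l) = 0" unfolding eq using zero a by simp
  qed
qed

text \<open>Solutions are parametrized linearly by their values at w - 1, ..., w - N. Evaluation on
  S_i becomes an endomorphism of the same finite coordinate space, injective by
  \<open>solution_unique\<close>.\<close>

lemma solution_surj:
  assumes v: "\<And>j. j \<in> {1..N} \<Longrightarrow> v j \<in> H"
  shows "\<exists>f. solution f \<and> (\<forall>j\<in>{1..N}. f (pt j) = v j)"
proof -
  obtain w where w: "\<And>s. s \<in> {1..n} \<Longrightarrow> w - z s \<notin> \<int>"
    and ex: "\<And>v. (\<forall>j. v j \<in> H) \<Longrightarrow> \<exists>C d. (\<forall>Q k. C Q k \<in> H) \<and>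
      (\<forall>u. good_point N z {1..n} u \<longrightarrow> D (qsum A \<theta> d C) u = 0) \<and>
      (\<forall>j\<in>{1..N}. qsum A \<theta> d C (w - of_nat j) = v j)"
    using module_solution[where \<Lambda> = \<Lambda> and r = r and e = e and z = z and n = n, OF N1 args dominant last_zero irreducible] by blast
  have ini: "f = (\<lambda>u. 0)" if "solution f" "\<And>j. j \<in> {1..N} \<Longrightarrow> f (w - of_nat j) = 0" for f
  proof -
    obtain C d where C: "f = qsum A \<theta> d C" using \<open>solution f\<close> by (auto simp: solution_def)
    have "C Q k p = 0" if Q: "Q \<in> A" "k \<le> d" for Q k p
    proof (rule qsum_coeff_zero[OF args _ Q, of C w])
      fix j :: nat
      have "f (w + of_nat j) = 0"
      proof (rule forward_zero[where N = N and e = "mod_op r e" and z = z and q = q and ss = "site_list n"])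
        show "D f (w + of_nat j) = 0" for j
          by (rule solution_zero[OF \<open>solution f\<close>], rule good_point_generic) (rule w)
      qed (rule \<open>\<And>j. j \<in> {1..N} \<Longrightarrow> f (w - of_nat j) = 0\<close>)
      then show "qsum A \<theta> d C (w + of_nat j) p = 0" unfolding C by simp
    qed
    then show ?thesis unfolding C by (intro ext) (simp add: qsum_def)
  qed
  let ?MI = "multi_indices n r"
  define vals where "vals = (\<lambda>(x :: nat \<times> (nat \<Rightarrow> nat) \<Rightarrow> complex) j p. if j \<in> {1..N} \<and> p \<in> ?MI then x (j, p) else 0)"
  \<comment> \<open>An arbitrary choice of a solution for each set of values at w - j. It is linear
    in these values because they determine the solution.\<close>
  define sol where "sol = (\<lambda>x. SOME f. solution f \<and> (\<forall>j\<in>{1..N}. f (w - of_nat j) = vals x j))"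
  have sol: "solution (sol x) \<and> (\<forall>j\<in>{1..N}. sol x (w - of_nat j) = vals x j)" for x
  proof -
    have "\<forall>j. vals x j \<in> H" by (simp add: tensor_space_def vals_def)
    from ex[OF this] have "\<exists>f. solution f \<and> (\<forall>j\<in>{1..N}. f (w - of_nat j) = vals x j)"
      unfolding solution_def by blast
    then show ?thesis unfolding sol_def by (rule someI_ex)
  qed
  have eqI: "f = g" if "solution f" "solution g" "\<And>j. j \<in> {1..N} \<Longrightarrow> f (w - of_nat j) = g (w - of_nat j)" for f g
  proof -
    have "(\<lambda>u. f u - g u) = (\<lambda>u. 0)" by (rule ini[OF solution_diff[OF that(1,2)]]) (simp add: that(3) del: pw)
    then show ?thesis by (simp add: fun_eq_iff)
  qed
  have add: "sol (\<lambda>a. x a + y a) = (\<lambda>u. sol x u + sol y u)" for x y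
  proof (rule eqI)
    show "sol (\<lambda>a. x a + y a) (w - of_nat j) = sol x (w - of_nat j) + sol y (w - of_nat j)" if "j \<in> {1..N}" for j
      using sol[of x] sol[of y] sol[of "\<lambda>a. x a + y a"] that by (intro ext) (simp add: vals_def)
  qed (use sol solution_add in auto)
  have scale: "sol (\<lambda>a. c * x a) = (\<lambda>u. sc c \<triangleright> sol x u)" for c x
  proof (rule eqI)
    show "sol (\<lambda>a. c * x a) (w - of_nat j) = sc c \<triangleright> sol x (w - of_nat j)" if "j \<in> {1..N}" for j
      using sol[of x] sol[of "\<lambda>a. c * x a"] that by (intro ext) (simp add: vals_def ap_sc)
  qed (use sol solution_scale in auto)
  let ?B = "{1..N} \<times> ?MI" and ?L = "\<lambda>x b. sol x (pt (fst b)) (snd b)"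
  have "\<exists>x. (\<forall>a. a \<notin> ?B \<longrightarrow> x a = 0) \<and> (\<forall>b\<in>?B. ?L x b = v (fst b) (snd b))"
  proof (rule injective_square_system)
    show "finite ?B" "finite ?B" by (auto simp: finite_multi_indices)
    show "?L (\<lambda>a. x a + y a) b = ?L x b + ?L y b" for x y b by (simp add: add)
    show "?L (\<lambda>a. c * x a) b = c * ?L x b" for c x b by (simp add: scale ap_sc)
    fix x assume x: "\<forall>b\<in>?B. ?L x b = 0"
    have "sol x = (\<lambda>u. 0)"
    proof (rule solution_unique)
      fix a assume a: "a \<in> {1..N}"
      show "sol x (pt a) = 0"
      proof
        fix p show "sol x (pt a) p = 0 p"
        proof (cases "p \<in> ?MI")
          case True
          then show ?thesis using x a by (auto dest: bspec[of _ _ "(a, p)"])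
        next
          case False
          then show ?thesis using solution_tensor[of "sol x"] sol[of x] by (auto simp: tensor_space_def)
        qed
      qed
    qed (use sol in auto)
    show "\<forall>a\<in>?B. x a = 0"
    proof
      fix a assume a: "a \<in> ?B"
      have "vals x (fst a) = 0" using sol[of x] a unfolding \<open>sol x = (\<lambda>u. 0)\<close> by auto
      then have "vals x (fst a) (snd a) = 0" by simp
      then show "x a = 0" using a by (auto simp: vals_def)
    qed
  qed simp
  then obtain x where x: "\<And>b. b \<in> ?B \<Longrightarrow> ?L x b = v (fst b) (snd b)" by blast
  have "sol x (pt j) = v j" if j: "j \<in> {1..N}" for j
  proof
    fix p show "sol x (pt j) p = v j p"
    proof (cases "p \<in> ?MI")
      case True
      then show ?thesis using x[of "(j, p)"] j by simp
    next
      case False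
      then show ?thesis using solution_tensor[of "sol x" "pt j"] sol[of x] v[OF j] by (auto simp: tensor_space_def)
    qed
  qed
  then show ?thesis using sol by blast
qed

definition weight_op :: "nat \<Rightarrow> (nat \<Rightarrow> nat) lop" where
  "weight_op c = (\<Sum>s\<in>{1..n}. mod_op r e s c c)"

lemma weight_space_iff:
  "x \<in> weight_space N n r e m \<longleftrightarrow> x \<in> H \<and> (\<forall>c\<in>{1..N}. weight_op c \<triangleright> x = sc (m c) \<triangleright> x)"
proof -
  have "(\<lambda>p. \<Sum>s=1..n. on_factor n r s (e s c c) x p) = weight_op c \<triangleright> x" if "x \<in> H" for c
    by (rule ext) (simp add: weight_op_def sum_ap sum_apply mod_op_def on_factor_slot[OF that])
  moreover have "(\<lambda>p. m c * x p) = sc (m c) \<triangleright> x" for c by (rule ext) (simp add: ap_sc)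
  ultimately show ?thesis unfolding weight_space_def by auto
qed

lemma weight_op_tensor: "x \<in> H \<Longrightarrow> weight_op c \<triangleright> x \<in> H"
  by (rule op_supp_tensor) (auto simp: weight_op_def intro!: op_supp_sum op_supp_mod_op)

lemma D_weight_op:
  assumes c: "c \<in> {1..N}"
  shows "D (\<lambda>u. weight_op c \<triangleright> f u) u = weight_op c \<triangleright> D f u"
proof (rule dop_weight[OF _ c])
  fix v a b assume ab: "a \<in> {1..N}" "b \<in> {1..N}"
  let ?T = "Tt N (mod_op r e) z (site_list n) v" and ?g = "\<lambda>a. sc (q a / ppi z (site_list n) v)"
  have h: "weight_op c * ?T a b = ?T a b * weight_op c + (if c = b then ?T a c else 0) - (if c = a then ?T c b else 0)"
    using Tt_total_comm[OF sites _ distinct_site_list ab c c, where z = z and u = v] by (simp add: set_site_list weight_op_def)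
  show "weight_op c * Mt N (mod_op r e) z q (site_list n) v a b = Mt N (mod_op r e) z q (site_list n) v a b * weight_op c
    + (if c = b then Mt N (mod_op r e) z q (site_list n) v a c else 0) - (if c = a then Mt N (mod_op r e) z q (site_list n) v c b else 0)"
    unfolding Mt_def sc_left_comm[of "weight_op c"] h
    by (auto simp: distrib_left right_diff_distrib mult.assoc)
qed

text \<open>The operator e_cc - m_c maps solutions to solutions, and the image of f vanishes on S_i,
  hence identically. The coefficients of a quasi-exponential are unique, so each of them is
  annihilated as well.\<close>

lemma solution_weight:
  assumes f: "solution f" and pts: "\<And>j. j \<in> {1..N} \<Longrightarrow> f (pt j) \<in> weight_space N n r e m"
  shows "quasi_exponential N q \<theta> (weight_space N n r e m) f"
proof -
  obtain C d where C: "\<And>Q k. C Q k \<in> H" "f = qsum A \<theta> d C" using f by (auto simp: solution_def)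
  have "C Q k \<in> weight_space N n r e m" if Q: "Q \<in> A" "k \<le> d" for Q k
    unfolding weight_space_iff
  proof (intro conjI ballI C(1))
    fix c assume c: "c \<in> {1..N}"
    let ?B = "weight_op c - sc (m c)"
    have "solution (\<lambda>u. weight_op c \<triangleright> f u)"
      by (rule solution_ap[where B = "weight_op c", OF f]) (simp_all add: weight_op_tensor D_weight_op[OF c])
    from solution_diff[OF this solution_scale[OF f, of "m c"]]
    have "solution (\<lambda>u. ?B \<triangleright> f u)" by (simp only: ap_minus)
    then have "(\<lambda>u. ?B \<triangleright> f u) = (\<lambda>u. 0)"
    proof (rule solution_unique)
      fix a assume "a \<in> {1..N}"
      then show "?B \<triangleright> f (pt a) = 0" using pts[of a] c by (simp add: ap_minus weight_space_iff del: pw)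
    qed
    then have "qsum A \<theta> d (\<lambda>Q k. ?B \<triangleright> C Q k) u = 0" for u
      unfolding qsum_ap C(2)[symmetric] by (rule fun_cong)
    then have "(?B \<triangleright> C Q k) p = 0" for p
      by (intro qsum_coeff_zero[OF args _ Q, of "\<lambda>Q k. ?B \<triangleright> C Q k" 0]) (simp only: zero_fun_apply)
    then have "?B \<triangleright> C Q k = 0" by auto
    then show "weight_op c \<triangleright> C Q k = sc (m c) \<triangleright> C Q k" by (simp add: ap_minus del: pw)
  qed
  then show ?thesis unfolding quasi_exponential_def C(2)
    by (intro exI[of _ C] exI[of _ d]) (simp add: qsum_def)
qed

lemma kernel_solution:
  assumes "f \<in> quasi_exponential_kernel N n r e z q \<theta> m"
  shows "solution f"
proof -
  obtain C d where C: "\<forall>Q\<in>A. \<forall>k\<le>d. C Q k \<in> weight_space N n r e m"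
    "\<forall>u. f u = (\<lambda>p. \<Sum>Q\<in>A. power_with_arg \<theta> Q u * (\<Sum>k\<le>d. u ^ k * C Q k p))"
    using assms by (auto simp: quasi_exponential_kernel_def quasi_exponential_def)
  \<comment> \<open>In \<open>quasi_exponential\<close> nothing is said about coefficients outside
    the bases and degrees that occur; they are set to 0, as \<open>solution\<close> wants all of
    them in \<open>H\<close>.\<close>
  let ?C = "\<lambda>Q k. if Q \<in> A \<and> k \<le> d then C Q k else 0"
  have CH: "?C Q k \<in> H" for Q k using C(1) tensor_0 by (auto simp: weight_space_iff)
  have fC: "f = qsum A \<theta> d ?C" by (intro ext) (simp add: C(2) qsum_def)
  have "in_difference_kernel N n r e z (diagonal q) f" using assms by (simp add: quasi_exponential_kernel_def)
  moreover have "f u \<in> H" for u unfolding fC by (rule qsum_tensor[OF CH])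
  ultimately have "\<forall>u. good_point N z {1..n} u \<longrightarrow> D f u = 0"
    using in_difference_kernel_dop[of f n r N e z q] by simp
  then show ?thesis by (intro solutionI[where C = ?C and d = d, OF CH fC]) simp
qed

lemma solution_kernel:
  assumes "solution f" "\<And>j. j \<in> {1..N} \<Longrightarrow> f (pt j) \<in> weight_space N n r e m"
  shows "f \<in> quasi_exponential_kernel N n r e z q \<theta> m"
  using solution_weight[OF assms] in_difference_kernel_dop[of f n r N e z q, OF solution_tensor[OF assms(1)]] assms(1)
  by (auto simp: quasi_exponential_kernel_def solution_def)

end

theorem theorem7p2:
  fixes N n i :: nat
    and q :: "nat \<Rightarrow> complex" and \<theta> :: "complex \<Rightarrow> real"
    and \<Lambda> :: "nat \<Rightarrow> nat \<Rightarrow> complex" and z m :: "nat \<Rightarrow> complex"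
    and r :: "nat \<Rightarrow> nat" and e :: "nat \<Rightarrow> nat \<Rightarrow> nat \<Rightarrow> complex mat"
  assumes "N \<ge> 1"
    and "\<And>a. a \<in> {1..N} \<Longrightarrow> q a \<noteq> 0"
    and "\<And>a. a \<in> {1..N} \<Longrightarrow> rcis (cmod (q a)) (\<theta> (q a)) = q a"
    and "\<And>s. s \<in> {1..n} \<Longrightarrow> integral_dominant N (\<Lambda> s)"
    and "\<And>s. s \<in> {1..n} \<Longrightarrow> \<Lambda> s N = 0"
    and "\<And>s. s \<in> {1..n} \<Longrightarrow> irreducible_highest_weight_module N (\<Lambda> s) (r s) (e s)"
    and "i \<in> {1..n}"
    and "\<And>j. j \<in> {1..n} \<Longrightarrow> j \<noteq> i \<Longrightarrow> z i - z j \<notin> \<int>"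
  shows "(\<forall>f \<in> quasi_exponential_kernel N n r e z q \<theta> m.
           \<forall>g \<in> quasi_exponential_kernel N n r e z q \<theta> m.
             (\<forall>j\<in>{1..N}. f (eval_point N (\<Lambda> i) (z i) j) = g (eval_point N (\<Lambda> i) (z i) j))
             \<longrightarrow> f = g)
       \<and> (\<forall>f \<in> quasi_exponential_kernel N n r e z q \<theta> m. \<forall>j\<in>{1<..N}.
           (\<forall>l\<in>{j..N}. f (eval_point N (\<Lambda> i) (z i) l) = (\<lambda>p. 0))
           \<longrightarrow> (\<forall>k::nat. 1 \<le> k \<and> real k \<le> Re (\<Lambda> i (j - 1)) + real N - real j + 1
                 \<longrightarrow> f (z i - of_nat k) = (\<lambda>p. 0)))
       \<and> (\<forall>v. (\<forall>j\<in>{1..N}. v j \<in> weight_space N n r e m)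
           \<longrightarrow> (\<exists>f \<in> quasi_exponential_kernel N n r e z q \<theta> m.
                 \<forall>j\<in>{1..N}. f (eval_point N (\<Lambda> i) (z i) j) = v j))"
proof -
  interpret evaluation_setting N n i q \<theta> \<Lambda> z r e
    by unfold_locales (use assms in auto)
  have zero: "(\<lambda>p. 0) = (0 :: tensor)" by auto
  show ?thesis
  proof (intro conjI ballI allI impI)
    fix f g assume fg: "f \<in> quasi_exponential_kernel N n r e z q \<theta> m" "g \<in> quasi_exponential_kernel N n r e z q \<theta> m"
      and eq: "\<forall>j\<in>{1..N}. f (pt j) = g (pt j)"
    have "(\<lambda>u. f u - g u) = (\<lambda>u. 0)"
      by (rule solution_unique[OF solution_diff[OF fg[THEN kernel_solution]]]) (use eq in \<open>simp del: pw\<close>)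
    then show "f = g" by (simp add: fun_eq_iff)
  next
    fix f j and k :: nat
    assume f: "f \<in> quasi_exponential_kernel N n r e z q \<theta> m" and j: "j \<in> {1<..N}"
      and pts: "\<forall>l\<in>{j..N}. f (pt l) = (\<lambda>p. 0)"
      and k: "1 \<le> k \<and> real k \<le> Re (\<Lambda> i (j - 1)) + real N - real j + 1"
    show "f (z i - of_nat k) = (\<lambda>p. 0)"
      unfolding zero
    proof (rule solution_zeros_partial[OF kernel_solution[OF f] j])
      show "f (pt l) = 0" if "l \<in> {j..N}" for l using pts that zero by metis
    qed (use k in auto)
  next
    fix v assume v: "\<forall>j\<in>{1..N}. v j \<in> weight_space N n r e m"
    then obtain f where "solution f" "\<forall>j\<in>{1..N}. f (pt j) = v j"
      using solution_surj[of v] by (auto simp: weight_space_iff)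
    then show "\<exists>f \<in> quasi_exponential_kernel N n r e z q \<theta> m. \<forall>j\<in>{1..N}. f (pt j) = v j"
      using v by (intro bexI[of _ f] solution_kernel) simp_all
  qed
qed

end
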